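(* Let $\mathcal{L}$ be an abstract intuitionistic logic and let $\mathcal{L}'$ be one of the six standard intuitionistic logics ($\mathcal{L}'\in StIL$). If $\mathcal{L}' \sqsubseteq \mathcal{L}$ (that is, $\mathcal{L}$ extends $\mathcal{L}'$), and $\mathcal{L}$ is preserved under $\mathcal{L}'$-asimulations, is $\star$-compact, and has the Tarski Union Property, then $\mathcal{L}' \bowtie \mathcal{L}$ (the two logics are expressively equivalent).
   Context: Signatures and models. A signature $\Theta$ consists of predicate letters of positive arities ($\Theta_n$ = the $n$-ary ones) and individual constants $Const_\Theta$; no function symbols. A (Kripke) $\Theta$-model is $\mathcal{M}=\langle W,\prec,\mathfrak{A},\mathbb{H}\rangle$: $W\neq\emptyset$; $\prec$ a partial order on $W$; $\mathfrak{A}$ assigns to each $w\in W$ a classical $\Theta$-structure $\mathfrak{A}_w=(A_w,I_w)$, with $A_w\cap A_v=\emptyset$ for $w\neq v$; $\mathbb{H}$ assigns to each pair $w\prec v$ a homomorphism $\mathbb{H}_{wv}:\mathfrak{A}_w\to\mathfrak{A}_v$ (predicates preserved, $I_v(c)=\mathbb{H}_{wv}(I_w(c))$), with $\mathbb{H}_{ww}=id$ and $\mathbb{H}_{wu}=\mathbb{H}_{vu}\circ\mathbb{H}_{wv}$ for $w\prec v\prec u$. $\mathbb{A}=\bigcup_w A_w$; $\mathbb{H}_{wv}\langle\bar a\rangle$ acts componentwise. A pointed model is $(\mathcal{M},w)$, $w\in W$. $[W,w]=\{v:w\prec v\}$, and $[\mathcal{M},w]$ is the restriction of $\mathcal{M}$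 to $[W,w]$. For pairwise distinct constants $\bar c_n\notin\Theta$ and $\bar a_n\in A_w^n$, $([\mathcal{M},w],\bar c_n/\bar a_n)$ is the expansion of $[\mathcal{M},w]$ interpreting $c_i$ at $v$ as $\mathbb{H}_{wv}(a_i)$. For $\mathcal{N}=\langle U,\lhd,\mathfrak{B},\mathbb{G}\rangle$ (with $\mathfrak{B}_u=(B_u,J_u)$): $\mathcal{M}\subseteq\mathcal{N}$ (submodel) iff $W\subseteq U$, $\prec=\lhd\cap(W\times W)$, each $\mathfrak{A}_w$ is a classical substructure of $\mathfrak{B}_w$, and $\mathbb{H}_{wv}=\mathbb{G}_{wv}\upharpoonright A_w$. The union of a countable $\subseteq$-chain is the componentwise union. $(\mathcal{M},w)\oplus(\bar c_n/\bar a_n)$ is the set of $(\Theta\cup\{\bar c_n\})$-models $\mathcal{N}$ with $[\mathcal{M},w]\subseteq\mathcal{N}\upharpoonright\Theta\subseteq\mathcal{M}$ and $J_w(c_i)=a_i$. An isomorphism $(g,h):\mathcal{M}\cong\mathcal{N}$ consists of bijections $g:\mathbb{A}\to\mathbb{B}$, $h:W\to U$ with $v\prec u\Leftrightarrow h(v)\lhd h(u)$, $g\upharpoonright A_v:\mathfrak{A}_v\cong\mathfrak{B}_{h(v)}$, and $g(\mathbb{H}_{vu}(a))=\mathbb{G}_{h(v)h(u)}(g(a))$. Standard semantics. Formulas are built from atoms $P(t_1,\dots,t_m)$ (terms = variables or constants), $\bot$, and (in languages with equality) $t_1\equiv t_2$, using $\wedge,\vee,\to,\forall,\exists$. At $w$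 under an assignment $\bar a$ of elements of $A_w$: atoms hold iff the values lie in $I_w(P)$ (resp. coincide); $\bot$ never; $\wedge,\vee$ as usual; $\varphi\to\psi$ holds iff for every $v$ with $w\prec v$, if $\varphi$ holds at $v$ under $\mathbb{H}_{wv}\langle\bar a\rangle$ then so does $\psi$; $\exists x\varphi$ iff some $a\in A_w$ for $x$ works; $\forall x\varphi$ iff for all $v\succ w$ and all $a\in A_v$, $\varphi$ holds at $v$ under $\mathbb{H}_{wv}\langle\bar a\rangle$ and $x\mapsto a$. $In$ (resp. $Su$) is the class of models with all $\mathbb{H}_{wv}$ injective (resp. surjective), $Bi=In\cap Su$. $StIL=\{\mathsf{IL},\mathsf{CD},\mathsf{IL}^\equiv,\mathsf{CD}^\equiv,\mathsf{In}^\equiv,\mathsf{Bi}^\equiv\}$: respectively language without $\equiv$ over all models; without $\equiv$ over $Su$; with $\equiv$ over all models; with $\equiv$ over $Su$; with $\equiv$ over $In$; with $\equiv$ over $Bi$. For such a logic, $Str(\Theta)$ = pointed $\Theta$-models from its class, $L(\Theta)$ = its sentences over $\Theta$, and $\boxplus=\oplus$. Theories and types. $Th_\mathcal{L}(\mathcal{M},w)=(\{\phi\in L(\Theta):\mathcal{M},w\models_\mathcal{L}\phi\},\{\phi\in L(\Theta):\mathcal{M},w\not\models_\mathcal{L}\phi\})$; $Th^+$ is the first component. $Tp_\mathcal{L}(\mathcal{M},w,\bar c_n/\bar a_n)=Th_\mathcal{L}(([\mathcal{M},w],\bar c_n/\bar a_n),w)$. $\mathcal{M}\preccurlyeq_\mathcal{L}\mathcal{N}$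 iff $\mathcal{M}\subseteq\mathcal{N}$ and $Tp_\mathcal{L}(\mathcal{M},w,\bar c_n/\bar a_n)=Tp_\mathcal{L}(\mathcal{N},w,\bar c_n/\bar a_n)$ for all $w\in W$, $n$, $\bar a_n\in A_w^n$ and fresh $\bar c_n$. Asimulations. Fix pairwise distinct constants $c_1,c_2,\dots\notin\Theta$. For $\mathcal{L}'\in StIL$, a relation $A$ is an $\mathcal{L}'$-asimulation from $(\mathcal{M}_1,w_1,\bar a_n)$ to $(\mathcal{M}_2,w_2,\bar b_n)$ iff $A$ relates pairs $(w;\bar\alpha_l)$ ($w\in W_i$, $\bar\alpha_l\in\mathbb{A}_i^l$) to pairs $(v;\bar\beta_l)$ ($v\in W_j$, $\bar\beta_l\in\mathbb{A}_j^l$), $\{i,j\}=\{1,2\}$; $(w_1;\bar a_n)A(w_2;\bar b_n)$; and whenever $(w;\bar\alpha_l)A(v;\bar\beta_l)$ with $w\in W_i$, $v\in W_j$, $\bar\alpha_l\in(A_i)_w^l$, $\bar\beta_l\in(A_j)_v^l$: (atom) every atomic sentence of the language of $\mathcal{L}'$ over $\Theta\cup\{c_1,\dots,c_l\}$ true at $w$ in $([\mathcal{M}_i,w],\bar c_l/\bar\alpha_l)$ is true at $v$ in $([\mathcal{M}_j,v],\bar c_l/\bar\beta_l)$; (s-back) if $v\prec_j t$ there is $u$ with $w\prec_i u$, $(u;(\mathbb{H}_i)_{wu}\langle\bar\alpha_l\rangle)A(t;(\mathbb{H}_j)_{vt}\langle\bar\beta_l\rangle)$ and $(t;(\mathbb{H}_j)_{vt}\langle\bar\beta_l\rangle)A(u;(\mathbb{H}_i)_{wu}\langle\bar\alpha_l\rangle)$;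 (obj-forth) for each $\alpha'\in(A_i)_w$ there is $\beta'\in(A_j)_v$ with $(w;\bar\alpha_l{}^\frown\alpha')A(v;\bar\beta_l{}^\frown\beta')$; (obj-back) for each $t$ with $v\prec_j t$ and $\beta'\in(A_j)_t$ there are $u$ with $w\prec_i u$ and $\alpha'\in(A_i)_u$ with $(u;(\mathbb{H}_i)_{wu}\langle\bar\alpha_l\rangle^\frown\alpha')A(t;(\mathbb{H}_j)_{vt}\langle\bar\beta_l\rangle^\frown\beta')$. Abstract intuitionistic logics. A quadruple $\mathcal{L}=(Str_\mathcal{L},L,\models_\mathcal{L},\boxplus_\mathcal{L})$: $Str_\mathcal{L}(\Theta)$ is a class of pointed $\Theta$-models closed under isomorphisms, signature renamings, changing the point within the same model, reducts to subsignatures, unions of countable $\subseteq$-chains of models with a common point, and constant extensions (if $(\mathcal{M},w)\in Str_\mathcal{L}(\Theta)$ then some $\mathcal{N}\in(\mathcal{M},w)\oplus(\bar c_n/\bar a_n)$ has $(\mathcal{N},w)\in Str_\mathcal{L}(\Theta\cup\{\bar c_n\})$); $L(\Theta)$ is a set of sentences; $\models_\mathcal{L}$ relates $(\mathcal{M},w)\in Str_\mathcal{L}(\Theta)$ to $\phi\in L(\Theta)$; $(\mathcal{M},w)\boxplus_\mathcal{L}(\bar c_n/\bar a_n)$ is a nonempty subset of $(\mathcal{M},w)\oplus(\bar c_n/\bar a_n)$ whose members $\mathcal{N}$ satisfy $(\mathcal{N},v)\in Str_\mathcal{L}(\Theta\cup\{\bar c_n\})$ for all worlds $v$, and which contains every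 $\mathcal{N}'\in(\mathcal{M},w)\oplus(\bar c_n/\bar a_n)$ agreeing at $w$ on all $L(\Theta\cup\{\bar c_n\})$-sentences with some member. Required: (Occurrence) each $\phi$ has a finite $\Theta_\phi$ with $\phi\in L(\Theta')$ iff $\Theta_\phi\subseteq\Theta'$; (Renaming) signature renamings induce truth-preserving bijections of sentences; (Isomorphism) $\mathcal{M},w\models\phi\Leftrightarrow\mathcal{N},h(w)\models\phi$ when $(g,h):\mathcal{M}\cong\mathcal{N}$; (Expansion) for $\Theta\subseteq\Theta'$, $(\mathcal{M},w)\in Str_\mathcal{L}(\Theta')$, $\phi\in L(\Theta)$: $\mathcal{M},w\models\phi\Leftrightarrow\mathcal{M}\upharpoonright\Theta,w\models\phi$; (Propositional closure) $\bot\in L(\Theta)$ and $L(\Theta)$ is closed under intuitionistic $\to,\wedge,\vee$; (Quantifier closure) for $c\notin\Theta$, $\phi\in L(\Theta\cup\{c\})$ there are $\exists c\phi,\forall c\phi\in L(\Theta)$ with $\mathcal{M},w\models\exists c\phi$ iff $\exists a\in A_w\,\exists\mathcal{N}\in(\mathcal{M},w)\boxplus_\mathcal{L}(c/a)\,(\mathcal{N},w\models\phi)$, and $\mathcal{M},w\models\forall c\phi$ iff $\forall v\succ w\,\forall a\in A_v\,\exists\mathcal{N}\in(\mathcal{M},v)\boxplus_\mathcal{L}(c/a)\,(\mathcal{N},v\models\phi)$. $\mathcal{L}'\sqsubseteq\mathcal{L}$ iff $Str_\mathcal{L}=Str_{\mathcal{L}'}$, $(\mathcal{M},w)\boxplus_\mathcal{L}(\bar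 c/\bar a)\subseteq(\mathcal{M},w)\boxplus_{\mathcal{L}'}(\bar c/\bar a)$ always, and every $\phi\in L'(\Theta_\phi)$ has $\psi\in L(\Theta_\phi)$ with $\Theta_\psi=\Theta_\phi$ true at exactly the same $(\mathcal{M},w)\in Str(\Theta_\phi)$. $\mathcal{L}\bowtie\mathcal{L}'$ iff both $\mathcal{L}\sqsubseteq\mathcal{L}'$ and $\mathcal{L}'\sqsubseteq\mathcal{L}$. Properties. $\mathcal{L}$ is preserved under $\mathcal{L}'$-asimulations iff for all $(\mathcal{M}_1,w_1),(\mathcal{M}_2,w_2)\in Str_\mathcal{L}(\Theta)$, if there is an $\mathcal{L}'$-asimulation from $(\mathcal{M}_1,w_1)$ to $(\mathcal{M}_2,w_2)$ (empty tuples) then every $\phi\in L(\Theta)$ true at $(\mathcal{M}_1,w_1)$ is true at $(\mathcal{M}_2,w_2)$. $\mathcal{L}$ is $\star$-compact iff for every $(\Gamma,\Delta)\subseteq(L(\Theta),L(\Theta))$, if for all finite $\Gamma'\subseteq\Gamma,\Delta'\subseteq\Delta$ some $(\mathcal{M},w)\in Str_\mathcal{L}(\Theta)$ makes all of $\Gamma'$ true and all of $\Delta'$ false, then some $(\mathcal{M},w)\in Str_\mathcal{L}(\Theta)$ does so for $(\Gamma,\Delta)$. $\mathcal{L}$ has the Tarski Union Property iff for every chain $\mathcal{M}_0\preccurlyeq_\mathcal{L}\mathcal{M}_1\preccurlyeq_\mathcal{L}\cdots$, $\mathcal{M}_n\preccurlyeq_\mathcal{L}\bigcup_k\mathcal{M}_k$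 for all $n$.
   Formalization: In ⊑, Θ_ψ=Θ_φ is required only if the target logic has a sentence with exactly that signature (IL, CD have none with constants but no predicate letters); for a standard logic ⊞ is ⊕ restricted to its model class, since ⊕ may leave Su. *)

theory Defs
  imports Main "HOL-Library.FuncSet" "HOL-Library.Equipollence"
begin

section \<open>The universe of sets\<close>

text \<open>
  A single type \<open>'u\<close> plays the role of the universe: symbols of signatures, worlds and elements of
  models are all taken from it. A subset of \<open>'u\<close> counts as a set if it is small, that is, has fewer
  elements than \<open>'u\<close>; all other subsets are proper classes. As in set theory, a signature therefore
  never exhausts the available symbols, and fresh constants always exist. The axioms are
  Union-Replacement (equivalently, regularity of the cardinality of \<open>'u\<close>) and smallness of the
  continuum. The cardinality of \<open>'u\<close> may be inaccessible, in which case \<open>'u\<close> is a Grothendieck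
  universe, but need not be.
\<close>

definition small :: "'u set \<Rightarrow> bool" where
  "small X \<longleftrightarrow> X \<prec> (UNIV :: 'u set)"

definition set_universe :: "'u itself \<Rightarrow> bool" where
  "set_universe (_ :: 'u itself) \<longleftrightarrow>
     (UNIV :: nat set set) \<prec> (UNIV :: 'u set) \<and>
     (\<forall>(X :: 'u set) (F :: 'u \<Rightarrow> 'u set).
        small X \<longrightarrow> (\<forall>x\<in>X. small (F x)) \<longrightarrow> small (\<Union>x\<in>X. F x))"


section \<open>Signatures and Kripke models\<close>

text \<open>A predicate letter is a name together with its arity, so \<open>preds \<Theta> n\<close> is \<open>\<Theta>\<^sub>n\<close>.\<close>

record 'u signature =
  preds :: "nat \<Rightarrow> 'u set"
  csts :: "'u set"

definition is_sig :: "'u signature \<Rightarrow> bool" where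
  "is_sig \<Theta> \<longleftrightarrow> preds \<Theta> 0 = {} \<and> (\<forall>n. small (preds \<Theta> n)) \<and> small (csts \<Theta>)"

definition finite_sig :: "'u signature \<Rightarrow> bool" where
  "finite_sig \<Theta> \<longleftrightarrow> finite (SIGMA n:UNIV. preds \<Theta> n) \<and> finite (csts \<Theta>)"

definition sub_sig :: "'u signature \<Rightarrow> 'u signature \<Rightarrow> bool" where
  "sub_sig \<Theta> \<Theta>' \<longleftrightarrow> (\<forall>n. preds \<Theta> n \<subseteq> preds \<Theta>' n) \<and> csts \<Theta> \<subseteq> csts \<Theta>'"

definition add_consts :: "'u signature \<Rightarrow> 'u list \<Rightarrow> 'u signature" where
  "add_consts \<Theta> cs = \<Theta>\<lparr>csts := csts \<Theta> \<union> set cs\<rparr>"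

text \<open>
  A model carries its signature \<open>sgn\<close>. \<open>pint M w P\<close> holds the tuples of all lengths \<open>n\<close> that satisfy
  the \<open>n\<close>-ary letter named \<open>P\<close> at \<open>w\<close>. All components are normalised outside of their domains
  (see \<open>is_model\<close>), so that equality of models is equality in the set-theoretic sense.
\<close>

record 'u kmodel =
  sgn :: "'u signature"
  wlds :: "'u set"
  acc :: "('u \<times> 'u) set"
  dmn :: "'u \<Rightarrow> 'u set"
  pint :: "'u \<Rightarrow> 'u \<Rightarrow> 'u list set"
  cint :: "'u \<Rightarrow> 'u \<Rightarrow> 'u"
  hom :: "'u \<Rightarrow> 'u \<Rightarrow> 'u \<Rightarrow> 'u"

definition is_model :: "'u signature \<Rightarrow> 'u kmodel \<Rightarrow> bool" where
  "is_model \<Theta> M \<longleftrightarrow>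
     sgn M = \<Theta> \<and>
     wlds M \<noteq> {} \<and> small (wlds M) \<and> partial_order_on (wlds M) (acc M) \<and>
     (\<forall>w\<in>wlds M. dmn M w \<noteq> {} \<and> small (dmn M w)) \<and>
     (\<forall>w. w \<notin> wlds M \<longrightarrow> dmn M w = {}) \<and>
     (\<forall>w\<in>wlds M. \<forall>v\<in>wlds M. w \<noteq> v \<longrightarrow> dmn M w \<inter> dmn M v = {}) \<and>
     (\<forall>w P. \<forall>as\<in>pint M w P. set as \<subseteq> dmn M w \<and> P \<in> preds \<Theta> (length as)) \<and>
     (\<forall>w\<in>wlds M. cint M w \<in> csts \<Theta> \<rightarrow>\<^sub>E dmn M w) \<and>
     (\<forall>w. w \<notin> wlds M \<longrightarrow> cint M w = (\<lambda>_. undefined)) \<and>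
     (\<forall>w v. (w, v) \<in> acc M \<longrightarrow>
        hom M w v \<in> dmn M w \<rightarrow>\<^sub>E dmn M v \<and>
        (\<forall>P. \<forall>as\<in>pint M w P. map (hom M w v) as \<in> pint M v P) \<and>
        (\<forall>c\<in>csts \<Theta>. cint M v c = hom M w v (cint M w c))) \<and>
     (\<forall>w v. (w, v) \<notin> acc M \<longrightarrow> hom M w v = (\<lambda>_. undefined)) \<and>
     (\<forall>w\<in>wlds M. \<forall>a\<in>dmn M w. hom M w w a = a) \<and>
     (\<forall>w v u. (w, v) \<in> acc M \<longrightarrow> (v, u) \<in> acc M \<longrightarrow>
        (\<forall>a\<in>dmn M w. hom M w u a = hom M v u (hom M w v a)))"

definition elems :: "'u kmodel \<Rightarrow> 'u set" where
  "elems M = (\<Union>w\<in>wlds M. dmn M w)"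

definition reduct :: "'u kmodel \<Rightarrow> 'u signature \<Rightarrow> 'u kmodel" where
  "reduct M \<Theta> = M\<lparr>sgn := \<Theta>,
     pint := (\<lambda>w P. {as \<in> pint M w P. P \<in> preds \<Theta> (length as)}),
     cint := (\<lambda>w. restrict (cint M w) (csts \<Theta>))\<rparr>"

text \<open>\<open>cone M w\<close> is \<open>[M, w]\<close>, and \<open>cone_exp M w cs as\<close> is \<open>([M, w], cs / as)\<close>.\<close>

definition cone :: "'u kmodel \<Rightarrow> 'u \<Rightarrow> 'u kmodel" where
  "cone M w = (let V = {v. (w, v) \<in> acc M} in
     \<lparr>sgn = sgn M, wlds = V, acc = acc M \<inter> V \<times> V,
      dmn = (\<lambda>v. if v \<in> V then dmn M v else {}),
      pint = (\<lambda>v. if v \<in> V then pint M v else (\<lambda>_. {})),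
      cint = (\<lambda>v. if v \<in> V then cint M v else (\<lambda>_. undefined)),
      hom = (\<lambda>v u. if v \<in> V \<and> u \<in> V then hom M v u else (\<lambda>_. undefined))\<rparr>)"

definition cone_exp :: "'u kmodel \<Rightarrow> 'u \<Rightarrow> 'u list \<Rightarrow> 'u list \<Rightarrow> 'u kmodel" where
  "cone_exp M w cs as = (cone M w)\<lparr>sgn := add_consts (sgn M) cs,
     cint := (\<lambda>v. if (w, v) \<in> acc M
                  then (\<lambda>c. case map_of (zip cs as) c of
                              Some a \<Rightarrow> hom M w v a
                            | None \<Rightarrow> cint M v c)
                  else (\<lambda>_. undefined))\<rparr>"

definition submodel :: "'u kmodel \<Rightarrow> 'u kmodel \<Rightarrow> bool" where
  "submodel M N \<longleftrightarrow>
     sgn M = sgn N \<and> wlds M \<subseteq> wlds N \<and> acc M = acc N \<inter> wlds M \<times> wlds M \<and>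
     (\<forall>w\<in>wlds M. dmn M w \<subseteq> dmn N w \<and>
        (\<forall>P. pint M w P = pint N w P \<inter> lists (dmn M w)) \<and>
        (\<forall>c\<in>csts (sgn M). cint M w c = cint N w c)) \<and>
     (\<forall>w v. (w, v) \<in> acc M \<longrightarrow> hom M w v = restrict (hom N w v) (dmn M w))"

text \<open>
  Componentwise union of a chain of models. Along a chain all constants and homomorphisms agree where
  defined, so reading their values off the first model in which they are defined yields the union of
  their graphs.
\<close>

definition chain_union :: "(nat \<Rightarrow> 'u kmodel) \<Rightarrow> 'u kmodel" where
  "chain_union Ms =
     \<lparr>sgn = sgn (Ms 0),
      wlds = (\<Union>n. wlds (Ms n)),
      acc = (\<Union>n. acc (Ms n)),
      dmn = (\<lambda>w. \<Union>n. dmn (Ms n) w),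
      pint = (\<lambda>w P. \<Union>n. pint (Ms n) w P),
      cint = (\<lambda>w. if \<exists>n. w \<in> wlds (Ms n)
                  then cint (Ms (LEAST n. w \<in> wlds (Ms n))) w else (\<lambda>_. undefined)),
      hom = (\<lambda>w v a. if \<exists>n. (w, v) \<in> acc (Ms n) \<and> a \<in> dmn (Ms n) w
                     then hom (Ms (LEAST n. (w, v) \<in> acc (Ms n) \<and> a \<in> dmn (Ms n) w)) w v a
                     else undefined)\<rparr>"

definition name_tuple :: "'u kmodel \<Rightarrow> 'u \<Rightarrow> 'u list \<Rightarrow> 'u list \<Rightarrow> bool" where
  "name_tuple M w cs as \<longleftrightarrow>
     distinct cs \<and> set cs \<inter> csts (sgn M) = {} \<and> length as = length cs \<and> set as \<subseteq> dmn M w"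

text \<open>\<open>oplus M w cs as\<close> is \<open>(M, w) \<oplus> (cs / as)\<close>.\<close>

definition oplus :: "'u kmodel \<Rightarrow> 'u \<Rightarrow> 'u list \<Rightarrow> 'u list \<Rightarrow> 'u kmodel set" where
  "oplus M w cs as = {N. is_model (add_consts (sgn M) cs) N \<and>
     submodel (cone M w) (reduct N (sgn M)) \<and> submodel (reduct N (sgn M)) M \<and>
     map (cint N w) cs = as}"

definition model_iso :: "('u \<Rightarrow> 'u) \<Rightarrow> ('u \<Rightarrow> 'u) \<Rightarrow> 'u kmodel \<Rightarrow> 'u kmodel \<Rightarrow> bool" where
  "model_iso g h M N \<longleftrightarrow>
     sgn M = sgn N \<and>
     bij_betw g (elems M) (elems N) \<and> bij_betw h (wlds M) (wlds N) \<and>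
     (\<forall>v\<in>wlds M. \<forall>u\<in>wlds M. (v, u) \<in> acc M \<longleftrightarrow> (h v, h u) \<in> acc N) \<and>
     (\<forall>v\<in>wlds M. bij_betw g (dmn M v) (dmn N (h v)) \<and>
        (\<forall>P. \<forall>as\<in>lists (dmn M v). as \<in> pint M v P \<longleftrightarrow> map g as \<in> pint N (h v) P) \<and>
        (\<forall>c\<in>csts (sgn M). g (cint M v c) = cint N (h v) c)) \<and>
     (\<forall>v u. (v, u) \<in> acc M \<longrightarrow> (\<forall>a\<in>dmn M v. g (hom M v u a) = hom N (h v) (h u) (g a)))"

definition is_renaming ::
    "'u signature \<Rightarrow> 'u signature \<Rightarrow> (nat \<Rightarrow> 'u \<Rightarrow> 'u) \<Rightarrow> ('u \<Rightarrow> 'u) \<Rightarrow> bool" where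
  "is_renaming \<Theta> \<Theta>' fp fc \<longleftrightarrow>
     (\<forall>n. bij_betw (fp n) (preds \<Theta> n) (preds \<Theta>' n)) \<and> bij_betw fc (csts \<Theta>) (csts \<Theta>')"

definition rename_model ::
    "'u signature \<Rightarrow> (nat \<Rightarrow> 'u \<Rightarrow> 'u) \<Rightarrow> ('u \<Rightarrow> 'u) \<Rightarrow> 'u kmodel \<Rightarrow> 'u kmodel" where
  "rename_model \<Theta>' fp fc M = M\<lparr>sgn := \<Theta>',
     pint := (\<lambda>w Q. {as. \<exists>P\<in>preds (sgn M) (length as). fp (length as) P = Q \<and> as \<in> pint M w P}),
     cint := (\<lambda>w. if w \<in> wlds M
                  then (\<lambda>d\<in>csts \<Theta>'. cint M w (inv_into (csts (sgn M)) fc d))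
                  else (\<lambda>_. undefined))\<rparr>"


section \<open>Abstract intuitionistic logics\<close>

text \<open>
  \<open>Sat L M w \<phi>\<close> is only meaningful for \<open>(M, w) \<in> Str L \<Theta>\<close> and \<open>\<phi> \<in> Sen L \<Theta>\<close>; \<open>Bpl\<close> is the
  operation \<open>\<boxplus>\<close>. The type \<open>'s\<close> of sentences is arbitrary.
\<close>

record ('u, 's) logic =
  Str :: "'u signature \<Rightarrow> ('u kmodel \<times> 'u) set"
  Sen :: "'u signature \<Rightarrow> 's set"
  Sat :: "'u kmodel \<Rightarrow> 'u \<Rightarrow> 's \<Rightarrow> bool"
  Bpl :: "'u kmodel \<Rightarrow> 'u \<Rightarrow> 'u list \<Rightarrow> 'u list \<Rightarrow> 'u kmodel set"

definition structures_ok :: "('u, 's) logic \<Rightarrow> bool" where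
  "structures_ok L \<longleftrightarrow> (\<forall>\<Theta>. is_sig \<Theta> \<longrightarrow>
     (\<forall>M w. (M, w) \<in> Str L \<Theta> \<longrightarrow>
        is_model \<Theta> M \<and> w \<in> wlds M \<and>
        (\<forall>N g h. is_model \<Theta> N \<and> model_iso g h M N \<longrightarrow> (N, h w) \<in> Str L \<Theta>) \<and>
        (\<forall>\<Theta>' fp fc. is_sig \<Theta>' \<and> is_renaming \<Theta> \<Theta>' fp fc \<longrightarrow>
           (rename_model \<Theta>' fp fc M, w) \<in> Str L \<Theta>') \<and>
        (\<forall>v\<in>wlds M. (M, v) \<in> Str L \<Theta>) \<and>
        (\<forall>\<Theta>'. is_sig \<Theta>' \<and> sub_sig \<Theta>' \<Theta> \<longrightarrow> (reduct M \<Theta>', w) \<in> Str L \<Theta>') \<and>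
        (\<forall>cs as. name_tuple M w cs as \<longrightarrow>
           (\<exists>N\<in>oplus M w cs as. (N, w) \<in> Str L (add_consts \<Theta> cs)))) \<and>
     (\<forall>Ms w. (\<forall>n. (Ms n, w) \<in> Str L \<Theta> \<and> submodel (Ms n) (Ms (Suc n))) \<longrightarrow>
        (chain_union Ms, w) \<in> Str L \<Theta>))"

definition boxplus_ok :: "('u, 's) logic \<Rightarrow> bool" where
  "boxplus_ok L \<longleftrightarrow> (\<forall>\<Theta> M w cs as.
     is_sig \<Theta> \<and> (M, w) \<in> Str L \<Theta> \<and> name_tuple M w cs as \<longrightarrow>
       Bpl L M w cs as \<noteq> {} \<and> Bpl L M w cs as \<subseteq> oplus M w cs as \<and>
       (\<forall>N\<in>Bpl L M w cs as. \<forall>v\<in>wlds N. (N, v) \<in> Str L (add_consts \<Theta> cs)) \<and>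
       (\<forall>N\<in>Bpl L M w cs as. \<forall>N'\<in>oplus M w cs as.
          (N', w) \<in> Str L (add_consts \<Theta> cs) \<and>
          (\<forall>\<phi>\<in>Sen L (add_consts \<Theta> cs). Sat L N w \<phi> \<longleftrightarrow> Sat L N' w \<phi>) \<longrightarrow>
          N' \<in> Bpl L M w cs as))"

definition occurs_exactly :: "('u, 's) logic \<Rightarrow> 's \<Rightarrow> 'u signature \<Rightarrow> bool" where
  "occurs_exactly L \<phi> \<Theta> \<longleftrightarrow> is_sig \<Theta> \<and> finite_sig \<Theta> \<and>
     (\<forall>\<Theta>'. is_sig \<Theta>' \<longrightarrow> (\<phi> \<in> Sen L \<Theta>' \<longleftrightarrow> sub_sig \<Theta> \<Theta>'))"

definition sen_sig :: "('u, 's) logic \<Rightarrow> 's \<Rightarrow> 'u signature" where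
  "sen_sig L \<phi> = (THE \<Theta>. occurs_exactly L \<phi> \<Theta>)"

definition occurrence :: "('u, 's) logic \<Rightarrow> bool" where
  "occurrence L \<longleftrightarrow> (\<forall>\<Theta>. is_sig \<Theta> \<longrightarrow> (\<forall>\<phi>\<in>Sen L \<Theta>. \<exists>\<Theta>'. occurs_exactly L \<phi> \<Theta>'))"

definition renaming :: "('u, 's) logic \<Rightarrow> bool" where
  "renaming L \<longleftrightarrow> (\<forall>\<Theta> \<Theta>' fp fc. is_sig \<Theta> \<and> is_sig \<Theta>' \<and> is_renaming \<Theta> \<Theta>' fp fc \<longrightarrow>
     (\<exists>F. bij_betw F (Sen L \<Theta>) (Sen L \<Theta>') \<and>
        (\<forall>(M, w)\<in>Str L \<Theta>. \<forall>\<phi>\<in>Sen L \<Theta>.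
           Sat L M w \<phi> \<longleftrightarrow> Sat L (rename_model \<Theta>' fp fc M) w (F \<phi>))))"

definition isomorphism_invariant :: "('u, 's) logic \<Rightarrow> bool" where
  "isomorphism_invariant L \<longleftrightarrow> (\<forall>\<Theta>. is_sig \<Theta> \<longrightarrow>
     (\<forall>(M, w)\<in>Str L \<Theta>. \<forall>N g h. is_model \<Theta> N \<and> model_iso g h M N \<longrightarrow>
        (\<forall>\<phi>\<in>Sen L \<Theta>. Sat L M w \<phi> \<longleftrightarrow> Sat L N (h w) \<phi>)))"

definition expansion :: "('u, 's) logic \<Rightarrow> bool" where
  "expansion L \<longleftrightarrow> (\<forall>\<Theta> \<Theta>'. is_sig \<Theta> \<and> is_sig \<Theta>' \<and> sub_sig \<Theta> \<Theta>' \<longrightarrow>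
     (\<forall>(M, w)\<in>Str L \<Theta>'. \<forall>\<phi>\<in>Sen L \<Theta>. Sat L M w \<phi> \<longleftrightarrow> Sat L (reduct M \<Theta>) w \<phi>))"

definition propositional_closure :: "('u, 's) logic \<Rightarrow> bool" where
  "propositional_closure L \<longleftrightarrow> (\<forall>\<Theta>. is_sig \<Theta> \<longrightarrow>
     (\<exists>\<chi>\<in>Sen L \<Theta>. \<forall>(M, w)\<in>Str L \<Theta>. \<not> Sat L M w \<chi>) \<and>
     (\<forall>\<phi>\<in>Sen L \<Theta>. \<forall>\<psi>\<in>Sen L \<Theta>.
        (\<exists>\<chi>\<in>Sen L \<Theta>. \<forall>(M, w)\<in>Str L \<Theta>.
           Sat L M w \<chi> \<longleftrightarrow> (\<forall>v. (w, v) \<in> acc M \<longrightarrow> Sat L M v \<phi> \<longrightarrow> Sat L M v \<psi>)) \<and>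
        (\<exists>\<chi>\<in>Sen L \<Theta>. \<forall>(M, w)\<in>Str L \<Theta>. Sat L M w \<chi> \<longleftrightarrow> Sat L M w \<phi> \<and> Sat L M w \<psi>) \<and>
        (\<exists>\<chi>\<in>Sen L \<Theta>. \<forall>(M, w)\<in>Str L \<Theta>. Sat L M w \<chi> \<longleftrightarrow> Sat L M w \<phi> \<or> Sat L M w \<psi>)))"

definition quantifier_closure :: "('u, 's) logic \<Rightarrow> bool" where
  "quantifier_closure L \<longleftrightarrow> (\<forall>\<Theta> c. is_sig \<Theta> \<and> c \<notin> csts \<Theta> \<longrightarrow>
     (\<forall>\<phi>\<in>Sen L (add_consts \<Theta> [c]).
        (\<exists>\<chi>\<in>Sen L \<Theta>. \<forall>(M, w)\<in>Str L \<Theta>.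
           Sat L M w \<chi> \<longleftrightarrow> (\<exists>a\<in>dmn M w. \<exists>N\<in>Bpl L M w [c] [a]. Sat L N w \<phi>)) \<and>
        (\<exists>\<chi>\<in>Sen L \<Theta>. \<forall>(M, w)\<in>Str L \<Theta>.
           Sat L M w \<chi> \<longleftrightarrow> (\<forall>v. (w, v) \<in> acc M \<longrightarrow>
             (\<forall>a\<in>dmn M v. \<exists>N\<in>Bpl L M v [c] [a]. Sat L N v \<phi>)))))"

definition abstract_logic :: "('u, 's) logic \<Rightarrow> bool" where
  "abstract_logic L \<longleftrightarrow>
     structures_ok L \<and> boxplus_ok L \<and> occurrence L \<and> renaming L \<and> isomorphism_invariant L \<and>
     expansion L \<and> propositional_closure L \<and> quantifier_closure L"

text \<open>
  \<open>extends L' L\<close> is \<open>L' \<sqsubseteq> L\<close>. The requirement that the signature of \<open>\<psi>\<close> be all of the signature of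
  \<open>\<phi>\<close> is imposed whenever \<open>L\<close> has some sentence with exactly that signature. The proviso only concerns
  a degenerate case: without equality and predicate letters, no formula can mention a constant, so an
  equality-free standard logic has no sentence whose signature consists of constants only, whereas an
  abstract logic may have one (for instance a copy of falsum tagged with a constant).
\<close>

definition extends :: "('u, 't) logic \<Rightarrow> ('u, 's) logic \<Rightarrow> bool" where
  "extends L' L \<longleftrightarrow>
     (\<forall>\<Theta>. is_sig \<Theta> \<longrightarrow> Str L \<Theta> = Str L' \<Theta>) \<and>
     (\<forall>\<Theta> M w cs as. is_sig \<Theta> \<and> (M, w) \<in> Str L \<Theta> \<and> name_tuple M w cs as \<longrightarrow>
        Bpl L M w cs as \<subseteq> Bpl L' M w cs as) \<and>
     (\<forall>\<Theta>. is_sig \<Theta> \<longrightarrow> (\<forall>\<phi>\<in>Sen L' \<Theta>. let \<Theta>\<phi> = sen_sig L' \<phi> in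
        \<exists>\<psi>\<in>Sen L \<Theta>\<phi>.
          ((\<exists>\<chi>\<in>Sen L \<Theta>\<phi>. sen_sig L \<chi> = \<Theta>\<phi>) \<longrightarrow> sen_sig L \<psi> = \<Theta>\<phi>) \<and>
          (\<forall>(M, w)\<in>Str L \<Theta>\<phi>. Sat L' M w \<phi> \<longleftrightarrow> Sat L M w \<psi>)))"

definition equally_expressive :: "('u, 't) logic \<Rightarrow> ('u, 's) logic \<Rightarrow> bool" where
  "equally_expressive L' L \<longleftrightarrow> extends L' L \<and> extends L L'"


section \<open>Theories, types and model-theoretic properties\<close>

definition Th :: "('u, 's) logic \<Rightarrow> 'u kmodel \<Rightarrow> 'u \<Rightarrow> 's set \<times> 's set" where
  "Th L M w = ({\<phi> \<in> Sen L (sgn M). Sat L M w \<phi>}, {\<phi> \<in> Sen L (sgn M). \<not> Sat L M w \<phi>})"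

definition Tp :: "('u, 's) logic \<Rightarrow> 'u kmodel \<Rightarrow> 'u \<Rightarrow> 'u list \<Rightarrow> 'u list \<Rightarrow> 's set \<times> 's set" where
  "Tp L M w cs as = Th L (cone_exp M w cs as) w"

definition elementary_submodel :: "('u, 's) logic \<Rightarrow> 'u kmodel \<Rightarrow> 'u kmodel \<Rightarrow> bool" where
  "elementary_submodel L M N \<longleftrightarrow> submodel M N \<and>
     (\<forall>w\<in>wlds M. \<forall>cs as. name_tuple M w cs as \<longrightarrow> Tp L M w cs as = Tp L N w cs as)"

definition star_compact :: "('u, 's) logic \<Rightarrow> bool" where
  "star_compact L \<longleftrightarrow> (\<forall>\<Theta> \<Gamma> \<Delta>. is_sig \<Theta> \<and> \<Gamma> \<subseteq> Sen L \<Theta> \<and> \<Delta> \<subseteq> Sen L \<Theta> \<and>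
     (\<forall>\<Gamma>' \<Delta>'. finite \<Gamma>' \<and> finite \<Delta>' \<and> \<Gamma>' \<subseteq> \<Gamma> \<and> \<Delta>' \<subseteq> \<Delta> \<longrightarrow>
        (\<exists>(M, w)\<in>Str L \<Theta>. (\<forall>\<phi>\<in>\<Gamma>'. Sat L M w \<phi>) \<and> (\<forall>\<phi>\<in>\<Delta>'. \<not> Sat L M w \<phi>))) \<longrightarrow>
     (\<exists>(M, w)\<in>Str L \<Theta>. (\<forall>\<phi>\<in>\<Gamma>. Sat L M w \<phi>) \<and> (\<forall>\<phi>\<in>\<Delta>. \<not> Sat L M w \<phi>)))"

definition tarski_union_property :: "('u, 's) logic \<Rightarrow> bool" where
  "tarski_union_property L \<longleftrightarrow> (\<forall>\<Theta> Ms. is_sig \<Theta> \<and>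
     (\<forall>n. (\<forall>w\<in>wlds (Ms n). (Ms n, w) \<in> Str L \<Theta>) \<and> is_model \<Theta> (Ms n)) \<and>
     (\<forall>n. elementary_submodel L (Ms n) (Ms (Suc n))) \<longrightarrow>
     (\<forall>n. elementary_submodel L (Ms n) (chain_union Ms)))"


section \<open>The standard intuitionistic logics\<close>

datatype 'u tm = Var nat | Cst 'u

datatype 'u fm =
    Bot
  | Atom 'u "'u tm list"
  | Eq "'u tm" "'u tm"
  | And "'u fm" "'u fm"
  | Or "'u fm" "'u fm"
  | Imp "'u fm" "'u fm"
  | All nat "'u fm"
  | Ex nat "'u fm"

fun tm_vars :: "'u tm \<Rightarrow> nat set" where
  "tm_vars (Var x) = {x}"
| "tm_vars (Cst c) = {}"

fun tm_over :: "'u signature \<Rightarrow> 'u tm \<Rightarrow> bool" where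
  "tm_over \<Theta> (Var x) \<longleftrightarrow> True"
| "tm_over \<Theta> (Cst c) \<longleftrightarrow> c \<in> csts \<Theta>"

fun fv :: "'u fm \<Rightarrow> nat set" where
  "fv Bot = {}"
| "fv (Atom P ts) = (\<Union>t\<in>set ts. tm_vars t)"
| "fv (Eq s t) = tm_vars s \<union> tm_vars t"
| "fv (And \<phi> \<psi>) = fv \<phi> \<union> fv \<psi>"
| "fv (Or \<phi> \<psi>) = fv \<phi> \<union> fv \<psi>"
| "fv (Imp \<phi> \<psi>) = fv \<phi> \<union> fv \<psi>"
| "fv (All x \<phi>) = fv \<phi> - {x}"
| "fv (Ex x \<phi>) = fv \<phi> - {x}"

text \<open>The Boolean argument says whether the language has equality.\<close>

fun fm_over :: "bool \<Rightarrow> 'u signature \<Rightarrow> 'u fm \<Rightarrow> bool" where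
  "fm_over e \<Theta> Bot \<longleftrightarrow> True"
| "fm_over e \<Theta> (Atom P ts) \<longleftrightarrow> P \<in> preds \<Theta> (length ts) \<and> (\<forall>t\<in>set ts. tm_over \<Theta> t)"
| "fm_over e \<Theta> (Eq s t) \<longleftrightarrow> e \<and> tm_over \<Theta> s \<and> tm_over \<Theta> t"
| "fm_over e \<Theta> (And \<phi> \<psi>) \<longleftrightarrow> fm_over e \<Theta> \<phi> \<and> fm_over e \<Theta> \<psi>"
| "fm_over e \<Theta> (Or \<phi> \<psi>) \<longleftrightarrow> fm_over e \<Theta> \<phi> \<and> fm_over e \<Theta> \<psi>"
| "fm_over e \<Theta> (Imp \<phi> \<psi>) \<longleftrightarrow> fm_over e \<Theta> \<phi> \<and> fm_over e \<Theta> \<psi>"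
| "fm_over e \<Theta> (All x \<phi>) \<longleftrightarrow> fm_over e \<Theta> \<phi>"
| "fm_over e \<Theta> (Ex x \<phi>) \<longleftrightarrow> fm_over e \<Theta> \<phi>"

fun tm_val :: "'u kmodel \<Rightarrow> 'u \<Rightarrow> (nat \<Rightarrow> 'u) \<Rightarrow> 'u tm \<Rightarrow> 'u" where
  "tm_val M w s (Var x) = s x"
| "tm_val M w s (Cst c) = cint M w c"

fun holds :: "'u kmodel \<Rightarrow> 'u \<Rightarrow> (nat \<Rightarrow> 'u) \<Rightarrow> 'u fm \<Rightarrow> bool" where
  "holds M w s Bot \<longleftrightarrow> False"
| "holds M w s (Atom P ts) \<longleftrightarrow> map (tm_val M w s) ts \<in> pint M w P"
| "holds M w s (Eq t1 t2) \<longleftrightarrow> tm_val M w s t1 = tm_val M w s t2"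
| "holds M w s (And \<phi> \<psi>) \<longleftrightarrow> holds M w s \<phi> \<and> holds M w s \<psi>"
| "holds M w s (Or \<phi> \<psi>) \<longleftrightarrow> holds M w s \<phi> \<or> holds M w s \<psi>"
| "holds M w s (Imp \<phi> \<psi>) \<longleftrightarrow> (\<forall>v. (w, v) \<in> acc M \<longrightarrow>
     holds M v (hom M w v \<circ> s) \<phi> \<longrightarrow> holds M v (hom M w v \<circ> s) \<psi>)"
| "holds M w s (All x \<phi>) \<longleftrightarrow> (\<forall>v. (w, v) \<in> acc M \<longrightarrow>
     (\<forall>a\<in>dmn M v. holds M v ((hom M w v \<circ> s)(x := a)) \<phi>))"
| "holds M w s (Ex x \<phi>) \<longleftrightarrow> (\<exists>a\<in>dmn M w. holds M w (s(x := a)) \<phi>)"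

datatype stil = IL | CD | IL_eq | CD_eq | In_eq | Bi_eq

fun has_eq :: "stil \<Rightarrow> bool" where
  "has_eq IL \<longleftrightarrow> False"
| "has_eq CD \<longleftrightarrow> False"
| "has_eq _ \<longleftrightarrow> True"

definition inj_model :: "'u kmodel \<Rightarrow> bool" where
  "inj_model M \<longleftrightarrow> (\<forall>(w, v)\<in>acc M. inj_on (hom M w v) (dmn M w))"

definition surj_model :: "'u kmodel \<Rightarrow> bool" where
  "surj_model M \<longleftrightarrow> (\<forall>(w, v)\<in>acc M. hom M w v ` dmn M w = dmn M v)"

fun in_class :: "stil \<Rightarrow> 'u kmodel \<Rightarrow> bool" where
  "in_class IL M \<longleftrightarrow> True"
| "in_class CD M \<longleftrightarrow> surj_model M"
| "in_class IL_eq M \<longleftrightarrow> True"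
| "in_class CD_eq M \<longleftrightarrow> surj_model M"
| "in_class In_eq M \<longleftrightarrow> inj_model M"
| "in_class Bi_eq M \<longleftrightarrow> inj_model M \<and> surj_model M"

text \<open>
  The operation \<open>\<boxplus>\<close> of a standard logic is \<open>\<oplus>\<close>, read within the class of models of that logic: a
  member of \<open>(M, w) \<oplus> (cs / as)\<close> may shrink domains outside of \<open>[M, w]\<close> and thereby lose surjectivity.
\<close>

definition std_logic :: "stil \<Rightarrow> ('u, 'u fm) logic" where
  "std_logic K =
     \<lparr>Str = (\<lambda>\<Theta>. {(M, w). is_model \<Theta> M \<and> w \<in> wlds M \<and> in_class K M}),
      Sen = (\<lambda>\<Theta>. {\<phi>. fm_over (has_eq K) \<Theta> \<phi> \<and> fv \<phi> = {}}),
      Sat = (\<lambda>M w \<phi>. \<forall>s. (\<forall>x. s x \<in> dmn M w) \<longrightarrow> holds M w s \<phi>),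
      Bpl = (\<lambda>M w cs as. {N \<in> oplus M w cs as. in_class K N})\<rparr>"


section \<open>Asimulations\<close>

definition fresh_consts :: "'u signature \<Rightarrow> nat \<Rightarrow> 'u" where
  "fresh_consts \<Theta> = (SOME c. inj c \<and> range c \<inter> csts \<Theta> = {})"

definition atomic :: "'u fm \<Rightarrow> bool" where
  "atomic \<phi> \<longleftrightarrow> (\<exists>P ts. \<phi> = Atom P ts) \<or> (\<exists>s t. \<phi> = Eq s t)"

definition asimulation :: "stil \<Rightarrow> 'u kmodel \<Rightarrow> 'u \<Rightarrow> 'u list \<Rightarrow> 'u kmodel \<Rightarrow> 'u \<Rightarrow> 'u list \<Rightarrow>
    ('u \<times> 'u list \<Rightarrow> 'u \<times> 'u list \<Rightarrow> bool) \<Rightarrow> bool" where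
  "asimulation K M1 w1 as M2 w2 bs A \<longleftrightarrow>
     (\<forall>w \<alpha> v \<beta>. A (w, \<alpha>) (v, \<beta>) \<longrightarrow> length \<alpha> = length \<beta> \<and>
        (\<exists>(Mi, Mj)\<in>{(M1, M2), (M2, M1)}.
           w \<in> wlds Mi \<and> \<alpha> \<in> lists (elems Mi) \<and> v \<in> wlds Mj \<and> \<beta> \<in> lists (elems Mj))) \<and>
     A (w1, as) (w2, bs) \<and>
     (\<forall>(Mi, Mj)\<in>{(M1, M2), (M2, M1)}. \<forall>w \<alpha> v \<beta>.
        A (w, \<alpha>) (v, \<beta>) \<and> w \<in> wlds Mi \<and> v \<in> wlds Mj \<and>
        \<alpha> \<in> lists (dmn Mi w) \<and> \<beta> \<in> lists (dmn Mj v) \<longrightarrow>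
        \<comment> \<open>atom\<close>
        (let cs = map (fresh_consts (sgn M1)) [0..<length \<alpha>] in
           \<forall>\<phi>\<in>Sen (std_logic K) (add_consts (sgn M1) cs). atomic \<phi> \<longrightarrow>
             Sat (std_logic K) (cone_exp Mi w cs \<alpha>) w \<phi> \<longrightarrow>
             Sat (std_logic K) (cone_exp Mj v cs \<beta>) v \<phi>) \<and>
        \<comment> \<open>s-back\<close>
        (\<forall>t. (v, t) \<in> acc Mj \<longrightarrow> (\<exists>u. (w, u) \<in> acc Mi \<and>
           A (u, map (hom Mi w u) \<alpha>) (t, map (hom Mj v t) \<beta>) \<and>
           A (t, map (hom Mj v t) \<beta>) (u, map (hom Mi w u) \<alpha>))) \<and>
        \<comment> \<open>obj-forth\<close>
        (\<forall>a\<in>dmn Mi w. \<exists>b\<in>dmn Mj v. A (w, \<alpha> @ [a]) (v, \<beta> @ [b])) \<and>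
        \<comment> \<open>obj-back\<close>
        (\<forall>t. (v, t) \<in> acc Mj \<longrightarrow> (\<forall>b\<in>dmn Mj t. \<exists>u. (w, u) \<in> acc Mi \<and> (\<exists>a\<in>dmn Mi u.
           A (u, map (hom Mi w u) \<alpha> @ [a]) (t, map (hom Mj v t) \<beta> @ [b])))))"

definition preserved_under_asimulations :: "stil \<Rightarrow> ('u, 's) logic \<Rightarrow> bool" where
  "preserved_under_asimulations K L \<longleftrightarrow> (\<forall>\<Theta> M1 w1 M2 w2.
     is_sig \<Theta> \<and> (M1, w1) \<in> Str L \<Theta> \<and> (M2, w2) \<in> Str L \<Theta> \<and>
     (\<exists>A. asimulation K M1 w1 [] M2 w2 [] A) \<longrightarrow>
     (\<forall>\<phi>\<in>Sen L \<Theta>. Sat L M1 w1 \<phi> \<longrightarrow> Sat L M2 w2 \<phi>))"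

end

theory Submission
  imports Defs "HOL-Library.Countable_Set"
begin

text \<open>
  If a sentence \<open>\<phi>\<close> of \<open>L\<close> with finite signature were not equivalent to a standard sentence, compactness
  would give pointed models \<open>(M, w)\<close> of \<open>\<phi>\<close> and \<open>(N, v)\<close> of its failure such that every standard
  sentence true at \<open>w\<close> is true at \<open>v\<close>. If both models realise enough types, inclusion of standard types
  is an asimulation between them, which contradicts preservation.

  It remains to pass to such saturated models without changing the \<open>L\<close>-theory. Bounded morphisms are
  asimulations, so a model may be replaced by its tree unravelling. The elementary diagram of a tree \<open>M\<close>
  can be expressed in \<open>L\<close> at the root: for every world \<open>v\<close> one adds letters for ``above \<open>v\<close>'' and ``not
  below \<open>v\<close>'', which together pin down \<open>v\<close>, and for every element \<open>a\<close> a letter for the images of \<open>a\<close>.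
  Further letters name the world and element that realise a given type. A model \<open>N\<close> of finitely
  satisfiable conditions of this kind exists by compactness, and \<open>M\<close> embeds in the unravelling of \<open>N\<close>
  by recursion along the tree; this yields an \<open>L\<close>-elementary extension of \<open>M\<close> that realises all types
  finitely satisfiable in \<open>M\<close>. The Tarski Union Property allows one to iterate this \<open>\<omega>\<close> times.
\<close>


section \<open>Small sets\<close>

lemma lepoll_linear: "A \<lesssim> B \<or> B \<lesssim> A"
  using ordLeq_total[OF card_of_Well_order[of A] card_of_Well_order[of B]]
  unfolding lepoll_def by (auto simp flip: card_of_ordLeq)

text \<open>The parameter \<open>\<U>\<close> makes the type \<open>'u\<close> visible in the abbreviation \<open>tiny\<close>, which extends \<open>small\<close>
  to sets over other types.\<close>

locale universe =
  fixes \<U> :: "'u set"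
  assumes \<U>_UNIV: "\<U> = UNIV"
    and set_universe: "set_universe TYPE('u)"
begin

abbreviation tiny :: "'a set \<Rightarrow> bool" where
  "tiny X \<equiv> X \<prec> \<U>"

lemma small_iff_tiny: "small (X :: 'u set) \<longleftrightarrow> tiny X"
  by (simp add: small_def \<U>_UNIV)

lemma small_UN: "small (X :: 'u set) \<Longrightarrow> (\<And>x. x \<in> X \<Longrightarrow> small (F x :: 'u set)) \<Longrightarrow> small (\<Union>x\<in>X. F x)"
  using set_universe unfolding set_universe_def by blast

lemma tiny_image: "tiny X \<Longrightarrow> tiny (f ` X)"
  by (rule lesspoll_trans1[OF image_lepoll])

lemma tiny_subset: "tiny Y \<Longrightarrow> X \<subseteq> Y \<Longrightarrow> tiny X"
  by (rule lesspoll_trans1[OF subset_imp_lepoll])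

lemma tiny_inj_image: "inj_on f X \<Longrightarrow> tiny (f ` X) \<longleftrightarrow> tiny X"
  using tiny_image inj_on_image_eqpoll_self[of f X] eq_lesspoll_trans eqpoll_sym by blast

lemma tiny_Pow_countable:
  assumes "countable X" shows "tiny (Pow X)"
proof -
  have "Pow X \<lesssim> (UNIV :: nat set set)"
    using inj_on_image_Pow[OF inj_on_to_nat_on[OF assms]] unfolding lepoll_def by blast
  moreover have "tiny (UNIV :: nat set set)"
    using set_universe unfolding set_universe_def \<U>_UNIV by blast
  ultimately show ?thesis by (rule lesspoll_trans1)
qed

lemma tiny_countable: "countable X \<Longrightarrow> tiny X"
  by (rule lesspoll_trans1[OF lepoll_Pow_self tiny_Pow_countable])

lemma tiny_finite: "finite X \<Longrightarrow> tiny X"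
  by (simp add: tiny_countable countable_finite)

definition code :: "'a set \<Rightarrow> 'a \<Rightarrow> 'u" where
  "code X = (SOME f. inj_on f X)"

lemma inj_on_code: "tiny X \<Longrightarrow> inj_on (code X :: _ \<Rightarrow> 'u) X"
  unfolding code_def lesspoll_def lepoll_def by (intro someI_ex[of "\<lambda>f. inj_on f X"]) blast

lemma infinite_universe: "infinite (UNIV :: 'u set)"
  using lesspoll_imp_lepoll[OF tiny_countable[of "UNIV :: nat set"]]
  by (simp add: infinite_le_lepoll \<U>_UNIV)

definition pairing :: "'u \<times> 'u \<Rightarrow> 'u" where
  "pairing = (SOME p. inj p)"

lemma inj_pairing: "inj pairing"
proof -
  have "ordLeq3 (card_of (UNIV :: ('u \<times> 'u) set)) (card_of (UNIV :: 'u set))"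
    using card_of_Times_same_infinite[OF infinite_universe] by (simp add: ordIso_iff_ordLeq)
  then have "\<exists>p :: 'u \<times> 'u \<Rightarrow> 'u. inj p" unfolding card_of_ordLeq[symmetric] by blast
  then show ?thesis unfolding pairing_def by (rule someI_ex)
qed

lemma pairing_eq [simp]: "pairing p = pairing q \<longleftrightarrow> p = q"
  by (rule inj_eq[OF inj_pairing])

definition unpair :: "'u \<Rightarrow> 'u \<times> 'u" where
  "unpair = inv pairing"

lemma unpair_pairing [simp]: "unpair (pairing p) = p"
  by (simp add: unpair_def inj_pairing)

lemma tiny_Sigma:
  assumes "tiny X" "\<And>x. x \<in> X \<Longrightarrow> tiny (F x)"
  shows "tiny (Sigma X F)"
proof -
  let ?f = "code X :: _ \<Rightarrow> 'u" and ?g = "\<lambda>x. code (F x) :: _ \<Rightarrow> 'u"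
  note f = inj_on_code[OF assms(1)] and g = inj_on_code[OF assms(2)]
  let ?e = "\<lambda>(x, y). pairing (?f x, ?g x y)" and ?x = "the_inv_into X ?f"
  have "?e ` Sigma X F = (\<Union>z\<in>?f ` X. (\<lambda>y. pairing (z, ?g (?x z) y)) ` F (?x z))"
    using f by (force simp: the_inv_into_f_f)
  also have "small \<dots>"
    by (rule small_UN) (use assms f in \<open>auto simp: small_iff_tiny the_inv_into_f_f intro!: tiny_image\<close>)
  finally have "tiny (?e ` Sigma X F)" by (simp add: small_iff_tiny)
  moreover have "inj_on ?e (Sigma X F)" using f g by (auto simp: inj_on_def)
  ultimately show ?thesis by (simp add: tiny_inj_image)
qed

lemma tiny_UN:
  assumes "tiny X" "\<And>x. x \<in> X \<Longrightarrow> tiny (F x)"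
  shows "tiny (\<Union>x\<in>X. F x)"
proof -
  have "(\<Union>x\<in>X. F x) = snd ` Sigma X F" by force
  then show ?thesis using tiny_image[OF tiny_Sigma[OF assms]] by simp
qed

lemma tiny_Un:
  assumes "tiny X" "tiny Y" shows "tiny (X \<union> Y)"
proof -
  have "tiny (\<Union>b\<in>{False, True}. if b then X else Y)"
    by (rule tiny_UN) (use assms in \<open>auto simp: tiny_finite\<close>)
  then show ?thesis by (simp add: Un_commute)
qed

lemma tiny_lists:
  assumes "tiny X" shows "tiny (lists X)"
proof -
  have "tiny {xs \<in> lists X. length xs = n}" for n
  proof (induction n)
    case 0
    then show ?case by (rule tiny_subset[of "{[]}"]) (auto simp: tiny_finite)
  next
    case (Suc n)
    have "{xs \<in> lists X. length xs = Suc n} \<subseteq> case_prod (#) ` (X \<times> {xs \<in> lists X. length xs = n})"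
      by (force simp: length_Suc_conv)
    then show ?case by (rule tiny_subset[rotated]) (intro tiny_image tiny_Sigma assms Suc)
  qed
  then have "tiny (\<Union>n. {xs \<in> lists X. length xs = n})"
    by (intro tiny_UN tiny_countable[of UNIV]) auto
  then show ?thesis by (rule tiny_subset) auto
qed

lemma ex_fresh_inj:
  assumes "tiny X" "small (S :: 'u set)"
  shows "\<exists>f :: _ \<Rightarrow> 'u. inj_on f X \<and> f ` X \<inter> S = {}"
proof -
  have "\<not> (UNIV - S) \<lesssim> X"
  proof
    assume "UNIV - S \<lesssim> X"
    then have "tiny (UNIV - S)" using assms(1) by (rule lesspoll_trans1)
    then have "tiny ((UNIV - S) \<union> S)" using assms(2) unfolding small_iff_tiny by (rule tiny_Un)
    then show False by (simp add: lesspoll_def \<U>_UNIV)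
  qed
  then have "X \<lesssim> UNIV - S" using lepoll_linear by blast
  then show ?thesis unfolding lepoll_def by blast
qed

lemma ex_inj_extending_inverse:
  assumes "small (X :: 'u set)" "small (Y :: 'u set)" "inj_on e Y"
  shows "\<exists>g :: 'u \<Rightarrow> 'u. inj_on g X \<and> (\<forall>y\<in>Y. g (e y) = y)"
proof -
  obtain f :: "'u \<Rightarrow> 'u" where f: "inj_on f X" "f ` X \<inter> Y = {}"
    using ex_fresh_inj[of X Y] assms by (auto simp: small_iff_tiny)
  let ?g = "\<lambda>x. if x \<in> e ` Y then the_inv_into Y e x else f x"
  have "inj_on ?g X"
  proof (rule inj_onI)
    fix x y assume xy: "x \<in> X" "y \<in> X" "?g x = ?g y"
    have "?g z \<in> Y \<longleftrightarrow> z \<in> e ` Y" if "z \<in> X" for z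
      using that f(2) assms(3) by (auto simp: the_inv_into_f_f)
    then have "x \<in> e ` Y \<longleftrightarrow> y \<in> e ` Y" using xy by metis
    then show "x = y" using xy f(1) assms(3) by (auto simp: the_inv_into_f_f inj_on_def split: if_splits)
  qed
  then show ?thesis using assms(3) by (intro exI[of _ ?g]) (auto simp: the_inv_into_f_f)
qed

end


section \<open>Signatures\<close>

lemma sub_sig_refl: "sub_sig \<Theta> \<Theta>"
  by (simp add: sub_sig_def)

lemma sub_sig_trans: "sub_sig \<Theta> \<Theta>' \<Longrightarrow> sub_sig \<Theta>' \<Theta>'' \<Longrightarrow> sub_sig \<Theta> \<Theta>''"
  unfolding sub_sig_def by (meson order_trans)

lemma sub_sig_antisym: "sub_sig \<Theta> \<Theta>' \<Longrightarrow> sub_sig \<Theta>' \<Theta> \<Longrightarrow> \<Theta> = (\<Theta>' :: 'u signature)"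
  by (rule signature.equality) (auto simp: sub_sig_def fun_eq_iff)

lemma add_consts_simps [simp]:
  "preds (add_consts \<Theta> cs) = preds \<Theta>" "csts (add_consts \<Theta> cs) = csts \<Theta> \<union> set cs"
  by (simp_all add: add_consts_def)

lemma add_consts_append: "add_consts \<Theta> (cs @ ds) = add_consts (add_consts \<Theta> cs) ds"
  by (simp add: add_consts_def Un_assoc)

lemma add_consts_Nil [simp]: "add_consts \<Theta> [] = \<Theta>"
  by (simp add: add_consts_def)

lemma sub_sig_add_consts: "sub_sig \<Theta> \<Theta>' \<Longrightarrow> sub_sig (add_consts \<Theta> cs) (add_consts \<Theta>' cs)"
  by (auto simp: sub_sig_def)

lemma finite_sig_imp_fresh_arity:
  assumes "finite_sig \<Theta>" shows "\<exists>m>0. preds \<Theta> m = {}"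
proof -
  have "finite (fst ` (SIGMA n:UNIV. preds \<Theta> n))" using assms by (simp add: finite_sig_def)
  then obtain k where "\<forall>n\<in>fst ` (SIGMA n:UNIV. preds \<Theta> n). n \<le> k"
    using finite_nat_set_iff_bounded_le by blast
  then have "preds \<Theta> (Suc k) = {}" by force
  then show ?thesis by blast
qed

context universe
begin

lemma is_sig_add_consts:
  assumes "is_sig (\<Theta> :: 'u signature)" shows "is_sig (add_consts \<Theta> cs)"
  using assms tiny_Un[OF _ tiny_finite[OF finite_set], of "csts \<Theta>" cs]
  by (simp add: is_sig_def small_iff_tiny)

lemma is_sig_sub_sig:
  assumes "is_sig \<Theta>'" "sub_sig \<Theta> (\<Theta>' :: 'u signature)" shows "is_sig \<Theta>"
  using assms tiny_subset unfolding is_sig_def sub_sig_def small_iff_tiny by (metis subset_empty)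

lemma fresh_consts_fresh:
  assumes "is_sig (\<Theta> :: 'u signature)"
  shows "inj (fresh_consts \<Theta>)" "range (fresh_consts \<Theta>) \<inter> csts \<Theta> = {}"
proof -
  have "\<exists>c :: nat \<Rightarrow> 'u. inj_on c UNIV \<and> range c \<inter> csts \<Theta> = {}"
    using assms by (intro ex_fresh_inj tiny_countable) (simp_all add: is_sig_def)
  then have "inj (fresh_consts \<Theta>) \<and> range (fresh_consts \<Theta>) \<inter> csts \<Theta> = {}"
    unfolding fresh_consts_def by (rule someI_ex)
  then show "inj (fresh_consts \<Theta>)" "range (fresh_consts \<Theta>) \<inter> csts \<Theta> = {}" by auto
qed

end


section \<open>Models and formulas\<close>

lemma
  assumes "is_model \<Theta> M"
  shows model_sgn: "sgn M = \<Theta>"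
    and model_partial_order: "partial_order_on (wlds M) (acc M)"
    and model_wlds_nonempty: "wlds M \<noteq> {}"
    and model_small_wlds: "small (wlds M)"
    and model_dmn_nonempty: "w \<in> wlds M \<Longrightarrow> dmn M w \<noteq> {}"
    and model_small_dmn: "w \<in> wlds M \<Longrightarrow> small (dmn M w)"
    and model_dmn_out: "w \<notin> wlds M \<Longrightarrow> dmn M w = {}"
    and model_hom_id: "a \<in> dmn M w \<Longrightarrow> hom M w w a = a"
    and model_hom_comp: "(w, v) \<in> acc M \<Longrightarrow> (v, u) \<in> acc M \<Longrightarrow> a \<in> dmn M w \<Longrightarrow>
      hom M v u (hom M w v a) = hom M w u a"
  using assms unfolding is_model_def by ((elim conjE, assumption) | (elim conjE, metis empty_iff))+

lemma
  assumes "is_model \<Theta> M"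
  shows model_acc_wlds: "(w, v) \<in> acc M \<Longrightarrow> w \<in> wlds M \<and> v \<in> wlds M"
    and model_acc_refl: "w \<in> wlds M \<Longrightarrow> (w, w) \<in> acc M"
    and model_acc_trans: "(w, v) \<in> acc M \<Longrightarrow> (v, u) \<in> acc M \<Longrightarrow> (w, u) \<in> acc M"
    and model_acc_antisym: "(w, v) \<in> acc M \<Longrightarrow> (v, w) \<in> acc M \<Longrightarrow> w = v"
  using model_partial_order[OF assms]
  unfolding partial_order_on_def preorder_on_def refl_on_def trans_def antisym_def by blast+

lemma
  assumes "is_model \<Theta> M"
  shows model_hom: "(w, v) \<in> acc M \<Longrightarrow> a \<in> dmn M w \<Longrightarrow> hom M w v a \<in> dmn M v"
    and model_hom_ext: "a \<notin> dmn M w \<Longrightarrow> hom M w v a = undefined"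
    and model_hom_out: "(w, v) \<notin> acc M \<Longrightarrow> hom M w v = (\<lambda>_. undefined)"
    and model_pint_hom: "(w, v) \<in> acc M \<Longrightarrow> as \<in> pint M w P \<Longrightarrow> map (hom M w v) as \<in> pint M v P"
    and model_cint_hom: "(w, v) \<in> acc M \<Longrightarrow> c \<in> csts \<Theta> \<Longrightarrow> hom M w v (cint M w c) = cint M v c"
proof -
  have hom: "(w, v) \<in> acc M \<longrightarrow> hom M w v \<in> dmn M w \<rightarrow>\<^sub>E dmn M v \<and>
      (\<forall>P. \<forall>as\<in>pint M w P. map (hom M w v) as \<in> pint M v P) \<and>
      (\<forall>c\<in>csts \<Theta>. cint M v c = hom M w v (cint M w c))" for w v
    using assms unfolding is_model_def by (elim conjE) blast
  have out: "(w, v) \<notin> acc M \<longrightarrow> hom M w v = (\<lambda>_. undefined)" for w v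
    using assms unfolding is_model_def by (elim conjE) blast
  show "(w, v) \<in> acc M \<Longrightarrow> a \<in> dmn M w \<Longrightarrow> hom M w v a \<in> dmn M v"
    "(w, v) \<notin> acc M \<Longrightarrow> hom M w v = (\<lambda>_. undefined)"
    "(w, v) \<in> acc M \<Longrightarrow> as \<in> pint M w P \<Longrightarrow> map (hom M w v) as \<in> pint M v P"
    using hom out by blast+
  show "a \<notin> dmn M w \<Longrightarrow> hom M w v a = undefined"
    "(w, v) \<in> acc M \<Longrightarrow> c \<in> csts \<Theta> \<Longrightarrow> hom M w v (cint M w c) = cint M v c"
    using hom out by (metis PiE_arb)+
qed

lemma
  assumes "is_model \<Theta> M"
  shows model_dmn_disjoint: "a \<in> dmn M w \<Longrightarrow> a \<in> dmn M v \<Longrightarrow> w = v"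
    and model_dmn_wlds: "a \<in> dmn M w \<Longrightarrow> w \<in> wlds M"
    and model_pint: "as \<in> pint M w P \<Longrightarrow> set as \<subseteq> dmn M w \<and> P \<in> preds \<Theta> (length as)"
    and model_cint: "w \<in> wlds M \<Longrightarrow> c \<in> csts \<Theta> \<Longrightarrow> cint M w c \<in> dmn M w"
    and model_cint_ext: "c \<notin> csts \<Theta> \<Longrightarrow> cint M w c = undefined"
    and model_cint_out: "w \<notin> wlds M \<Longrightarrow> cint M w = (\<lambda>_. undefined)"
proof -
  have disjoint: "w \<in> wlds M \<longrightarrow> v \<in> wlds M \<longrightarrow> w \<noteq> v \<longrightarrow> dmn M w \<inter> dmn M v = {}" for w v
    using assms unfolding is_model_def by (elim conjE) blast
  have cint: "w \<in> wlds M \<longrightarrow> cint M w \<in> csts \<Theta> \<rightarrow>\<^sub>E dmn M w" "w \<notin> wlds M \<longrightarrow> cint M w = (\<lambda>_. undefined)" for w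
    using assms unfolding is_model_def by (elim conjE, blast)+
  show "a \<in> dmn M w \<Longrightarrow> w \<in> wlds M" using model_dmn_out[OF assms] by blast
  show "a \<in> dmn M w \<Longrightarrow> a \<in> dmn M v \<Longrightarrow> w = v" using disjoint model_dmn_out[OF assms] by blast
  show "as \<in> pint M w P \<Longrightarrow> set as \<subseteq> dmn M w \<and> P \<in> preds \<Theta> (length as)"
    using assms unfolding is_model_def by (elim conjE) blast
  show "w \<in> wlds M \<Longrightarrow> c \<in> csts \<Theta> \<Longrightarrow> cint M w c \<in> dmn M w" "w \<notin> wlds M \<Longrightarrow> cint M w = (\<lambda>_. undefined)"
    using cint by blast+
  show "c \<notin> csts \<Theta> \<Longrightarrow> cint M w c = undefined" using cint by (metis PiE_arb)
qed

lemma (in universe) small_elems: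
  assumes "is_model \<Theta> (M :: 'u kmodel)" shows "small (elems M)"
  unfolding elems_def using model_small_wlds[OF assms] model_small_dmn[OF assms] by (rule small_UN)

lemma model_dmn_elems: "is_model \<Theta> M \<Longrightarrow> a \<in> dmn M w \<Longrightarrow> a \<in> elems M"
  using model_dmn_wlds by (fastforce simp: elems_def)

lemma set_map_hom_subset:
  "is_model \<Theta> M \<Longrightarrow> (w, v) \<in> acc M \<Longrightarrow> set as \<subseteq> dmn M w \<Longrightarrow> set (map (hom M w v) as) \<subseteq> dmn M v"
  using model_hom by fastforce

lemma map_hom_id: "is_model \<Theta> M \<Longrightarrow> set as \<subseteq> dmn M w \<Longrightarrow> map (hom M w w) as = as"
  using model_hom_id by (fastforce intro: map_idI)

lemma map_hom_comp:
  assumes "is_model \<Theta> M" "(w, v) \<in> acc M" "(v, u) \<in> acc M" "set as \<subseteq> dmn M w"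
  shows "map (hom M v u) (map (hom M w v) as) = map (hom M w u) as"
  using assms model_hom_comp[OF assms(1-3)] by auto

definition formulas :: "bool \<Rightarrow> 'u signature \<Rightarrow> nat \<Rightarrow> 'u fm set" where
  "formulas q \<Theta> k = {\<psi>. fm_over q \<Theta> \<psi> \<and> fv \<psi> \<subseteq> {..<k}}"

lemma Sen_std: "Sen (std_logic K) \<Theta> = formulas (has_eq K) \<Theta> 0"
  by (simp add: std_logic_def formulas_def)

lemma formulas_mono: "\<psi> \<in> formulas q \<Theta> k \<Longrightarrow> k \<le> l \<Longrightarrow> \<psi> \<in> formulas q \<Theta> l"
  unfolding formulas_def by force

lemma formulas_connectives [simp]:
  "Bot \<in> formulas q \<Theta> k"
  "And \<phi> \<psi> \<in> formulas q \<Theta> k \<longleftrightarrow> \<phi> \<in> formulas q \<Theta> k \<and> \<psi> \<in> formulas q \<Theta> k"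
  "Or \<phi> \<psi> \<in> formulas q \<Theta> k \<longleftrightarrow> \<phi> \<in> formulas q \<Theta> k \<and> \<psi> \<in> formulas q \<Theta> k"
  "Imp \<phi> \<psi> \<in> formulas q \<Theta> k \<longleftrightarrow> \<phi> \<in> formulas q \<Theta> k \<and> \<psi> \<in> formulas q \<Theta> k"
  by (auto simp: formulas_def)

lemma holds_cong:
  "(\<And>x. x \<in> fv \<phi> \<Longrightarrow> s x = s' x) \<Longrightarrow> holds M w s \<phi> \<longleftrightarrow> holds M w s' \<phi>"
proof (induction \<phi> arbitrary: w s s')
  case (Atom P ts)
  have "tm_val M w s t = tm_val M w s' t" if "t \<in> set ts" for t
    using Atom that by (cases t) force+
  then show ?case by (simp cong: map_cong)
next
  case (Eq t1 t2)
  then show ?case by (cases t1; cases t2) auto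
next
  case (And \<phi> \<psi>)
  then show ?case by (metis UnCI fv.simps(4) holds.simps(4))
next
  case (Or \<phi> \<psi>)
  then show ?case by (metis UnCI fv.simps(5) holds.simps(5))
next
  case (Imp \<phi> \<psi>)
  have "holds M v (hom M w v \<circ> s) \<phi> = holds M v (hom M w v \<circ> s') \<phi>"
    "holds M v (hom M w v \<circ> s) \<psi> = holds M v (hom M w v \<circ> s') \<psi>" for v
    using Imp.prems by (auto intro!: Imp.IH)
  then show ?case by simp
next
  case (All x \<phi>)
  have "holds M v ((hom M w v \<circ> s)(x := a)) \<phi> = holds M v ((hom M w v \<circ> s')(x := a)) \<phi>" for v a
    using All.prems by (auto intro!: All.IH)
  then show ?case by simp
next
  case (Ex x \<phi>)
  have "holds M w (s(x := a)) \<phi> = holds M w (s'(x := a)) \<phi>" for a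
    using Ex.prems by (auto intro!: Ex.IH)
  then show ?case by simp
qed simp

lemma holds_nth_map:
  assumes "\<psi> \<in> formulas q \<Theta> (length as)"
  shows "holds M w (f \<circ> nth as) \<psi> \<longleftrightarrow> holds M w (nth (map f as)) \<psi>"
  by (rule holds_cong) (use assms in \<open>auto simp: formulas_def\<close>)

lemma holds_nth_upd:
  assumes "\<psi> \<in> formulas q \<Theta> (Suc (length as))"
  shows "holds M w ((nth as)(length as := a)) \<psi> \<longleftrightarrow> holds M w (nth (as @ [a])) \<psi>"
  by (rule holds_cong) (use assms in \<open>auto simp: formulas_def nth_append less_Suc_eq subset_iff\<close>)

lemma Sat_std_iff:
  assumes "is_model \<Theta> M" "w \<in> wlds M" "fv \<phi> = {}"
  shows "Sat (std_logic K) M w \<phi> \<longleftrightarrow> holds M w s \<phi>"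
proof -
  obtain a where "a \<in> dmn M w" using model_dmn_nonempty[OF assms(1,2)] by blast
  then have "\<exists>s. \<forall>x. s x \<in> dmn M w" by (intro exI[of _ "\<lambda>_. a"]) simp
  moreover have "holds M w s' \<phi> \<longleftrightarrow> holds M w s \<phi>" for s'
    using assms(3) by (intro holds_cong) simp
  ultimately show ?thesis unfolding std_logic_def by (simp, blast)
qed

lemma tm_val_hom:
  assumes "is_model \<Theta> M" "(w, v) \<in> acc M" "tm_over \<Theta> t"
  shows "hom M w v (tm_val M w s t) = tm_val M v (hom M w v \<circ> s) t"
  using assms by (cases t) (auto simp: model_cint_hom)

lemma holds_persistent:
  assumes M: "is_model \<Theta> M"
  shows "fm_over q \<Theta> \<phi> \<Longrightarrow> (w, v) \<in> acc M \<Longrightarrow> (\<And>x. x \<in> fv \<phi> \<Longrightarrow> s x \<in> dmn M w) \<Longrightarrow>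
    holds M w s \<phi> \<Longrightarrow> holds M v (hom M w v \<circ> s) \<phi>"
proof (induction \<phi> arbitrary: w v s)
  case (Atom P ts)
  then have "map (hom M w v) (map (tm_val M w s) ts) \<in> pint M v P"
    by (intro model_pint_hom[OF M]) auto
  moreover have "map (hom M w v) (map (tm_val M w s) ts) = map (tm_val M v (hom M w v \<circ> s)) ts"
    using Atom.prems tm_val_hom[OF M] by auto
  ultimately show ?case by (metis holds.simps(2))
next
  case (Eq t1 t2)
  then show ?case using tm_val_hom[OF M] by (metis fm_over.simps(3) holds.simps(3))
next
  case (Imp \<phi> \<psi>)
  have "holds M u (hom M v u \<circ> (hom M w v \<circ> s)) \<chi> = holds M u (hom M w u \<circ> s) \<chi>"
    if "(v, u) \<in> acc M" "fv \<chi> \<subseteq> fv (Imp \<phi> \<psi>)" for u \<chi>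
    using that Imp.prems by (intro holds_cong) (auto simp: model_hom_comp[OF M])
  then show ?case using Imp.prems model_acc_trans[OF M] by (auto simp del: o_apply)
next
  case (All x \<phi>)
  have "holds M u ((hom M v u \<circ> (hom M w v \<circ> s))(x := a)) \<phi> = holds M u ((hom M w u \<circ> s)(x := a)) \<phi>"
    if "(v, u) \<in> acc M" for u a
    using that All.prems by (intro holds_cong) (auto simp: model_hom_comp[OF M])
  then show ?case using All.prems model_acc_trans[OF M] by (auto simp del: o_apply)
next
  case (Ex x \<phi>)
  then obtain a where a: "a \<in> dmn M w" "holds M w (s(x := a)) \<phi>" by auto
  have "holds M v (hom M w v \<circ> s(x := a)) \<phi>"
    by (rule Ex.IH[OF _ _ _ a(2)]) (use Ex.prems a in auto)
  then show ?case using model_hom[OF M _ a(1)] Ex.prems(2) by (auto simp: fun_upd_comp simp del: o_apply)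
qed auto

lemma holds_persistent_tuple:
  assumes "is_model \<Theta> M" "\<psi> \<in> formulas q \<Theta> (length as)" "(w, v) \<in> acc M" "set as \<subseteq> dmn M w"
    and "holds M w (nth as) \<psi>"
  shows "holds M v (nth (map (hom M w v) as)) \<psi>"
  unfolding holds_nth_map[OF assms(2), symmetric]
  by (rule holds_persistent[OF assms(1) _ assms(3) _ assms(5)])
    (use assms(2,4) in \<open>auto simp: formulas_def subset_iff\<close>)

fun BigAnd :: "'u fm list \<Rightarrow> 'u fm" where
  "BigAnd [] = Imp Bot Bot"
| "BigAnd (\<phi> # \<phi>s) = And \<phi> (BigAnd \<phi>s)"

fun BigOr :: "'u fm list \<Rightarrow> 'u fm" where
  "BigOr [] = Bot"
| "BigOr (\<phi> # \<phi>s) = Or \<phi> (BigOr \<phi>s)"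

lemma holds_BigAnd [simp]: "holds M w s (BigAnd \<phi>s) \<longleftrightarrow> (\<forall>\<phi>\<in>set \<phi>s. holds M w s \<phi>)"
  by (induction \<phi>s) auto

lemma holds_BigOr [simp]: "holds M w s (BigOr \<phi>s) \<longleftrightarrow> (\<exists>\<phi>\<in>set \<phi>s. holds M w s \<phi>)"
  by (induction \<phi>s) auto

lemma BigAnd_formulas [simp]: "BigAnd \<phi>s \<in> formulas q \<Theta> k \<longleftrightarrow> set \<phi>s \<subseteq> formulas q \<Theta> k"
  by (induction \<phi>s) (auto simp: formulas_def)

lemma BigOr_formulas [simp]: "BigOr \<phi>s \<in> formulas q \<Theta> k \<longleftrightarrow> set \<phi>s \<subseteq> formulas q \<Theta> k"
  by (induction \<phi>s) (auto simp: formulas_def)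


section \<open>Bounded morphisms\<close>

definition bounded_morphism ::
    "bool \<Rightarrow> 'u signature \<Rightarrow> ('u \<Rightarrow> 'u) \<Rightarrow> ('u \<Rightarrow> 'u) \<Rightarrow> 'u kmodel \<Rightarrow> 'u \<Rightarrow> 'u kmodel \<Rightarrow> bool" where
  "bounded_morphism q \<Theta> p e M w N \<longleftrightarrow> (\<forall>v. (w, v) \<in> acc M \<longrightarrow>
     p v \<in> wlds N \<and>
     (\<forall>t. (p v, t) \<in> acc N \<longleftrightarrow> (\<exists>u. (v, u) \<in> acc M \<and> p u = t)) \<and>
     e ` dmn M v = dmn N (p v) \<and> (q \<longrightarrow> inj_on e (dmn M v)) \<and>
     (\<forall>P as. set as \<subseteq> dmn M v \<and> P \<in> preds \<Theta> (length as) \<longrightarrow>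
        (as \<in> pint M v P \<longleftrightarrow> map e as \<in> pint N (p v) P)) \<and>
     (\<forall>c\<in>csts \<Theta>. cint M v c \<in> dmn M v \<and> e (cint M v c) = cint N (p v) c) \<and>
     (\<forall>u. (v, u) \<in> acc M \<longrightarrow> (\<forall>a\<in>dmn M v. e (hom M v u a) = hom N (p v) (p u) (e a))))"

lemma
  assumes "bounded_morphism q \<Theta> p e M w N" "(w, v) \<in> acc M"
  shows morphism_wlds: "p v \<in> wlds N"
    and morphism_forth: "(v, u) \<in> acc M \<Longrightarrow> (p v, p u) \<in> acc N"
    and morphism_back: "(p v, t) \<in> acc N \<Longrightarrow> \<exists>u. (v, u) \<in> acc M \<and> p u = t"
    and morphism_dmn: "e ` dmn M v = dmn N (p v)"
    and morphism_inj: "q \<Longrightarrow> inj_on e (dmn M v)"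
    and morphism_pint: "set as \<subseteq> dmn M v \<Longrightarrow> P \<in> preds \<Theta> (length as) \<Longrightarrow>
      as \<in> pint M v P \<longleftrightarrow> map e as \<in> pint N (p v) P"
    and morphism_cint: "c \<in> csts \<Theta> \<Longrightarrow> cint M v c \<in> dmn M v \<and> e (cint M v c) = cint N (p v) c"
    and morphism_hom: "(v, u) \<in> acc M \<Longrightarrow> a \<in> dmn M v \<Longrightarrow> e (hom M v u a) = hom N (p v) (p u) (e a)"
  using assms by (auto simp: bounded_morphism_def)

lemma morphism_map_hom:
  assumes "bounded_morphism q \<Theta> p e M w N" "(w, v) \<in> acc M" "(v, u) \<in> acc M" "set as \<subseteq> dmn M v"
  shows "map e (map (hom M v u) as) = map (hom N (p v) (p u)) (map e as)"
  using assms(4) morphism_hom[OF assms(1-3)] by auto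

context
  fixes q \<Theta> p e and M N :: "'u kmodel" and w \<Theta>\<^sub>M
  assumes M: "is_model \<Theta>\<^sub>M M" and morphism: "bounded_morphism q \<Theta> p e M w N"
begin

lemma morphism_tm_val:
  assumes "(w, v) \<in> acc M" "tm_over \<Theta> t" "\<And>x. x \<in> tm_vars t \<Longrightarrow> s x \<in> dmn M v"
  shows "tm_val M v s t \<in> dmn M v" "e (tm_val M v s t) = tm_val N (p v) (e \<circ> s) t"
  using assms morphism_cint[OF morphism assms(1)] by (cases t; auto)+

lemma morphism_holds_Atom:
  assumes "fm_over q \<Theta> (Atom P ts)" and v: "(w, v) \<in> acc M"
    and "\<And>x. x \<in> fv (Atom P ts) \<Longrightarrow> s x \<in> dmn M v"
  shows "holds M v s (Atom P ts) \<longleftrightarrow> holds N (p v) (e \<circ> s) (Atom P ts)"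
proof -
  have "set (map (tm_val M v s) ts) \<subseteq> dmn M v"
    using assms by (auto intro!: morphism_tm_val(1))
  moreover have "map e (map (tm_val M v s) ts) = map (tm_val N (p v) (e \<circ> s)) ts"
    using assms by (auto intro!: morphism_tm_val(2))
  ultimately show ?thesis
    using morphism_pint[OF morphism v] assms(1) by (metis fm_over.simps(2) holds.simps(2) length_map)
qed

lemma morphism_holds_Eq:
  assumes "fm_over q \<Theta> (Eq t1 t2)" and v: "(w, v) \<in> acc M"
    and "\<And>x. x \<in> fv (Eq t1 t2) \<Longrightarrow> s x \<in> dmn M v"
  shows "holds M v s (Eq t1 t2) \<longleftrightarrow> holds N (p v) (e \<circ> s) (Eq t1 t2)"
proof -
  have "tm_val M v s t \<in> dmn M v" "e (tm_val M v s t) = tm_val N (p v) (e \<circ> s) t" if "t = t1 \<or> t = t2" for t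
    using that assms by (auto intro!: morphism_tm_val)
  moreover have "inj_on e (dmn M v)" using morphism_inj[OF morphism v] assms(1) by simp
  ultimately show ?thesis by (metis holds.simps(3) inj_onD)
qed

lemma morphism_holds_hom:
  assumes IH: "\<And>v s. (w, v) \<in> acc M \<Longrightarrow> (\<And>x. x \<in> fv \<chi> \<Longrightarrow> s x \<in> dmn M v) \<Longrightarrow>
      holds M v s \<chi> \<longleftrightarrow> holds N (p v) (e \<circ> s) \<chi>"
    and v: "(w, v) \<in> acc M" and u: "(v, u) \<in> acc M" and s: "\<And>x. x \<in> fv \<chi> \<Longrightarrow> x \<notin> X \<Longrightarrow> s x \<in> dmn M v"
    and s': "\<And>x. x \<in> X \<Longrightarrow> s' x \<in> dmn M u"
  shows "holds M u (override_on (hom M v u \<circ> s) s' X) \<chi> \<longleftrightarrow>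
    holds N (p u) (override_on (hom N (p v) (p u) \<circ> (e \<circ> s)) (e \<circ> s') X) \<chi>" (is "?L \<longleftrightarrow> ?R")
proof -
  have "?L \<longleftrightarrow> holds N (p u) (e \<circ> override_on (hom M v u \<circ> s) s' X) \<chi>"
    using model_acc_trans[OF M v u] model_hom[OF M u] s s' by (intro IH) (auto simp: override_on_def)
  also have "\<dots> \<longleftrightarrow> ?R"
    using s u by (intro holds_cong) (auto simp: override_on_def morphism_hom[OF morphism v])
  finally show ?thesis .
qed

lemma morphism_all_above:
  assumes "(w, v) \<in> acc M" "\<And>u. (v, u) \<in> acc M \<Longrightarrow> Q u \<longleftrightarrow> Q' (p u)"
  shows "(\<forall>u. (v, u) \<in> acc M \<longrightarrow> Q u) \<longleftrightarrow> (\<forall>t. (p v, t) \<in> acc N \<longrightarrow> Q' t)"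
  using assms morphism_forth[OF morphism] morphism_back[OF morphism] by metis

lemma morphism_holds:
  "fm_over q \<Theta> \<phi> \<Longrightarrow> (w, v) \<in> acc M \<Longrightarrow> (\<And>x. x \<in> fv \<phi> \<Longrightarrow> s x \<in> dmn M v) \<Longrightarrow>
    holds M v s \<phi> \<longleftrightarrow> holds N (p v) (e \<circ> s) \<phi>"
proof (induction \<phi> arbitrary: v s)
  case (Atom P ts)
  then show ?case by (rule morphism_holds_Atom)
next
  case (Eq t1 t2)
  then show ?case by (rule morphism_holds_Eq)
next
  case (Imp \<phi> \<psi>)
  have "holds M u (hom M v u \<circ> s) \<phi> \<longleftrightarrow> holds N (p u) (hom N (p v) (p u) \<circ> (e \<circ> s)) \<phi>"
    "holds M u (hom M v u \<circ> s) \<psi> \<longleftrightarrow> holds N (p u) (hom N (p v) (p u) \<circ> (e \<circ> s)) \<psi>"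
    if "(v, u) \<in> acc M" for u
    using morphism_holds_hom[OF Imp.IH(1) Imp.prems(2) that, of "{}" s]
      morphism_holds_hom[OF Imp.IH(2) Imp.prems(2) that, of "{}" s] Imp.prems
    by (simp_all del: o_apply)
  then show ?case
    unfolding holds.simps using Imp.prems(2) by (intro morphism_all_above) auto
next
  case (All x \<phi>)
  have "holds M u ((hom M v u \<circ> s)(x := a)) \<phi> \<longleftrightarrow> holds N (p u) ((hom N (p v) (p u) \<circ> (e \<circ> s))(x := e a)) \<phi>"
    if "(v, u) \<in> acc M" "a \<in> dmn M u" for u a
    using morphism_holds_hom[OF All.IH All.prems(2) that(1), of "{x}" s "\<lambda>_. a"] that All.prems
    by (simp add: override_on_insert comp_def)
  moreover have "dmn N (p u) = e ` dmn M u" if "(v, u) \<in> acc M" for u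
    using morphism_dmn[OF morphism model_acc_trans[OF M All.prems(2) that]] by simp
  ultimately show ?case
    unfolding holds.simps using All.prems(2) by (intro morphism_all_above) auto
next
  case (Ex x \<phi>)
  have "holds M v (s(x := a)) \<phi> \<longleftrightarrow> holds N (p v) ((e \<circ> s)(x := e a)) \<phi>" if "a \<in> dmn M v" for a
    using Ex.IH[of v "s(x := a)"] Ex.prems that by (simp add: fun_upd_def comp_def if_distrib[of e])
  then show ?case unfolding holds.simps morphism_dmn[OF morphism Ex.prems(2), symmetric] by simp
qed auto

lemma morphism_holds_tuple:
  assumes "\<psi> \<in> formulas q \<Theta> (length as)" "(w, v) \<in> acc M" "set as \<subseteq> dmn M v"
  shows "holds M v (nth as) \<psi> \<longleftrightarrow> holds N (p v) (nth (map e as)) \<psi>"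
  unfolding holds_nth_map[OF assms(1), symmetric]
  by (rule morphism_holds) (use assms in \<open>auto simp: formulas_def subset_iff\<close>)

end


section \<open>Constructions of models\<close>

lemma is_modelI:
  assumes "sgn M = \<Theta>" "wlds M \<noteq> {}" "small (wlds M)" "partial_order_on (wlds M) (acc M)"
    and "\<And>w. w \<in> wlds M \<Longrightarrow> dmn M w \<noteq> {} \<and> small (dmn M w)" "\<And>w. w \<notin> wlds M \<Longrightarrow> dmn M w = {}"
    and disjoint: "\<And>w v a. a \<in> dmn M w \<Longrightarrow> a \<in> dmn M v \<Longrightarrow> w = v"
    and "\<And>w P as. as \<in> pint M w P \<Longrightarrow> set as \<subseteq> dmn M w \<and> P \<in> preds \<Theta> (length as)"
    and cint: "\<And>w c. w \<in> wlds M \<Longrightarrow> c \<in> csts \<Theta> \<Longrightarrow> cint M w c \<in> dmn M w"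
      "\<And>w c. \<not> (w \<in> wlds M \<and> c \<in> csts \<Theta>) \<Longrightarrow> cint M w c = undefined"
    and hom: "\<And>w v a. (w, v) \<in> acc M \<Longrightarrow> a \<in> dmn M w \<Longrightarrow> hom M w v a \<in> dmn M v"
      "\<And>w v a. \<not> ((w, v) \<in> acc M \<and> a \<in> dmn M w) \<Longrightarrow> hom M w v a = undefined"
    and "\<And>w v P as. (w, v) \<in> acc M \<Longrightarrow> as \<in> pint M w P \<Longrightarrow> map (hom M w v) as \<in> pint M v P"
    and cint_hom: "\<And>w v c. (w, v) \<in> acc M \<Longrightarrow> c \<in> csts \<Theta> \<Longrightarrow> hom M w v (cint M w c) = cint M v c"
    and "\<And>w a. a \<in> dmn M w \<Longrightarrow> hom M w w a = a"
    and hom_comp: "\<And>w v u a. (w, v) \<in> acc M \<Longrightarrow> (v, u) \<in> acc M \<Longrightarrow> a \<in> dmn M w \<Longrightarrow>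
      hom M v u (hom M w v a) = hom M w u a"
  shows "is_model \<Theta> M"
  unfolding is_model_def
proof (intro conjI allI ballI impI)
  show "dmn M w \<inter> dmn M v = {}" if "w \<noteq> v" for w v
    using disjoint that by blast
  show "cint M w \<in> csts \<Theta> \<rightarrow>\<^sub>E dmn M w" if "w \<in> wlds M" for w
    using cint that by (intro PiE_I) auto
  show "cint M w = (\<lambda>_. undefined)" if "w \<notin> wlds M" for w
    using cint(2) that by blast
  show "hom M w v \<in> dmn M w \<rightarrow>\<^sub>E dmn M v" if "(w, v) \<in> acc M" for w v
    using hom that by (intro PiE_I) auto
  show "hom M w v = (\<lambda>_. undefined)" if "(w, v) \<notin> acc M" for w v
    using hom(2) that by blast
  show "cint M v c = hom M w v (cint M w c)" if "(w, v) \<in> acc M" "c \<in> csts \<Theta>" for w v c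
    using cint_hom that by metis
  show "hom M w u a = hom M v u (hom M w v a)"
    if "(w, v) \<in> acc M" "(v, u) \<in> acc M" "a \<in> dmn M w" for w v u a
    using hom_comp that by metis
qed (simp_all add: assms)

lemma model_eqI:
  assumes M: "is_model \<Theta> M" and N: "is_model \<Theta> N" and wlds: "wlds M = wlds N" and acc: "acc M = acc N"
    and dmn: "\<And>w. w \<in> wlds M \<Longrightarrow> dmn M w = dmn N w"
    and pint: "\<And>w P as. as \<in> pint M w P \<longleftrightarrow> as \<in> pint N w P"
    and cint: "\<And>w c. w \<in> wlds M \<Longrightarrow> c \<in> csts \<Theta> \<Longrightarrow> cint M w c = cint N w c"
    and hom: "\<And>w v a. (w, v) \<in> acc M \<Longrightarrow> a \<in> dmn M w \<Longrightarrow> hom M w v a = hom N w v a"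
  shows "M = N"
proof -
  have "dmn M w = dmn N w" for w
    using dmn wlds model_dmn_out[OF M, of w] model_dmn_out[OF N, of w] by (cases "w \<in> wlds M") auto
  then have eq_dmn: "dmn M = dmn N" by blast
  have "pint M = pint N" using pint by (intro ext) auto
  moreover have "cint M = cint N"
  proof (intro ext)
    show "cint M w c = cint N w c" for w c
      using cint wlds model_cint_out[OF M] model_cint_out[OF N] model_cint_ext[OF M] model_cint_ext[OF N]
      by (cases "w \<in> wlds M"; cases "c \<in> csts \<Theta>") auto
  qed
  moreover have "hom M = hom N"
  proof (intro ext)
    show "hom M w v a = hom N w v a" for w v a
      using hom acc eq_dmn model_hom_out[OF M] model_hom_out[OF N] model_hom_ext[OF M] model_hom_ext[OF N]
      by (cases "(w, v) \<in> acc M"; cases "a \<in> dmn M w") auto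
  qed
  ultimately show ?thesis
    using wlds acc eq_dmn model_sgn[OF M] model_sgn[OF N] by (intro kmodel.equality) auto
qed

lemma partial_order_on_restrict:
  assumes "partial_order_on W R" "V \<subseteq> W"
  shows "partial_order_on V (R \<inter> V \<times> V)"
  using assms unfolding partial_order_on_def preorder_on_def refl_on_def trans_def antisym_def by blast

lemma bounded_morphism_idI:
  assumes M: "is_model \<Theta>\<^sub>M M" and N: "is_model \<Theta>\<^sub>N N" and csts: "csts \<Theta> \<subseteq> csts \<Theta>\<^sub>M"
    and acc: "\<And>v u. (w, v) \<in> acc M \<Longrightarrow> (v, u) \<in> acc N \<longleftrightarrow> (v, u) \<in> acc M"
    and dmn: "\<And>v. (w, v) \<in> acc M \<Longrightarrow> dmn N v = dmn M v"
    and pint: "\<And>v P as. (w, v) \<in> acc M \<Longrightarrow> P \<in> preds \<Theta> (length as) \<Longrightarrow> as \<in> pint N v P \<longleftrightarrow> as \<in> pint M v P"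
    and cint: "\<And>v c. (w, v) \<in> acc M \<Longrightarrow> c \<in> csts \<Theta> \<Longrightarrow> cint N v c = cint M v c"
    and hom: "\<And>v u a. (w, v) \<in> acc M \<Longrightarrow> (v, u) \<in> acc M \<Longrightarrow> a \<in> dmn M v \<Longrightarrow> hom N v u a = hom M v u a"
  shows "bounded_morphism q \<Theta> (\<lambda>x. x) (\<lambda>x. x) M w N"
  unfolding bounded_morphism_def
proof (intro allI impI conjI)
  fix v assume v: "(w, v) \<in> acc M"
  have vM: "v \<in> wlds M" using model_acc_wlds[OF M v] by blast
  then show "v \<in> wlds N" using acc[OF v, of v] model_acc_refl[OF M] model_acc_wlds[OF N] by blast
  show "\<forall>c\<in>csts \<Theta>. cint M v c \<in> dmn M v \<and> cint M v c = cint N v c"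
    using cint[OF v] csts model_cint[OF M vM] by auto
qed (use acc dmn pint hom in auto)

lemma reduct_simps [simp]:
  "sgn (reduct M \<Theta>) = \<Theta>" "wlds (reduct M \<Theta>) = wlds M" "acc (reduct M \<Theta>) = acc M"
  "dmn (reduct M \<Theta>) = dmn M" "hom (reduct M \<Theta>) = hom M"
  "as \<in> pint (reduct M \<Theta>) v P \<longleftrightarrow> as \<in> pint M v P \<and> P \<in> preds \<Theta> (length as)"
  "cint (reduct M \<Theta>) v = restrict (cint M v) (csts \<Theta>)"
  by (auto simp: reduct_def)

lemma morphism_reduct:
  assumes "is_model \<Theta>' M" "is_model \<Theta> (reduct M \<Theta>)" "sub_sig \<Theta> \<Theta>'"
  shows "bounded_morphism q \<Theta> (\<lambda>x. x) (\<lambda>x. x) M w (reduct M \<Theta>)"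
  by (rule bounded_morphism_idI[OF assms(1,2)]) (use assms(3) in \<open>auto simp: sub_sig_def\<close>)

lemma name_tupleD:
  assumes "name_tuple M w cs as"
  shows "distinct cs" "set cs \<inter> csts (sgn M) = {}" "length as = length cs" "set as \<subseteq> dmn M w"
  using assms by (auto simp: name_tuple_def)

lemma name_tuple_nth: "name_tuple M w cs as \<Longrightarrow> i < length cs \<Longrightarrow> as ! i \<in> dmn M w"
  by (auto simp: name_tuple_def)

lemma name_tuple_Nil [simp]: "name_tuple M w [] []"
  by (simp add: name_tuple_def)

lemma name_tuple_hom:
  assumes "is_model \<Theta> M" "(v, u) \<in> acc M" "name_tuple M v cs as"
  shows "name_tuple M u cs (map (hom M v u) as)"
  using assms(3) set_map_hom_subset[OF assms(1,2)] by (auto simp: name_tuple_def)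


subsection \<open>Cones with named elements\<close>

lemma cone_exp_simps [simp]:
  "sgn (cone_exp M w cs as) = add_consts (sgn M) cs"
  "wlds (cone_exp M w cs as) = {v. (w, v) \<in> acc M}"
  "(v, u) \<in> acc (cone_exp M w cs as) \<longleftrightarrow> (v, u) \<in> acc M \<and> (w, v) \<in> acc M \<and> (w, u) \<in> acc M"
  "dmn (cone_exp M w cs as) v = (if (w, v) \<in> acc M then dmn M v else {})"
  "pint (cone_exp M w cs as) v = (if (w, v) \<in> acc M then pint M v else (\<lambda>_. {}))"
  "hom (cone_exp M w cs as) v u = (if (w, v) \<in> acc M \<and> (w, u) \<in> acc M then hom M v u else (\<lambda>_. undefined))"
  by (auto simp: cone_exp_def cone_def Let_def)

lemma acc_cone_exp: "acc (cone_exp M w cs as) = acc M \<inter> {v. (w, v) \<in> acc M} \<times> {v. (w, v) \<in> acc M}"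
  by (auto simp: cone_exp_def cone_def Let_def)

lemma cint_cone_exp:
  "cint (cone_exp M w cs as) v c = (if (w, v) \<in> acc M then
     case map_of (zip cs as) c of Some a \<Rightarrow> hom M w v a | None \<Rightarrow> cint M v c else undefined)"
  by (simp add: cone_exp_def)

lemma cint_cone_exp_old:
  "(w, v) \<in> acc M \<Longrightarrow> c \<notin> set cs \<Longrightarrow> cint (cone_exp M w cs as) v c = cint M v c"
  by (cases "map_of (zip cs as) c") (auto simp: cint_cone_exp dest!: map_of_SomeD set_zip_leftD)

lemma cint_cone_exp_new:
  assumes "(w, v) \<in> acc M" "name_tuple M w cs as" "i < length cs"
  shows "cint (cone_exp M w cs as) v (cs ! i) = hom M w v (as ! i)"
  using assms by (simp add: cint_cone_exp map_of_zip_nth name_tuple_def)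

lemma
  assumes M: "is_model \<Theta> M" and names: "name_tuple M w cs as" and v: "(w, v) \<in> acc M"
    and c: "c \<in> csts \<Theta> \<union> set cs"
  shows cint_cone_exp_dmn: "cint (cone_exp M w cs as) v c \<in> dmn M v"
    and cint_cone_exp_hom: "(v, u) \<in> acc M \<Longrightarrow>
      hom M v u (cint (cone_exp M w cs as) v c) = cint (cone_exp M w cs as) u c"
proof -
  have "cint (cone_exp M w cs as) v c \<in> dmn M v \<and> ((v, u) \<in> acc M \<longrightarrow>
      hom M v u (cint (cone_exp M w cs as) v c) = cint (cone_exp M w cs as) u c)" for u
  proof (cases "c \<in> set cs")
    case True
    then obtain i where "i < length cs" "c = cs ! i" by (metis in_set_conv_nth)
    then show ?thesis
      using v name_tuple_nth[OF names] cint_cone_exp_new[OF _ names] model_hom[OF M]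
        model_hom_comp[OF M] model_acc_trans[OF M] by simp
  next
    case False
    then show ?thesis
      using v c model_acc_wlds[OF M v] model_cint[OF M] model_cint_hom[OF M] model_acc_trans[OF M v]
      by (auto simp: cint_cone_exp_old)
  qed
  then show "cint (cone_exp M w cs as) v c \<in> dmn M v"
    "(v, u) \<in> acc M \<Longrightarrow> hom M v u (cint (cone_exp M w cs as) v c) = cint (cone_exp M w cs as) u c"
    by blast+
qed

lemma is_model_cone_exp:
  assumes M: "is_model \<Theta> M" and w: "w \<in> wlds M" and names: "name_tuple M w cs as"
  shows "is_model (add_consts \<Theta> cs) (cone_exp M w cs as)" (is "is_model _ ?C")
proof -
  have above: "{v. (w, v) \<in> acc M} \<subseteq> wlds M" using model_acc_wlds[OF M] by blast
  show ?thesis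
  proof (rule is_modelI)
    show "wlds ?C \<noteq> {}" using model_acc_refl[OF M w] by auto
    show "small (wlds ?C)"
      using above model_small_wlds[OF M] unfolding small_def cone_exp_simps
      by (meson lesspoll_trans1 subset_imp_lepoll)
    show "partial_order_on (wlds ?C) (acc ?C)"
      unfolding acc_cone_exp cone_exp_simps
      by (rule partial_order_on_restrict[OF model_partial_order[OF M] above])
    show "cint ?C v c = undefined" if "\<not> (v \<in> wlds ?C \<and> c \<in> csts (add_consts \<Theta> cs))" for v c
      using that model_cint_ext[OF M] cint_cone_exp_old[of w v M c cs as] by (auto simp: cint_cone_exp)
    show "dmn ?C v \<noteq> {} \<and> small (dmn ?C v)" if "v \<in> wlds ?C" for v
      using that above model_dmn_nonempty[OF M] model_small_dmn[OF M] by auto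
    show "v = u" if "a \<in> dmn ?C v" "a \<in> dmn ?C u" for v u a
      using that model_dmn_disjoint[OF M] by (auto split: if_splits)
    show "hom ?C v u a = undefined" if "\<not> ((v, u) \<in> acc ?C \<and> a \<in> dmn ?C v)" for v u a
      using that model_hom_ext[OF M, of a v u] fun_cong[OF model_hom_out[OF M, of v u]] by auto
  qed (use model_sgn[OF M] cint_cone_exp_dmn[OF M names] cint_cone_exp_hom[OF M names] model_pint[OF M]
      model_hom[OF M]
      model_pint_hom[OF M] model_hom_id[OF M] model_hom_comp[OF M] in \<open>auto split: if_splits\<close>)
qed

lemma in_class_cone_exp: "in_class K M \<Longrightarrow> in_class K (cone_exp M w cs as)"
  by (cases K) (fastforce simp: inj_model_def surj_model_def)+

lemma morphism_cone:
  assumes "is_model \<Theta> M" "w \<in> wlds M"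
  shows "bounded_morphism q \<Theta> (\<lambda>x. x) (\<lambda>x. x) M w (cone_exp M w [] [])"
  by (rule bounded_morphism_idI[OF assms(1) is_model_cone_exp[OF assms name_tuple_Nil]])
    (use model_acc_trans[OF assms(1)] in \<open>auto simp: cint_cone_exp_old\<close>)

lemma morphism_cone_exp_base:
  assumes M: "is_model \<Theta> M" and w: "w \<in> wlds M" and names: "name_tuple M w cs as"
  shows "bounded_morphism q \<Theta> (\<lambda>x. x) (\<lambda>x. x) (cone_exp M w cs as) w M"
proof (rule bounded_morphism_idI[OF is_model_cone_exp[OF assms] M])
  fix v c assume "(w, v) \<in> acc (cone_exp M w cs as)" "c \<in> csts \<Theta>"
  then show "cint M v c = cint (cone_exp M w cs as) v c"
    using name_tupleD(2)[OF names] model_sgn[OF M] by (subst cint_cone_exp_old) auto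
qed (use model_acc_trans[OF M] in auto)

lemma morphism_cone_exp:
  assumes M: "is_model \<Theta>\<^sub>M M" and N: "is_model \<Theta>\<^sub>N N" and w: "w \<in> wlds M"
    and morphism: "bounded_morphism q \<Theta> p e M w N"
    and names: "name_tuple M w cs as" and names': "name_tuple N (p w) cs (map e as)"
  shows "bounded_morphism q (add_consts \<Theta> cs) p e (cone_exp M w cs as) w (cone_exp N (p w) cs (map e as))"
    (is "bounded_morphism q _ p e ?C w ?D")
  unfolding bounded_morphism_def
proof (intro allI impI)
  fix v assume "(w, v) \<in> acc ?C"
  then have v: "(w, v) \<in> acc M" by simp
  have pv: "(p w, p v) \<in> acc N" using morphism_forth[OF morphism model_acc_refl[OF M w] v] .
  have acc: "(p v, t) \<in> acc ?D \<longleftrightarrow> (\<exists>u. (v, u) \<in> acc ?C \<and> p u = t)" for t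
    using morphism_forth[OF morphism v] morphism_back[OF morphism v, of t] v pv
      model_acc_trans[OF M v] model_acc_trans[OF N pv]
    unfolding cone_exp_simps by blast
  have cint: "cint ?C v c \<in> dmn ?C v \<and> e (cint ?C v c) = cint ?D (p v) c"
    if "c \<in> csts (add_consts \<Theta> cs)" for c
  proof (cases "c \<in> set cs")
    case True
    then obtain i where i: "i < length cs" "c = cs ! i" by (metis in_set_conv_nth)
    moreover have "length as = length cs" using names by (simp add: name_tuple_def)
    ultimately show ?thesis
      using v pv cint_cone_exp_new[OF v names i(1)] cint_cone_exp_new[OF pv names' i(1)]
        morphism_hom[OF morphism model_acc_refl[OF M w] v] name_tuple_nth[OF names i(1)] model_hom[OF M v]
      by simp
  next
    case False
    then show ?thesis using that v pv morphism_cint[OF morphism v] by (simp add: cint_cone_exp_old)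
  qed
  show "p v \<in> wlds ?D \<and>
     (\<forall>t. (p v, t) \<in> acc ?D \<longleftrightarrow> (\<exists>u. (v, u) \<in> acc ?C \<and> p u = t)) \<and>
     e ` dmn ?C v = dmn ?D (p v) \<and> (q \<longrightarrow> inj_on e (dmn ?C v)) \<and>
     (\<forall>P as. set as \<subseteq> dmn ?C v \<and> P \<in> preds (add_consts \<Theta> cs) (length as) \<longrightarrow>
        (as \<in> pint ?C v P \<longleftrightarrow> map e as \<in> pint ?D (p v) P)) \<and>
     (\<forall>c\<in>csts (add_consts \<Theta> cs). cint ?C v c \<in> dmn ?C v \<and> e (cint ?C v c) = cint ?D (p v) c) \<and>
     (\<forall>u. (v, u) \<in> acc ?C \<longrightarrow> (\<forall>a\<in>dmn ?C v. e (hom ?C v u a) = hom ?D (p v) (p u) (e a)))"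
  proof (intro conjI)
    show "\<forall>u. (v, u) \<in> acc ?C \<longrightarrow> (\<forall>a\<in>dmn ?C v. e (hom ?C v u a) = hom ?D (p v) (p u) (e a))"
      using v pv morphism_hom[OF morphism v] morphism_forth[OF morphism v] model_acc_trans[OF N pv] by auto
    show "p v \<in> wlds ?D" using pv by simp
    show "\<forall>t. (p v, t) \<in> acc ?D \<longleftrightarrow> (\<exists>u. (v, u) \<in> acc ?C \<and> p u = t)" using acc by blast
    show "\<forall>c\<in>csts (add_consts \<Theta> cs). cint ?C v c \<in> dmn ?C v \<and> e (cint ?C v c) = cint ?D (p v) c"
      using cint by blast
  qed (use v pv morphism_dmn[OF morphism v] morphism_inj[OF morphism v] morphism_pint[OF morphism v] in simp_all)
qed

lemma name_tuple_append:
  assumes "is_model \<Theta> M" "name_tuple M v cs as" "(v, u) \<in> acc M" "name_tuple (cone_exp M v cs as) u ds bs"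
  shows "name_tuple M u (cs @ ds) (map (hom M v u) as @ bs)"
  using name_tupleD[OF name_tuple_hom[OF assms(1,3,2)]] name_tupleD[OF assms(4)] assms(3)
  by (auto simp: name_tuple_def)

lemma cone_exp_cone_exp:
  assumes M: "is_model \<Theta> M" and names: "name_tuple M v cs as" and vu: "(v, u) \<in> acc M"
    and names': "name_tuple (cone_exp M v cs as) u ds bs"
  shows "cone_exp (cone_exp M v cs as) u ds bs = cone_exp M u (cs @ ds) (map (hom M v u) as @ bs)"
proof (rule model_eqI[of "add_consts \<Theta> (cs @ ds)"])
  let ?C = "cone_exp M v cs as"
  have v: "v \<in> wlds M" and u: "u \<in> wlds M" using model_acc_wlds[OF M vu] by auto
  show "is_model (add_consts \<Theta> (cs @ ds)) (cone_exp ?C u ds bs)"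
    unfolding add_consts_append
    by (rule is_model_cone_exp[OF is_model_cone_exp[OF M v names] _ names']) (simp add: vu)
  show "is_model (add_consts \<Theta> (cs @ ds)) (cone_exp M u (cs @ ds) (map (hom M v u) as @ bs))"
    by (rule is_model_cone_exp[OF M u name_tuple_append[OF M names vu names']])
  have vt: "(v, t) \<in> acc M" if "(u, t) \<in> acc M" for t using model_acc_trans[OF M vu that] .
  show "wlds (cone_exp ?C u ds bs) = wlds (cone_exp M u (cs @ ds) (map (hom M v u) as @ bs))"
    "acc (cone_exp ?C u ds bs) = acc (cone_exp M u (cs @ ds) (map (hom M v u) as @ bs))"
    using vu vt by auto
  show "cint (cone_exp ?C u ds bs) t d = cint (cone_exp M u (cs @ ds) (map (hom M v u) as @ bs)) t d"
    if "t \<in> wlds (cone_exp ?C u ds bs)" for t d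
  proof -
    have t: "(u, t) \<in> acc M" using that by simp
    have len: "length as = length cs" and disjoint: "set cs \<inter> set ds = {}"
      using name_tupleD[OF names] name_tupleD[OF names'] by auto
    have "map_of (zip cs (map (hom M v u) as)) d = map_option (hom M v u) (map_of (zip cs as) d)"
      by (simp add: zip_map2 map_of_map)
    moreover have "hom M u t (hom M v u a) = hom M v t a" if "map_of (zip cs as) d = Some a" for a
      using that names
      by (intro model_hom_comp[OF M vu t]) (auto simp: name_tuple_def dest: map_of_SomeD set_zip_rightD)
    moreover have "map_of (zip cs as) d = None \<or> map_of (zip ds bs) d = None"
      using disjoint by (metis disjoint_iff map_of_SomeD not_None_eq set_zip_leftD)
    ultimately show ?thesis
      using vu t vt[OF t] len
      by (auto simp: cint_cone_exp map_add_def split: option.split dest: map_of_SomeD set_zip_leftD)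
  qed
qed (use vu model_acc_trans[OF M vu] in auto)

lemma cone_exp_reduct:
  assumes "length as = length cs"
  shows "cone_exp (reduct M \<Theta>) w cs as = reduct (cone_exp M w cs as) (add_consts \<Theta> cs)"
proof (rule kmodel.equality)
  show "pint (cone_exp (reduct M \<Theta>) w cs as) = pint (reduct (cone_exp M w cs as) (add_consts \<Theta> cs))"
    by (intro ext) (auto simp: reduct_def)
  show "cint (cone_exp (reduct M \<Theta>) w cs as) = cint (reduct (cone_exp M w cs as) (add_consts \<Theta> cs))"
    using assms map_of_zip_is_None[of cs as]
    by (intro ext) (auto simp: cint_cone_exp restrict_def split: option.split dest: map_of_SomeD set_zip_leftD)
qed (auto simp: fun_eq_iff acc_cone_exp)

lemma oplusD:
  assumes M: "is_model \<Theta> M" and N: "N \<in> oplus M w cs as"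
  shows "is_model (add_consts \<Theta> cs) N" "map (cint N w) cs = as" "acc N = acc M \<inter> wlds N \<times> wlds N"
    "(w, v) \<in> acc M \<Longrightarrow> v \<in> wlds N" "(w, v) \<in> acc M \<Longrightarrow> dmn N v = dmn M v"
    "v \<in> wlds N \<Longrightarrow> as' \<in> pint N v P \<longleftrightarrow> as' \<in> pint M v P \<and> set as' \<subseteq> dmn N v"
    "v \<in> wlds N \<Longrightarrow> c \<in> csts \<Theta> \<Longrightarrow> cint N v c = cint M v c"
    "(v, u) \<in> acc N \<Longrightarrow> a \<in> dmn N v \<Longrightarrow> hom N v u a = hom M v u a"
proof -
  have mod: "is_model (add_consts \<Theta> cs) N" and lower: "submodel (cone M w) (reduct N \<Theta>)"
    and upper: "submodel (reduct N \<Theta>) M" and names: "map (cint N w) cs = as"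
    using N model_sgn[OF M] by (auto simp: oplus_def)
  show "is_model (add_consts \<Theta> cs) N" "map (cint N w) cs = as" by fact+
  show "acc N = acc M \<inter> wlds N \<times> wlds N" using upper by (simp add: submodel_def)
  show in_N: "v \<in> wlds N" if "(w, v) \<in> acc M" for v
    using lower that by (auto simp: submodel_def cone_def Let_def)
  show "dmn N v = dmn M v" if "(w, v) \<in> acc M" for v
    using lower upper in_N[OF that] that by (auto simp: submodel_def cone_def Let_def)
  show "cint N v c = cint M v c" if "v \<in> wlds N" "c \<in> csts \<Theta>" for v c
    using upper that by (simp add: submodel_def)
  show "hom N v u a = hom M v u a" if "(v, u) \<in> acc N" "a \<in> dmn N v" for v u a
    using upper that by (simp add: submodel_def)
  have "pint (reduct N \<Theta>) v P = pint N v P" for v P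
    using model_pint[OF mod] by (auto simp: reduct_def)
  then show "as' \<in> pint N v P \<longleftrightarrow> as' \<in> pint M v P \<and> set as' \<subseteq> dmn N v" if "v \<in> wlds N" for v P as'
    using upper that by (auto simp: submodel_def in_lists_conv_set)
qed

text \<open>So all members of \<open>(M, w) \<oplus> (cs / as)\<close> agree above \<open>w\<close>.\<close>

lemma cone_oplus:
  assumes M: "is_model \<Theta> M" and w: "w \<in> wlds M" and names: "name_tuple M w cs as"
    and N: "N \<in> oplus M w cs as"
  shows "cone_exp N w [] [] = cone_exp M w cs as"
proof (rule model_eqI)
  note N_facts = oplusD[OF M N]
  have wN: "w \<in> wlds N" using N_facts(4) model_acc_refl[OF M w] by blast
  show "is_model (add_consts \<Theta> cs) (cone_exp N w [] [])"
    using is_model_cone_exp[OF N_facts(1) wN name_tuple_Nil] by simp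
  show "is_model (add_consts \<Theta> cs) (cone_exp M w cs as)" by (rule is_model_cone_exp[OF M w names])
  have acc: "(w, v) \<in> acc N \<longleftrightarrow> (w, v) \<in> acc M" for v using N_facts(3,4) wN by auto
  then show "wlds (cone_exp N w [] []) = wlds (cone_exp M w cs as)" by simp
  show "acc (cone_exp N w [] []) = acc (cone_exp M w cs as)"
    using acc N_facts(3,4) by (auto simp: acc_cone_exp)
  show "as' \<in> pint (cone_exp N w [] []) v P \<longleftrightarrow> as' \<in> pint (cone_exp M w cs as) v P" for v P as'
    using acc N_facts(4,5,6)[of v] model_pint[OF M, of as' v P] by auto
  show "cint (cone_exp N w [] []) v c = cint (cone_exp M w cs as) v c"
    if "v \<in> wlds (cone_exp N w [] [])" "c \<in> csts (add_consts \<Theta> cs)" for v c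
  proof (cases "c \<in> set cs")
    case True
    then obtain i where i: "i < length cs" "c = cs ! i" by (metis in_set_conv_nth)
    have v: "(w, v) \<in> acc N" "(w, v) \<in> acc M" using that acc by auto
    have "cint N v c = hom N w v (cint N w c)" using model_cint_hom[OF N_facts(1) v(1)] that by simp
    also have "cint N w c = as ! i" using N_facts(2) i by auto
    also have "hom N w v (as ! i) = hom M w v (as ! i)"
      using N_facts(8)[OF v(1)] N_facts(5)[OF model_acc_refl[OF M w]] name_tuple_nth[OF names i(1)] by simp
    finally show ?thesis using i v cint_cone_exp_new[OF v(2) names i(1)] by (simp add: cint_cone_exp_old)
  next
    case False
    then show ?thesis using that acc N_facts(4,7) by (simp add: cint_cone_exp_old)
  qed
qed (use oplusD[OF M N] w model_acc_refl[OF M w] in auto)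


subsection \<open>Pullbacks\<close>

definition pullback :: "'u kmodel \<Rightarrow> 'u set \<Rightarrow> ('u \<times> 'u) set \<Rightarrow> ('u \<Rightarrow> 'u set) \<Rightarrow> ('u \<Rightarrow> 'u) \<Rightarrow> ('u \<Rightarrow> 'u) \<Rightarrow>
    ('u \<Rightarrow> 'u \<Rightarrow> 'u) \<Rightarrow> ('u \<Rightarrow> 'u \<Rightarrow> 'u \<Rightarrow> 'u) \<Rightarrow> 'u kmodel" where
  "pullback N W R D p e C H = \<lparr>sgn = sgn N, wlds = W, acc = R, dmn = (\<lambda>v. if v \<in> W then D v else {}),
     pint = (\<lambda>v P. {as. v \<in> W \<and> set as \<subseteq> D v \<and> map e as \<in> pint N (p v) P}),
     cint = (\<lambda>v. if v \<in> W then restrict (C v) (csts (sgn N)) else (\<lambda>_. undefined)),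
     hom = (\<lambda>v u. if (v, u) \<in> R then restrict (H v u) (D v) else (\<lambda>_. undefined))\<rparr>"

lemma is_model_pullback:
  assumes N: "is_model \<Theta> N" and W: "W \<noteq> {}" "small W" and R: "partial_order_on W R"
    and D: "\<And>v. v \<in> W \<Longrightarrow> D v \<noteq> {} \<and> small (D v)"
      "\<And>v u a. v \<in> W \<Longrightarrow> u \<in> W \<Longrightarrow> a \<in> D v \<Longrightarrow> a \<in> D u \<Longrightarrow> v = u"
    and p: "\<And>v u. (v, u) \<in> R \<Longrightarrow> (p v, p u) \<in> acc N"
    and C: "\<And>v c. v \<in> W \<Longrightarrow> c \<in> csts \<Theta> \<Longrightarrow> C v c \<in> D v"
      "\<And>v u c. (v, u) \<in> R \<Longrightarrow> c \<in> csts \<Theta> \<Longrightarrow> H v u (C v c) = C u c"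
    and H: "\<And>v u a. (v, u) \<in> R \<Longrightarrow> a \<in> D v \<Longrightarrow> H v u a \<in> D u"
      "\<And>v u a. (v, u) \<in> R \<Longrightarrow> a \<in> D v \<Longrightarrow> e (H v u a) = hom N (p v) (p u) (e a)"
      "\<And>v a. v \<in> W \<Longrightarrow> a \<in> D v \<Longrightarrow> H v v a = a"
      "\<And>v u t a. (v, u) \<in> R \<Longrightarrow> (u, t) \<in> R \<Longrightarrow> a \<in> D v \<Longrightarrow> H u t (H v u a) = H v t a"
  shows "is_model \<Theta> (pullback N W R D p e C H)" (is "is_model \<Theta> ?P")
proof (rule is_modelI)
  have RW: "v \<in> W \<and> u \<in> W" if "(v, u) \<in> R" for v u
    using R that by (auto simp: partial_order_on_def preorder_on_def)
  have refl: "(v, v) \<in> R" if "v \<in> W" for v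
    using R that by (auto simp: partial_order_on_def preorder_on_def refl_on_def)
  have trans: "(v, t) \<in> R" if "(v, u) \<in> R" "(u, t) \<in> R" for v u t
    using R that by (auto simp: partial_order_on_def preorder_on_def elim: transE)
  show "set as \<subseteq> dmn ?P v \<and> P \<in> preds \<Theta> (length as)" if "as \<in> pint ?P v P" for v P as
    using that model_pint[OF N, of "map e as" "p v" P] by (auto simp: pullback_def)
  show "map (hom ?P v u) as \<in> pint ?P u P" if vu: "(v, u) \<in> acc ?P" and as: "as \<in> pint ?P v P" for v u P as
  proof -
    have vu: "(v, u) \<in> R" and as: "set as \<subseteq> D v" "map e as \<in> pint N (p v) P"
      using vu as by (auto simp: pullback_def)
    have hom: "map (hom ?P v u) as = map (H v u) as" using vu as by (auto simp: pullback_def)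
    have "map e (map (H v u) as) = map (hom N (p v) (p u)) (map e as)"
      using as H(2)[OF vu] by auto
    then have "map e (map (H v u) as) \<in> pint N (p u) P"
      using model_pint_hom[OF N p[OF vu] as(2)] by metis
    then show ?thesis
      unfolding hom using H(1)[OF vu] as(1) RW[OF vu] by (auto simp: pullback_def)
  qed
  show "hom ?P u t (hom ?P v u a) = hom ?P v t a"
    if "(v, u) \<in> acc ?P" "(u, t) \<in> acc ?P" "a \<in> dmn ?P v" for v u t a
    using that H(1,4) trans by (auto simp: pullback_def split: if_splits)
  show "hom ?P v v a = a" if "a \<in> dmn ?P v" for v a
    using that H(3) refl by (auto simp: pullback_def split: if_splits)
qed (use W R D C H(1) model_sgn[OF N] in
    \<open>auto simp: pullback_def partial_order_on_def preorder_on_def split: if_splits\<close>)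

lemma morphism_pullback:
  assumes N: "is_model \<Theta> N" and P: "is_model \<Theta> (pullback N W R D p e C H)"
    and p: "\<And>v u. (v, u) \<in> R \<Longrightarrow> (p v, p u) \<in> acc N"
      "\<And>v t. v \<in> W \<Longrightarrow> (p v, t) \<in> acc N \<Longrightarrow> \<exists>u. (v, u) \<in> R \<and> p u = t"
    and e: "\<And>v. v \<in> W \<Longrightarrow> e ` D v = dmn N (p v)" "\<And>v. q \<Longrightarrow> v \<in> W \<Longrightarrow> inj_on e (D v)"
      "\<And>v c. v \<in> W \<Longrightarrow> c \<in> csts \<Theta> \<Longrightarrow> e (C v c) = cint N (p v) c"
      "\<And>v u a. (v, u) \<in> R \<Longrightarrow> a \<in> D v \<Longrightarrow> e (H v u a) = hom N (p v) (p u) (e a)"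
  shows "bounded_morphism q \<Theta> p e (pullback N W R D p e C H) w N"
  unfolding bounded_morphism_def
proof (intro allI impI conjI ballI)
  let ?P = "pullback N W R D p e C H"
  have RW: "v \<in> W \<and> u \<in> W" if "(v, u) \<in> R" for v u
    using model_acc_wlds[OF P] that by (simp add: pullback_def)
  fix v assume "(w, v) \<in> acc ?P"
  then have v: "(w, v) \<in> R" "v \<in> W" using RW by (auto simp: pullback_def)
  show "p v \<in> wlds N" using p(1)[OF v(1)] model_acc_wlds[OF N] by blast
  show "(p v, t) \<in> acc N \<longleftrightarrow> (\<exists>u. (v, u) \<in> acc ?P \<and> p u = t)" for t
    using p(1) p(2)[OF v(2)] by (auto simp: pullback_def)
  show "cint ?P v c \<in> dmn ?P v" "e (cint ?P v c) = cint N (p v) c" if "c \<in> csts \<Theta>" for c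
    using model_cint[OF P _ that] that e(3) v model_sgn[OF N] by (simp_all add: pullback_def)
  show "e ` dmn ?P v = dmn N (p v)" "q \<Longrightarrow> inj_on e (dmn ?P v)"
    using e(1,2) v by (simp_all add: pullback_def)
  show "as \<in> pint ?P v P \<longleftrightarrow> map e as \<in> pint N (p v) P"
    if "set as \<subseteq> dmn ?P v \<and> P \<in> preds \<Theta> (length as)" for P as
    using that v by (simp add: pullback_def)
  show "e (hom ?P v u a) = hom N (p v) (p u) (e a)" if "(v, u) \<in> acc ?P" "a \<in> dmn ?P v" for u a
    using that e(4) v by (simp add: pullback_def)
qed


subsection \<open>Isomorphic copies\<close>

lemma
  assumes "model_iso g h M N"
  shows iso_wlds: "bij_betw h (wlds M) (wlds N)"
    and iso_acc: "v \<in> wlds M \<Longrightarrow> u \<in> wlds M \<Longrightarrow> (v, u) \<in> acc M \<longleftrightarrow> (h v, h u) \<in> acc N"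
    and iso_dmn: "v \<in> wlds M \<Longrightarrow> bij_betw g (dmn M v) (dmn N (h v))"
    and iso_pint: "v \<in> wlds M \<Longrightarrow> set as \<subseteq> dmn M v \<Longrightarrow> as \<in> pint M v P \<longleftrightarrow> map g as \<in> pint N (h v) P"
    and iso_cint: "v \<in> wlds M \<Longrightarrow> c \<in> csts (sgn M) \<Longrightarrow> g (cint M v c) = cint N (h v) c"
    and iso_hom: "(v, u) \<in> acc M \<Longrightarrow> a \<in> dmn M v \<Longrightarrow> g (hom M v u a) = hom N (h v) (h u) (g a)"
  using assms by (simp_all add: model_iso_def in_lists_conv_set subset_iff)

lemma morphism_iso:
  assumes M: "is_model \<Theta> M" and N: "is_model \<Theta> N" and iso: "model_iso g h M N"
  shows "bounded_morphism q \<Theta> h g M w N"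
  unfolding bounded_morphism_def
proof (intro allI impI conjI ballI)
  fix v assume "(w, v) \<in> acc M"
  then have v: "v \<in> wlds M" using model_acc_wlds[OF M] by blast
  show "h v \<in> wlds N" using v iso_wlds[OF iso] by (auto simp: bij_betw_def)
  show "(h v, t) \<in> acc N \<longleftrightarrow> (\<exists>u. (v, u) \<in> acc M \<and> h u = t)" for t
  proof
    assume t: "(h v, t) \<in> acc N"
    then obtain u where "u \<in> wlds M" "h u = t"
      using iso_wlds[OF iso] model_acc_wlds[OF N] by (metis bij_betw_imp_surj_on imageE)
    then show "\<exists>u. (v, u) \<in> acc M \<and> h u = t" using t iso_acc[OF iso v] by blast
  qed (use iso_acc[OF iso v] model_acc_wlds[OF M] in blast)
  show "cint M v c \<in> dmn M v" "g (cint M v c) = cint N (h v) c" if "c \<in> csts \<Theta>" for c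
    using model_cint[OF M v that] iso_cint[OF iso v] that model_sgn[OF M] by auto
qed (use iso_dmn[OF iso] iso_pint[OF iso] iso_hom[OF iso] model_acc_wlds[OF M] in \<open>auto simp: bij_betw_def\<close>)

lemma partial_order_on_image:
  assumes R: "partial_order_on W R" and inj: "inj_on h W"
  shows "partial_order_on (h ` W) (map_prod h h ` R)"
  unfolding partial_order_on_def preorder_on_def
proof (intro conjI transI antisymI)
  have RW: "v \<in> W" "u \<in> W" if "(v, u) \<in> R" for v u
    using R that by (auto simp: partial_order_on_def preorder_on_def)
  show "refl_on (h ` W) (map_prod h h ` R)" "map_prod h h ` R \<subseteq> h ` W \<times> h ` W"
    using R by (force simp: partial_order_on_def preorder_on_def refl_on_def)+
  fix x y
  assume "(x, y) \<in> map_prod h h ` R"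
  then obtain v u where vu: "(v, u) \<in> R" "x = h v" "y = h u" by auto
  show "(x, z) \<in> map_prod h h ` R" if yz: "(y, z) \<in> map_prod h h ` R" for z
  proof -
    obtain u' t where ut: "(u', t) \<in> R" "y = h u'" "z = h t" using yz by auto
    have "u' = u" using vu ut RW inj by (metis inj_onD)
    then show ?thesis
      using vu ut R by (force simp: partial_order_on_def preorder_on_def elim: transE)
  qed
  show "x = y" if yx: "(y, x) \<in> map_prod h h ` R"
  proof -
    obtain u' v' where uv: "(u', v') \<in> R" "y = h u'" "x = h v'" using yx by auto
    have "u' = u" "v' = v" using vu uv RW inj by (metis inj_onD)+
    then show ?thesis using vu uv R by (auto simp: partial_order_on_def antisym_def)
  qed
qed

definition iso_copy :: "('u \<Rightarrow> 'u) \<Rightarrow> ('u \<Rightarrow> 'u) \<Rightarrow> 'u kmodel \<Rightarrow> 'u kmodel" where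
  "iso_copy g h M = (let h' = the_inv_into (wlds M) h; g' = the_inv_into (elems M) g in
     pullback M (h ` wlds M) (map_prod h h ` acc M) (\<lambda>x. g ` dmn M (h' x)) h' g'
       (\<lambda>x c. g (cint M (h' x) c)) (\<lambda>x y a. g (hom M (h' x) (h' y) (g' a))))"

context universe
begin

context
  fixes M :: "'u kmodel" and g h :: "'u \<Rightarrow> 'u" and \<Theta> :: "'u signature"
  assumes M: "is_model \<Theta> M" and inj: "inj_on g (elems M)" "inj_on h (wlds M)"
begin

lemma the_inv_into_wlds [simp]: "v \<in> wlds M \<Longrightarrow> the_inv_into (wlds M) h (h v) = v"
  by (rule the_inv_into_f_f[OF inj(2)])

lemma the_inv_into_dmn: "a \<in> dmn M v \<Longrightarrow> the_inv_into (elems M) g (g a) = a"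
  by (rule the_inv_into_f_f[OF inj(1) model_dmn_elems[OF M]])

lemma map_prod_acc_iff:
  assumes "v \<in> wlds M" "u \<in> wlds M"
  shows "(h v, h u) \<in> map_prod h h ` acc M \<longleftrightarrow> (v, u) \<in> acc M"
proof
  assume "(h v, h u) \<in> map_prod h h ` acc M"
  then obtain v' u' where "(v', u') \<in> acc M" "h v = h v'" "h u = h u'" by auto
  then show "(v, u) \<in> acc M" using assms model_acc_wlds[OF M] inj(2) by (metis inj_onD)
qed (use map_prod_imageI[of v u "acc M" h h] in simp)

lemma is_model_iso_copy: "is_model \<Theta> (iso_copy g h M)"
  unfolding iso_copy_def Let_def
proof (rule is_model_pullback[OF M])
  show "h ` wlds M \<noteq> {}" using model_wlds_nonempty[OF M] by simp
  show "small (h ` wlds M)" using model_small_wlds[OF M] by (simp add: small_iff_tiny tiny_image)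
  show "partial_order_on (h ` wlds M) (map_prod h h ` acc M)"
    by (rule partial_order_on_image[OF model_partial_order[OF M] inj(2)])
  let ?h' = "the_inv_into (wlds M) h" and ?g' = "the_inv_into (elems M) g"
  show "x = y"
    if "x \<in> h ` wlds M" "y \<in> h ` wlds M" "a \<in> g ` dmn M (?h' x)" "a \<in> g ` dmn M (?h' y)" for x y a
  proof -
    have "?g' a \<in> dmn M v" if "a \<in> g ` dmn M v" for v using that by (auto simp: the_inv_into_dmn)
    then have "?h' x = ?h' y" using that(3,4) model_dmn_disjoint[OF M] by blast
    then show ?thesis using that(1,2) by (metis imageE the_inv_into_wlds)
  qed
  show "g (hom M (?h' x) (?h' x) (?g' a)) = a" if "a \<in> g ` dmn M (?h' x)" for x a
    using that by (auto simp: the_inv_into_dmn model_hom_id[OF M])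
  fix x y assume "(x, y) \<in> map_prod h h ` acc M"
  then have xy: "(?h' x, ?h' y) \<in> acc M" using model_acc_wlds[OF M] by auto
  then show "(?h' x, ?h' y) \<in> acc M" .
  show "g (hom M (?h' x) (?h' y) (?g' (g (cint M (?h' x) c)))) = g (cint M (?h' y) c)" if "c \<in> csts \<Theta>" for c
    using model_acc_wlds[OF M xy] model_cint_hom[OF M xy that]
    by (simp add: the_inv_into_dmn[OF model_cint[OF M _ that]])
  fix a assume "a \<in> g ` dmn M (?h' x)"
  then obtain b where b: "b \<in> dmn M (?h' x)" "a = g b" by blast
  note hom_b = model_hom[OF M xy b(1)]
  show "g (hom M (?h' x) (?h' y) (?g' a)) \<in> g ` dmn M (?h' y)"
    "?g' (g (hom M (?h' x) (?h' y) (?g' a))) = hom M (?h' x) (?h' y) (?g' a)"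
    using b hom_b by (simp_all add: the_inv_into_dmn[OF b(1)] the_inv_into_dmn[OF hom_b])
  fix z assume "(y, z) \<in> map_prod h h ` acc M"
  then have "(?h' y, ?h' z) \<in> acc M" using model_acc_wlds[OF M] by auto
  then show "g (hom M (?h' y) (?h' z) (?g' (g (hom M (?h' x) (?h' y) (?g' a))))) = g (hom M (?h' x) (?h' z) (?g' a))"
    using b model_hom_comp[OF M xy] by (simp add: the_inv_into_dmn[OF b(1)] the_inv_into_dmn[OF hom_b])
qed (auto simp: small_iff_tiny model_cint[OF M] model_dmn_nonempty[OF M]
    model_small_dmn[OF M, unfolded small_iff_tiny] intro!: tiny_image)

lemma model_iso_iso_copy: "model_iso g h M (iso_copy g h M)"
  unfolding model_iso_def
proof (intro conjI allI impI ballI)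
  have simps: "sgn (iso_copy g h M) = sgn M" "wlds (iso_copy g h M) = h ` wlds M"
    "acc (iso_copy g h M) = map_prod h h ` acc M"
    by (simp_all add: iso_copy_def pullback_def Let_def)
  have dmn: "dmn (iso_copy g h M) (h v) = g ` dmn M v" if "v \<in> wlds M" for v
    using that by (simp add: iso_copy_def pullback_def Let_def)
  show "sgn M = sgn (iso_copy g h M)" "bij_betw h (wlds M) (wlds (iso_copy g h M))"
    using inj(2) by (simp_all add: simps bij_betw_def)
  have "elems (iso_copy g h M) = g ` elems M" by (auto simp: elems_def simps dmn)
  then show "bij_betw g (elems M) (elems (iso_copy g h M))" using inj(1) by (simp add: bij_betw_def)
  show "bij_betw g (dmn M v) (dmn (iso_copy g h M) (h v))" if "v \<in> wlds M" for v
    using that inj(1) model_dmn_elems[OF M] by (auto simp: dmn bij_betw_def intro: inj_on_subset)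
  show "(v, u) \<in> acc M \<longleftrightarrow> (h v, h u) \<in> acc (iso_copy g h M)" if "v \<in> wlds M" "u \<in> wlds M" for v u
    unfolding simps map_prod_acc_iff[OF that] ..
  show "as \<in> pint M v P \<longleftrightarrow> map g as \<in> pint (iso_copy g h M) (h v) P"
    if "v \<in> wlds M" "as \<in> lists (dmn M v)" for v P as
  proof -
    have "map (the_inv_into (elems M) g) (map g as) = as"
      using that(2) the_inv_into_dmn[of _ v] by (simp add: in_lists_conv_set map_idI)
    then show ?thesis
      using that by (auto simp: iso_copy_def pullback_def Let_def in_lists_conv_set)
  qed
  show "g (cint M v c) = cint (iso_copy g h M) (h v) c" if "v \<in> wlds M" "c \<in> csts (sgn M)" for v c
    using that by (simp add: iso_copy_def pullback_def Let_def)
  show "g (hom M v u a) = hom (iso_copy g h M) (h v) (h u) (g a)"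
    if "(v, u) \<in> acc M" "a \<in> dmn M v" for v u a
    using that model_acc_wlds[OF M that(1)] map_prod_acc_iff the_inv_into_dmn[OF that(2)]
    by (simp add: iso_copy_def pullback_def Let_def)
qed

end

end


section \<open>Naming elements by constants\<close>

fun inst_tm :: "(nat \<Rightarrow> 'u option) \<Rightarrow> 'u tm \<Rightarrow> 'u tm" where
  "inst_tm \<sigma> (Var x) = (case \<sigma> x of None \<Rightarrow> Var x | Some c \<Rightarrow> Cst c)"
| "inst_tm \<sigma> (Cst c) = Cst c"

fun inst :: "(nat \<Rightarrow> 'u option) \<Rightarrow> 'u fm \<Rightarrow> 'u fm" where
  "inst \<sigma> Bot = Bot"
| "inst \<sigma> (Atom P ts) = Atom P (map (inst_tm \<sigma>) ts)"
| "inst \<sigma> (Eq s t) = Eq (inst_tm \<sigma> s) (inst_tm \<sigma> t)"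
| "inst \<sigma> (And \<phi> \<psi>) = And (inst \<sigma> \<phi>) (inst \<sigma> \<psi>)"
| "inst \<sigma> (Or \<phi> \<psi>) = Or (inst \<sigma> \<phi>) (inst \<sigma> \<psi>)"
| "inst \<sigma> (Imp \<phi> \<psi>) = Imp (inst \<sigma> \<phi>) (inst \<sigma> \<psi>)"
| "inst \<sigma> (All x \<phi>) = All x (inst (\<sigma>(x := None)) \<phi>)"
| "inst \<sigma> (Ex x \<phi>) = Ex x (inst (\<sigma>(x := None)) \<phi>)"

lemma tm_vars_inst_tm: "tm_vars (inst_tm \<sigma> t) = tm_vars t - dom \<sigma>"
  by (cases t) (auto split: option.splits)

lemma fv_inst: "fv (inst \<sigma> \<phi>) = fv \<phi> - dom \<sigma>"
  by (induction \<phi> arbitrary: \<sigma>) (auto simp: tm_vars_inst_tm split: if_splits)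

lemma tm_over_inst_tm: "tm_over \<Theta> t \<Longrightarrow> ran \<sigma> \<subseteq> set cs \<Longrightarrow> tm_over (add_consts \<Theta> cs) (inst_tm \<sigma> t)"
  by (cases t) (auto simp: ran_def split: option.splits)

lemma ran_upd_None: "ran (\<sigma>(x := None)) \<subseteq> ran \<sigma>"
  by (auto simp: ran_def)

lemma fm_over_inst: "fm_over q \<Theta> \<phi> \<Longrightarrow> ran \<sigma> \<subseteq> set cs \<Longrightarrow> fm_over q (add_consts \<Theta> cs) (inst \<sigma> \<phi>)"
proof (induction \<phi> arbitrary: \<sigma>)
  case (All x \<phi>)
  then show ?case using ran_upd_None[of \<sigma> x] by fastforce
next
  case (Ex x \<phi>)
  then show ?case using ran_upd_None[of \<sigma> x] by fastforce
qed (auto simp: tm_over_inst_tm)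

definition inst_asg :: "'u kmodel \<Rightarrow> 'u \<Rightarrow> (nat \<Rightarrow> 'u option) \<Rightarrow> (nat \<Rightarrow> 'u) \<Rightarrow> nat \<Rightarrow> 'u" where
  "inst_asg M w \<sigma> s x = (case \<sigma> x of None \<Rightarrow> s x | Some c \<Rightarrow> cint M w c)"

lemma tm_val_inst_tm: "tm_val M w s (inst_tm \<sigma> t) = tm_val M w (inst_asg M w \<sigma> s) t"
  by (cases t) (auto simp: inst_asg_def split: option.splits)

lemma inst_asg_hom:
  assumes "is_model \<Theta> M" "(w, v) \<in> acc M" "ran \<sigma> \<subseteq> csts \<Theta>"
  shows "inst_asg M v \<sigma> (hom M w v \<circ> s) = hom M w v \<circ> inst_asg M w \<sigma> s"
  using assms(3) model_cint_hom[OF assms(1,2)]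
  by (auto simp: inst_asg_def ran_def fun_eq_iff split: option.splits)

lemma inst_asg_upd: "inst_asg M w (\<sigma>(x := None)) (s(x := a)) = (inst_asg M w \<sigma> s)(x := a)"
  by (auto simp: inst_asg_def fun_eq_iff split: option.splits)

lemma holds_inst:
  assumes M: "is_model \<Theta> M"
  shows "ran \<sigma> \<subseteq> csts \<Theta> \<Longrightarrow> holds M w s (inst \<sigma> \<phi>) \<longleftrightarrow> holds M w (inst_asg M w \<sigma> s) \<phi>"
proof (induction \<phi> arbitrary: w s \<sigma>)
  case (Atom P ts)
  then show ?case by (simp add: tm_val_inst_tm comp_def)
next
  case (Imp \<phi> \<psi>)
  then show ?case by (simp add: inst_asg_hom[OF M] del: o_apply)
next
  case (All x \<phi>)
  have "ran (\<sigma>(x := None)) \<subseteq> csts \<Theta>" using All.prems ran_upd_None[of \<sigma> x] by blast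
  then show ?case
    unfolding inst.simps holds.simps using All.IH
    by (simp add: inst_asg_hom[OF M _ All.prems] inst_asg_upd del: o_apply fun_upd_apply)
next
  case (Ex x \<phi>)
  have "ran (\<sigma>(x := None)) \<subseteq> csts \<Theta>" using Ex.prems ran_upd_None[of \<sigma> x] by blast
  then show ?case
    unfolding inst.simps holds.simps using Ex.IH by (simp add: inst_asg_upd del: fun_upd_apply)
qed (auto simp: tm_val_inst_tm)

definition var_names :: "'u list \<Rightarrow> nat \<Rightarrow> 'u option" where
  "var_names cs i = (if i < length cs then Some (cs ! i) else None)"

lemma dom_var_names: "dom (var_names cs) = {..<length cs}"
  by (auto simp: var_names_def dom_def)

lemma ran_var_names: "ran (var_names cs) \<subseteq> set cs"
  by (auto simp: var_names_def ran_def split: if_splits)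

lemma inst_var_names_sentence:
  assumes "\<psi> \<in> formulas q \<Theta> (length cs)"
  shows "inst (var_names cs) \<psi> \<in> formulas q (add_consts \<Theta> cs) 0"
  using assms by (auto simp: formulas_def fv_inst dom_var_names fm_over_inst ran_var_names)

lemma holds_inst_var_names:
  assumes M: "is_model \<Theta> M" and w: "w \<in> wlds M" and names: "name_tuple M w cs as"
    and \<psi>: "\<psi> \<in> formulas q \<Theta> (length cs)"
  shows "holds (cone_exp M w cs as) w s (inst (var_names cs) \<psi>) \<longleftrightarrow> holds M w (nth as) \<psi>"
proof -
  let ?C = "cone_exp M w cs as"
  note C = is_model_cone_exp[OF M w names] and ww = model_acc_refl[OF M w]
  have "holds ?C w s (inst (var_names cs) \<psi>) \<longleftrightarrow> holds ?C w (inst_asg ?C w (var_names cs) s) \<psi>"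
    using ran_var_names by (intro holds_inst[OF C]) fastforce
  also have "\<dots> \<longleftrightarrow> holds ?C w (nth as) \<psi>"
  proof (rule holds_cong)
    fix x assume "x \<in> fv \<psi>"
    then have "x < length cs" using \<psi> by (auto simp: formulas_def)
    then show "inst_asg ?C w (var_names cs) s x = as ! x"
      using cint_cone_exp_new[OF ww names] name_tuple_nth[OF names] model_hom_id[OF M]
      by (simp add: inst_asg_def var_names_def)
  qed
  also have "\<dots> \<longleftrightarrow> holds M w (nth (map (\<lambda>x. x) as)) \<psi>"
    using \<psi> ww name_tupleD[OF names]
    by (intro morphism_holds_tuple[OF C morphism_cone_exp_base[OF M w names, of q]]) auto
  finally show ?thesis by simp
qed

lemma Sat_std_inst_var_names:
  assumes "is_model \<Theta> M" "w \<in> wlds M" "name_tuple M w cs as" "\<psi> \<in> formulas q \<Theta> (length cs)"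
  shows "Sat (std_logic K) (cone_exp M w cs as) w (inst (var_names cs) \<psi>) \<longleftrightarrow> holds M w (nth as) \<psi>"
proof -
  have "w \<in> wlds (cone_exp M w cs as)" "fv (inst (var_names cs) \<psi>) = {}"
    using model_acc_refl[OF assms(1,2)] inst_var_names_sentence[OF assms(4)] by (simp_all add: formulas_def)
  then show ?thesis
    using Sat_std_iff[OF is_model_cone_exp[OF assms(1-3)]] holds_inst_var_names[OF assms] by metis
qed

lemma ex_tm_inst_var_names:
  assumes "tm_over (add_consts \<Theta> cs) t" "tm_vars t = {}"
  shows "\<exists>t'. tm_over \<Theta> t' \<and> tm_vars t' \<subseteq> {..<length cs} \<and> inst_tm (var_names cs) t' = t"
proof (cases t)
  case (Cst d)
  show ?thesis
  proof (cases "d \<in> set cs")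
    case True
    then obtain i where "i < length cs" "d = cs ! i" by (metis in_set_conv_nth)
    then show ?thesis using Cst by (intro exI[of _ "Var i"]) (simp add: var_names_def)
  next
    case False
    then show ?thesis using Cst assms by (intro exI[of _ "Cst d"]) simp
  qed
qed (use assms in simp)

lemma atomic_sentenceE:
  assumes "atomic \<phi>" and \<phi>: "\<phi> \<in> formulas q (add_consts \<Theta> cs) 0"
  obtains \<psi> where "atomic \<psi>" "\<psi> \<in> formulas q \<Theta> (length cs)" "\<phi> = inst (var_names cs) \<psi>"
proof -
  obtain f where f: "\<And>t. tm_over (add_consts \<Theta> cs) t \<Longrightarrow> tm_vars t = {} \<Longrightarrow>
      tm_over \<Theta> (f t) \<and> tm_vars (f t) \<subseteq> {..<length cs} \<and> inst_tm (var_names cs) (f t) = t"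
    using ex_tm_inst_var_names by metis
  consider P ts where "\<phi> = Atom P ts" | s t where "\<phi> = Eq s t"
    using assms(1) by (auto simp: atomic_def)
  then show thesis
  proof cases
    case (1 P ts)
    then have "tm_over (add_consts \<Theta> cs) t" "tm_vars t = {}" if "t \<in> set ts" for t
      using that \<phi> by (auto simp: formulas_def)
    then have "\<forall>t\<in>set ts. tm_over \<Theta> (f t) \<and> tm_vars (f t) \<subseteq> {..<length cs} \<and> inst_tm (var_names cs) (f t) = t"
      using f by blast
    then show thesis
      using 1 \<phi>
      by (intro that[of "Atom P (map f ts)"]) (auto simp: atomic_def formulas_def intro: map_idI[symmetric])
  next
    case (2 s t)
    then show thesis
      using \<phi> f[of s] f[of t] by (intro that[of "Eq (f s) (f t)"]) (auto simp: atomic_def formulas_def)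
  qed
qed


section \<open>Invariance under asimulations\<close>

text \<open>An asimulation between disjoint models consists of a relation \<open>R\<close> in one direction and a
  relation \<open>S\<close> in the other, which only interact in the condition for \<open>\<rightarrow>\<close>.\<close>

definition half_asimulation ::
    "bool \<Rightarrow> 'u signature \<Rightarrow> 'u kmodel \<Rightarrow> 'u kmodel \<Rightarrow> ('u \<Rightarrow> 'u list \<Rightarrow> 'u \<Rightarrow> 'u list \<Rightarrow> bool) \<Rightarrow>
      ('u \<Rightarrow> 'u list \<Rightarrow> 'u \<Rightarrow> 'u list \<Rightarrow> bool) \<Rightarrow> bool" where
  "half_asimulation q \<Theta> M N R S \<longleftrightarrow> (\<forall>w \<alpha> v \<beta>. R w \<alpha> v \<beta> \<longrightarrow>
     w \<in> wlds M \<and> v \<in> wlds N \<and> set \<alpha> \<subseteq> dmn M w \<and> set \<beta> \<subseteq> dmn N v \<and> length \<alpha> = length \<beta> \<and>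
     (\<forall>\<psi>\<in>formulas q \<Theta> (length \<alpha>). atomic \<psi> \<longrightarrow> holds M w (nth \<alpha>) \<psi> \<longrightarrow> holds N v (nth \<beta>) \<psi>) \<and>
     (\<forall>t. (v, t) \<in> acc N \<longrightarrow> (\<exists>u. (w, u) \<in> acc M \<and>
        R u (map (hom M w u) \<alpha>) t (map (hom N v t) \<beta>) \<and> S t (map (hom N v t) \<beta>) u (map (hom M w u) \<alpha>))) \<and>
     (\<forall>a\<in>dmn M w. \<exists>b\<in>dmn N v. R w (\<alpha> @ [a]) v (\<beta> @ [b])) \<and>
     (\<forall>t. (v, t) \<in> acc N \<longrightarrow> (\<forall>b\<in>dmn N t. \<exists>u. (w, u) \<in> acc M \<and>
        (\<exists>a\<in>dmn M u. R u (map (hom M w u) \<alpha> @ [a]) t (map (hom N v t) \<beta> @ [b])))))"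

lemma
  assumes "half_asimulation q \<Theta> M N R S" "R w \<alpha> v \<beta>"
  shows half_asimulation_dmn: "w \<in> wlds M" "v \<in> wlds N" "set \<alpha> \<subseteq> dmn M w" "set \<beta> \<subseteq> dmn N v"
      "length \<alpha> = length \<beta>"
    and half_asimulation_atom: "\<psi> \<in> formulas q \<Theta> (length \<alpha>) \<Longrightarrow> atomic \<psi> \<Longrightarrow>
      holds M w (nth \<alpha>) \<psi> \<Longrightarrow> holds N v (nth \<beta>) \<psi>"
    and half_asimulation_s_back: "(v, t) \<in> acc N \<Longrightarrow> \<exists>u. (w, u) \<in> acc M \<and>
      R u (map (hom M w u) \<alpha>) t (map (hom N v t) \<beta>) \<and> S t (map (hom N v t) \<beta>) u (map (hom M w u) \<alpha>)"
    and half_asimulation_obj_forth: "a \<in> dmn M w \<Longrightarrow> \<exists>b\<in>dmn N v. R w (\<alpha> @ [a]) v (\<beta> @ [b])"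
    and half_asimulation_obj_back: "(v, t) \<in> acc N \<Longrightarrow> b \<in> dmn N t \<Longrightarrow> \<exists>u. (w, u) \<in> acc M \<and>
      (\<exists>a\<in>dmn M u. R u (map (hom M w u) \<alpha> @ [a]) t (map (hom N v t) \<beta> @ [b]))"
  using assms unfolding half_asimulation_def by blast+

lemma half_asimulationI:
  assumes "\<And>w \<alpha> v \<beta>. R w \<alpha> v \<beta> \<Longrightarrow> w \<in> wlds M \<and> v \<in> wlds N \<and> set \<alpha> \<subseteq> dmn M w \<and> set \<beta> \<subseteq> dmn N v \<and>
      length \<alpha> = length \<beta>"
    and "\<And>w \<alpha> v \<beta> \<psi>. R w \<alpha> v \<beta> \<Longrightarrow> \<psi> \<in> formulas q \<Theta> (length \<alpha>) \<Longrightarrow> atomic \<psi> \<Longrightarrow>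
      holds M w (nth \<alpha>) \<psi> \<Longrightarrow> holds N v (nth \<beta>) \<psi>"
    and "\<And>w \<alpha> v \<beta> t. R w \<alpha> v \<beta> \<Longrightarrow> (v, t) \<in> acc N \<Longrightarrow> \<exists>u. (w, u) \<in> acc M \<and>
      R u (map (hom M w u) \<alpha>) t (map (hom N v t) \<beta>) \<and> S t (map (hom N v t) \<beta>) u (map (hom M w u) \<alpha>)"
    and "\<And>w \<alpha> v \<beta> a. R w \<alpha> v \<beta> \<Longrightarrow> a \<in> dmn M w \<Longrightarrow> \<exists>b\<in>dmn N v. R w (\<alpha> @ [a]) v (\<beta> @ [b])"
    and "\<And>w \<alpha> v \<beta> t b. R w \<alpha> v \<beta> \<Longrightarrow> (v, t) \<in> acc N \<Longrightarrow> b \<in> dmn N t \<Longrightarrow> \<exists>u. (w, u) \<in> acc M \<and>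
      (\<exists>a\<in>dmn M u. R u (map (hom M w u) \<alpha> @ [a]) t (map (hom N v t) \<beta> @ [b]))"
  shows "half_asimulation q \<Theta> M N R S"
  unfolding half_asimulation_def using assms by (intro allI impI conjI ballI) blast+

lemma name_tuple_map_consts:
  assumes "inj c" "range c \<inter> csts (sgn M) = {}" "set \<alpha> \<subseteq> dmn M w"
  shows "name_tuple M w (map c [0..<length \<alpha>]) \<alpha>"
  using assms by (auto simp: name_tuple_def distinct_map intro: inj_on_subset)

definition asimulation_step :: "stil \<Rightarrow> 'u signature \<Rightarrow> 'u kmodel \<Rightarrow> 'u kmodel \<Rightarrow>
    ('u \<times> 'u list \<Rightarrow> 'u \<times> 'u list \<Rightarrow> bool) \<Rightarrow> 'u \<Rightarrow> 'u list \<Rightarrow> 'u \<Rightarrow> 'u list \<Rightarrow> bool" where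
  "asimulation_step K \<Theta> M N A w \<alpha> v \<beta> \<longleftrightarrow>
     (let cs = map (fresh_consts \<Theta>) [0..<length \<alpha>] in
        \<forall>\<phi>\<in>Sen (std_logic K) (add_consts \<Theta> cs). atomic \<phi> \<longrightarrow>
          Sat (std_logic K) (cone_exp M w cs \<alpha>) w \<phi> \<longrightarrow> Sat (std_logic K) (cone_exp N v cs \<beta>) v \<phi>) \<and>
     (\<forall>t. (v, t) \<in> acc N \<longrightarrow> (\<exists>u. (w, u) \<in> acc M \<and>
        A (u, map (hom M w u) \<alpha>) (t, map (hom N v t) \<beta>) \<and> A (t, map (hom N v t) \<beta>) (u, map (hom M w u) \<alpha>))) \<and>
     (\<forall>a\<in>dmn M w. \<exists>b\<in>dmn N v. A (w, \<alpha> @ [a]) (v, \<beta> @ [b])) \<and>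
     (\<forall>t. (v, t) \<in> acc N \<longrightarrow> (\<forall>b\<in>dmn N t. \<exists>u. (w, u) \<in> acc M \<and> (\<exists>a\<in>dmn M u.
        A (u, map (hom M w u) \<alpha> @ [a]) (t, map (hom N v t) \<beta> @ [b]))))"

lemma asimulation_iff_step:
  "asimulation K M1 w1 as M2 w2 bs A \<longleftrightarrow>
     (\<forall>w \<alpha> v \<beta>. A (w, \<alpha>) (v, \<beta>) \<longrightarrow> length \<alpha> = length \<beta> \<and>
        (\<exists>(Mi, Mj)\<in>{(M1, M2), (M2, M1)}.
           w \<in> wlds Mi \<and> \<alpha> \<in> lists (elems Mi) \<and> v \<in> wlds Mj \<and> \<beta> \<in> lists (elems Mj))) \<and>
     A (w1, as) (w2, bs) \<and>
     (\<forall>(Mi, Mj)\<in>{(M1, M2), (M2, M1)}. \<forall>w \<alpha> v \<beta>.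
        A (w, \<alpha>) (v, \<beta>) \<and> w \<in> wlds Mi \<and> v \<in> wlds Mj \<and>
        \<alpha> \<in> lists (dmn Mi w) \<and> \<beta> \<in> lists (dmn Mj v) \<longrightarrow>
        asimulation_step K (sgn M1) Mi Mj A w \<alpha> v \<beta>)"
  unfolding asimulation_def asimulation_step_def ..

lemma (in universe) half_asimulation_atomic_sentence:
  fixes M N :: "'u kmodel"
  assumes sig: "is_sig \<Theta>" and M: "is_model \<Theta> M" and N: "is_model \<Theta> N"
    and half: "half_asimulation (has_eq K) \<Theta> M N R S" and R: "R w \<alpha> v \<beta>"
    and cs: "cs = map (fresh_consts \<Theta>) [0..<length \<alpha>]"
    and \<phi>: "atomic \<phi>" "\<phi> \<in> Sen (std_logic K) (add_consts \<Theta> cs)"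
    and sat: "Sat (std_logic K) (cone_exp M w cs \<alpha>) w \<phi>"
  shows "Sat (std_logic K) (cone_exp N v cs \<beta>) v \<phi>"
proof -
  note dmn = half_asimulation_dmn[OF half R]
  have names: "name_tuple M w cs \<alpha>" "name_tuple N v cs \<beta>"
    unfolding cs using name_tuple_map_consts[OF fresh_consts_fresh(1)[OF sig]] fresh_consts_fresh(2)[OF sig]
      dmn model_sgn[OF M] model_sgn[OF N] by metis+
  obtain \<psi> where \<psi>: "atomic \<psi>" "\<psi> \<in> formulas (has_eq K) \<Theta> (length cs)" "\<phi> = inst (var_names cs) \<psi>"
    using \<phi> unfolding Sen_std by (rule atomic_sentenceE)
  have "holds M w (nth \<alpha>) \<psi>"
    using sat unfolding \<psi>(3) Sat_std_inst_var_names[OF M dmn(1) names(1) \<psi>(2)] .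
  then have "holds N v (nth \<beta>) \<psi>"
    using half_asimulation_atom[OF half R _ \<psi>(1)] \<psi>(2) cs by simp
  then show ?thesis
    unfolding \<psi>(3) Sat_std_inst_var_names[OF N dmn(2) names(2) \<psi>(2)] .
qed

lemma (in universe) half_asimulation_step:
  fixes M N :: "'u kmodel"
  assumes "is_sig \<Theta>" "is_model \<Theta> M" "is_model \<Theta> N"
    and half: "half_asimulation (has_eq K) \<Theta> M N R S" and R: "R w \<alpha> v \<beta>"
    and A: "\<And>w \<alpha> v \<beta>. R w \<alpha> v \<beta> \<Longrightarrow> A (w, \<alpha>) (v, \<beta>)" "\<And>w \<alpha> v \<beta>. S w \<alpha> v \<beta> \<Longrightarrow> A (w, \<alpha>) (v, \<beta>)"
  shows "asimulation_step K \<Theta> M N A w \<alpha> v \<beta>"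
  unfolding asimulation_step_def Let_def
proof (intro conjI)
  show "\<forall>\<phi>\<in>Sen (std_logic K) (add_consts \<Theta> (map (fresh_consts \<Theta>) [0..<length \<alpha>])). atomic \<phi> \<longrightarrow>
      Sat (std_logic K) (cone_exp M w (map (fresh_consts \<Theta>) [0..<length \<alpha>]) \<alpha>) w \<phi> \<longrightarrow>
      Sat (std_logic K) (cone_exp N v (map (fresh_consts \<Theta>) [0..<length \<alpha>]) \<beta>) v \<phi>"
    using half_asimulation_atomic_sentence[OF assms(1-3) half R refl] by blast
  show "\<forall>t. (v, t) \<in> acc N \<longrightarrow> (\<exists>u. (w, u) \<in> acc M \<and>
      A (u, map (hom M w u) \<alpha>) (t, map (hom N v t) \<beta>) \<and> A (t, map (hom N v t) \<beta>) (u, map (hom M w u) \<alpha>))"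
    using half_asimulation_s_back[OF half R] A by blast
  show "\<forall>a\<in>dmn M w. \<exists>b\<in>dmn N v. A (w, \<alpha> @ [a]) (v, \<beta> @ [b])"
    using half_asimulation_obj_forth[OF half R] A(1) by blast
  show "\<forall>t. (v, t) \<in> acc N \<longrightarrow> (\<forall>b\<in>dmn N t. \<exists>u. (w, u) \<in> acc M \<and> (\<exists>a\<in>dmn M u.
      A (u, map (hom M w u) \<alpha> @ [a]) (t, map (hom N v t) \<beta> @ [b])))"
    using half_asimulation_obj_back[OF half R] A(1) by blast
qed

lemma (in universe) asimulation_of_halves:
  fixes M N :: "'u kmodel"
  assumes sig: "is_sig \<Theta>" and M: "is_model \<Theta> M" and N: "is_model \<Theta> N" and disjoint: "wlds M \<inter> wlds N = {}"
    and R: "half_asimulation (has_eq K) \<Theta> M N R S" and S: "half_asimulation (has_eq K) \<Theta> N M S R"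
    and start: "R w1 [] w2 []"
  shows "asimulation K M w1 [] N w2 [] (\<lambda>(w, \<alpha>) (v, \<beta>). R w \<alpha> v \<beta> \<or> S w \<alpha> v \<beta>)"
    (is "asimulation _ _ _ _ _ _ _ ?A")
  unfolding asimulation_iff_step
proof (intro conjI)
  have elems: "\<alpha> \<in> lists (elems M')" if "w \<in> wlds M'" "set \<alpha> \<subseteq> dmn M' w" for M' :: "'u kmodel" and w \<alpha>
    using that by (auto simp: elems_def in_lists_conv_set)
  show "\<forall>w \<alpha> v \<beta>. ?A (w, \<alpha>) (v, \<beta>) \<longrightarrow> length \<alpha> = length \<beta> \<and> (\<exists>(Mi, Mj)\<in>{(M, N), (N, M)}.
      w \<in> wlds Mi \<and> \<alpha> \<in> lists (elems Mi) \<and> v \<in> wlds Mj \<and> \<beta> \<in> lists (elems Mj))"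
  proof (intro allI impI)
    fix w \<alpha> v \<beta> assume "?A (w, \<alpha>) (v, \<beta>)"
    then consider "R w \<alpha> v \<beta>" | "S w \<alpha> v \<beta>" by auto
    then show "length \<alpha> = length \<beta> \<and> (\<exists>(Mi, Mj)\<in>{(M, N), (N, M)}.
        w \<in> wlds Mi \<and> \<alpha> \<in> lists (elems Mi) \<and> v \<in> wlds Mj \<and> \<beta> \<in> lists (elems Mj))"
    proof cases
      case 1
      then show ?thesis using half_asimulation_dmn[OF R 1] elems by simp
    next
      case 2
      then show ?thesis using half_asimulation_dmn[OF S 2] elems by simp
    qed
  qed
  show "?A (w1, []) (w2, [])" using start by simp
  have "asimulation_step K \<Theta> M N ?A w \<alpha> v \<beta>" if "?A (w, \<alpha>) (v, \<beta>)" "w \<in> wlds M" for w \<alpha> v \<beta>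
    using that disjoint half_asimulation_dmn(1)[OF S]
    by (intro half_asimulation_step[OF sig M N R]) (auto simp: disjoint_iff)
  moreover have "asimulation_step K \<Theta> N M ?A w \<alpha> v \<beta>" if "?A (w, \<alpha>) (v, \<beta>)" "w \<in> wlds N" for w \<alpha> v \<beta>
    using that disjoint half_asimulation_dmn(1)[OF R]
    by (intro half_asimulation_step[OF sig N M S]) (auto simp: disjoint_iff)
  ultimately show "\<forall>(Mi, Mj)\<in>{(M, N), (N, M)}. \<forall>w \<alpha> v \<beta>. ?A (w, \<alpha>) (v, \<beta>) \<and> w \<in> wlds Mi \<and> v \<in> wlds Mj \<and>
      \<alpha> \<in> lists (dmn Mi w) \<and> \<beta> \<in> lists (dmn Mj v) \<longrightarrow> asimulation_step K (sgn M) Mi Mj ?A w \<alpha> v \<beta>"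
    unfolding model_sgn[OF M] by simp
qed

definition rel_image :: "('u \<Rightarrow> 'u) \<Rightarrow> ('u \<Rightarrow> 'u) \<Rightarrow> ('u \<Rightarrow> 'u list \<Rightarrow> 'u \<Rightarrow> 'u list \<Rightarrow> bool) \<Rightarrow>
    'u \<Rightarrow> 'u list \<Rightarrow> 'u \<Rightarrow> 'u list \<Rightarrow> bool" where
  "rel_image h k R w \<alpha> v \<beta> \<longleftrightarrow> (\<exists>w0 v0. w = h w0 \<and> v = k v0 \<and> R w0 \<alpha> v0 \<beta>)"

lemma rel_imageI: "R w \<alpha> v \<beta> \<Longrightarrow> rel_image h k R (h w) \<alpha> (k v) \<beta>"
  by (auto simp: rel_image_def)

lemma iso_id_dmn:
  assumes "model_iso (\<lambda>x. x) h M N" "w \<in> wlds M" shows "dmn N (h w) = dmn M w"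
  using bij_betw_imp_surj_on[OF iso_dmn[OF assms]] by simp

lemma iso_map_hom:
  assumes "model_iso (\<lambda>x. x) h M N" "(w, u) \<in> acc M" "set \<alpha> \<subseteq> dmn M w"
  shows "map (hom N (h w) (h u)) \<alpha> = map (hom M w u) \<alpha>"
  using assms(3) iso_hom[OF assms(1,2)] by auto

lemma iso_id_holds:
  assumes M: "is_model \<Theta> M" "is_model \<Theta> M'" and iso: "model_iso (\<lambda>x. x) h M M'"
    and "w \<in> wlds M" "set \<alpha> \<subseteq> dmn M w" "\<psi> \<in> formulas q \<Theta> (length \<alpha>)"
  shows "holds M' (h w) (nth \<alpha>) \<psi> \<longleftrightarrow> holds M w (nth \<alpha>) \<psi>"
  using morphism_holds_tuple[OF M(1) morphism_iso[OF M iso, of q w] _ model_acc_refl[OF M(1)], of \<psi> \<alpha>]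
    assms(4-6) by simp

lemma half_asimulation_iso:
  assumes M: "is_model \<Theta> M" "is_model \<Theta> M'" "model_iso (\<lambda>x. x) h M M'"
    and N: "is_model \<Theta> N" "is_model \<Theta> N'" "model_iso (\<lambda>x. x) k N N'"
    and half: "half_asimulation q \<Theta> M N R S"
  shows "half_asimulation q \<Theta> M' N' (rel_image h k R) (rel_image k h S)"
proof (rule half_asimulationI)
  fix w' \<alpha> v' \<beta> assume "rel_image h k R w' \<alpha> v' \<beta>"
  then obtain w v where w': "w' = h w" and v': "v' = k v" and R: "R w \<alpha> v \<beta>" by (auto simp: rel_image_def)
  note in_dmn = half_asimulation_dmn[OF half R]
  note dmn_M = iso_id_dmn[OF M(3)] and dmn_N = iso_id_dmn[OF N(3)]
  note hom_M = iso_map_hom[OF M(3) _ in_dmn(3)] and hom_N = iso_map_hom[OF N(3) _ in_dmn(4)]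
  have acc: "(h w, h u) \<in> acc M'" if "(w, u) \<in> acc M" for u
    using that iso_acc[OF M(3)] model_acc_wlds[OF M(1) that] by blast
  show "w' \<in> wlds M' \<and> v' \<in> wlds N' \<and> set \<alpha> \<subseteq> dmn M' w' \<and> set \<beta> \<subseteq> dmn N' v' \<and> length \<alpha> = length \<beta>"
    using in_dmn dmn_M[OF in_dmn(1)] dmn_N[OF in_dmn(2)] bij_betwE[OF iso_wlds[OF M(3)]]
      bij_betwE[OF iso_wlds[OF N(3)]]
    by (simp add: w' v')
  show "holds N' v' (nth \<beta>) \<psi>"
    if "\<psi> \<in> formulas q \<Theta> (length \<alpha>)" "atomic \<psi>" "holds M' w' (nth \<alpha>) \<psi>" for \<psi>
    using that half_asimulation_atom[OF half R that(1,2)] in_dmn(5)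
      iso_id_holds[OF M in_dmn(1,3) that(1)] iso_id_holds[OF N in_dmn(2,4), of \<psi> q] by (simp add: w' v')
  show "\<exists>b\<in>dmn N' v'. rel_image h k R w' (\<alpha> @ [a]) v' (\<beta> @ [b])" if "a \<in> dmn M' w'" for a
    using half_asimulation_obj_forth[OF half R] that rel_imageI[of R]
    unfolding w' v' dmn_M[OF in_dmn(1)] dmn_N[OF in_dmn(2)] by blast
  fix t' assume "(v', t') \<in> acc N'"
  then obtain t where t: "(v, t) \<in> acc N" "t' = k t"
    using morphism_back[OF morphism_iso[OF N, of q v] model_acc_refl[OF N(1) in_dmn(2)]] v' by blast
  have dmn_t: "dmn N' t' = dmn N t" using dmn_N model_acc_wlds[OF N(1) t(1)] t(2) by simp
  show "\<exists>u. (w', u) \<in> acc M' \<and> rel_image h k R u (map (hom M' w' u) \<alpha>) t' (map (hom N' v' t') \<beta>) \<and>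
      rel_image k h S t' (map (hom N' v' t') \<beta>) u (map (hom M' w' u) \<alpha>)"
    using half_asimulation_s_back[OF half R t(1)] acc hom_M rel_imageI
    unfolding w' v' t(2) hom_N[OF t(1)] by metis
  fix b assume "b \<in> dmn N' t'"
  then obtain u a where u: "(w, u) \<in> acc M" "a \<in> dmn M u"
    and R': "R u (map (hom M w u) \<alpha> @ [a]) t (map (hom N v t) \<beta> @ [b])"
    using half_asimulation_obj_back[OF half R t(1)] dmn_t by blast
  have "a \<in> dmn M' (h u)" using u dmn_M model_acc_wlds[OF M(1)] by blast
  then show "\<exists>u. (w', u) \<in> acc M' \<and> (\<exists>a\<in>dmn M' u.
      rel_image h k R u (map (hom M' w' u) \<alpha> @ [a]) t' (map (hom N' v' t') \<beta> @ [b]))"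
    using acc[OF u(1)] rel_imageI[of R, OF R', of h k]
    unfolding w' v' t(2) hom_N[OF t(1)] hom_M[OF u(1), symmetric] by blast
qed

locale extension_logic = universe \<U> for \<U> :: "'u set" +
  fixes L :: "('u, 's) logic" and K :: stil
  assumes abstract: "abstract_logic L"
    and ext: "extends (std_logic K) L"
    and preserved: "preserved_under_asimulations K L"
begin

lemma Str_iff: "is_sig \<Theta> \<Longrightarrow> (M, w) \<in> Str L \<Theta> \<longleftrightarrow> is_model \<Theta> M \<and> w \<in> wlds M \<and> in_class K M"
  using ext by (simp add: extends_def std_logic_def)

lemma
  assumes "is_sig \<Theta>" "(M, w) \<in> Str L \<Theta>"
  shows Str_model: "is_model \<Theta> M"
    and Str_wlds: "w \<in> wlds M"
    and Str_in_class: "in_class K M"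
    and Str_change_point: "v \<in> wlds M \<Longrightarrow> (M, v) \<in> Str L \<Theta>"
  using assms by (simp_all add: Str_iff)

lemma Str_above:
  assumes "is_sig \<Theta>" "(M, w) \<in> Str L \<Theta>" "(w, v) \<in> acc M" shows "(M, v) \<in> Str L \<Theta>"
  using Str_change_point[OF assms(1,2)] model_acc_wlds[OF Str_model[OF assms(1,2)] assms(3)] by blast

lemma Str_iso:
  assumes "is_sig \<Theta>" "(M, w) \<in> Str L \<Theta>" "is_model \<Theta> N" "model_iso g h M N"
  shows "(N, h w) \<in> Str L \<Theta>"
  using abstract assms unfolding abstract_logic_def structures_ok_def by blast

lemma Sat_iso:
  assumes "is_sig \<Theta>" "(M, w) \<in> Str L \<Theta>" "is_model \<Theta> N" "model_iso g h M N" "\<phi> \<in> Sen L \<Theta>"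
  shows "Sat L M w \<phi> \<longleftrightarrow> Sat L N (h w) \<phi>"
  using abstract assms unfolding abstract_logic_def isomorphism_invariant_def by blast

lemma Sen_mono:
  assumes "is_sig \<Theta>" "is_sig \<Theta>'" "sub_sig \<Theta> \<Theta>'" "\<phi> \<in> Sen L \<Theta>"
  shows "\<phi> \<in> Sen L \<Theta>'"
proof -
  obtain \<Theta>\<phi> where "occurs_exactly L \<phi> \<Theta>\<phi>"
    using abstract assms unfolding abstract_logic_def occurrence_def by blast
  then show ?thesis using assms sub_sig_trans unfolding occurs_exactly_def by blast
qed

text \<open>An asimulation cannot tell to which of the two models a world belongs, so \<open>N\<close> is first made
  disjoint from \<open>M\<close>.\<close>

lemma half_asimulation_Sat:
  assumes sig: "is_sig \<Theta>" and SM: "(M, w) \<in> Str L \<Theta>" and SN: "(N, v) \<in> Str L \<Theta>"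
    and R: "half_asimulation (has_eq K) \<Theta> M N R S" and S: "half_asimulation (has_eq K) \<Theta> N M S R"
    and start: "R w [] v []" and \<phi>: "\<phi> \<in> Sen L \<Theta>" "Sat L M w \<phi>"
  shows "Sat L N v \<phi>"
proof -
  note M = Str_model[OF sig SM] and N = Str_model[OF sig SN]
  obtain k :: "'u \<Rightarrow> 'u" where k: "inj_on k (wlds N)" "k ` wlds N \<inter> wlds M = {}"
    using ex_fresh_inj[of "wlds N" "wlds M"] model_small_wlds[OF M] model_small_wlds[OF N]
    by (auto simp: small_iff_tiny)
  let ?N = "iso_copy (\<lambda>x. x) k N"
  have N': "is_model \<Theta> ?N" and iso_N: "model_iso (\<lambda>x. x) k N ?N"
    using is_model_iso_copy[OF N _ k(1)] model_iso_iso_copy[OF N _ k(1)] by simp_all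
  have iso_M: "model_iso (\<lambda>x. x) (\<lambda>x. x) M M" by (simp add: model_iso_def bij_betw_def)
  have "wlds ?N = k ` wlds N" using iso_wlds[OF iso_N] by (simp add: bij_betw_def)
  then have disjoint: "wlds M \<inter> wlds ?N = {}" using k(2) by blast
  have "asimulation K M w [] ?N (k v) []
      (\<lambda>(w, \<alpha>) (v, \<beta>). rel_image (\<lambda>x. x) k R w \<alpha> v \<beta> \<or> rel_image k (\<lambda>x. x) S w \<alpha> v \<beta>)"
    using half_asimulation_iso[OF M M iso_M N N' iso_N R] half_asimulation_iso[OF N N' iso_N M M iso_M S]
      rel_imageI[of R _ _ _ _ "\<lambda>x. x" k, OF start] by (rule asimulation_of_halves[OF sig M N' disjoint])
  then have "Sat L ?N (k v) \<phi>"
    using preserved sig SM Str_iso[OF sig SN N' iso_N] \<phi> unfolding preserved_under_asimulations_def by blast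
  then show ?thesis using Sat_iso[OF sig SN N' iso_N \<phi>(1)] by simp
qed

end

definition morphism_graph ::
    "('u \<Rightarrow> 'u) \<Rightarrow> ('u \<Rightarrow> 'u) \<Rightarrow> 'u kmodel \<Rightarrow> 'u \<Rightarrow> 'u \<Rightarrow> 'u list \<Rightarrow> 'u \<Rightarrow> 'u list \<Rightarrow> bool" where
  "morphism_graph p e M w v \<alpha> t \<beta> \<longleftrightarrow> (w, v) \<in> acc M \<and> set \<alpha> \<subseteq> dmn M v \<and> t = p v \<and> \<beta> = map e \<alpha>"

context
  fixes q \<Theta> p e and M N :: "'u kmodel" and w and \<Theta>\<^sub>M
  assumes M: "is_model \<Theta>\<^sub>M M" and morphism: "bounded_morphism q \<Theta> p e M w N"
begin

abbreviation (input) "G \<equiv> morphism_graph p e M w"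

lemma morphism_graph_dmn:
  assumes "G v \<alpha> t \<beta>"
  shows "v \<in> wlds M \<and> t \<in> wlds N \<and> set \<alpha> \<subseteq> dmn M v \<and> set \<beta> \<subseteq> dmn N t \<and> length \<alpha> = length \<beta>"
  using assms morphism_wlds[OF morphism, of v] morphism_dmn[OF morphism, of v] model_acc_wlds[OF M, of w v]
  by (auto simp: morphism_graph_def)

lemma morphism_graph_holds:
  assumes "G v \<alpha> t \<beta>" "\<psi> \<in> formulas q \<Theta> (length \<alpha>)"
  shows "holds M v (nth \<alpha>) \<psi> \<longleftrightarrow> holds N t (nth \<beta>) \<psi>"
  using assms morphism_holds_tuple[OF M morphism assms(2)] by (simp add: morphism_graph_def)

lemma morphism_graph_snoc: "G v \<alpha> t \<beta> \<Longrightarrow> a \<in> dmn M v \<Longrightarrow> G v (\<alpha> @ [a]) t (\<beta> @ [e a])"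
  by (simp add: morphism_graph_def)

lemma morphism_graph_hom:
  assumes "G v \<alpha> t \<beta>" "(v, u) \<in> acc M"
  shows "(t, p u) \<in> acc N" "G u (map (hom M v u) \<alpha>) (p u) (map (hom N t (p u)) \<beta>)"
proof -
  have v: "(w, v) \<in> acc M" "set \<alpha> \<subseteq> dmn M v" "t = p v" "\<beta> = map e \<alpha>"
    using assms(1) by (auto simp: morphism_graph_def)
  show "(t, p u) \<in> acc N" unfolding v(3) by (rule morphism_forth[OF morphism v(1) assms(2)])
  show "G u (map (hom M v u) \<alpha>) (p u) (map (hom N t (p u)) \<beta>)"
    unfolding morphism_graph_def v(3,4) morphism_map_hom[OF morphism v(1) assms(2) v(2)]
    using model_acc_trans[OF M v(1) assms(2)] set_map_hom_subset[OF M assms(2) v(2)] by simp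
qed

lemma morphism_graph_back:
  assumes "G v \<alpha> t \<beta>" "(t, t') \<in> acc N"
  obtains u where "(v, u) \<in> acc M" "t' = p u" "G u (map (hom M v u) \<alpha>) t' (map (hom N t t') \<beta>)"
  using assms morphism_back[OF morphism, of v t'] morphism_graph_hom(2)[OF assms(1)]
  unfolding morphism_graph_def by metis

lemma half_asimulation_morphism: "half_asimulation q \<Theta> M N G (\<lambda>t \<beta> v \<alpha>. G v \<alpha> t \<beta>)"
proof (rule half_asimulationI)
  fix v \<alpha> t \<beta> assume G: "G v \<alpha> t \<beta>"
  show "\<exists>b\<in>dmn N t. G v (\<alpha> @ [a]) t (\<beta> @ [b])" if "a \<in> dmn M v" for a
    using G that morphism_graph_snoc morphism_dmn[OF morphism] unfolding morphism_graph_def by blast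
  fix t' assume t': "(t, t') \<in> acc N"
  obtain u where u: "(v, u) \<in> acc M" "t' = p u" "G u (map (hom M v u) \<alpha>) t' (map (hom N t t') \<beta>)"
    using G t' by (rule morphism_graph_back)
  then show "\<exists>u. (v, u) \<in> acc M \<and> G u (map (hom M v u) \<alpha>) t' (map (hom N t t') \<beta>) \<and>
      G u (map (hom M v u) \<alpha>) t' (map (hom N t t') \<beta>)" by blast
  fix b assume b: "b \<in> dmn N t'"
  have "e ` dmn M u = dmn N t'" using u morphism_dmn[OF morphism, of u] by (simp add: morphism_graph_def)
  then obtain a where "a \<in> dmn M u" "b = e a" using b by blast
  then show "\<exists>u. (v, u) \<in> acc M \<and> (\<exists>a\<in>dmn M u. G u (map (hom M v u) \<alpha> @ [a]) t' (map (hom N t t') \<beta> @ [b]))"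
    using u morphism_graph_snoc[OF u(3)] by blast
qed (use morphism_graph_dmn morphism_graph_holds in blast)+

lemma half_asimulation_morphism_converse: "half_asimulation q \<Theta> N M (\<lambda>t \<beta> v \<alpha>. G v \<alpha> t \<beta>) G"
proof (rule half_asimulationI)
  fix t \<beta> v \<alpha> assume G: "G v \<alpha> t \<beta>"
  show "holds M v (nth \<alpha>) \<psi>" if "\<psi> \<in> formulas q \<Theta> (length \<beta>)" "holds N t (nth \<beta>) \<psi>" for \<psi>
    using G that morphism_graph_holds morphism_graph_dmn by metis
  show "\<exists>a\<in>dmn M v. G v (\<alpha> @ [a]) t (\<beta> @ [b])" if "b \<in> dmn N t" for b
    using G that morphism_graph_snoc[OF G] morphism_dmn[OF morphism, of v]
    by (auto simp: morphism_graph_def)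
  fix u assume u: "(v, u) \<in> acc M"
  then show "\<exists>t'. (t, t') \<in> acc N \<and> G u (map (hom M v u) \<alpha>) t' (map (hom N t t') \<beta>) \<and>
      G u (map (hom M v u) \<alpha>) t' (map (hom N t t') \<beta>)"
    using morphism_graph_hom[OF G] by blast
  show "\<exists>t'. (t, t') \<in> acc N \<and> (\<exists>b\<in>dmn N t'. G u (map (hom M v u) \<alpha> @ [a]) t' (map (hom N t t') \<beta> @ [b]))"
    if "a \<in> dmn M u" for a
    using morphism_graph_hom[OF G u] morphism_graph_snoc that morphism_dmn[OF morphism, of u]
    unfolding morphism_graph_def by blast
qed (use morphism_graph_dmn in metis)+

end

definition persistence_graph :: "'u kmodel \<Rightarrow> 'u \<Rightarrow> 'u list \<Rightarrow> 'u \<Rightarrow> 'u list \<Rightarrow> bool" where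
  "persistence_graph M w \<alpha> v \<beta> \<longleftrightarrow> (w, v) \<in> acc M \<and> set \<alpha> \<subseteq> dmn M w \<and> \<beta> = map (hom M w v) \<alpha>"

lemma half_asimulation_persistence:
  assumes M: "is_model \<Theta> M"
  shows "half_asimulation q \<Theta> M M (persistence_graph M) (persistence_graph M)"
proof (rule half_asimulationI)
  have refl: "persistence_graph M w \<alpha> w \<alpha>" if "w \<in> wlds M" "set \<alpha> \<subseteq> dmn M w" for w \<alpha>
    using that model_acc_refl[OF M] by (simp add: persistence_graph_def map_hom_id[OF M])
  fix w \<alpha> v \<beta> assume "persistence_graph M w \<alpha> v \<beta>"
  then have wv: "(w, v) \<in> acc M" and \<alpha>: "set \<alpha> \<subseteq> dmn M w" and \<beta>: "\<beta> = map (hom M w v) \<alpha>"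
    by (simp_all add: persistence_graph_def)
  show "w \<in> wlds M \<and> v \<in> wlds M \<and> set \<alpha> \<subseteq> dmn M w \<and> set \<beta> \<subseteq> dmn M v \<and> length \<alpha> = length \<beta>"
    using wv \<alpha> model_acc_wlds[OF M wv] set_map_hom_subset[OF M wv \<alpha>] by (simp add: \<beta>)
  show "holds M v (nth \<beta>) \<psi>" if "\<psi> \<in> formulas q \<Theta> (length \<alpha>)" "holds M w (nth \<alpha>) \<psi>" for \<psi>
    unfolding \<beta> by (rule holds_persistent_tuple[OF M that(1) wv \<alpha> that(2)])
  show "\<exists>b\<in>dmn M v. persistence_graph M w (\<alpha> @ [a]) v (\<beta> @ [b])" if "a \<in> dmn M w" for a
    using that wv \<alpha> model_hom[OF M wv] by (auto simp: persistence_graph_def \<beta>)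
  fix t assume vt: "(v, t) \<in> acc M"
  have t: "(w, t) \<in> acc M" "t \<in> wlds M" using model_acc_trans[OF M wv vt] model_acc_wlds[OF M vt] by auto
  have \<alpha>t: "set (map (hom M w t) \<alpha>) \<subseteq> dmn M t" by (rule set_map_hom_subset[OF M t(1) \<alpha>])
  show "\<exists>u. (w, u) \<in> acc M \<and> persistence_graph M u (map (hom M w u) \<alpha>) t (map (hom M v t) \<beta>) \<and>
      persistence_graph M t (map (hom M v t) \<beta>) u (map (hom M w u) \<alpha>)"
    unfolding \<beta> map_hom_comp[OF M wv vt \<alpha>] using t refl[OF t(2) \<alpha>t] by blast
  show "\<exists>u. (w, u) \<in> acc M \<and> (\<exists>a\<in>dmn M u.
      persistence_graph M u (map (hom M w u) \<alpha> @ [a]) t (map (hom M v t) \<beta> @ [b]))" if "b \<in> dmn M t" for b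
    unfolding \<beta> map_hom_comp[OF M wv vt \<alpha>]
    using t that refl[OF t(2), of "map (hom M w t) \<alpha> @ [b]"] \<alpha>t by auto
qed

context extension_logic
begin

lemma Sat_morphism:
  assumes sig: "is_sig \<Theta>" and SM: "(M, w) \<in> Str L \<Theta>" and SN: "(N, p w) \<in> Str L \<Theta>"
    and morphism: "bounded_morphism (has_eq K) \<Theta> p e M w N" and \<phi>: "\<phi> \<in> Sen L \<Theta>"
  shows "Sat L M w \<phi> \<longleftrightarrow> Sat L N (p w) \<phi>"
proof -
  note M = Str_model[OF sig SM]
  have "morphism_graph p e M w w [] (p w) []"
    using model_acc_refl[OF M Str_wlds[OF sig SM]] by (simp add: morphism_graph_def)
  then show ?thesis
    using half_asimulation_Sat[OF sig SM SN half_asimulation_morphism[OF M morphism]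
        half_asimulation_morphism_converse[OF M morphism] _ \<phi>]
      half_asimulation_Sat[OF sig SN SM half_asimulation_morphism_converse[OF M morphism]
        half_asimulation_morphism[OF M morphism] _ \<phi>] by blast
qed

lemma Sat_persistent:
  assumes sig: "is_sig \<Theta>" and SM: "(M, w) \<in> Str L \<Theta>" and wv: "(w, v) \<in> acc M"
    and \<phi>: "\<phi> \<in> Sen L \<Theta>" "Sat L M w \<phi>"
  shows "Sat L M v \<phi>"
  by (rule half_asimulation_Sat[OF sig SM Str_above[OF sig SM wv]
        half_asimulation_persistence[OF Str_model[OF sig SM]]
        half_asimulation_persistence[OF Str_model[OF sig SM]] _ \<phi>])
    (simp add: persistence_graph_def wv)

end


section \<open>Sentences about tuples\<close>

lemma all_name_tuple_snoc:
  assumes M: "is_model \<Theta> M" and c: "c \<notin> csts (sgn M)" "c \<notin> set cs"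
  shows "(\<forall>v as. (w, v) \<in> acc M \<longrightarrow> name_tuple M v (cs @ [c]) as \<longrightarrow> Q v as) \<longleftrightarrow>
    (\<forall>v as. (w, v) \<in> acc M \<longrightarrow> name_tuple M v cs as \<longrightarrow>
      (\<forall>u a. (v, u) \<in> acc M \<longrightarrow> a \<in> dmn M u \<longrightarrow> Q u (map (hom M v u) as @ [a])))" (is "?L \<longleftrightarrow> ?R")
proof
  assume ?L
  moreover have "name_tuple M u (cs @ [c]) (map (hom M v u) as @ [a])"
    if "name_tuple M v cs as" "(v, u) \<in> acc M" "a \<in> dmn M u" for v u as a
    using name_tuple_hom[OF M that(2,1)] that(3) c by (auto simp: name_tuple_def)
  ultimately show ?R using model_acc_trans[OF M] by blast
next
  assume ?R
  show ?L
  proof (intro allI impI)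
    fix v bs assume v: "(w, v) \<in> acc M" and names: "name_tuple M v (cs @ [c]) bs"
    then obtain as a where bs: "bs = as @ [a]" by (cases bs rule: rev_cases) (auto simp: name_tuple_def)
    have as: "name_tuple M v cs as" "a \<in> dmn M v" using names bs by (auto simp: name_tuple_def)
    moreover have "(v, v) \<in> acc M" using model_acc_refl[OF M] model_acc_wlds[OF M v] by blast
    ultimately have "Q v (map (hom M v v) as @ [a])" using \<open>?R\<close> v by blast
    then show "Q v bs" using map_hom_id[OF M name_tupleD(4)[OF as(1)]] bs by simp
  qed
qed

context extension_logic
begin

abbreviation Sat_tuple :: "'u kmodel \<Rightarrow> 'u \<Rightarrow> 'u list \<Rightarrow> 'u list \<Rightarrow> 's \<Rightarrow> bool" where
  "Sat_tuple M w cs as \<phi> \<equiv> Sat L (cone_exp M w cs as) w \<phi>"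

lemma Str_cone_exp:
  assumes sig: "is_sig \<Theta>" and SM: "(M, w) \<in> Str L \<Theta>" and names: "name_tuple M w cs as"
    and wv: "(w, v) \<in> acc M"
  shows "(cone_exp M w cs as, v) \<in> Str L (add_consts \<Theta> cs)"
  unfolding Str_iff[OF is_sig_add_consts[OF sig]]
  using is_model_cone_exp[OF Str_model[OF sig SM] Str_wlds[OF sig SM] names]
    in_class_cone_exp[OF Str_in_class[OF sig SM]] wv by simp

lemma Str_cone_exp_point:
  assumes "is_sig \<Theta>" "(M, w) \<in> Str L \<Theta>" "name_tuple M w cs as"
  shows "(cone_exp M w cs as, w) \<in> Str L (add_consts \<Theta> cs)"
  using assms Str_cone_exp model_acc_refl Str_model Str_wlds by metis

lemma Sat_cone:
  assumes sig: "is_sig \<Theta>" and SM: "(M, w) \<in> Str L \<Theta>" and \<phi>: "\<phi> \<in> Sen L \<Theta>"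
  shows "Sat_tuple M w [] [] \<phi> \<longleftrightarrow> Sat L M w \<phi>"
  using Sat_morphism[OF sig SM _ morphism_cone[OF Str_model[OF sig SM] Str_wlds[OF sig SM]] \<phi>]
    Str_cone_exp_point[OF sig SM name_tuple_Nil] by simp

lemma Sat_cone_exp_above:
  assumes sig: "is_sig \<Theta>" and SM: "(M, v) \<in> Str L \<Theta>" and vu: "(v, u) \<in> acc M"
    and names: "name_tuple M v cs as" and \<phi>: "\<phi> \<in> Sen L (add_consts \<Theta> cs)"
  shows "Sat L (cone_exp M v cs as) u \<phi> \<longleftrightarrow> Sat_tuple M u cs (map (hom M v u) as) \<phi>"
  using Sat_cone[OF is_sig_add_consts[OF sig] Str_cone_exp[OF sig SM names vu] \<phi>]
    cone_exp_cone_exp[OF Str_model[OF sig SM] names vu name_tuple_Nil] by simp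

lemma Sat_tuple_persistent:
  assumes sig: "is_sig \<Theta>" and SM: "(M, v) \<in> Str L \<Theta>" and vu: "(v, u) \<in> acc M"
    and names: "name_tuple M v cs as" and \<phi>: "\<phi> \<in> Sen L (add_consts \<Theta> cs)" "Sat_tuple M v cs as \<phi>"
  shows "Sat_tuple M u cs (map (hom M v u) as) \<phi>"
proof -
  have "(v, u) \<in> acc (cone_exp M v cs as)"
    using vu model_acc_refl[OF Str_model[OF sig SM] Str_wlds[OF sig SM]] by simp
  then show ?thesis
    unfolding Sat_cone_exp_above[OF sig SM vu names \<phi>(1), symmetric]
    by (rule Sat_persistent[OF is_sig_add_consts[OF sig] Str_cone_exp_point[OF sig SM names] _ \<phi>])
qed

lemma Sat_tuple_morphism:
  assumes sig: "is_sig \<Theta>" and SM: "(M, w) \<in> Str L \<Theta>" and SN: "(N, p w) \<in> Str L \<Theta>"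
    and morphism: "bounded_morphism (has_eq K) \<Theta> p e M w N"
    and names: "name_tuple M w cs as" and \<phi>: "\<phi> \<in> Sen L (add_consts \<Theta> cs)"
  shows "Sat_tuple M w cs as \<phi> \<longleftrightarrow> Sat_tuple N (p w) cs (map e as) \<phi>"
proof -
  note M = Str_model[OF sig SM] and N = Str_model[OF sig SN] and w = Str_wlds[OF sig SM]
  have names': "name_tuple N (p w) cs (map e as)"
    using names morphism_dmn[OF morphism model_acc_refl[OF M w]] model_sgn[OF M] model_sgn[OF N]
    by (auto simp: name_tuple_def)
  show ?thesis
    by (rule Sat_morphism[where p = p and e = e, OF is_sig_add_consts[OF sig] Str_cone_exp_point[OF sig SM names]
          Str_cone_exp_point[OF sig SN names'] morphism_cone_exp[OF M N w morphism names names'] \<phi>])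
qed

lemma Str_reduct:
  assumes "is_sig \<Theta>" "is_sig \<Theta>'" "sub_sig \<Theta> \<Theta>'" "(M, w) \<in> Str L \<Theta>'"
  shows "(reduct M \<Theta>, w) \<in> Str L \<Theta>"
  using abstract assms unfolding abstract_logic_def structures_ok_def by blast

lemma Sat_reduct:
  assumes "is_sig \<Theta>" "is_sig \<Theta>'" "sub_sig \<Theta> \<Theta>'" "(M, w) \<in> Str L \<Theta>'" "\<phi> \<in> Sen L \<Theta>"
  shows "Sat L (reduct M \<Theta>) w \<phi> \<longleftrightarrow> Sat L M w \<phi>"
  using abstract assms unfolding abstract_logic_def expansion_def by blast

lemma Sat_tuple_reduct:
  assumes "is_sig \<Theta>" "is_sig \<Theta>'" "sub_sig \<Theta> \<Theta>'" "(M, w) \<in> Str L \<Theta>'"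
    and names: "name_tuple M w cs as" and "\<phi> \<in> Sen L (add_consts \<Theta> cs)"
  shows "Sat_tuple (reduct M \<Theta>) w cs as \<phi> \<longleftrightarrow> Sat_tuple M w cs as \<phi>"
  unfolding cone_exp_reduct[OF name_tupleD(3)[OF names]]
  using assms
  by (intro Sat_reduct[of _ "add_consts \<Theta>' cs"] is_sig_add_consts sub_sig_add_consts Str_cone_exp_point)

lemma Str_oplus:
  assumes sig: "is_sig \<Theta>" and SM: "(M, w) \<in> Str L \<Theta>" and N: "N \<in> oplus M w cs as" "in_class K N"
  shows "(N, w) \<in> Str L (add_consts \<Theta> cs)"
  using oplusD(1,4)[OF Str_model[OF sig SM] N(1)]
    model_acc_refl[OF Str_model[OF sig SM] Str_wlds[OF sig SM]] N(2)
  by (simp add: Str_iff[OF is_sig_add_consts[OF sig]])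

lemma Sat_oplus:
  assumes sig: "is_sig \<Theta>" and SM: "(M, w) \<in> Str L \<Theta>" and names: "name_tuple M w cs as"
    and N: "N \<in> oplus M w cs as" "in_class K N" and \<phi>: "\<phi> \<in> Sen L (add_consts \<Theta> cs)"
  shows "Sat L N w \<phi> \<longleftrightarrow> Sat_tuple M w cs as \<phi>"
  using Sat_cone[OF is_sig_add_consts[OF sig] Str_oplus[OF sig SM N] \<phi>]
    cone_oplus[OF Str_model[OF sig SM] Str_wlds[OF sig SM] names N(1)] by simp

lemma
  assumes sig: "is_sig \<Theta>" and SM: "(M, w) \<in> Str L \<Theta>" and names: "name_tuple M w cs as"
  shows Bpl_nonempty: "Bpl L M w cs as \<noteq> {}"
    and Bpl_oplus: "N \<in> Bpl L M w cs as \<Longrightarrow> N \<in> oplus M w cs as \<and> in_class K N"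
proof -
  have Bpl: "Bpl L M w cs as \<noteq> {} \<and> Bpl L M w cs as \<subseteq> oplus M w cs as \<and>
      (\<forall>N\<in>Bpl L M w cs as. \<forall>v\<in>wlds N. (N, v) \<in> Str L (add_consts \<Theta> cs))"
    using abstract assms unfolding abstract_logic_def boxplus_ok_def by blast
  then show "Bpl L M w cs as \<noteq> {}" by blast
  assume N: "N \<in> Bpl L M w cs as"
  then have "w \<in> wlds N"
    using Bpl oplusD(4)[OF Str_model[OF sig SM]] model_acc_refl[OF Str_model[OF sig SM] Str_wlds[OF sig SM]]
    by blast
  then show "N \<in> oplus M w cs as \<and> in_class K N"
    using N Bpl Str_in_class[OF is_sig_add_consts[OF sig]] by blast
qed

lemma ex_forall_sentence:
  assumes sig: "is_sig \<Theta>" and c: "c \<notin> csts \<Theta>" and \<phi>: "\<phi> \<in> Sen L (add_consts \<Theta> [c])"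
  obtains \<chi> where "\<chi> \<in> Sen L \<Theta>" "\<And>M w. (M, w) \<in> Str L \<Theta> \<Longrightarrow>
    Sat L M w \<chi> \<longleftrightarrow> (\<forall>v a. (w, v) \<in> acc M \<longrightarrow> a \<in> dmn M v \<longrightarrow> Sat_tuple M v [c] [a] \<phi>)"
proof -
  have "quantifier_closure L" using abstract by (simp add: abstract_logic_def)
  from this[unfolded quantifier_closure_def, rule_format, OF conjI[OF sig c] \<phi>, THEN conjunct2]
  obtain \<chi> where \<chi>: "\<chi> \<in> Sen L \<Theta>" and iff: "\<And>M w. (M, w) \<in> Str L \<Theta> \<Longrightarrow>
      Sat L M w \<chi> \<longleftrightarrow> (\<forall>v. (w, v) \<in> acc M \<longrightarrow> (\<forall>a\<in>dmn M v. \<exists>N\<in>Bpl L M v [c] [a]. Sat L N v \<phi>))" by blast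
  have "(\<exists>N\<in>Bpl L M v [c] [a]. Sat L N v \<phi>) \<longleftrightarrow> Sat_tuple M v [c] [a] \<phi>"
    if SM: "(M, w) \<in> Str L \<Theta>" and v: "(w, v) \<in> acc M" and a: "a \<in> dmn M v" for M w v a
  proof -
    note Sv = Str_above[OF sig SM v]
    have "name_tuple M v [c] [a]" using a c model_sgn[OF Str_model[OF sig SM]] by (simp add: name_tuple_def)
    then show ?thesis
      using Bpl_nonempty[OF sig Sv] Bpl_oplus[OF sig Sv] Sat_oplus[OF sig Sv _ _ _ \<phi>] by blast
  qed
  then show thesis using that[OF \<chi>] iff by metis
qed

lemma
  assumes sig: "is_sig \<Theta>" and \<phi>: "\<phi> \<in> Sen L \<Theta>" and \<psi>: "\<psi> \<in> Sen L \<Theta>"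
  shows ex_imp_sentence: "\<exists>\<chi>\<in>Sen L \<Theta>. \<forall>(M, w)\<in>Str L \<Theta>.
      Sat L M w \<chi> \<longleftrightarrow> (\<forall>v. (w, v) \<in> acc M \<longrightarrow> Sat L M v \<phi> \<longrightarrow> Sat L M v \<psi>)"
    and ex_and_sentence: "\<exists>\<chi>\<in>Sen L \<Theta>. \<forall>(M, w)\<in>Str L \<Theta>. Sat L M w \<chi> \<longleftrightarrow> Sat L M w \<phi> \<and> Sat L M w \<psi>"
  using abstract assms unfolding abstract_logic_def propositional_closure_def by blast+

lemma Sat_tuple_forall_const:
  assumes sig: "is_sig \<Theta>" and SM: "(M, v) \<in> Str L \<Theta>" and names: "name_tuple M v cs as"
    and c: "c \<notin> csts (add_consts \<Theta> cs)"
    and \<chi>: "\<And>M w. (M, w) \<in> Str L (add_consts \<Theta> cs) \<Longrightarrow> Sat L M w \<chi> \<longleftrightarrow>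
      (\<forall>u a. (w, u) \<in> acc M \<longrightarrow> a \<in> dmn M u \<longrightarrow> Sat_tuple M u [c] [a] \<phi>)"
  shows "Sat_tuple M v cs as \<chi> \<longleftrightarrow> (\<forall>u a. (v, u) \<in> acc M \<longrightarrow> a \<in> dmn M u \<longrightarrow>
    Sat_tuple M u (cs @ [c]) (map (hom M v u) as @ [a]) \<phi>)"
proof -
  note M = Str_model[OF sig SM]
  have "name_tuple (cone_exp M v cs as) u [c] [a]" if "(v, u) \<in> acc M" "a \<in> dmn M u" for u a
    using that c model_sgn[OF M] by (simp add: name_tuple_def)
  then show ?thesis
    unfolding \<chi>[OF Str_cone_exp_point[OF sig SM names]]
    using model_acc_refl[OF M Str_wlds[OF sig SM]] cone_exp_cone_exp[OF M names] by auto
qed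

lemma ex_forall_tuple_sentence:
  assumes sig: "is_sig \<Theta>" and "distinct cs" "set cs \<inter> csts \<Theta> = {}" "\<phi> \<in> Sen L (add_consts \<Theta> cs)"
  obtains \<chi> where "\<chi> \<in> Sen L \<Theta>" "\<And>M w. (M, w) \<in> Str L \<Theta> \<Longrightarrow>
    Sat L M w \<chi> \<longleftrightarrow> (\<forall>v as. (w, v) \<in> acc M \<longrightarrow> name_tuple M v cs as \<longrightarrow> Sat_tuple M v cs as \<phi>)"
  using assms(2-4)
proof (induction cs arbitrary: \<phi> thesis rule: rev_induct)
  case Nil
  have "Sat L M w \<phi> \<longleftrightarrow> (\<forall>v. (w, v) \<in> acc M \<longrightarrow> Sat_tuple M v [] [] \<phi>)" if SM: "(M, w) \<in> Str L \<Theta>" for M w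
    using Sat_persistent[OF sig SM] Sat_cone[OF sig Str_above[OF sig SM]] Nil.prems(4)
      model_acc_refl[OF Str_model[OF sig SM] Str_wlds[OF sig SM]] by auto
  then show ?case using Nil.prems(4) by (intro Nil.prems(1)[of \<phi>]) (auto simp: name_tuple_def)
next
  case (snoc c cs)
  let ?\<Theta> = "add_consts \<Theta> cs"
  have cs: "distinct cs" "set cs \<inter> csts \<Theta> = {}" and c: "c \<notin> csts ?\<Theta>"
    using snoc.prems by auto
  obtain \<chi>' where \<chi>': "\<chi>' \<in> Sen L ?\<Theta>" "\<And>M w. (M, w) \<in> Str L ?\<Theta> \<Longrightarrow>
      Sat L M w \<chi>' \<longleftrightarrow> (\<forall>v a. (w, v) \<in> acc M \<longrightarrow> a \<in> dmn M v \<longrightarrow> Sat_tuple M v [c] [a] \<phi>)"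
    using ex_forall_sentence[OF is_sig_add_consts[OF sig] c] snoc.prems(4) unfolding add_consts_append
    by blast
  obtain \<chi> where \<chi>: "\<chi> \<in> Sen L \<Theta>" "\<And>M w. (M, w) \<in> Str L \<Theta> \<Longrightarrow>
      Sat L M w \<chi> \<longleftrightarrow> (\<forall>v as. (w, v) \<in> acc M \<longrightarrow> name_tuple M v cs as \<longrightarrow> Sat_tuple M v cs as \<chi>')"
    using snoc.IH[OF _ cs \<chi>'(1)] by blast
  have "Sat L M w \<chi> \<longleftrightarrow> 
      (\<forall>v as. (w, v) \<in> acc M \<longrightarrow> name_tuple M v (cs @ [c]) as \<longrightarrow> Sat_tuple M v (cs @ [c]) as \<phi>)"
    (is "_ \<longleftrightarrow> ?R") if SM: "(M, w) \<in> Str L \<Theta>" for M w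
  proof -
    note M = Str_model[OF sig SM]
    have inner: "Sat_tuple M v cs as \<chi>' \<longleftrightarrow> (\<forall>u a. (v, u) \<in> acc M \<longrightarrow> a \<in> dmn M u \<longrightarrow>
        Sat_tuple M u (cs @ [c]) (map (hom M v u) as @ [a]) \<phi>)"
      if v: "(w, v) \<in> acc M" and names: "name_tuple M v cs as" for v as
      by (rule Sat_tuple_forall_const[OF sig Str_above[OF sig SM v] names c \<chi>'(2)])
    have "?R \<longleftrightarrow> (\<forall>v as. (w, v) \<in> acc M \<longrightarrow> name_tuple M v cs as \<longrightarrow>
        (\<forall>u a. (v, u) \<in> acc M \<longrightarrow> a \<in> dmn M u \<longrightarrow> Sat_tuple M u (cs @ [c]) (map (hom M v u) as @ [a]) \<phi>))"
      using c model_sgn[OF M] by (intro all_name_tuple_snoc[OF M]) auto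
    then show ?thesis unfolding \<chi>(2)[OF SM] using inner by simp
  qed
  then show ?case by (rule snoc.prems(1)[OF \<chi>(1)])
qed

definition entails_above :: "'u kmodel \<Rightarrow> 'u \<Rightarrow> 'u list \<Rightarrow> 's \<Rightarrow> 's \<Rightarrow> bool" where
  "entails_above M w cs \<phi> \<psi> \<longleftrightarrow> (\<forall>v as. (w, v) \<in> acc M \<longrightarrow> name_tuple M v cs as \<longrightarrow>
     Sat_tuple M v cs as \<phi> \<longrightarrow> Sat_tuple M v cs as \<psi>)"

lemma ex_entailment_sentence:
  assumes sig: "is_sig \<Theta>" and cs: "distinct cs" "set cs \<inter> csts \<Theta> = {}"
    and \<phi>: "\<phi> \<in> Sen L (add_consts \<Theta> cs)" and \<psi>: "\<psi> \<in> Sen L (add_consts \<Theta> cs)"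
  obtains \<chi> where "\<chi> \<in> Sen L \<Theta>" "\<And>M w. (M, w) \<in> Str L \<Theta> \<Longrightarrow> Sat L M w \<chi> \<longleftrightarrow> entails_above M w cs \<phi> \<psi>"
proof -
  obtain \<theta> where \<theta>: "\<theta> \<in> Sen L (add_consts \<Theta> cs)" "\<And>M w. (M, w) \<in> Str L (add_consts \<Theta> cs) \<Longrightarrow>
      Sat L M w \<theta> \<longleftrightarrow> (\<forall>v. (w, v) \<in> acc M \<longrightarrow> Sat L M v \<phi> \<longrightarrow> Sat L M v \<psi>)"
    using ex_imp_sentence[OF is_sig_add_consts[OF sig] \<phi> \<psi>] by blast
  obtain \<chi> where \<chi>: "\<chi> \<in> Sen L \<Theta>" "\<And>M w. (M, w) \<in> Str L \<Theta> \<Longrightarrow>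
      Sat L M w \<chi> \<longleftrightarrow> (\<forall>v as. (w, v) \<in> acc M \<longrightarrow> name_tuple M v cs as \<longrightarrow> Sat_tuple M v cs as \<theta>)"
    using ex_forall_tuple_sentence[OF sig cs \<theta>(1)] by blast
  have "Sat L M w \<chi> \<longleftrightarrow> entails_above M w cs \<phi> \<psi>" if SM: "(M, w) \<in> Str L \<Theta>" for M w
  proof -
    note M = Str_model[OF sig SM]
    have refl: "(v, v) \<in> acc M" if "(w, v) \<in> acc M" for v
      using model_acc_refl[OF M] model_acc_wlds[OF M that] by blast
    have \<theta>_iff: "Sat_tuple M v cs as \<theta> \<longleftrightarrow> (\<forall>u. (v, u) \<in> acc M \<longrightarrow>
        Sat_tuple M u cs (map (hom M v u) as) \<phi> \<longrightarrow> Sat_tuple M u cs (map (hom M v u) as) \<psi>)"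
      if v: "(w, v) \<in> acc M" and names: "name_tuple M v cs as" for v as
    proof -
      note Sv = Str_above[OF sig SM v]
      show ?thesis
        unfolding \<theta>(2)[OF Str_cone_exp_point[OF sig Sv names]]
        using Sat_cone_exp_above[OF sig Sv _ names \<phi>] Sat_cone_exp_above[OF sig Sv _ names \<psi>] refl[OF v]
        by auto
    qed
    show ?thesis
      unfolding \<chi>(2)[OF SM] entails_above_def
    proof (intro iffI allI impI)
      fix v as assume "\<forall>v as. (w, v) \<in> acc M \<longrightarrow> name_tuple M v cs as \<longrightarrow> Sat_tuple M v cs as \<theta>"
        and v: "(w, v) \<in> acc M" and names: "name_tuple M v cs as" and "Sat_tuple M v cs as \<phi>"
      then show "Sat_tuple M v cs as \<psi>"
        using \<theta>_iff[OF v names] refl[OF v] map_hom_id[OF M name_tupleD(4)[OF names]] by metis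
    next
      fix v as assume "\<forall>v as. (w, v) \<in> acc M \<longrightarrow> name_tuple M v cs as \<longrightarrow>
          Sat_tuple M v cs as \<phi> \<longrightarrow> Sat_tuple M v cs as \<psi>"
        and v: "(w, v) \<in> acc M" and names: "name_tuple M v cs as"
      then show "Sat_tuple M v cs as \<theta>"
        unfolding \<theta>_iff[OF v names] using model_acc_trans[OF M v] name_tuple_hom[OF M _ names] by blast
    qed
  qed
  then show thesis by (rule that[OF \<chi>(1)])
qed

end


section \<open>Translation of standard formulas\<close>

instance tm :: (countable) countable by countable_datatype
instance fm :: (countable) countable by countable_datatype

lemma fm_over_symbols:
  "fm_over q \<Theta> \<phi> \<Longrightarrow> set_fm \<phi> \<subseteq> (\<Union>n. preds \<Theta> n) \<union> csts \<Theta>"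
proof (induction \<phi>)
  case (Atom P ts)
  have "set_tm t \<subseteq> csts \<Theta>" if "t \<in> set ts" for t using Atom that by (cases t) auto
  then show ?case using Atom by auto
next
  case (Eq s t)
  then show ?case by (cases s; cases t) auto
qed auto

lemma countable_formulas:
  assumes "finite_sig \<Theta>"
  shows "countable (formulas q \<Theta> k)"
proof -
  let ?S = "(\<Union>n. preds \<Theta> n) \<union> csts \<Theta>"
  have "(\<Union>n. preds \<Theta> n) = snd ` (SIGMA n:UNIV. preds \<Theta> n)" by force
  then have "finite ?S" using assms by (simp add: finite_sig_def)
  then have inj: "inj_on (to_nat_on ?S) ?S" by (simp add: countable_finite inj_on_to_nat_on)
  have "inj_on (map_fm (to_nat_on ?S)) {\<phi>. set_fm \<phi> \<subseteq> ?S}"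
  proof (rule inj_onI)
    fix \<phi> \<psi> assume "\<phi> \<in> {\<phi>. set_fm \<phi> \<subseteq> ?S}" "\<psi> \<in> {\<phi>. set_fm \<phi> \<subseteq> ?S}"
      "map_fm (to_nat_on ?S) \<phi> = map_fm (to_nat_on ?S) \<psi>"
    then show "\<phi> = \<psi>" using inj by (elim fm.inj_map_strong[rotated]) (auto dest: inj_onD)
  qed
  moreover have "formulas q \<Theta> k \<subseteq> {\<phi>. set_fm \<phi> \<subseteq> ?S}"
    unfolding formulas_def using fm_over_symbols by blast
  ultimately show ?thesis
    using countable_image_inj_on[of "map_fm (to_nat_on ?S)"] by (blast intro: inj_on_subset)
qed

fun tm_csts :: "'u tm \<Rightarrow> 'u set" where
  "tm_csts (Var x) = {}"
| "tm_csts (Cst c) = {c}"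

fun fm_csts :: "'u fm \<Rightarrow> 'u set" where
  "fm_csts Bot = {}"
| "fm_csts (Atom P ts) = (\<Union>t\<in>set ts. tm_csts t)"
| "fm_csts (Eq s t) = tm_csts s \<union> tm_csts t"
| "fm_csts (And \<phi> \<psi>) = fm_csts \<phi> \<union> fm_csts \<psi>"
| "fm_csts (Or \<phi> \<psi>) = fm_csts \<phi> \<union> fm_csts \<psi>"
| "fm_csts (Imp \<phi> \<psi>) = fm_csts \<phi> \<union> fm_csts \<psi>"
| "fm_csts (All x \<phi>) = fm_csts \<phi>"
| "fm_csts (Ex x \<phi>) = fm_csts \<phi>"

fun fm_preds :: "'u fm \<Rightarrow> (nat \<times> 'u) set" where
  "fm_preds Bot = {}"
| "fm_preds (Atom P ts) = {(length ts, P)}"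
| "fm_preds (Eq s t) = {}"
| "fm_preds (And \<phi> \<psi>) = fm_preds \<phi> \<union> fm_preds \<psi>"
| "fm_preds (Or \<phi> \<psi>) = fm_preds \<phi> \<union> fm_preds \<psi>"
| "fm_preds (Imp \<phi> \<psi>) = fm_preds \<phi> \<union> fm_preds \<psi>"
| "fm_preds (All x \<phi>) = fm_preds \<phi>"
| "fm_preds (Ex x \<phi>) = fm_preds \<phi>"

definition fm_sig :: "'u fm \<Rightarrow> 'u signature" where
  "fm_sig \<phi> = \<lparr>preds = (\<lambda>n. {P. (n, P) \<in> fm_preds \<phi>}), csts = fm_csts \<phi>\<rparr>"

lemma tm_over_iff: "tm_over \<Theta> t \<longleftrightarrow> tm_csts t \<subseteq> csts \<Theta>"
  by (cases t) auto

lemma fm_over_iff: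
  "fm_over q \<Theta> \<phi> \<longleftrightarrow> fm_over q (fm_sig \<phi>) \<phi> \<and> sub_sig (fm_sig \<phi>) \<Theta>"
proof -
  let ?universal = "\<lparr>preds = (\<lambda>_. UNIV), csts = UNIV\<rparr>"
  have over: "fm_over q \<Theta> \<phi> \<longleftrightarrow> fm_over q ?universal \<phi> \<and>
      (\<forall>n P. (n, P) \<in> fm_preds \<phi> \<longrightarrow> P \<in> preds \<Theta> n) \<and> fm_csts \<phi> \<subseteq> csts \<Theta>" for \<Theta>
    by (induction \<phi>) (auto simp: tm_over_iff)
  show ?thesis unfolding over[of \<Theta>] over[of "fm_sig \<phi>"] by (auto simp: fm_sig_def sub_sig_def)
qed

lemma fm_over_mono: "fm_over q \<Theta> \<psi> \<Longrightarrow> sub_sig \<Theta> \<Theta>' \<Longrightarrow> fm_over q \<Theta>' \<psi>"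
  using fm_over_iff[of q \<Theta> \<psi>] fm_over_iff[of q \<Theta>' \<psi>] sub_sig_trans by blast

lemma formulas_sub_sig: "\<psi> \<in> formulas q \<Theta> k \<Longrightarrow> sub_sig \<Theta> \<Theta>' \<Longrightarrow> \<psi> \<in> formulas q \<Theta>' k"
  by (auto simp: formulas_def intro: fm_over_mono)

lemma finite_fm_sig: "finite_sig (fm_sig \<phi>)"
proof -
  have "finite (tm_csts t)" for t :: "'a tm" by (cases t) auto
  then have "finite (fm_csts \<phi>)" by (induction \<phi>) auto
  moreover have "finite (fm_preds \<phi>)" by (induction \<phi>) auto
  moreover have "(SIGMA n:UNIV. {P. (n, P) \<in> fm_preds \<phi>}) = fm_preds \<phi>" by auto
  ultimately show ?thesis by (simp add: finite_sig_def fm_sig_def)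
qed

lemma sen_sig_eq:
  assumes "occurs_exactly L \<phi> \<Theta>" shows "sen_sig L \<phi> = \<Theta>"
  unfolding sen_sig_def
proof (rule the_equality[where P = "occurs_exactly L \<phi>", OF assms])
  fix \<Theta>' assume "occurs_exactly L \<phi> \<Theta>'"
  with assms have "sub_sig \<Theta> \<Theta>'" "sub_sig \<Theta>' \<Theta>"
    unfolding occurs_exactly_def using sub_sig_refl by blast+
  then show "\<Theta>' = \<Theta>" using sub_sig_antisym by blast
qed

lemma (in universe) occurs_exactly_fm_sig:
  assumes sig: "is_sig (\<Theta> :: 'u signature)" and \<phi>: "\<phi> \<in> Sen (std_logic K) \<Theta>"
  shows "occurs_exactly (std_logic K) \<phi> (fm_sig \<phi>)"
proof -
  have over: "fm_over (has_eq K) (fm_sig \<phi>) \<phi>" "sub_sig (fm_sig \<phi>) \<Theta>" "fv \<phi> = {}"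
    using \<phi> fm_over_iff[of "has_eq K" \<Theta> \<phi>] by (auto simp: Sen_std formulas_def)
  have "\<phi> \<in> Sen (std_logic K) \<Theta>' \<longleftrightarrow> sub_sig (fm_sig \<phi>) \<Theta>'" for \<Theta>'
    using over fm_over_iff[of "has_eq K" \<Theta>' \<phi>] by (simp add: Sen_std formulas_def)
  then show ?thesis
    unfolding occurs_exactly_def using is_sig_sub_sig[OF sig over(2)] finite_fm_sig by simp
qed

context extension_logic
begin

lemma ex_sentence_translation:
  assumes sig: "is_sig \<Theta>" and \<psi>: "\<psi> \<in> Sen (std_logic K) \<Theta>"
  obtains \<psi>' where "\<psi>' \<in> Sen L \<Theta>" "\<And>M w. (M, w) \<in> Str L \<Theta> \<Longrightarrow> Sat L M w \<psi>' \<longleftrightarrow> Sat (std_logic K) M w \<psi>"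
proof -
  let ?\<Theta> = "fm_sig \<psi>"
  have \<psi>': "fm_over (has_eq K) ?\<Theta> \<psi>" "fv \<psi> = {}" and sub: "sub_sig ?\<Theta> \<Theta>"
    using \<psi> fm_over_iff[of "has_eq K" \<Theta> \<psi>] by (auto simp: Sen_std formulas_def)
  note sig' = is_sig_sub_sig[OF sig sub]
  have "\<forall>\<phi>\<in>Sen (std_logic K) \<Theta>. \<exists>\<chi>\<in>Sen L (sen_sig (std_logic K) \<phi>).
      \<forall>(M, w)\<in>Str L (sen_sig (std_logic K) \<phi>). Sat (std_logic K) M w \<phi> \<longleftrightarrow> Sat L M w \<chi>"
    using ext sig unfolding extends_def Let_def by blast
  from bspec[OF this \<psi>] obtain \<chi> where \<chi>: "\<chi> \<in> Sen L ?\<Theta>"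
    "\<And>M w. (M, w) \<in> Str L ?\<Theta> \<Longrightarrow> Sat (std_logic K) M w \<psi> \<longleftrightarrow> Sat L M w \<chi>"
    unfolding sen_sig_eq[OF occurs_exactly_fm_sig[OF sig \<psi>]] by blast
  have "Sat L M w \<chi> \<longleftrightarrow> Sat (std_logic K) M w \<psi>" if SM: "(M, w) \<in> Str L \<Theta>" for M w
  proof -
    note M = Str_model[OF sig SM] and w = Str_wlds[OF sig SM] and SR = Str_reduct[OF sig' sig sub SM]
    note R = Str_model[OF sig' SR]
    have "Sat L M w \<chi> \<longleftrightarrow> Sat (std_logic K) (reduct M ?\<Theta>) w \<psi>"
      using Sat_reduct[OF sig' sig sub SM \<chi>(1)] \<chi>(2)[OF SR] by simp
    also have "\<dots> \<longleftrightarrow> holds (reduct M ?\<Theta>) w (nth []) \<psi>"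
      by (rule Sat_std_iff[OF R _ \<psi>'(2)]) (simp add: w)
    also have "\<dots> \<longleftrightarrow> holds M w (nth []) \<psi>"
      using morphism_holds[OF M morphism_reduct[OF M R sub] \<psi>'(1) model_acc_refl[OF M w], of "nth []"] \<psi>'(2)
      by (simp add: comp_def)
    also have "\<dots> \<longleftrightarrow> Sat (std_logic K) M w \<psi>" by (rule Sat_std_iff[OF M w \<psi>'(2), symmetric])
    finally show ?thesis .
  qed
  then show thesis using that Sen_mono[OF sig' sig sub \<chi>(1)] by blast
qed

definition translate :: "'u signature \<Rightarrow> 'u list \<Rightarrow> 'u fm \<Rightarrow> 's" where
  "translate \<Theta> cs \<psi> = (SOME \<psi>'. \<psi>' \<in> Sen L (add_consts \<Theta> cs) \<and> (\<forall>(M, w)\<in>Str L (add_consts \<Theta> cs).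
     Sat L M w \<psi>' \<longleftrightarrow> Sat (std_logic K) M w (inst (var_names cs) \<psi>)))"

context
  fixes \<Theta> :: "'u signature" and cs :: "'u list" and \<psi>
  assumes sig: "is_sig \<Theta>" and \<psi>: "\<psi> \<in> formulas (has_eq K) \<Theta> (length cs)"
begin

lemma translate_Sen: "translate \<Theta> cs \<psi> \<in> Sen L (add_consts \<Theta> cs)"
  and Sat_translate: "(M, w) \<in> Str L (add_consts \<Theta> cs) \<Longrightarrow>
    Sat L M w (translate \<Theta> cs \<psi>) \<longleftrightarrow> Sat (std_logic K) M w (inst (var_names cs) \<psi>)"
proof -
  have "inst (var_names cs) \<psi> \<in> Sen (std_logic K) (add_consts \<Theta> cs)"
    unfolding Sen_std by (rule inst_var_names_sentence[OF \<psi>])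
  then have "\<exists>\<psi>'. \<psi>' \<in> Sen L (add_consts \<Theta> cs) \<and> (\<forall>(M, w)\<in>Str L (add_consts \<Theta> cs).
     Sat L M w \<psi>' \<longleftrightarrow> Sat (std_logic K) M w (inst (var_names cs) \<psi>))"
    by (rule ex_sentence_translation[OF is_sig_add_consts[OF sig]]) blast
  from someI_ex[OF this]
  show "translate \<Theta> cs \<psi> \<in> Sen L (add_consts \<Theta> cs)" "(M, w) \<in> Str L (add_consts \<Theta> cs) \<Longrightarrow>
    Sat L M w (translate \<Theta> cs \<psi>) \<longleftrightarrow> Sat (std_logic K) M w (inst (var_names cs) \<psi>)"
    unfolding translate_def by blast+
qed

lemma Sat_tuple_translate:
  assumes SM: "(M, w) \<in> Str L \<Theta>" and names: "name_tuple M w cs as"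
  shows "Sat_tuple M w cs as (translate \<Theta> cs \<psi>) \<longleftrightarrow> holds M w (nth as) \<psi>"
  using Sat_translate[OF Str_cone_exp_point[OF sig SM names]]
    Sat_std_inst_var_names[OF Str_model[OF sig SM] Str_wlds[OF sig SM] names \<psi>] by simp

end

lemma Sat_translate_sentence:
  assumes "is_sig \<Theta>" "(M, w) \<in> Str L \<Theta>" "\<psi> \<in> formulas (has_eq K) \<Theta> 0"
  shows "Sat L M w (translate \<Theta> [] \<psi>) \<longleftrightarrow> holds M w (nth []) \<psi>"
  using Sat_tuple_translate[OF assms(1) _ assms(2) name_tuple_Nil, of \<psi>]
    translate_Sen[OF assms(1), of \<psi> "[]"]
    Sat_cone[OF assms(1,2), of "translate \<Theta> [] \<psi>"] assms(3) by simp

end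

definition fm_entails_above :: "'u kmodel \<Rightarrow> 'u \<Rightarrow> nat \<Rightarrow> 'u fm \<Rightarrow> 'u fm \<Rightarrow> bool" where
  "fm_entails_above M w k \<phi> \<psi> \<longleftrightarrow> (\<forall>v as. (w, v) \<in> acc M \<longrightarrow> length as = k \<longrightarrow> set as \<subseteq> dmn M v \<longrightarrow>
     holds M v (nth as) \<phi> \<longrightarrow> holds M v (nth as) \<psi>)"

context extension_logic
begin

lemma entails_above_translate:
  assumes sig: "is_sig \<Theta>" and SM: "(M, w) \<in> Str L \<Theta>" and cs: "distinct cs" "set cs \<inter> csts \<Theta> = {}"
    and formulas: "\<phi> \<in> formulas (has_eq K) \<Theta> (length cs)" "\<psi> \<in> formulas (has_eq K) \<Theta> (length cs)"
  shows "entails_above M w cs (translate \<Theta> cs \<phi>) (translate \<Theta> cs \<psi>) \<longleftrightarrow> fm_entails_above M w (length cs) \<phi> \<psi>"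
proof -
  have "name_tuple M v cs as \<longleftrightarrow> length as = length cs \<and> set as \<subseteq> dmn M v" for v as
    using cs model_sgn[OF Str_model[OF sig SM]] by (auto simp: name_tuple_def)
  then show ?thesis
    unfolding entails_above_def fm_entails_above_def
    using Sat_tuple_translate[OF sig formulas(1) Str_above[OF sig SM]]
      Sat_tuple_translate[OF sig formulas(2) Str_above[OF sig SM]] by auto
qed

lemma elementary_Sat_tuple:
  assumes "is_model \<Theta> M" "is_model \<Theta> N" and "elementary_submodel L M N" "w \<in> wlds M"
    and "name_tuple M w cs as" "\<phi> \<in> Sen L (add_consts \<Theta> cs)"
  shows "Sat_tuple M w cs as \<phi> \<longleftrightarrow> Sat_tuple N w cs as \<phi>"
proof -
  have "Th L (cone_exp M w cs as) w = Th L (cone_exp N w cs as) w"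
    using assms(3-5) by (auto simp: elementary_submodel_def Tp_def)
  then show ?thesis
    using assms(6) model_sgn[OF assms(1)] model_sgn[OF assms(2)] by (auto simp: Th_def)
qed

lemma elementary_holds:
  assumes sig: "is_sig \<Theta>" and SM: "(M, w) \<in> Str L \<Theta>" and SN: "(N, w) \<in> Str L \<Theta>"
    and elementary: "elementary_submodel L M N" and \<alpha>: "set \<alpha> \<subseteq> dmn M w"
    and \<psi>: "\<psi> \<in> formulas (has_eq K) \<Theta> (length \<alpha>)"
  shows "holds M w (nth \<alpha>) \<psi> \<longleftrightarrow> holds N w (nth \<alpha>) \<psi>"
proof -
  note M = Str_model[OF sig SM] and N = Str_model[OF sig SN] and w = Str_wlds[OF sig SM]
  let ?cs = "map (fresh_consts \<Theta>) [0..<length \<alpha>]"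
  have "set \<alpha> \<subseteq> dmn N w" using \<alpha> elementary w unfolding elementary_submodel_def submodel_def by blast
  then have names: "name_tuple M w ?cs \<alpha>" "name_tuple N w ?cs \<alpha>"
    using fresh_consts_fresh[OF sig] \<alpha> model_sgn[OF M] model_sgn[OF N]
    by (auto intro!: name_tuple_map_consts)
  have \<psi>': "\<psi> \<in> formulas (has_eq K) \<Theta> (length ?cs)" using \<psi> by simp
  show ?thesis
    using elementary_Sat_tuple[OF M N elementary w names(1) translate_Sen[OF sig \<psi>']]
      Sat_tuple_translate[OF sig \<psi>' SM names(1)] Sat_tuple_translate[OF sig \<psi>' SN names(2)] by simp
qed

end


section \<open>Trees\<close>

definition tree_rooted :: "'u kmodel \<Rightarrow> 'u \<Rightarrow> bool" where
  "tree_rooted M r \<longleftrightarrow> r \<in> wlds M \<and> (\<forall>v\<in>wlds M. (r, v) \<in> acc M) \<and>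
     (\<exists>par (d :: 'u \<Rightarrow> nat). \<forall>v\<in>wlds M. v \<noteq> r \<longrightarrow> par v \<in> wlds M \<and> d (par v) < d v \<and> (par v, v) \<in> acc M \<and>
        (\<forall>u. (u, v) \<in> acc M \<longrightarrow> u = v \<or> (u, par v) \<in> acc M))"

lemma
  assumes "tree_rooted M r"
  shows tree_root: "r \<in> wlds M" and tree_root_least: "v \<in> wlds M \<Longrightarrow> (r, v) \<in> acc M"
  using assms by (simp_all add: tree_rooted_def)

lemma tree_parentE:
  assumes "tree_rooted M r"
  obtains par and d :: "'u \<Rightarrow> nat" where "\<And>v. v \<in> wlds M \<Longrightarrow> v \<noteq> r \<Longrightarrow> par v \<in> wlds M"
    "\<And>v. v \<in> wlds M \<Longrightarrow> v \<noteq> r \<Longrightarrow> d (par v) < d v"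
    "\<And>v. v \<in> wlds M \<Longrightarrow> v \<noteq> r \<Longrightarrow> (par v, v) \<in> acc M"
    "\<And>u v. v \<in> wlds M \<Longrightarrow> v \<noteq> r \<Longrightarrow> (u, v) \<in> acc M \<Longrightarrow> u = v \<or> (u, par v) \<in> acc M"
  using assms unfolding tree_rooted_def by blast

text \<open>Without equality, no sentence can force two names of an element to have the same value. A tree
  can then only be embedded if it is injective with distinct constants.\<close>

definition proper_tree :: "bool \<Rightarrow> 'u kmodel \<Rightarrow> 'u \<Rightarrow> bool" where
  "proper_tree q M r \<longleftrightarrow> tree_rooted M r \<and> (\<not> q \<longrightarrow> inj_model M \<and> inj_on (cint M r) (csts (sgn M)))"

lemma proper_tree_reduct: "proper_tree q M r \<Longrightarrow> sub_sig \<Theta> (sgn M) \<Longrightarrow> proper_tree q (reduct M \<Theta>) r"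
  by (auto simp: proper_tree_def tree_rooted_def inj_model_def sub_sig_def inj_on_def subset_iff)

lemma tree_rooted_iso:
  assumes N: "is_model \<Theta> N" and iso: "model_iso g h M N" and tree: "tree_rooted M r"
  shows "tree_rooted N (h r)"
proof -
  obtain par and d :: "_ \<Rightarrow> nat" where par: "\<And>v. v \<in> wlds M \<Longrightarrow> v \<noteq> r \<Longrightarrow> par v \<in> wlds M"
    "\<And>v. v \<in> wlds M \<Longrightarrow> v \<noteq> r \<Longrightarrow> d (par v) < d v" "\<And>v. v \<in> wlds M \<Longrightarrow> v \<noteq> r \<Longrightarrow> (par v, v) \<in> acc M"
    "\<And>u v. v \<in> wlds M \<Longrightarrow> v \<noteq> r \<Longrightarrow> (u, v) \<in> acc M \<Longrightarrow> u = v \<or> (u, par v) \<in> acc M"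
    using tree by (rule tree_parentE) blast
  define h' where "h' = the_inv_into (wlds M) h"
  have h': "h' (h v) = v" if "v \<in> wlds M" for v
    using that iso_wlds[OF iso] by (simp add: h'_def bij_betw_def the_inv_into_f_f)
  have onto: "\<exists>v0\<in>wlds M. v = h v0" if "v \<in> wlds N" for v
    using that iso_wlds[OF iso] by (auto simp: bij_betw_def)
  have into: "h v \<in> wlds N" if "v \<in> wlds M" for v
    using that iso_wlds[OF iso] by (auto simp: bij_betw_def)
  show ?thesis
    unfolding tree_rooted_def
  proof (intro conjI ballI exI impI allI)
    show "h r \<in> wlds N" using into tree_root[OF tree] .
    show "(h r, v) \<in> acc N" if "v \<in> wlds N" for v
      using onto[OF that] tree_root_least[OF tree] iso_acc[OF iso tree_root[OF tree]] by blast
    fix v assume "v \<in> wlds N" "v \<noteq> h r"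
    then obtain v0 where v0: "v0 \<in> wlds M" "v = h v0" "v0 \<noteq> r" using onto by blast
    note par = par[OF v0(1,3)]
    show "h (par (h' v)) \<in> wlds N" "d (h' (h (par (h' v)))) < d (h' v)" "(h (par (h' v)), v) \<in> acc N"
      using v0 par(1-3) into iso_acc[OF iso] by (simp_all add: h')
    fix u assume "(u, v) \<in> acc N"
    moreover from this obtain u0 where u0: "u0 \<in> wlds M" "u = h u0"
      using onto model_acc_wlds[OF N] by blast
    ultimately have "u0 = v0 \<or> (u0, par v0) \<in> acc M" using v0 iso_acc[OF iso] par(4) by blast
    then show "u = v \<or> (u, h (par (h' v))) \<in> acc N" using u0 v0 par(1) iso_acc[OF iso] by (auto simp: h')
  qed
qed

lemma inj_model_iso:
  assumes M: "is_model \<Theta> M" and N: "is_model \<Theta> N" and iso: "model_iso g h M N" and "inj_model M"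
  shows "inj_model N"
  unfolding inj_model_def
proof (intro ballI, clarify, rule inj_onI)
  fix v u x y assume vu: "(v, u) \<in> acc N" and "x \<in> dmn N v" "y \<in> dmn N v"
    and eq: "hom N v u x = hom N v u y"
  obtain v0 u0 where 0: "v0 \<in> wlds M" "v = h v0" "u0 \<in> wlds M" "u = h u0"
    using model_acc_wlds[OF N vu] iso_wlds[OF iso] by (metis bij_betw_imp_surj_on imageE)
  have vu0: "(v0, u0) \<in> acc M" using vu 0 iso_acc[OF iso] by blast
  obtain x0 y0 where xy: "x0 \<in> dmn M v0" "x = g x0" "y0 \<in> dmn M v0" "y = g y0"
    using \<open>x \<in> dmn N v\<close> \<open>y \<in> dmn N v\<close> iso_dmn[OF iso 0(1)] 0(2) by (metis bij_betw_imp_surj_on imageE)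
  have "g (hom M v0 u0 x0) = g (hom M v0 u0 y0)" using iso_hom[OF iso vu0] xy eq 0 by simp
  then have "hom M v0 u0 x0 = hom M v0 u0 y0"
    using iso_dmn[OF iso 0(3)] model_hom[OF M vu0] xy by (meson bij_betw_imp_inj_on inj_onD)
  then show "x = y" using \<open>inj_model M\<close> vu0 xy by (auto simp: inj_model_def dest: inj_onD)
qed

lemma proper_tree_iso:
  assumes M: "is_model \<Theta> M" and N: "is_model \<Theta> N" and iso: "model_iso g h M N" and tree: "proper_tree q M r"
  shows "proper_tree q N (h r)"
proof -
  have r: "r \<in> wlds M" using tree by (simp add: proper_tree_def tree_root)
  have "inj_on g (dmn M r)" using iso_dmn[OF iso r] by (rule bij_betw_imp_inj_on)
  then have "inj_on (cint N (h r)) (csts (sgn N))" if "inj_on (cint M r) (csts (sgn M))"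
    using that iso_cint[OF iso r] model_cint[OF M r] model_sgn[OF M] model_sgn[OF N]
    by (auto simp: inj_on_def)
  then show ?thesis
    using tree tree_rooted_iso[OF N iso] inj_model_iso[OF M N iso] by (auto simp: proper_tree_def)
qed


subsection \<open>Unravelling\<close>

locale unravelling = universe \<U> for \<U> :: "'u set" +
  fixes \<Theta> :: "'u signature" and N :: "'u kmodel" and r :: 'u
  assumes N: "is_model \<Theta> N" and r: "r \<in> wlds N"
begin

definition paths :: "'u list set" where
  "paths = {xs. sorted_wrt (\<lambda>u v. (u, v) \<in> acc N) (r # xs)}"

definition endpoint :: "'u list \<Rightarrow> 'u" where
  "endpoint xs = last (r # xs)"

definition node :: "'u list \<Rightarrow> 'u" where
  "node = code paths"

definition path :: "'u \<Rightarrow> 'u list" where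
  "path = the_inv_into paths node"

definition prefix_order :: "('u \<times> 'u) set" where
  "prefix_order = {(node xs, node (xs @ zs)) | xs zs. xs @ zs \<in> paths}"

definition tree :: "'u kmodel" where
  "tree = pullback N (node ` paths) prefix_order (\<lambda>x. (\<lambda>a. pairing (x, a)) ` dmn N (endpoint (path x)))
     (endpoint \<circ> path) (\<lambda>b. snd (unpair b)) (\<lambda>x c. pairing (x, cint N (endpoint (path x)) c))
     (\<lambda>x y b. pairing (y, hom N (endpoint (path x)) (endpoint (path y)) (snd (unpair b))))"

lemma tiny_paths: "tiny paths"
proof -
  have "paths \<subseteq> lists (wlds N)"
    using model_acc_wlds[OF N] by (auto simp: paths_def in_lists_conv_set)
  then show ?thesis
    using tiny_subset[OF tiny_lists] model_small_wlds[OF N] by (simp add: small_iff_tiny)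
qed

lemma path_node [simp]: "xs \<in> paths \<Longrightarrow> path (node xs) = xs"
  unfolding path_def node_def by (rule the_inv_into_f_f[OF inj_on_code[OF tiny_paths]])

lemma node_eq_iff: "xs \<in> paths \<Longrightarrow> ys \<in> paths \<Longrightarrow> node xs = node ys \<longleftrightarrow> xs = ys"
  using path_node by metis

lemma Nil_paths [simp]: "[] \<in> paths"
  by (simp add: paths_def)

lemma endpoint_Nil [simp]: "endpoint [] = r"
  by (simp add: endpoint_def)

lemma endpoint_snoc [simp]: "endpoint (xs @ [t]) = t"
  by (simp add: endpoint_def)

lemma paths_appendD: "xs @ zs \<in> paths \<Longrightarrow> xs \<in> paths"
  by (auto simp: paths_def sorted_wrt_append)

lemma acc_endpoint:
  assumes xs: "xs \<in> paths" and x: "x \<in> set (r # xs)"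
  shows "(x, endpoint xs) \<in> acc N"
proof (cases xs rule: rev_cases)
  case Nil
  then show ?thesis using x model_acc_refl[OF N r] by simp
next
  case (snoc ys y)
  then have "(z, y) \<in> acc N" if "z \<in> set (r # ys)" for z
    using that xs by (auto simp: paths_def sorted_wrt_append)
  moreover from this have "(y, y) \<in> acc N"
    using model_acc_refl[OF N] model_acc_wlds[OF N] by (meson list.set_intros(1))
  ultimately show ?thesis using x snoc by auto
qed

lemma acc_endpoint_append:
  assumes "xs @ zs \<in> paths" shows "(endpoint xs, endpoint (xs @ zs)) \<in> acc N"
proof (rule acc_endpoint[OF assms])
  have "endpoint xs \<in> set (r # xs)" unfolding endpoint_def by (rule last_in_set) simp
  then show "endpoint xs \<in> set (r # xs @ zs)" by auto
qed

lemma paths_snoc: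
  assumes xs: "xs \<in> paths" and t: "(endpoint xs, t) \<in> acc N"
  shows "xs @ [t] \<in> paths"
proof -
  have "(x, t) \<in> acc N" if "x \<in> set (r # xs)" for x
    using model_acc_trans[OF N acc_endpoint[OF xs that] t] .
  then show ?thesis using xs by (simp add: paths_def sorted_wrt_append)
qed

lemma endpoint_wlds: "xs \<in> paths \<Longrightarrow> endpoint xs \<in> wlds N"
  using acc_endpoint[of xs r] model_acc_wlds[OF N] by auto

lemma prefix_orderE:
  assumes "(x, y) \<in> prefix_order"
  obtains xs zs where "x = node xs" "y = node (xs @ zs)" "xs \<in> paths" "xs @ zs \<in> paths"
  using assms paths_appendD unfolding prefix_order_def by blast

lemma prefix_order_iff:
  assumes xs: "xs \<in> paths" and ys: "ys \<in> paths"
  shows "(node xs, node ys) \<in> prefix_order \<longleftrightarrow> (\<exists>zs. ys = xs @ zs)"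
proof
  assume "(node xs, node ys) \<in> prefix_order"
  then show "\<exists>zs. ys = xs @ zs"
  proof (rule prefix_orderE)
    fix xs' zs assume "node xs = node xs'" "node ys = node (xs' @ zs)" "xs' \<in> paths" "xs' @ zs \<in> paths"
    then show ?thesis using xs ys by (simp add: node_eq_iff)
  qed
qed (use ys in \<open>auto simp: prefix_order_def\<close>)

lemma acc_prefix_order:
  assumes "(x, y) \<in> prefix_order"
  shows "(endpoint (path x), endpoint (path y)) \<in> acc N"
  using assms acc_endpoint_append by (auto elim: prefix_orderE)

lemma partial_order_prefix_order: "partial_order_on (node ` paths) prefix_order"
  unfolding partial_order_on_def preorder_on_def
proof (intro conjI transI antisymI)
  show "refl_on (node ` paths) prefix_order" "prefix_order \<subseteq> node ` paths \<times> node ` paths"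
    using prefix_order_iff by (auto simp: refl_on_def elim!: prefix_orderE)
  fix x y assume xy: "(x, y) \<in> prefix_order"
  show "(x, z) \<in> prefix_order" if yz: "(y, z) \<in> prefix_order" for z
    using xy
  proof (rule prefix_orderE)
    fix xs zs assume "x = node xs" "y = node (xs @ zs)" "xs \<in> paths" "xs @ zs \<in> paths"
    then show ?thesis using yz prefix_order_iff by (auto elim!: prefix_orderE simp: node_eq_iff)
  qed
  show "x = y" if yx: "(y, x) \<in> prefix_order"
    using xy
  proof (rule prefix_orderE)
    fix xs zs assume "x = node xs" "y = node (xs @ zs)" "xs \<in> paths" "xs @ zs \<in> paths"
    then show ?thesis using yx prefix_order_iff by (auto elim!: prefix_orderE simp: node_eq_iff)
  qed
qed

lemma is_model_tree: "is_model \<Theta> tree"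
  unfolding tree_def
proof (rule is_model_pullback[OF N _ _ partial_order_prefix_order])
  show "node ` paths \<noteq> {}" using Nil_paths by blast
  show "small (node ` paths)" unfolding small_iff_tiny by (rule tiny_image[OF tiny_paths])
  fix x y assume "(x, y) \<in> prefix_order"
  then show "((endpoint \<circ> path) x, (endpoint \<circ> path) y) \<in> acc N" using acc_prefix_order by simp
qed (auto simp: small_iff_tiny model_dmn_nonempty[OF N] endpoint_wlds acc_prefix_order model_cint[OF N]
    model_hom[OF N] model_hom_id[OF N] model_hom_comp[OF N] model_cint_hom[OF N]
    model_small_dmn[OF N, unfolded small_iff_tiny] intro!: tiny_image)

lemma morphism_tree: "bounded_morphism q \<Theta> (endpoint \<circ> path) (\<lambda>b. snd (unpair b)) tree w N"
  using is_model_tree unfolding tree_def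
proof (rule morphism_pullback[OF N])
  fix x t assume "x \<in> node ` paths" "((endpoint \<circ> path) x, t) \<in> acc N"
  then obtain xs where xs: "xs \<in> paths" "x = node xs" "(endpoint xs, t) \<in> acc N" by auto
  then have "xs @ [t] \<in> paths" by (intro paths_snoc)
  then show "\<exists>y. (x, y) \<in> prefix_order \<and> (endpoint \<circ> path) y = t"
    using xs prefix_order_iff by (intro exI[of _ "node (xs @ [t])"]) auto
qed (auto simp: acc_prefix_order inj_on_def image_image)

lemma tree_simps:
  "wlds tree = node ` paths" "acc tree = prefix_order"
  "x \<in> node ` paths \<Longrightarrow> dmn tree x = (\<lambda>a. pairing (x, a)) ` dmn N (endpoint (path x))"
  "(x, y) \<in> prefix_order \<Longrightarrow> a \<in> dmn N (endpoint (path x)) \<Longrightarrow>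
    hom tree x y (pairing (x, a)) = pairing (y, hom N (endpoint (path x)) (endpoint (path y)) a)"
  by (auto simp: tree_def pullback_def)

lemma tree_rooted_tree: "tree_rooted tree (node [])"
  unfolding tree_rooted_def tree_simps(1,2)
proof (intro conjI ballI exI impI allI)
  show "node [] \<in> node ` paths" by simp
  show "(node [], x) \<in> prefix_order" if "x \<in> node ` paths" for x
    using that prefix_order_iff by auto
  let ?par = "\<lambda>x. node (butlast (path x))" and ?d = "\<lambda>x. length (path x)"
  fix x assume "x \<in> node ` paths" "x \<noteq> node []"
  then obtain xs where xs: "xs \<in> paths" "x = node xs" "xs \<noteq> []" by auto
  then have par: "butlast xs \<in> paths" using paths_appendD[of "butlast xs" "[last xs]"] by simp
  show "?par x \<in> node ` paths" "?d (?par x) < ?d x" using xs par by simp_all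
  show "(?par x, x) \<in> prefix_order"
    using xs par prefix_order_iff append_butlast_last_id[OF xs(3)] by (metis path_node)
  fix u assume "(u, x) \<in> prefix_order"
  then obtain us zs where us: "us \<in> paths" "u = node us" "xs = us @ zs"
    using xs by (auto elim!: prefix_orderE simp: node_eq_iff)
  show "u = x \<or> (u, ?par x) \<in> prefix_order"
  proof (cases zs rule: rev_cases)
    case (snoc zs' z)
    then show ?thesis using us xs par prefix_order_iff[OF us(1) par] by (simp add: butlast_append)
  qed (use us xs in simp)
qed

lemma inj_model_tree: "inj_model N \<Longrightarrow> inj_model tree"
  unfolding inj_model_def tree_simps(2)
proof (intro ballI, clarify)
  fix x y assume "\<forall>(w, v)\<in>acc N. inj_on (hom N w v) (dmn N w)" and xy: "(x, y) \<in> prefix_order"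
  then have "inj_on (hom N (endpoint (path x)) (endpoint (path y))) (dmn N (endpoint (path x)))"
    using acc_prefix_order by blast
  moreover have "x \<in> node ` paths" using xy by (auto elim: prefix_orderE)
  ultimately show "inj_on (hom tree x y) (dmn tree x)"
    using xy by (auto simp: tree_simps inj_on_def)
qed

lemma surj_model_tree: "surj_model N \<Longrightarrow> surj_model tree"
  unfolding surj_model_def tree_simps(2)
proof (intro ballI, clarify)
  fix x y assume surj: "\<forall>(w, v)\<in>acc N. hom N w v ` dmn N w = dmn N v" and xy: "(x, y) \<in> prefix_order"
  have "x \<in> node ` paths" "y \<in> node ` paths" using xy by (auto elim: prefix_orderE)
  then have "hom tree x y ` dmn tree x =
      (\<lambda>a. pairing (y, a)) ` hom N (endpoint (path x)) (endpoint (path y)) ` dmn N (endpoint (path x))"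
    using xy by (simp add: tree_simps image_image)
  also have "\<dots> = dmn tree y"
    using surj acc_prefix_order[OF xy] \<open>y \<in> node ` paths\<close> by (fastforce simp: tree_simps)
  finally show "hom tree x y ` dmn tree x = dmn tree y" .
qed

lemma in_class_tree: "in_class K N \<Longrightarrow> in_class K tree"
  using inj_model_tree surj_model_tree by (cases K) auto

end


subsection \<open>Relabelling\<close>

definition home :: "'u kmodel \<Rightarrow> 'u \<Rightarrow> 'u" where
  "home M a = (THE v. a \<in> dmn M v)"

lemma home_eq: "is_model \<Theta> M \<Longrightarrow> a \<in> dmn M v \<Longrightarrow> home M a = v"
  unfolding home_def by (rule the_equality) (auto dest: model_dmn_disjoint)

text \<open>Each element is replaced by copies of it, one for every way to name it: as the image of an element
  further down, or by a constant. If \<open>cd\<close>, only elements at the root \<open>r\<close> are used as names, which makes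
  the homomorphisms bijective.\<close>

locale relabelling = universe \<U> for \<U> :: "'u set" +
  fixes \<Theta> :: "'u signature" and N :: "'u kmodel" and r :: 'u and cd :: bool
  assumes sig: "is_sig \<Theta>" and N: "is_model \<Theta> N" and least: "\<And>v. v \<in> wlds N \<Longrightarrow> (r, v) \<in> acc N"
    and surj: "cd \<Longrightarrow> surj_model N"
begin

definition labels :: "('u + 'u) set" where
  "labels = Inl ` elems N \<union> Inr ` csts \<Theta>"

definition fibre :: "'u \<Rightarrow> ('u + 'u) set" where
  "fibre v = Inl ` (\<Union>u\<in>{u. (u, v) \<in> acc N \<and> (cd \<longrightarrow> u = r)}. dmn N u) \<union> Inr ` csts \<Theta>"

definition label_value :: "'u \<Rightarrow> 'u + 'u \<Rightarrow> 'u" where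
  "label_value v = case_sum (\<lambda>a. hom N (home N a) v a) (cint N v)"

definition labelled :: "'u \<Rightarrow> 'u + 'u \<Rightarrow> 'u" where
  "labelled v l = pairing (v, code labels l)"

definition underlying :: "'u \<Rightarrow> 'u" where
  "underlying b = label_value (fst (unpair b)) (the_inv_into labels (code labels) (snd (unpair b)))"

definition relabelled :: "'u kmodel" where
  "relabelled = pullback N (wlds N) (acc N) (\<lambda>v. labelled v ` fibre v) id underlying
     (\<lambda>v c. labelled v (Inr c)) (\<lambda>v u b. pairing (u, snd (unpair b)))"

lemma tiny_labels: "tiny labels"
  using sig small_elems[OF N] unfolding labels_def is_sig_def small_iff_tiny
  by (intro tiny_Un tiny_image) auto

lemma fibre_subset: "fibre v \<subseteq> labels"
  using model_acc_wlds[OF N] by (auto simp: fibre_def labels_def elems_def)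

lemma labelled_inject: "l \<in> fibre v \<Longrightarrow> l' \<in> fibre u \<Longrightarrow> labelled v l = labelled u l' \<longleftrightarrow> v = u \<and> l = l'"
  unfolding labelled_def using inj_on_eq_iff[OF inj_on_code[OF tiny_labels]] fibre_subset
  by (auto simp: subset_iff)

lemma underlying_labelled [simp]: "l \<in> fibre v \<Longrightarrow> underlying (labelled v l) = label_value v l"
  using the_inv_into_f_f[OF inj_on_code[OF tiny_labels] subsetD[OF fibre_subset]]
  by (simp add: underlying_def labelled_def)

lemma hom_labelled: "pairing (u, snd (unpair (labelled v l))) = labelled u l"
  by (simp add: labelled_def)

lemma Inr_fibre: "c \<in> csts \<Theta> \<Longrightarrow> Inr c \<in> fibre v"
  by (simp add: fibre_def)

lemma Inl_fibreI: "(u, v) \<in> acc N \<Longrightarrow> cd \<longrightarrow> u = r \<Longrightarrow> a \<in> dmn N u \<Longrightarrow> Inl a \<in> fibre v"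
  by (auto simp: fibre_def)

lemma fibre_mono: "(v, u) \<in> acc N \<Longrightarrow> fibre v \<subseteq> fibre u"
  unfolding fibre_def using model_acc_trans[OF N] by blast

lemma fibre_constant: "cd \<Longrightarrow> (v, u) \<in> acc N \<Longrightarrow> fibre v = fibre u"
  unfolding fibre_def using least model_acc_wlds[OF N] by blast

lemma label_value_dmn:
  assumes v: "v \<in> wlds N"
  shows "label_value v ` fibre v = dmn N v"
proof
  show "label_value v ` fibre v \<subseteq> dmn N v"
    using model_hom[OF N] model_cint[OF N v] by (auto simp: fibre_def label_value_def home_eq[OF N])
  show "dmn N v \<subseteq> label_value v ` fibre v"
  proof
    fix x assume x: "x \<in> dmn N v"
    obtain u a where "(u, v) \<in> acc N" "cd \<longrightarrow> u = r" "a \<in> dmn N u" "hom N u v a = x"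
    proof (cases cd)
      case True
      then have "hom N r v ` dmn N r = dmn N v" using surj least[OF v] unfolding surj_model_def by blast
      then show ?thesis using x least[OF v] that by (metis imageE)
    next
      case False
      then show ?thesis using that[of v x] x model_acc_refl[OF N v] model_hom_id[OF N x] by simp
    qed
    then show "x \<in> label_value v ` fibre v"
      using Inl_fibreI by (intro image_eqI[of _ _ "Inl a"]) (auto simp: label_value_def home_eq[OF N])
  qed
qed

lemma label_value_hom:
  assumes "(v, u) \<in> acc N" "l \<in> fibre v"
  shows "label_value u l = hom N v u (label_value v l)"
  using assms model_hom_comp[OF N] model_cint_hom[OF N]
  by (auto simp: fibre_def label_value_def home_eq[OF N])

lemma is_model_relabelled: "is_model \<Theta> relabelled"
  unfolding relabelled_def
proof (rule is_model_pullback[OF N model_wlds_nonempty[OF N] model_small_wlds[OF N] model_partial_order[OF N]])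
  show "labelled v ` fibre v \<noteq> {} \<and> small (labelled v ` fibre v)" if "v \<in> wlds N" for v
    using label_value_dmn[OF that] model_dmn_nonempty[OF N that] tiny_subset[OF tiny_labels fibre_subset]
    by (auto simp: small_iff_tiny intro!: tiny_image)
  show "underlying (pairing (u, snd (unpair b))) = hom N (id v) (id u) (underlying b)"
    if vu: "(v, u) \<in> acc N" and b: "b \<in> labelled v ` fibre v" for v u b
    using b label_value_hom[OF vu] fibre_mono[OF vu] by (auto simp: hom_labelled subset_iff)
qed (use subsetD[OF fibre_mono] in \<open>auto simp: hom_labelled labelled_inject Inr_fibre\<close>)

lemma morphism_relabelled: "bounded_morphism False \<Theta> id underlying relabelled r N"
  using is_model_relabelled unfolding relabelled_def
proof (rule morphism_pullback[OF N])
  show "underlying ` labelled v ` fibre v = dmn N (id v)" if "v \<in> wlds N" for v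
    using label_value_dmn[OF that] by (simp add: image_image)
  show "underlying (pairing (u, snd (unpair b))) = hom N (id v) (id u) (underlying b)"
    if vu: "(v, u) \<in> acc N" and b: "b \<in> labelled v ` fibre v" for v u b
    using b label_value_hom[OF vu] fibre_mono[OF vu] by (auto simp: hom_labelled subset_iff)
qed (simp_all add: Inr_fibre label_value_def)

lemma relabelled_simps:
  "wlds relabelled = wlds N" "acc relabelled = acc N"
  "v \<in> wlds N \<Longrightarrow> dmn relabelled v = labelled v ` fibre v"
  "(v, u) \<in> acc N \<Longrightarrow> l \<in> fibre v \<Longrightarrow> hom relabelled v u (labelled v l) = labelled u l"
  "v \<in> wlds N \<Longrightarrow> c \<in> csts \<Theta> \<Longrightarrow> cint relabelled v c = labelled v (Inr c)"
  using model_sgn[OF N] by (auto simp: relabelled_def pullback_def hom_labelled)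

lemma inj_model_relabelled: "inj_model relabelled"
  unfolding inj_model_def relabelled_simps(2)
proof (intro ballI, clarify)
  fix v u assume vu: "(v, u) \<in> acc N"
  then show "inj_on (hom relabelled v u) (dmn relabelled v)"
    using model_acc_wlds[OF N vu] fibre_mono[OF vu]
    by (auto intro!: inj_onI simp: relabelled_simps labelled_inject subset_iff)
qed

lemma surj_model_relabelled: "cd \<Longrightarrow> surj_model relabelled"
  unfolding surj_model_def relabelled_simps(2)
proof (intro ballI, clarify)
  fix v u assume cd and vu: "(v, u) \<in> acc N"
  have "hom relabelled v u ` dmn relabelled v = labelled u ` fibre v"
    using model_acc_wlds[OF N vu] vu by (simp add: relabelled_simps image_image cong: image_cong_simp)
  then show "hom relabelled v u ` dmn relabelled v = dmn relabelled u"
    using fibre_constant[OF \<open>cd\<close> vu] model_acc_wlds[OF N vu] by (simp add: relabelled_simps)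
qed

lemma inj_on_cint_relabelled: "v \<in> wlds N \<Longrightarrow> inj_on (cint relabelled v) (csts \<Theta>)"
  using labelled_inject[OF Inr_fibre Inr_fibre] by (auto intro!: inj_onI simp: relabelled_simps)

lemma tree_rooted_relabelled: "tree_rooted relabelled v \<longleftrightarrow> tree_rooted N v"
  by (simp add: tree_rooted_def relabelled_simps)

end


context extension_logic
begin

lemma ex_rooted_tree:
  assumes sig: "is_sig \<Theta>" and SN: "(N, w) \<in> Str L \<Theta>"
  obtains T r where "(T, r) \<in> Str L \<Theta>" "tree_rooted T r"
    "\<And>\<phi>. \<phi> \<in> Sen L \<Theta> \<Longrightarrow> Sat L T r \<phi> \<longleftrightarrow> Sat L N w \<phi>"
proof -
  interpret unravelling \<U> \<Theta> N w
    by unfold_locales (rule Str_model[OF sig SN], rule Str_wlds[OF sig SN])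
  have T: "(tree, node []) \<in> Str L \<Theta>"
    using is_model_tree tree_root[OF tree_rooted_tree] in_class_tree[OF Str_in_class[OF sig SN]]
    by (simp add: Str_iff[OF sig])
  have "(N, (endpoint \<circ> path) (node [])) \<in> Str L \<Theta>" using SN by simp
  from Sat_morphism[OF sig T this morphism_tree] show thesis
    using that[OF T tree_rooted_tree] by simp
qed

lemma ex_proper_tree:
  assumes sig: "is_sig \<Theta>" and SN: "(N, w) \<in> Str L \<Theta>"
  obtains T r where "(T, r) \<in> Str L \<Theta>" "proper_tree (has_eq K) T r"
    "\<And>\<phi>. \<phi> \<in> Sen L \<Theta> \<Longrightarrow> Sat L T r \<phi> \<longleftrightarrow> Sat L N w \<phi>"
proof -
  obtain T r where T: "(T, r) \<in> Str L \<Theta>" "tree_rooted T r"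
      and Sat_T: "\<And>\<phi>. \<phi> \<in> Sen L \<Theta> \<Longrightarrow> Sat L T r \<phi> \<longleftrightarrow> Sat L N w \<phi>"
    using ex_rooted_tree[OF assms] by blast
  show thesis
  proof (cases "has_eq K")
    case True
    then show ?thesis using that[OF T(1) _ Sat_T] T(2) by (simp add: proper_tree_def)
  next
    case False
    interpret relabelling \<U> \<Theta> T r "K = CD"
      using sig Str_model[OF sig T(1)] tree_root_least[OF T(2)] Str_in_class[OF sig T(1)]
      by unfold_locales auto
    have "in_class K relabelled" using False surj_model_relabelled by (cases K) auto
    then have S: "(relabelled, r) \<in> Str L \<Theta>"
      using is_model_relabelled tree_root[OF T(2)] by (simp add: Str_iff[OF sig] relabelled_simps)
    have "proper_tree (has_eq K) relabelled r"
      using T(2) inj_model_relabelled inj_on_cint_relabelled[OF tree_root[OF T(2)]]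
        model_sgn[OF is_model_relabelled]
      by (simp add: proper_tree_def tree_rooted_relabelled)
    moreover have "Sat L relabelled r \<phi> \<longleftrightarrow> Sat L N w \<phi>" if "\<phi> \<in> Sen L \<Theta>" for \<phi>
      using Sat_morphism[OF sig S, of T id] T(1) morphism_relabelled False that Sat_T by simp
    ultimately show ?thesis by (rule that[OF S])
  qed
qed

end


section \<open>Embedding trees\<close>

definition embedding :: "'u signature \<Rightarrow> ('u \<Rightarrow> 'u) \<Rightarrow> ('u \<Rightarrow> 'u) \<Rightarrow> 'u kmodel \<Rightarrow> 'u kmodel \<Rightarrow> bool" where
  "embedding \<Theta> f g M N \<longleftrightarrow>
     (\<forall>v\<in>wlds M. f v \<in> wlds N) \<and> (\<forall>v\<in>wlds M. \<forall>u\<in>wlds M. (f v, f u) \<in> acc N \<longleftrightarrow> (v, u) \<in> acc M) \<and>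
     (\<forall>v. \<forall>a\<in>dmn M v. g a \<in> dmn N (f v)) \<and> inj_on g (elems M) \<and>
     (\<forall>v u. (v, u) \<in> acc M \<longrightarrow> (\<forall>a\<in>dmn M v. g (hom M v u a) = hom N (f v) (f u) (g a))) \<and>
     (\<forall>v\<in>wlds M. \<forall>c\<in>csts \<Theta>. g (cint M v c) = cint N (f v) c)"

lemma
  assumes "embedding \<Theta> f g M N"
  shows embedding_wlds: "v \<in> wlds M \<Longrightarrow> f v \<in> wlds N"
    and embedding_acc: "v \<in> wlds M \<Longrightarrow> u \<in> wlds M \<Longrightarrow> (f v, f u) \<in> acc N \<longleftrightarrow> (v, u) \<in> acc M"
    and embedding_dmn: "a \<in> dmn M v \<Longrightarrow> g a \<in> dmn N (f v)"
    and embedding_inj: "inj_on g (elems M)"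
    and embedding_hom: "(v, u) \<in> acc M \<Longrightarrow> a \<in> dmn M v \<Longrightarrow> g (hom M v u a) = hom N (f v) (f u) (g a)"
    and embedding_cint: "v \<in> wlds M \<Longrightarrow> c \<in> csts \<Theta> \<Longrightarrow> g (cint M v c) = cint N (f v) c"
  using assms unfolding embedding_def by blast+

lemma embedding_inj_wlds:
  assumes M: "is_model \<Theta> M" and N: "is_model \<Theta>' N" and "embedding \<Theta> f g M N"
  shows "inj_on f (wlds M)"
  using embedding_acc[OF assms(3)] embedding_wlds[OF assms(3)] model_acc_refl[OF N] model_acc_antisym[OF M]
  by (metis inj_onI)

lemma ex_choice_with_values:
  assumes "\<And>i j. i \<in> I \<Longrightarrow> j \<in> I \<Longrightarrow> s i = s j \<Longrightarrow> t i = t j" and "\<And>i. i \<in> I \<Longrightarrow> Q (s i) (t i)"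
    and "\<And>a. a \<in> A \<Longrightarrow> \<exists>x. Q a x"
  obtains \<gamma> where "\<And>i. i \<in> I \<Longrightarrow> \<gamma> (s i) = t i" "\<And>a. a \<in> A \<Longrightarrow> Q a (\<gamma> a)"
proof
  let ?\<gamma> = "\<lambda>a. if a \<in> s ` I then t (inv_into I s a) else SOME x. Q a x"
  show prescribed: "?\<gamma> (s i) = t i" if "i \<in> I" for i
    using that assms(1)[OF inv_into_into[of "s i" s I] that] by (simp add: f_inv_into_f)
  show "Q a (?\<gamma> a)" if "a \<in> A" for a
  proof (cases "a \<in> s ` I")
    case True
    then show ?thesis using prescribed assms(2) by auto
  next
    case False
    then show ?thesis using someI_ex[OF assms(3)[OF that]] by simp
  qed
qed

text \<open>A tree \<open>M\<close> is to be embedded into \<open>N\<close>, in which every world \<open>v\<close> and every element \<open>a\<close> of \<open>M\<close> have left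
  marks: \<open>above v t\<close> and \<open>not_below v t\<close> for worlds \<open>t\<close> of \<open>N\<close>, and \<open>image a t x\<close> for elements \<open>x\<close> of \<open>t\<close>.
  Marks persist, so none of them can pin down the image of \<open>v\<close>. But if \<open>v\<close> is sent to a \<open>t\<close> with \<open>above v t\<close>
  and not \<open>not_below v t\<close>, then all of the structure is determined.\<close>

locale marked_tree =
  fixes \<Theta> \<Theta>' :: "'u signature" and M N :: "'u kmodel" and r n :: 'u and q :: bool
    and above not_below :: "'u \<Rightarrow> 'u \<Rightarrow> bool" and image :: "'u \<Rightarrow> 'u \<Rightarrow> 'u \<Rightarrow> bool"
  assumes M: "is_model \<Theta> M" and tree: "proper_tree q M r" and N: "is_model \<Theta>' N" and n: "n \<in> wlds N"
    and csts: "csts \<Theta> \<subseteq> csts \<Theta>'"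
    and above_persistent: "above v t \<Longrightarrow> (t, t') \<in> acc N \<Longrightarrow> above v t'"
    and image_persistent: "image a t x \<Longrightarrow> (t, t') \<in> acc N \<Longrightarrow> image a t' (hom N t t' x)"
    and above_root: "above r n" and not_below_root: "\<not> not_below r n"
    and ex_successor: "(u, v) \<in> acc M \<Longrightarrow> t \<in> wlds N \<Longrightarrow> \<not> not_below u t \<Longrightarrow>
      \<exists>t'. (t, t') \<in> acc N \<and> above v t' \<and> \<not> not_below v t'"
    and above_incomparable: "v \<in> wlds M \<Longrightarrow> u \<in> wlds M \<Longrightarrow> (v, u) \<notin> acc M \<Longrightarrow> t \<in> wlds N \<Longrightarrow>
      above v t \<Longrightarrow> not_below u t"
    and ex_image: "a \<in> dmn M v \<Longrightarrow> t \<in> wlds N \<Longrightarrow> above v t \<Longrightarrow> \<exists>x\<in>dmn N t. image a t x"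
    and image_hom: "(v, u) \<in> acc M \<Longrightarrow> a \<in> dmn M v \<Longrightarrow> x \<in> dmn N t \<Longrightarrow> image a t x \<Longrightarrow> above u t \<Longrightarrow>
      image (hom M v u a) t x"
    and image_cint: "c \<in> csts \<Theta> \<Longrightarrow> image (cint M r c) n (cint N n c)"
    and image_merged: "a \<in> dmn M v \<Longrightarrow> b \<in> dmn M v \<Longrightarrow> a \<noteq> b \<Longrightarrow> x \<in> dmn N t \<Longrightarrow> image a t x \<Longrightarrow> image b t x \<Longrightarrow>
      not_below v t"
    and image_unique: "q \<Longrightarrow> a \<in> dmn M v \<Longrightarrow> x \<in> dmn N t \<Longrightarrow> y \<in> dmn N t \<Longrightarrow> image a t x \<Longrightarrow> image a t y \<Longrightarrow> x = y"
begin

lemma rooted: "tree_rooted M r"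
  using tree by (simp add: proper_tree_def)

lemmas root = tree_root[OF rooted] and least = tree_root_least[OF rooted]

definition admissible :: "'u \<Rightarrow> 'u \<Rightarrow> ('u \<Rightarrow> 'u) \<Rightarrow> bool" where
  "admissible v t \<gamma> \<longleftrightarrow> t \<in> wlds N \<and> above v t \<and> \<not> not_below v t \<and>
     (\<forall>a\<in>dmn M v. \<gamma> a \<in> dmn N t \<and> image a t (\<gamma> a))"

lemma
  assumes "admissible v t \<gamma>"
  shows admissible_world: "t \<in> wlds N" and admissible_above: "above v t" "\<not> not_below v t"
    and admissible_image: "a \<in> dmn M v \<Longrightarrow> \<gamma> a \<in> dmn N t \<and> image a t (\<gamma> a)"
  using assms unfolding admissible_def by blast+

lemma ex_admissible_root:
  obtains \<gamma> where "admissible r n \<gamma>" "\<And>c. c \<in> csts \<Theta> \<Longrightarrow> \<gamma> (cint M r c) = cint N n c"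
proof (rule ex_choice_with_values[of "csts \<Theta>" "cint M r" "cint N n" "\<lambda>a x. x \<in> dmn N n \<and> image a n x" "dmn M r"])
  have cint_N: "cint N n c \<in> dmn N n" if "c \<in> csts \<Theta>" for c
    using model_cint[OF N n] that csts by blast
  show "cint N n c = cint N n d" if "c \<in> csts \<Theta>" "d \<in> csts \<Theta>" "cint M r c = cint M r d" for c d
  proof (cases q)
    case True
    then show ?thesis
      using image_unique[OF True model_cint[OF M root] cint_N cint_N] image_cint that by metis
  next
    case False
    then show ?thesis using tree that model_sgn[OF M] by (auto simp: proper_tree_def dest: inj_onD)
  qed
  show "cint N n c \<in> dmn N n \<and> image (cint M r c) n (cint N n c)" if "c \<in> csts \<Theta>" for c
    using cint_N image_cint that by blast
  show "\<exists>x. x \<in> dmn N n \<and> image a n x" if "a \<in> dmn M r" for a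
    using ex_image[OF that n above_root] by blast
  fix \<gamma> assume "\<And>c. c \<in> csts \<Theta> \<Longrightarrow> \<gamma> (cint M r c) = cint N n c"
    and "\<And>a. a \<in> dmn M r \<Longrightarrow> \<gamma> a \<in> dmn N n \<and> image a n (\<gamma> a)"
  then show thesis using that[of \<gamma>] n above_root not_below_root by (simp add: admissible_def)
qed

lemma ex_admissible_successor:
  assumes uv: "(u, v) \<in> acc M" and \<gamma>: "admissible u t \<gamma>"
  obtains t' \<gamma>' where "(t, t') \<in> acc N" "admissible v t' \<gamma>'"
    "\<And>a. a \<in> dmn M u \<Longrightarrow> \<gamma>' (hom M u v a) = hom N t t' (\<gamma> a)"
proof -
  obtain t' where t': "(t, t') \<in> acc N" "above v t'" "\<not> not_below v t'"
    using ex_successor[OF uv admissible_world[OF \<gamma>] admissible_above(2)[OF \<gamma>]] by blast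
  have t'_wlds: "t' \<in> wlds N" using model_acc_wlds[OF N t'(1)] by blast
  have image: "hom N t t' (\<gamma> a) \<in> dmn N t' \<and> image (hom M u v a) t' (hom N t t' (\<gamma> a))"
    if "a \<in> dmn M u" for a
  proof -
    have "hom N t t' (\<gamma> a) \<in> dmn N t'" "image a t' (hom N t t' (\<gamma> a))"
      using admissible_image[OF \<gamma> that] model_hom[OF N t'(1)] image_persistent[OF _ t'(1)] by blast+
    then show ?thesis using image_hom[OF uv that _ _ t'(2)] by blast
  qed
  show thesis
  proof (rule ex_choice_with_values[of "dmn M u" "hom M u v" "\<lambda>a. hom N t t' (\<gamma> a)"
        "\<lambda>a x. x \<in> dmn N t' \<and> image a t' x" "dmn M v"])
    show "hom N t t' (\<gamma> a) = hom N t t' (\<gamma> b)"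
      if "a \<in> dmn M u" "b \<in> dmn M u" "hom M u v a = hom M u v b" for a b
    proof (cases q)
      case True
      then show ?thesis
        using image_unique[OF True model_hom[OF M uv that(1)]] image[OF that(1)] image[OF that(2)]
        unfolding that(3) by blast
    next
      case False
      then have "inj_on (hom M u v) (dmn M u)" using tree uv by (auto simp: proper_tree_def inj_model_def)
      then show ?thesis using that by (simp add: inj_on_eq_iff)
    qed
    show "\<exists>x. x \<in> dmn N t' \<and> image a t' x" if "a \<in> dmn M v" for a
      using ex_image[OF that t'_wlds t'(2)] by blast
    fix \<gamma>' assume "\<And>a. a \<in> dmn M u \<Longrightarrow> \<gamma>' (hom M u v a) = hom N t t' (\<gamma> a)"
      and "\<And>a. a \<in> dmn M v \<Longrightarrow> \<gamma>' a \<in> dmn N t' \<and> image a t' (\<gamma>' a)"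
    then show thesis using that[OF t'(1), of \<gamma>'] t' t'_wlds by (simp add: admissible_def)
  qed (rule image)
qed

definition coherent :: "('u \<Rightarrow> 'u) \<Rightarrow> ('u \<Rightarrow> 'u \<Rightarrow> 'u) \<Rightarrow> 'u \<Rightarrow> 'u \<Rightarrow> bool" where
  "coherent f \<gamma> u v \<longleftrightarrow> (f u, f v) \<in> acc N \<and> (\<forall>a\<in>dmn M u. \<gamma> v (hom M u v a) = hom N (f u) (f v) (\<gamma> u a))"

lemma coherent_refl:
  assumes "v \<in> wlds M" "admissible v (f v) (\<gamma> v)" shows "coherent f \<gamma> v v"
  using admissible_image[OF assms(2)] admissible_world[OF assms(2)] model_acc_refl[OF N]
    model_hom_id[OF M] model_hom_id[OF N] by (simp add: coherent_def)

lemma coherent_trans: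
  assumes "(u, v) \<in> acc M" "(v, w) \<in> acc M" and \<gamma>: "admissible u (f u) (\<gamma> u)"
    and uv: "coherent f \<gamma> u v" and vw: "coherent f \<gamma> v w"
  shows "coherent f \<gamma> u w"
  unfolding coherent_def
proof (intro conjI ballI)
  have acc: "(f u, f v) \<in> acc N" "(f v, f w) \<in> acc N" using uv vw by (simp_all add: coherent_def)
  then show "(f u, f w) \<in> acc N" using model_acc_trans[OF N] by blast
  fix a assume a: "a \<in> dmn M u"
  then have "\<gamma> w (hom M u w a) = \<gamma> w (hom M v w (hom M u v a))"
    using model_hom_comp[OF M assms(1,2)] by simp
  also have "\<dots> = hom N (f v) (f w) (hom N (f u) (f v) (\<gamma> u a))"
    using uv vw a model_hom[OF M assms(1)] by (simp add: coherent_def)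
  also have "\<dots> = hom N (f u) (f w) (\<gamma> u a)"
    using model_hom_comp[OF N acc] admissible_image[OF \<gamma> a] by simp
  finally show "\<gamma> w (hom M u w a) = hom N (f u) (f w) (\<gamma> u a)" .
qed

lemma ex_parentwise_coherent_family:
  assumes par: "\<And>v. v \<in> wlds M \<Longrightarrow> v \<noteq> r \<Longrightarrow> par v \<in> wlds M" "\<And>v. v \<in> wlds M \<Longrightarrow> v \<noteq> r \<Longrightarrow> (par v, v) \<in> acc M"
    and d: "\<And>v. v \<in> wlds M \<Longrightarrow> v \<noteq> r \<Longrightarrow> (d (par v) :: nat) < d v"
  obtains f \<gamma> where "f r = n" "\<And>c. c \<in> csts \<Theta> \<Longrightarrow> \<gamma> r (cint M r c) = cint N n c"
    "\<And>v. v \<in> wlds M \<Longrightarrow> admissible v (f v) (\<gamma> v)"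
    "\<And>v. v \<in> wlds M \<Longrightarrow> v \<noteq> r \<Longrightarrow> coherent f \<gamma> (par v) v"
proof -
  obtain \<gamma>0 where \<gamma>0: "admissible r n \<gamma>0" "\<And>c. c \<in> csts \<Theta> \<Longrightarrow> \<gamma>0 (cint M r c) = cint N n c"
    using ex_admissible_root by blast
  let ?parent = "{(par v, v) | v. v \<in> wlds M \<and> v \<noteq> r}"
  define P where "P F v y \<longleftrightarrow> (v = r \<longrightarrow> y = (n, \<gamma>0)) \<and> (v \<in> wlds M \<longrightarrow> admissible v (fst y) (snd y) \<and>
      (v \<noteq> r \<longrightarrow> coherent (fst \<circ> F(v := y)) (snd \<circ> F(v := y)) (par v) v))" for F and v :: 'u and y
  have "\<exists>F. \<forall>v. P F v (F v)"
  proof (rule dependent_wf_choice)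
    show "wf ?parent" by (rule wf_subset[OF wf_measure[of d]]) (use d in auto)
    show "P F v y = P F' v y" if "\<And>u. (u, v) \<in> ?parent \<Longrightarrow> F u = F' u" for F F' v y
      using that by (auto simp: P_def coherent_def)
    fix v F assume IH: "\<And>u. (u, v) \<in> ?parent \<Longrightarrow> P F u (F u)"
    show "\<exists>y. P F v y"
    proof (cases "v \<in> wlds M \<and> v \<noteq> r")
      case True
      then have "admissible (par v) (fst (F (par v))) (snd (F (par v)))"
        using IH par(1) by (auto simp: P_def)
      from ex_admissible_successor[OF par(2) this] obtain t' \<gamma>'
        where "(fst (F (par v)), t') \<in> acc N" "admissible v t' \<gamma>'"
          "\<And>a. a \<in> dmn M (par v) \<Longrightarrow> \<gamma>' (hom M (par v) v a) = hom N (fst (F (par v))) t' (snd (F (par v)) a)"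
        using True by blast
      then have "P F v (t', \<gamma>')" using True d by (force simp: P_def coherent_def)
      then show ?thesis by blast
    next
      case False
      then show ?thesis using \<gamma>0(1) by (auto simp: P_def)
    qed
  qed
  then obtain F where F: "\<And>v. P F v (F v)" by blast
  then show thesis using that[of "fst \<circ> F" "snd \<circ> F"] \<gamma>0(2) F[of r] by (auto simp: P_def)
qed

lemma ex_coherent_family:
  obtains f \<gamma> where "f r = n" "\<And>c. c \<in> csts \<Theta> \<Longrightarrow> \<gamma> r (cint M r c) = cint N n c"
    "\<And>v. v \<in> wlds M \<Longrightarrow> admissible v (f v) (\<gamma> v)" "\<And>u v. (u, v) \<in> acc M \<Longrightarrow> coherent f \<gamma> u v"
proof -
  obtain par and d :: "'u \<Rightarrow> nat" where par: "\<And>v. v \<in> wlds M \<Longrightarrow> v \<noteq> r \<Longrightarrow> par v \<in> wlds M"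
    "\<And>v. v \<in> wlds M \<Longrightarrow> v \<noteq> r \<Longrightarrow> d (par v) < d v" "\<And>v. v \<in> wlds M \<Longrightarrow> v \<noteq> r \<Longrightarrow> (par v, v) \<in> acc M"
    "\<And>u v. v \<in> wlds M \<Longrightarrow> v \<noteq> r \<Longrightarrow> (u, v) \<in> acc M \<Longrightarrow> u = v \<or> (u, par v) \<in> acc M"
    using rooted by (rule tree_parentE) blast
  obtain f \<gamma> where root_image: "f r = n" "\<And>c. c \<in> csts \<Theta> \<Longrightarrow> \<gamma> r (cint M r c) = cint N n c"
    and adm: "\<And>v. v \<in> wlds M \<Longrightarrow> admissible v (f v) (\<gamma> v)"
    and coh: "\<And>v. v \<in> wlds M \<Longrightarrow> v \<noteq> r \<Longrightarrow> coherent f \<gamma> (par v) v"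
    using ex_parentwise_coherent_family[of par d, OF par(1,3,2)] by blast
  have "coherent f \<gamma> u v" if "(u, v) \<in> acc M" for u v
    using that
  proof (induction "d v" arbitrary: v rule: less_induct)
    case less
    then have wlds: "u \<in> wlds M" "v \<in> wlds M" using model_acc_wlds[OF M] by auto
    show ?case
    proof (cases "u = v")
      case True
      then show ?thesis using coherent_refl adm wlds by simp
    next
      case False
      then have "v \<noteq> r" using model_acc_antisym[OF M] less.prems least[OF wlds(1)] by blast
      note parent = par(1-3)[OF wlds(2) this] and up = par(4)[OF wlds(2) this less.prems]
      show ?thesis
        using coherent_trans[OF _ parent(3), of u f \<gamma>] adm[OF wlds(1)] less.hyps[OF parent(2)]
          coh[OF wlds(2) \<open>v \<noteq> r\<close>] up False by blast
    qed
  qed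
  then show thesis using that root_image adm by blast
qed

lemma admissible_reflects_acc:
  assumes adm: "\<And>v. v \<in> wlds M \<Longrightarrow> admissible v (f v) \<gamma>"
    and "v \<in> wlds M" "u \<in> wlds M" "(f v, f u) \<in> acc N"
  shows "(v, u) \<in> acc M"
  using above_incomparable[OF assms(2,3)] above_persistent[OF admissible_above(1)[OF adm] assms(4)] assms(2,3)
    admissible_world[OF adm] admissible_above(2)[OF adm] by blast

lemma inj_on_admissible:
  assumes adm: "\<And>v. v \<in> wlds M \<Longrightarrow> admissible v (f v) \<gamma>"
  shows "inj_on \<gamma> (elems M)"
proof (rule inj_onI)
  fix a b assume "a \<in> elems M" "b \<in> elems M" and eq: "\<gamma> a = \<gamma> b"
  then obtain v u where vu: "v \<in> wlds M" "a \<in> dmn M v" "u \<in> wlds M" "b \<in> dmn M u"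
    by (auto simp: elems_def)
  note images = admissible_image[OF adm[OF vu(1)] vu(2)] admissible_image[OF adm[OF vu(3)] vu(4)]
  have "f v = f u" using images eq model_dmn_disjoint[OF N] by metis
  then have "(v, u) \<in> acc M" "(u, v) \<in> acc M"
    using admissible_reflects_acc[where f = f, OF adm] vu model_acc_refl[OF N admissible_world[OF adm]] by metis+
  then have "v = u" by (rule model_acc_antisym[OF M])
  then show "a = b"
    using image_merged[OF vu(2), of b "\<gamma> a" "f v"] vu images eq admissible_above(2)[OF adm[OF vu(1)]]
    by auto
qed

lemma ex_embedding:
  obtains f g where "f r = n" "embedding \<Theta> f g M N" "\<And>v. v \<in> wlds M \<Longrightarrow> admissible v (f v) g"
proof -
  obtain f \<gamma> where root_image: "f r = n" "\<And>c. c \<in> csts \<Theta> \<Longrightarrow> \<gamma> r (cint M r c) = cint N n c"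
    and adm\<gamma>: "\<And>v. v \<in> wlds M \<Longrightarrow> admissible v (f v) (\<gamma> v)"
    and coh: "\<And>u v. (u, v) \<in> acc M \<Longrightarrow> coherent f \<gamma> u v"
    using ex_coherent_family by blast
  define g where "g a = \<gamma> (home M a) a" for a
  have g: "g a = \<gamma> v a" if "a \<in> dmn M v" for v a using home_eq[OF M that] by (simp add: g_def)
  have adm: "admissible v (f v) g" if "v \<in> wlds M" for v using adm\<gamma>[OF that] g by (simp add: admissible_def)
  have acc: "(f u, f v) \<in> acc N" if "(u, v) \<in> acc M" for u v using coh[OF that] by (simp add: coherent_def)
  have hom: "g (hom M u v a) = hom N (f u) (f v) (g a)" if "(u, v) \<in> acc M" "a \<in> dmn M u" for u v a
    using coh[OF that(1)] that g[OF that(2)] g[OF model_hom[OF M that]] by (simp add: coherent_def)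
  have "g (cint M v c) = cint N (f v) c" if v: "v \<in> wlds M" and c: "c \<in> csts \<Theta>" for v c
  proof -
    have "g (cint M v c) = hom N (f r) (f v) (g (cint M r c))"
      using model_cint_hom[OF M least[OF v] c] hom[OF least[OF v] model_cint[OF M root c]] by simp
    also have "g (cint M r c) = cint N (f r) c"
      using g[OF model_cint[OF M root c]] root_image c by simp
    finally show ?thesis using model_cint_hom[OF N acc[OF least[OF v]]] c csts by auto
  qed
  then have "embedding \<Theta> f g M N"
    unfolding embedding_def
    using admissible_world[OF adm] acc admissible_reflects_acc[where f = f, OF adm]
      inj_on_admissible[where f = f, OF adm] hom admissible_image[OF adm] model_dmn_wlds[OF M] by blast
  then show thesis by (rule that[OF root_image(1) _ adm])
qed

end


section \<open>From elementary embeddings to elementary extensions\<close>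

lemma embedding_iso:
  assumes M: "is_model \<Theta> M" and N: "is_model \<Theta> N" and iso: "model_iso k h N M'"
    and emb: "embedding \<Theta> f g M N"
  shows "embedding \<Theta> (\<lambda>v. h (f v)) (\<lambda>a. k (g a)) M M'"
proof -
  have into: "g a \<in> elems N" if "a \<in> elems M" for a
    using that model_dmn_elems[OF N embedding_dmn[OF emb]] by (auto simp: elems_def[of M])
  have "inj_on k (elems N)" using iso by (simp add: model_iso_def bij_betw_def)
  then have "inj_on (\<lambda>a. k (g a)) (elems M)"
    using embedding_inj[OF emb] into by (auto simp: inj_on_def)
  moreover have "h (f v) \<in> wlds M'" if "v \<in> wlds M" for v
    using iso_wlds[OF iso] embedding_wlds[OF emb that] by (rule bij_betwE[THEN bspec])
  moreover have "k (g a) \<in> dmn M' (h (f v))" if "a \<in> dmn M v" for a v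
    using iso_dmn[OF iso embedding_wlds[OF emb model_dmn_wlds[OF M that]]] embedding_dmn[OF emb that]
    by (rule bij_betwE[THEN bspec])
  moreover have "k (g (hom M v u a)) = hom M' (h (f v)) (h (f u)) (k (g a))"
    if "(v, u) \<in> acc M" "a \<in> dmn M v" for v u a
    using that embedding_hom[OF emb that] embedding_dmn[OF emb that(2)] embedding_acc[OF emb]
      model_acc_wlds[OF M that(1)] by (simp add: iso_hom[OF iso])
  ultimately show ?thesis
    using embedding_wlds[OF emb] embedding_acc[OF emb] embedding_cint[OF emb] model_sgn[OF N]
    unfolding embedding_def by (simp add: iso_acc[OF iso] iso_cint[OF iso])
qed

lemma submodel_of_embedding:
  assumes M: "is_model \<Theta> M" and N: "is_model \<Theta> N" and emb: "embedding \<Theta> f g M N"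
    and f: "\<And>v. v \<in> wlds M \<Longrightarrow> f v = v" and g: "\<And>a. a \<in> elems M \<Longrightarrow> g a = a"
    and pint: "\<And>v as P. v \<in> wlds M \<Longrightarrow> set as \<subseteq> dmn M v \<Longrightarrow> as \<in> pint M v P \<longleftrightarrow> as \<in> pint N v P"
  shows "submodel M N"
proof -
  have g_dmn: "g a = a" if "a \<in> dmn M v" for a v using g that model_dmn_elems[OF M that] by blast
  have dmn: "dmn M v \<subseteq> dmn N v" for v
    using embedding_dmn[OF emb] f[OF model_dmn_wlds[OF M]] g_dmn by fastforce
  show ?thesis
    unfolding submodel_def model_sgn[OF M] model_sgn[OF N]
  proof (intro conjI ballI allI impI)
    show "wlds M \<subseteq> wlds N" using embedding_wlds[OF emb] f by force
    show "acc M = acc N \<inter> wlds M \<times> wlds M"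
      using embedding_acc[OF emb] f model_acc_wlds[OF M] by auto
    show "dmn M v \<subseteq> dmn N v" for v by (rule dmn)
    show "pint M v P = pint N v P \<inter> lists (dmn M v)" if v: "v \<in> wlds M" for v P
      using pint[OF v] model_pint[OF M] by (fastforce simp: in_lists_conv_set)
    show "cint M v c = cint N v c" if "v \<in> wlds M" "c \<in> csts \<Theta>" for v c
      using embedding_cint[OF emb that] f[OF that(1)] g_dmn[OF model_cint[OF M that]] by simp
    show "hom M v u = restrict (hom N v u) (dmn M v)" if vu: "(v, u) \<in> acc M" for v u
    proof
      show "hom M v u a = restrict (hom N v u) (dmn M v) a" for a
        using embedding_hom[OF emb vu] f g_dmn[OF model_hom[OF M vu]] g_dmn model_acc_wlds[OF M vu]
        by (cases "a \<in> dmn M v") (simp_all add: model_hom_ext[OF M])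
    qed
  qed (rule refl)
qed

lemma (in universe) ex_extension_of_embedding:
  assumes M: "is_model \<Theta> (M :: 'u kmodel)" and N: "is_model \<Theta> N" and emb: "embedding \<Theta> f g M N"
    and pint: "\<And>v as P. v \<in> wlds M \<Longrightarrow> set as \<subseteq> dmn M v \<Longrightarrow> as \<in> pint M v P \<longleftrightarrow> map g as \<in> pint N (f v) P"
  obtains M' h k where "is_model \<Theta> M'" "model_iso k h N M'" "submodel M M'"
    "\<And>v. v \<in> wlds M \<Longrightarrow> h (f v) = v" "\<And>a. a \<in> elems M \<Longrightarrow> k (g a) = a"
proof -
  obtain h where h: "inj_on h (wlds N)" "\<And>v. v \<in> wlds M \<Longrightarrow> h (f v) = v"
    using ex_inj_extending_inverse[OF _ _ embedding_inj_wlds[OF M N emb]] model_small_wlds[OF N]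
      model_small_wlds[OF M]
    by blast
  obtain k where k: "inj_on k (elems N)" "\<And>a. a \<in> elems M \<Longrightarrow> k (g a) = a"
    using ex_inj_extending_inverse[OF small_elems[OF N] small_elems[OF M] embedding_inj[OF emb]] by blast
  let ?M' = "iso_copy k h N"
  have M': "is_model \<Theta> ?M'" and iso: "model_iso k h N ?M'"
    using is_model_iso_copy[OF N k(1) h(1)] model_iso_iso_copy[OF N k(1) h(1)] .
  have "as \<in> pint M v P \<longleftrightarrow> as \<in> pint ?M' v P" if v: "v \<in> wlds M" and as: "set as \<subseteq> dmn M v" for v as P
  proof -
    have "map k (map g as) = as" using as k(2) model_dmn_elems[OF M] by (auto intro!: map_idI)
    moreover have "set (map g as) \<subseteq> dmn N (f v)" using as embedding_dmn[OF emb] by auto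
    ultimately show ?thesis
      using pint[OF v as] iso_pint[OF iso embedding_wlds[OF emb v], of "map g as" P] h(2)[OF v]
      by (simp del: map_map)
  qed
  then have "submodel M ?M'"
    using submodel_of_embedding[OF M M' embedding_iso[OF M N iso emb]] h(2) k(2) by blast
  then show thesis by (rule that[OF M' iso _ h(2) k(2)])
qed

context extension_logic
begin

definition elementary_embedding ::
    "'u signature \<Rightarrow> ('u \<Rightarrow> 'u) \<Rightarrow> ('u \<Rightarrow> 'u) \<Rightarrow> 'u kmodel \<Rightarrow> 'u kmodel \<Rightarrow> bool" where
  "elementary_embedding \<Theta> f g M N \<longleftrightarrow> embedding \<Theta> f g M N \<and>
     (\<forall>v\<in>wlds M. \<forall>cs as. name_tuple M v cs as \<longrightarrow>
        (\<forall>\<phi>\<in>Sen L (add_consts \<Theta> cs). Sat_tuple M v cs as \<phi> \<longleftrightarrow> Sat_tuple N (f v) cs (map g as) \<phi>))"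

lemma elementary_embedding_holds:
  assumes sig: "is_sig \<Theta>" and SM: "(M, v) \<in> Str L \<Theta>" and SN: "(N, f v) \<in> Str L \<Theta>"
    and emb: "elementary_embedding \<Theta> f g M N" and \<alpha>: "set \<alpha> \<subseteq> dmn M v"
    and \<psi>: "\<psi> \<in> formulas (has_eq K) \<Theta> (length \<alpha>)"
  shows "holds M v (nth \<alpha>) \<psi> \<longleftrightarrow> holds N (f v) (nth (map g \<alpha>)) \<psi>"
proof -
  let ?cs = "map (fresh_consts \<Theta>) [0..<length \<alpha>]"
  note M = Str_model[OF sig SM] and N = Str_model[OF sig SN]
  have "set (map g \<alpha>) \<subseteq> dmn N (f v)"
    using \<alpha> emb embedding_dmn[of \<Theta> f g M N] by (auto simp: elementary_embedding_def)
  then have names: "name_tuple M v ?cs \<alpha>" "name_tuple N (f v) ?cs (map g \<alpha>)"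
    using name_tuple_map_consts[OF fresh_consts_fresh(1)[OF sig], of M \<alpha> v]
      name_tuple_map_consts[OF fresh_consts_fresh(1)[OF sig], of N "map g \<alpha>" "f v"]
      fresh_consts_fresh(2)[OF sig] \<alpha> model_sgn[OF M] model_sgn[OF N] by simp_all
  have \<psi>': "\<psi> \<in> formulas (has_eq K) \<Theta> (length ?cs)" using \<psi> by simp
  have "Sat_tuple M v ?cs \<alpha> (translate \<Theta> ?cs \<psi>) \<longleftrightarrow> Sat_tuple N (f v) ?cs (map g \<alpha>) (translate \<Theta> ?cs \<psi>)"
    using emb Str_wlds[OF sig SM] names(1) translate_Sen[OF sig \<psi>'] unfolding elementary_embedding_def
    by blast
  then show ?thesis
    using Sat_tuple_translate[OF sig \<psi>' SM names(1)] Sat_tuple_translate[OF sig \<psi>' SN names(2)] by simp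
qed

lemma ex_elementary_extension:
  assumes sig: "is_sig \<Theta>" and SM: "(M, r) \<in> Str L \<Theta>" and SN: "(N, n) \<in> Str L \<Theta>"
    and elementary: "elementary_embedding \<Theta> f g M N"
  obtains M' h k where "is_model \<Theta> M'" "model_iso k h N M'" "elementary_submodel L M M'"
    "\<And>v. v \<in> wlds M \<Longrightarrow> h (f v) = v" "\<And>a. a \<in> elems M \<Longrightarrow> k (g a) = a"
proof -
  note M = Str_model[OF sig SM] and N = Str_model[OF sig SN]
  have emb: "embedding \<Theta> f g M N" using elementary by (simp add: elementary_embedding_def)
  have SMv: "(M, v) \<in> Str L \<Theta>" and SNv: "(N, f v) \<in> Str L \<Theta>" if "v \<in> wlds M" for v
    using that embedding_wlds[OF emb] Str_change_point[OF sig SM] Str_change_point[OF sig SN] by blast+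
  have pint: "as \<in> pint M v P \<longleftrightarrow> map g as \<in> pint N (f v) P"
    if v: "v \<in> wlds M" and as: "set as \<subseteq> dmn M v" for v as P
  proof (cases "P \<in> preds \<Theta> (length as)")
    case True
    let ?\<psi> = "Atom P (map Var [0..<length as])"
    have "?\<psi> \<in> formulas (has_eq K) \<Theta> (length as)" using True by (auto simp: formulas_def)
    from elementary_embedding_holds[OF sig SMv[OF v] SNv[OF v] elementary as this]
    have "map (nth as) [0..<length as] \<in> pint M v P \<longleftrightarrow> map (nth (map g as)) [0..<length as] \<in> pint N (f v) P"
      by (simp add: comp_def del: map_nth)
    then show ?thesis using map_nth[of "map g as"] by (simp add: map_nth)
  next
    case False
    then show ?thesis using model_pint[OF M, of as v P] model_pint[OF N, of "map g as" "f v" P] by auto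
  qed
  obtain M' h k where M': "is_model \<Theta> M'" and iso: "model_iso k h N M'" and sub: "submodel M M'"
      and h: "\<And>v. v \<in> wlds M \<Longrightarrow> h (f v) = v" and k: "\<And>a. a \<in> elems M \<Longrightarrow> k (g a) = a"
    by (rule ex_extension_of_embedding[OF M N emb pint]) (assumption | rule that)+
  have "Sat_tuple M v cs as \<phi> \<longleftrightarrow> Sat_tuple M' v cs as \<phi>"
    if v: "v \<in> wlds M" and names: "name_tuple M v cs as" and \<phi>: "\<phi> \<in> Sen L (add_consts \<Theta> cs)" for v cs as \<phi>
  proof -
    have names': "name_tuple N (f v) cs (map g as)"
      using names embedding_dmn[OF emb] model_sgn[OF M] model_sgn[OF N] by (auto simp: name_tuple_def)
    have "map k (map g as) = as"
      using k name_tupleD(4)[OF names] model_dmn_elems[OF M] by (auto intro!: map_idI)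
    then have "Sat_tuple N (f v) cs (map g as) \<phi> \<longleftrightarrow> Sat_tuple M' v cs as \<phi>"
      using Sat_tuple_morphism[OF sig SNv[OF v] _ morphism_iso[OF N M' iso] names' \<phi>]
        Str_iso[OF sig SNv[OF v] M' iso] h[OF v] by simp
    then show ?thesis using elementary v names \<phi> unfolding elementary_embedding_def by blast
  qed
  then have "elementary_submodel L M M'"
    using sub model_sgn[OF M] model_sgn[OF M'] by (auto simp: elementary_submodel_def Tp_def Th_def)
  then show thesis by (rule that[OF M' iso _ h k])
qed

end


section \<open>Requests\<close>

datatype 'u request =
  Request (is_local: bool) (base: 'u) (params: "'u list") (asserted: "'u fm set") (refuted: "'u fm set")

definition solves :: "'u kmodel \<Rightarrow> 'u request \<Rightarrow> 'u \<Rightarrow> 'u \<Rightarrow> bool" where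
  "solves M \<rho> u b \<longleftrightarrow> (base \<rho>, u) \<in> acc M \<and> (is_local \<rho> \<longrightarrow> u = base \<rho>) \<and> b \<in> dmn M u \<and>
     (\<forall>\<psi>\<in>asserted \<rho>. holds M u (nth (map (hom M (base \<rho>) u) (params \<rho>) @ [b])) \<psi>) \<and>
     (\<forall>\<psi>\<in>refuted \<rho>. \<not> holds M u (nth (map (hom M (base \<rho>) u) (params \<rho>) @ [b])) \<psi>)"

definition restrict_request :: "'u fm set \<Rightarrow> 'u request \<Rightarrow> 'u request" where
  "restrict_request F \<rho> = Request (is_local \<rho>) (base \<rho>) (params \<rho>) (asserted \<rho> \<inter> F) (refuted \<rho> \<inter> F)"

definition solvable :: "'u kmodel \<Rightarrow> 'u request \<Rightarrow> bool" where
  "solvable M \<rho> \<longleftrightarrow> (\<exists>u b. solves M \<rho> u b)"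

definition finitely_solvable :: "'u kmodel \<Rightarrow> 'u request \<Rightarrow> bool" where
  "finitely_solvable M \<rho> \<longleftrightarrow> (\<forall>F. finite F \<longrightarrow> solvable M (restrict_request F \<rho>))"

text \<open>Finite solvability has to be expressible by formulas at the base. For a local request this works
  only if nothing is refuted.\<close>

definition requests :: "bool \<Rightarrow> 'u signature \<Rightarrow> 'u kmodel \<Rightarrow> 'u request set" where
  "requests q \<Theta> M = {\<rho>. base \<rho> \<in> wlds M \<and> set (params \<rho>) \<subseteq> dmn M (base \<rho>) \<and>
     asserted \<rho> \<union> refuted \<rho> \<subseteq> formulas q \<Theta> (Suc (length (params \<rho>))) \<and> (is_local \<rho> \<longrightarrow> refuted \<rho> = {})}"

definition saturates :: "bool \<Rightarrow> 'u signature \<Rightarrow> 'u kmodel \<Rightarrow> 'u kmodel \<Rightarrow> bool" where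
  "saturates q \<Theta> M M' \<longleftrightarrow> (\<forall>\<rho>\<in>requests q \<Theta> M. finitely_solvable M \<rho> \<longrightarrow> solvable M' \<rho>)"

lemma
  assumes "\<rho> \<in> requests q \<Theta> M"
  shows request_base: "base \<rho> \<in> wlds M" and request_params: "set (params \<rho>) \<subseteq> dmn M (base \<rho>)"
    and request_formulas: "\<psi> \<in> asserted \<rho> \<union> refuted \<rho> \<Longrightarrow> \<psi> \<in> formulas q \<Theta> (Suc (length (params \<rho>)))"
    and request_local: "is_local \<rho> \<Longrightarrow> refuted \<rho> = {}"
  using assms by (auto simp: requests_def)

lemma
  assumes "solves M \<rho> u b"
  shows solves_acc: "(base \<rho>, u) \<in> acc M" and solves_local: "is_local \<rho> \<Longrightarrow> u = base \<rho>"
    and solves_dmn: "b \<in> dmn M u"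
    and solves_asserted: "\<psi> \<in> asserted \<rho> \<Longrightarrow> holds M u (nth (map (hom M (base \<rho>) u) (params \<rho>) @ [b])) \<psi>"
    and solves_refuted: "\<psi> \<in> refuted \<rho> \<Longrightarrow> \<not> holds M u (nth (map (hom M (base \<rho>) u) (params \<rho>) @ [b])) \<psi>"
  using assms by (auto simp: solves_def)

lemma solution_tuple:
  assumes "is_model \<Theta>' M" "\<rho> \<in> requests q \<Theta> M" "(base \<rho>, u) \<in> acc M" "b \<in> dmn M u"
  shows "set (map (hom M (base \<rho>) u) (params \<rho>) @ [b]) \<subseteq> dmn M u"
  using set_map_hom_subset[OF assms(1,3) request_params[OF assms(2)]] assms(4) by simp

lemma restrict_request_simps [simp]:
  "is_local (restrict_request F \<rho>) = is_local \<rho>" "base (restrict_request F \<rho>) = base \<rho>"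
  "params (restrict_request F \<rho>) = params \<rho>" "asserted (restrict_request F \<rho>) = asserted \<rho> \<inter> F"
  "refuted (restrict_request F \<rho>) = refuted \<rho> \<inter> F"
  by (simp_all add: restrict_request_def)

lemma restrict_requests: "\<rho> \<in> requests q \<Theta> M \<Longrightarrow> restrict_request F \<rho> \<in> requests q \<Theta> M"
  by (auto simp: requests_def)

definition transport :: "('u \<Rightarrow> 'u) \<Rightarrow> ('u \<Rightarrow> 'u) \<Rightarrow> 'u request \<Rightarrow> 'u request" where
  "transport p e \<rho> = Request (is_local \<rho>) (p (base \<rho>)) (map e (params \<rho>)) (asserted \<rho>) (refuted \<rho>)"

lemma transport_simps [simp]:
  "is_local (transport p e \<rho>) = is_local \<rho>" "base (transport p e \<rho>) = p (base \<rho>)"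
  "params (transport p e \<rho>) = map e (params \<rho>)" "asserted (transport p e \<rho>) = asserted \<rho>"
  "refuted (transport p e \<rho>) = refuted \<rho>"
  by (simp_all add: transport_def)

lemma solves_morphism:
  assumes M: "is_model \<Theta>' M" and morphism: "bounded_morphism q \<Theta> p e M (base \<rho>) N"
    and \<rho>: "\<rho> \<in> requests q \<Theta> M" and sol: "solves M \<rho> u b"
  shows "solves N (transport p e \<rho>) (p u) (e b)"
proof -
  note base = request_base[OF \<rho>] and acc = solves_acc[OF sol]
  note refl = model_acc_refl[OF M base]
  let ?as = "map (hom M (base \<rho>) u) (params \<rho>) @ [b]"
  have "map (hom N (p (base \<rho>)) (p u)) (map e (params \<rho>)) @ [e b] = map e ?as"
    using morphism_map_hom[OF morphism refl acc request_params[OF \<rho>]] by simp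
  moreover have "holds M u (nth ?as) \<psi> \<longleftrightarrow> holds N (p u) (nth (map e ?as)) \<psi>"
    if "\<psi> \<in> asserted \<rho> \<union> refuted \<rho>" for \<psi>
    by (rule morphism_holds_tuple[OF M morphism _ acc])
      (use request_formulas[OF \<rho> that] solution_tuple[OF M \<rho> acc solves_dmn[OF sol]] in simp_all)
  ultimately show ?thesis
    using sol morphism_forth[OF morphism refl acc] morphism_dmn[OF morphism acc]
    by (auto simp: solves_def simp del: map_append map_map)
qed


section \<open>Expansion by marks\<close>

text \<open>The new letters have an arity \<open>m\<close> that the signature does not use, so that any elements of the
  universe can serve as letters. They hold of constant tuples, being properties of single elements.\<close>

definition mark_sig :: "'u signature \<Rightarrow> nat \<Rightarrow> 'u set \<Rightarrow> 'u signature" where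
  "mark_sig \<Theta> m X = \<Theta>\<lparr>preds := (preds \<Theta>)(m := X)\<rparr>"

definition mark :: "'u kmodel \<Rightarrow> nat \<Rightarrow> 'u set \<Rightarrow> ('u \<Rightarrow> 'u \<Rightarrow> 'u \<Rightarrow> bool) \<Rightarrow> 'u kmodel" where
  "mark M m X I = M\<lparr>sgn := mark_sig (sgn M) m X,
     pint := (\<lambda>v x. pint M v x \<union> {replicate m a | a. a \<in> dmn M v \<and> x \<in> X \<and> I v x a})\<rparr>"

lemma mark_simps [simp]:
  "sgn (mark M m X I) = mark_sig (sgn M) m X" "wlds (mark M m X I) = wlds M" "acc (mark M m X I) = acc M"
  "dmn (mark M m X I) = dmn M" "cint (mark M m X I) = cint M" "hom (mark M m X I) = hom M"
  by (simp_all add: mark_def)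

lemma mark_sig_simps [simp]:
  "csts (mark_sig \<Theta> m X) = csts \<Theta>" "preds (mark_sig \<Theta> m X) = (preds \<Theta>)(m := X)"
  by (simp_all add: mark_sig_def)

lemma sub_sig_mark_sig: "preds \<Theta> m = {} \<Longrightarrow> sub_sig \<Theta> (mark_sig \<Theta> m X)"
  by (simp add: sub_sig_def)

lemma is_sig_mark_sig: "is_sig \<Theta> \<Longrightarrow> small X \<Longrightarrow> 0 < m \<Longrightarrow> is_sig (mark_sig \<Theta> m X)"
  by (simp add: is_sig_def)

lemma in_class_mark [simp]: "in_class K (mark M m X I) \<longleftrightarrow> in_class K M"
  by (cases K) (simp_all add: inj_model_def surj_model_def)

context
  fixes \<Theta> :: "'u signature" and M :: "'u kmodel" and m :: nat
    and X :: "'u set" and I :: "'u \<Rightarrow> 'u \<Rightarrow> 'u \<Rightarrow> bool"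
  assumes M: "is_model \<Theta> M" and m: "preds \<Theta> m = {}"
begin

lemma is_model_mark:
  assumes persistent: "\<And>v u x a. (v, u) \<in> acc M \<Longrightarrow> a \<in> dmn M v \<Longrightarrow> x \<in> X \<Longrightarrow> I v x a \<Longrightarrow> I u x (hom M v u a)"
  shows "is_model (mark_sig \<Theta> m X) (mark M m X I)"
proof (rule is_modelI)
  show "set as \<subseteq> dmn (mark M m X I) v \<and> x \<in> preds (mark_sig \<Theta> m X) (length as)"
    if "as \<in> pint (mark M m X I) v x" for v x as
    using that model_pint[OF M, of as v x] m by (auto simp: mark_def)
  show "map (hom (mark M m X I) v u) as \<in> pint (mark M m X I) u x"
    if vu: "(v, u) \<in> acc (mark M m X I)" and as: "as \<in> pint (mark M m X I) v x" for v u x as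
    using as vu model_pint_hom[OF M] model_hom[OF M] persistent by (auto simp: mark_def)
  show "cint (mark M m X I) v c = undefined"
    if "\<not> (v \<in> wlds (mark M m X I) \<and> c \<in> csts (mark_sig \<Theta> m X))" for v c
    using that model_cint_ext[OF M, of c v] fun_cong[OF model_cint_out[OF M, of v]] by auto
  show "hom (mark M m X I) v u a = undefined"
    if "\<not> ((v, u) \<in> acc (mark M m X I) \<and> a \<in> dmn (mark M m X I) v)" for v u a
    using that model_hom_ext[OF M, of a v u] fun_cong[OF model_hom_out[OF M, of v u]] by auto
  show "v = u" if "a \<in> dmn (mark M m X I) v" "a \<in> dmn (mark M m X I) u" for v u a
    using that model_dmn_disjoint[OF M] by simp
qed (use model_sgn[OF M] model_wlds_nonempty[OF M] model_small_wlds[OF M] model_partial_order[OF M]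
    model_dmn_nonempty[OF M] model_small_dmn[OF M] model_dmn_out[OF M] model_cint[OF M]
    model_hom[OF M] model_hom_id[OF M] model_hom_comp[OF M] model_cint_hom[OF M] in simp_all)

lemma reduct_mark: "reduct (mark M m X I) \<Theta> = M"
proof -
  have "{as \<in> pint (mark M m X I) v x. x \<in> preds \<Theta> (length as)} = pint M v x" for v x
    using model_pint[OF M] m by (auto simp: mark_def)
  moreover have "restrict (cint M v) (csts \<Theta>) = cint M v" for v
    using model_cint_ext[OF M] by (auto simp: restrict_def)
  ultimately show ?thesis
    unfolding reduct_def by (intro kmodel.equality) (simp_all add: model_sgn[OF M])
qed

lemma pint_mark_replicate:
  assumes "0 < m" "a \<in> dmn M v" "x \<in> X"
  shows "replicate m a \<in> pint (mark M m X I) v x \<longleftrightarrow> I v x a"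
proof -
  have "replicate m a \<notin> pint M v x"
    using model_pint[OF M, of "replicate m a" v x] m by auto
  moreover have "replicate m a = replicate m b \<longleftrightarrow> a = b" for b using assms(1) by (cases m) auto
  ultimately show ?thesis using assms by (auto simp: mark_def)
qed

end


section \<open>Limits of marked expansions\<close>

lemma star_compactE:
  assumes "star_compact L" "is_sig \<Theta>" "\<Gamma> \<subseteq> Sen L \<Theta>" "\<Delta> \<subseteq> Sen L \<Theta>"
    and "\<And>\<Gamma>' \<Delta>'. finite \<Gamma>' \<Longrightarrow> finite \<Delta>' \<Longrightarrow> \<Gamma>' \<subseteq> \<Gamma> \<Longrightarrow> \<Delta>' \<subseteq> \<Delta> \<Longrightarrow>
      \<exists>(M, w)\<in>Str L \<Theta>. (\<forall>\<phi>\<in>\<Gamma>'. Sat L M w \<phi>) \<and> (\<forall>\<phi>\<in>\<Delta>'. \<not> Sat L M w \<phi>)"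
  obtains M w where "(M, w) \<in> Str L \<Theta>" "\<And>\<phi>. \<phi> \<in> \<Gamma> \<Longrightarrow> Sat L M w \<phi>" "\<And>\<phi>. \<phi> \<in> \<Delta> \<Longrightarrow> \<not> Sat L M w \<phi>"
proof -
  have "\<exists>(M, w)\<in>Str L \<Theta>. (\<forall>\<phi>\<in>\<Gamma>. Sat L M w \<phi>) \<and> (\<forall>\<phi>\<in>\<Delta>. \<not> Sat L M w \<phi>)"
    using assms(2-5) by (intro assms(1)[unfolded star_compact_def, rule_format]) simp
  then show thesis using that by auto
qed

lemma (in extension_logic) ex_proper_tree_limit:
  assumes compact: "star_compact L" and sig: "is_sig \<Theta>"
    and \<Omega>: "\<And>F :: 'f set. finite F \<Longrightarrow> \<Omega> F \<noteq> {}" "\<And>F F'. F \<subseteq> F' \<Longrightarrow> \<Omega> F' \<subseteq> \<Omega> F"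
      "\<And>F M. M \<in> \<Omega> F \<Longrightarrow> (M, r) \<in> Str L \<Theta>"
    and \<nu>: "\<nu> \<in> Sen L \<Theta>" "\<And>F M. M \<in> \<Omega> F \<Longrightarrow> \<not> Sat L M r \<nu>"
  obtains N n where "(N, n) \<in> Str L \<Theta>" "proper_tree (has_eq K) N n" "\<not> Sat L N n \<nu>"
    "\<And>F \<chi>. finite F \<Longrightarrow> \<chi> \<in> Sen L \<Theta> \<Longrightarrow> (\<And>M. M \<in> \<Omega> F \<Longrightarrow> Sat L M r \<chi>) \<Longrightarrow> Sat L N n \<chi>"
proof -
  define T where "T = {\<chi> \<in> Sen L \<Theta>. \<exists>F. finite F \<and> (\<forall>M\<in>\<Omega> F. Sat L M r \<chi>)}"
  obtain N0 n0 where N0: "(N0, n0) \<in> Str L \<Theta>" "\<And>\<phi>. \<phi> \<in> T \<Longrightarrow> Sat L N0 n0 \<phi>" "\<And>\<phi>. \<phi> \<in> {\<nu>} \<Longrightarrow> \<not> Sat L N0 n0 \<phi>"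
  proof (rule star_compactE[OF compact sig, of T "{\<nu>}"])
    fix \<Gamma> \<Delta> assume fin: "finite \<Gamma>" and sub: "\<Gamma> \<subseteq> T" "\<Delta> \<subseteq> {\<nu>}"
    have "\<forall>\<chi>\<in>\<Gamma>. \<exists>F. finite F \<and> (\<forall>M\<in>\<Omega> F. Sat L M r \<chi>)" using sub(1) by (auto simp: T_def)
    from bchoice[OF this] obtain F where F: "\<forall>\<chi>\<in>\<Gamma>. finite (F \<chi>) \<and> (\<forall>M\<in>\<Omega> (F \<chi>). Sat L M r \<chi>)" by blast
    then have "finite (\<Union>\<chi>\<in>\<Gamma>. F \<chi>)" using fin by blast
    then obtain M where M: "M \<in> \<Omega> (\<Union>\<chi>\<in>\<Gamma>. F \<chi>)" using \<Omega>(1) by blast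
    have "Sat L M r \<chi>" if "\<chi> \<in> \<Gamma>" for \<chi>
      using F M \<Omega>(2)[of "F \<chi>" "\<Union>\<chi>\<in>\<Gamma>. F \<chi>"] that by blast
    then show "\<exists>(M, w)\<in>Str L \<Theta>. (\<forall>\<phi>\<in>\<Gamma>. Sat L M w \<phi>) \<and> (\<forall>\<phi>\<in>\<Delta>. \<not> Sat L M w \<phi>)"
      using \<Omega>(3)[OF M] \<nu>(2)[OF M] sub(2) by blast
  qed (use \<nu>(1) that in \<open>auto simp: T_def\<close>)
  obtain N n where N: "(N, n) \<in> Str L \<Theta>" "proper_tree (has_eq K) N n"
      "\<And>\<phi>. \<phi> \<in> Sen L \<Theta> \<Longrightarrow> Sat L N n \<phi> \<longleftrightarrow> Sat L N0 n0 \<phi>"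
    using ex_proper_tree[OF sig N0(1)] by blast
  show thesis
  proof (rule that[OF N(1,2)])
    show "\<not> Sat L N n \<nu>" using N(3)[OF \<nu>(1)] N0(3) by blast
    show "Sat L N n \<chi>" if "finite F" "\<chi> \<in> Sen L \<Theta>" "\<And>M. M \<in> \<Omega> F \<Longrightarrow> Sat L M r \<chi>" for F \<chi>
      using N(3) N0(2) that by (auto simp: T_def)
  qed
qed

datatype 'u marker =
  Image_of 'u | Above 'u | Not_below 'u | Realiser "'u request" | Not_below_realiser "'u request"

locale extension_step = extension_logic \<U> L K for \<U> :: "'u set" and L :: "('u, 's) logic" and K +
  fixes M :: "'u kmodel" and r :: 'u and \<Theta> :: "'u signature" and m :: nat
  assumes compact: "star_compact L" and sig: "is_sig \<Theta>" and fin: "finite_sig \<Theta>"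
    and SM: "(M, r) \<in> Str L \<Theta>" and tree: "proper_tree (has_eq K) M r"
    and m: "preds \<Theta> m = {}" "0 < m"
begin

lemmas M = Str_model[OF sig SM] and r = Str_wlds[OF sig SM]

lemma root_least: "v \<in> wlds M \<Longrightarrow> (r, v) \<in> acc M"
  using tree by (simp add: proper_tree_def tree_root_least)

definition open_requests :: "'u request set" where
  "open_requests = {\<rho> \<in> requests (has_eq K) \<Theta> M. finitely_solvable M \<rho>}"

lemma open_request: "\<rho> \<in> open_requests \<Longrightarrow> \<rho> \<in> requests (has_eq K) \<Theta> M"
  by (simp add: open_requests_def)

definition markers :: "'u marker set" where
  "markers = Image_of ` elems M \<union> Above ` wlds M \<union> Not_below ` wlds M \<union>
     Realiser ` open_requests \<union> Not_below_realiser ` open_requests"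

lemma markers_simps [simp]:
  "Image_of a \<in> markers \<longleftrightarrow> a \<in> elems M" "Above v \<in> markers \<longleftrightarrow> v \<in> wlds M"
  "Not_below v \<in> markers \<longleftrightarrow> v \<in> wlds M" "Realiser \<rho> \<in> markers \<longleftrightarrow> \<rho> \<in> open_requests"
  "Not_below_realiser \<rho> \<in> markers \<longleftrightarrow> \<rho> \<in> open_requests"
  by (auto simp: markers_def)

lemma tiny_open_requests: "tiny open_requests"
proof -
  let ?\<Phi> = "\<Union>k. formulas (has_eq K) \<Theta> k"
  let ?T = "(UNIV :: bool set) \<times> wlds M \<times> lists (elems M) \<times> Pow ?\<Phi> \<times> Pow ?\<Phi>"
  have "countable ?\<Phi>" using countable_formulas[OF fin] by blast
  then have "tiny ?T"
    using model_small_wlds[OF M] small_elems[OF M]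
    by (intro tiny_Sigma tiny_lists tiny_Pow_countable) (simp_all add: small_iff_tiny tiny_finite)
  moreover have "open_requests \<subseteq> (\<lambda>(l, w, \<alpha>, \<Gamma>, \<Delta>). Request l w \<alpha> \<Gamma> \<Delta>) ` ?T"
  proof
    fix \<rho> assume "\<rho> \<in> open_requests"
    then have \<rho>: "\<rho> \<in> requests (has_eq K) \<Theta> M" by (rule open_request)
    have "(is_local \<rho>, base \<rho>, params \<rho>, asserted \<rho>, refuted \<rho>) \<in> ?T"
      using request_base[OF \<rho>] request_params[OF \<rho>] request_formulas[OF \<rho>] model_dmn_elems[OF M]
      by (auto simp: in_lists_conv_set)
    then show "\<rho> \<in> (\<lambda>(l, w, \<alpha>, \<Gamma>, \<Delta>). Request l w \<alpha> \<Gamma> \<Delta>) ` ?T" by (rule rev_image_eqI) simp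
  qed
  ultimately show ?thesis by (rule tiny_subset[OF tiny_image])
qed

lemma tiny_markers: "tiny markers"
  unfolding markers_def using tiny_open_requests model_small_wlds[OF M] small_elems[OF M]
  by (intro tiny_Un tiny_image) (simp_all add: small_iff_tiny)

definition letter :: "'u marker \<Rightarrow> 'u" where
  "letter = code markers"

lemma inj_letter: "inj_on letter markers"
  unfolding letter_def by (rule inj_on_code[OF tiny_markers])

abbreviation \<Theta>' :: "'u signature" where
  "\<Theta>' \<equiv> mark_sig \<Theta> m (letter ` markers)"

lemma is_sig_\<Theta>': "is_sig \<Theta>'"
  using sig m(2) tiny_markers by (intro is_sig_mark_sig) (simp_all add: small_iff_tiny tiny_image)

lemma sub_sig_\<Theta>': "sub_sig \<Theta> \<Theta>'"
  by (rule sub_sig_mark_sig[OF m(1)])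

text \<open>Requests are solved only as far as the formulas in \<open>F\<close> are concerned; compactness takes \<open>F\<close> to the
  limit.\<close>

definition answers :: "'u fm set \<Rightarrow> ('u request \<Rightarrow> 'u \<times> 'u) \<Rightarrow> bool" where
  "answers F \<sigma> \<longleftrightarrow> (\<forall>\<rho>\<in>open_requests. solves M (restrict_request F \<rho>) (fst (\<sigma> \<rho>)) (snd (\<sigma> \<rho>)))"

lemma answersD: "answers F \<sigma> \<Longrightarrow> \<rho> \<in> open_requests \<Longrightarrow> solves M (restrict_request F \<rho>) (fst (\<sigma> \<rho>)) (snd (\<sigma> \<rho>))"
  by (simp add: answers_def)

lemma ex_answers:
  assumes "finite F" shows "\<exists>\<sigma>. answers F \<sigma>"
proof -
  have "\<forall>\<rho>\<in>open_requests. \<exists>x. solves M (restrict_request F \<rho>) (fst x) (snd x)"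
    using assms by (auto simp: open_requests_def finitely_solvable_def solvable_def)
  then show ?thesis unfolding answers_def by (rule bchoice)
qed

lemma answers_antimono: "answers F' \<sigma> \<Longrightarrow> F \<subseteq> F' \<Longrightarrow> answers F \<sigma>"
  by (auto simp: answers_def solves_def)

fun marked_by :: "('u request \<Rightarrow> 'u \<times> 'u) \<Rightarrow> 'u \<Rightarrow> 'u marker \<Rightarrow> 'u \<Rightarrow> bool" where
  "marked_by \<sigma> t (Image_of a) b \<longleftrightarrow> (home M a, t) \<in> acc M \<and> b = hom M (home M a) t a"
| "marked_by \<sigma> t (Above v) b \<longleftrightarrow> (v, t) \<in> acc M"
| "marked_by \<sigma> t (Not_below v) b \<longleftrightarrow> (t, v) \<notin> acc M"
| "marked_by \<sigma> t (Realiser \<rho>) b \<longleftrightarrow> (fst (\<sigma> \<rho>), t) \<in> acc M \<and> b = hom M (fst (\<sigma> \<rho>)) t (snd (\<sigma> \<rho>))"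
| "marked_by \<sigma> t (Not_below_realiser \<rho>) b \<longleftrightarrow> (t, fst (\<sigma> \<rho>)) \<notin> acc M"

lemma marked_by_persistent:
  assumes \<sigma>: "answers F \<sigma>" and k: "k \<in> markers" and tu: "(t, u) \<in> acc M" and b: "marked_by \<sigma> t k b"
  shows "marked_by \<sigma> u k (hom M t u b)"
proof (cases k)
  case (Image_of a)
  then have "a \<in> dmn M (home M a)" using k home_eq[OF M] by (auto simp: elems_def)
  then show ?thesis using Image_of b tu model_acc_trans[OF M] model_hom_comp[OF M] by auto
next
  case (Realiser \<rho>)
  then have "snd (\<sigma> \<rho>) \<in> dmn M (fst (\<sigma> \<rho>))" using k solves_dmn[OF answersD[OF \<sigma>]] by simp
  then show ?thesis using Realiser b tu model_acc_trans[OF M] model_hom_comp[OF M] by auto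
qed (use b tu model_acc_trans[OF M] in auto)

definition marked :: "('u request \<Rightarrow> 'u \<times> 'u) \<Rightarrow> 'u kmodel" where
  "marked \<sigma> = mark M m (letter ` markers) (\<lambda>t x. marked_by \<sigma> t (the_inv_into markers letter x))"

lemma marked_simps [simp]:
  "wlds (marked \<sigma>) = wlds M" "acc (marked \<sigma>) = acc M" "dmn (marked \<sigma>) = dmn M" "hom (marked \<sigma>) = hom M"
  "cint (marked \<sigma>) = cint M"
  by (simp_all add: marked_def)

lemma is_model_marked: "answers F \<sigma> \<Longrightarrow> is_model \<Theta>' (marked \<sigma>)"
  unfolding marked_def using marked_by_persistent
  by (intro is_model_mark[OF M m(1)]) (auto simp: the_inv_into_f_f[OF inj_letter])

lemma Str_marked: "answers F \<sigma> \<Longrightarrow> v \<in> wlds M \<Longrightarrow> (marked \<sigma>, v) \<in> Str L \<Theta>'"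
  unfolding Str_iff[OF is_sig_\<Theta>'] using is_model_marked Str_in_class[OF sig SM] by (simp add: marked_def)

lemma reduct_marked: "reduct (marked \<sigma>) \<Theta> = M"
  unfolding marked_def by (rule reduct_mark[OF M m(1)])

lemma holds_marked:
  assumes \<sigma>: "answers F \<sigma>" and \<psi>: "\<psi> \<in> formulas q \<Theta> (length as)" and v: "v \<in> wlds M"
    and as: "set as \<subseteq> dmn M v"
  shows "holds (marked \<sigma>) v (nth as) \<psi> \<longleftrightarrow> holds M v (nth as) \<psi>"
proof -
  have "bounded_morphism q \<Theta> (\<lambda>x. x) (\<lambda>x. x) (marked \<sigma>) v M"
    using morphism_reduct[OF is_model_marked[OF \<sigma>] _ sub_sig_\<Theta>', of q v] M by (simp add: reduct_marked)
  from morphism_holds_tuple[OF is_model_marked[OF \<sigma>] this \<psi>, of v] show ?thesis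
    using as model_acc_refl[OF M v] by simp
qed

lemma Sat_tuple_marked:
  assumes \<sigma>: "answers F \<sigma>" and v: "v \<in> wlds M" and names: "name_tuple (marked \<sigma>) v cs as"
    and \<phi>: "\<phi> \<in> Sen L (add_consts \<Theta> cs)"
  shows "Sat_tuple (marked \<sigma>) v cs as \<phi> \<longleftrightarrow> Sat_tuple M v cs as \<phi>"
  using Sat_tuple_reduct[OF sig is_sig_\<Theta>' sub_sig_\<Theta>' Str_marked[OF \<sigma> v] names \<phi>]
  by (simp add: reduct_marked)

definition bears :: "'u kmodel \<Rightarrow> 'u \<Rightarrow> 'u marker \<Rightarrow> 'u \<Rightarrow> bool" where
  "bears N t k b \<longleftrightarrow> replicate m b \<in> pint N t (letter k)"

definition world_bears :: "'u kmodel \<Rightarrow> 'u \<Rightarrow> 'u marker \<Rightarrow> bool" where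
  "world_bears N t k \<longleftrightarrow> (\<exists>b\<in>dmn N t. bears N t k b)"

definition elem_mark :: "'u marker \<Rightarrow> nat \<Rightarrow> 'u fm" where
  "elem_mark k i = Atom (letter k) (replicate m (Var i))"

definition world_mark :: "'u marker \<Rightarrow> 'u fm" where
  "world_mark k = Ex 0 (elem_mark k 0)"

lemma elem_mark_formulas [simp]: "k \<in> markers \<Longrightarrow> i < j \<Longrightarrow> elem_mark k i \<in> formulas q \<Theta>' j"
  by (auto simp: elem_mark_def formulas_def)

lemma world_mark_formulas [simp]: "k \<in> markers \<Longrightarrow> world_mark k \<in> formulas q \<Theta>' j"
  by (auto simp: world_mark_def elem_mark_def formulas_def)

lemma holds_elem_mark [simp]: "holds N t s (elem_mark k i) \<longleftrightarrow> bears N t k (s i)"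
  by (simp add: elem_mark_def bears_def)

lemma holds_world_mark [simp]: "holds N t s (world_mark k) \<longleftrightarrow> world_bears N t k"
  by (simp add: world_mark_def world_bears_def)

lemma bears_marked: "k \<in> markers \<Longrightarrow> b \<in> dmn M t \<Longrightarrow> bears (marked \<sigma>) t k b \<longleftrightarrow> marked_by \<sigma> t k b"
  unfolding bears_def marked_def
  using pint_mark_replicate[OF M m] the_inv_into_f_f[OF inj_letter] by simp

lemma bears_marked_Image_of:
  "a \<in> dmn M v \<Longrightarrow> b \<in> dmn M t \<Longrightarrow> bears (marked \<sigma>) t (Image_of a) b \<longleftrightarrow> (v, t) \<in> acc M \<and> b = hom M v t a"
  using model_dmn_elems[OF M] by (simp add: bears_marked home_eq[OF M])

lemma world_bears_marked:
  assumes "k \<in> markers" "t \<in> wlds M"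
  shows "world_bears (marked \<sigma>) t k \<longleftrightarrow> (\<exists>b\<in>dmn M t. marked_by \<sigma> t k b)"
  using assms by (simp add: world_bears_def bears_marked)

lemma
  assumes "t \<in> wlds M"
  shows world_bears_marked_Above: "v \<in> wlds M \<Longrightarrow> world_bears (marked \<sigma>) t (Above v) \<longleftrightarrow> (v, t) \<in> acc M"
    and world_bears_marked_Not_below:
      "v \<in> wlds M \<Longrightarrow> world_bears (marked \<sigma>) t (Not_below v) \<longleftrightarrow> (t, v) \<notin> acc M"
    and world_bears_marked_Not_below_realiser: "\<rho> \<in> open_requests \<Longrightarrow>
      world_bears (marked \<sigma>) t (Not_below_realiser \<rho>) \<longleftrightarrow> (t, fst (\<sigma> \<rho>)) \<notin> acc M"
  using assms model_dmn_nonempty[OF M] by (auto simp: world_bears_marked)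

end


locale marked_limit = extension_step \<U> L K M r \<Theta> m
  for \<U> :: "'u set" and L :: "('u, 's) logic" and K M r \<Theta> m +
  fixes N :: "'u kmodel" and n :: 'u
  assumes SN: "(N, n) \<in> Str L \<Theta>'" and tree_N: "proper_tree (has_eq K) N n"
    and not_below_root: "\<not> world_bears N n (Not_below r)"
    and limit: "finite F \<Longrightarrow> \<chi> \<in> Sen L \<Theta>' \<Longrightarrow> (\<And>\<sigma>. answers F \<sigma> \<Longrightarrow> Sat L (marked \<sigma>) r \<chi>) \<Longrightarrow> Sat L N n \<chi>"

lemma (in extension_step) ex_marked_limit: "\<exists>N n. marked_limit \<U> L K M r \<Theta> m N n"
proof -
  let ?\<psi> = "world_mark (Not_below r)"
  have \<psi>: "?\<psi> \<in> formulas (has_eq K) \<Theta>' 0" using r by simp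
  define \<nu> where "\<nu> = translate \<Theta>' [] ?\<psi>"
  have Sat_\<nu>: "Sat L A a \<nu> \<longleftrightarrow> world_bears A a (Not_below r)" if "(A, a) \<in> Str L \<Theta>'" for A a
    unfolding \<nu>_def using Sat_translate_sentence[OF is_sig_\<Theta>' that \<psi>] by simp
  have \<nu>: "\<nu> \<in> Sen L \<Theta>'" using translate_Sen[OF is_sig_\<Theta>', of ?\<psi> "[]"] \<psi> by (simp add: \<nu>_def)
  define \<Omega> where "\<Omega> F = marked ` {\<sigma>. answers F \<sigma>}" for F
  obtain N n where N: "(N, n) \<in> Str L \<Theta>'" "proper_tree (has_eq K) N n" "\<not> Sat L N n \<nu>"
    and lim: "\<And>F \<chi>. finite F \<Longrightarrow> \<chi> \<in> Sen L \<Theta>' \<Longrightarrow> (\<And>A. A \<in> \<Omega> F \<Longrightarrow> Sat L A r \<chi>) \<Longrightarrow> Sat L N n \<chi>"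
  proof (rule ex_proper_tree_limit[OF compact is_sig_\<Theta>', of \<Omega> r \<nu>])
    show "\<Omega> F \<noteq> {}" if "finite F" for F using ex_answers[OF that] by (auto simp: \<Omega>_def)
    show "\<Omega> F' \<subseteq> \<Omega> F" if "F \<subseteq> F'" for F F' using answers_antimono[OF _ that] by (auto simp: \<Omega>_def)
    show Str: "(A, r) \<in> Str L \<Theta>'" if "A \<in> \<Omega> F" for F A using that Str_marked r by (auto simp: \<Omega>_def)
    show "\<not> Sat L A r \<nu>" if "A \<in> \<Omega> F" for F A
      using that Sat_\<nu>[OF Str[OF that]] model_acc_refl[OF M r] world_bears_marked_Not_below[OF r r]
      by (auto simp: \<Omega>_def)
  qed (use \<nu> in blast)+
  have "marked_limit \<U> L K M r \<Theta> m N n"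
  proof
    show "Sat L N n \<chi>" if "finite F" "\<chi> \<in> Sen L \<Theta>'" "\<And>\<sigma>. answers F \<sigma> \<Longrightarrow> Sat L (marked \<sigma>) r \<chi>" for F \<chi>
      using that(3) by (intro lim[OF that(1,2)]) (auto simp: \<Omega>_def)
  qed (use N Sat_\<nu>[OF N(1)] in auto)
  then show ?thesis by blast
qed

context marked_limit
begin

lemmas N = Str_model[OF is_sig_\<Theta>' SN] and n = Str_wlds[OF is_sig_\<Theta>' SN]

lemma limit_root_least: "t \<in> wlds N \<Longrightarrow> (n, t) \<in> acc N"
  using tree_N by (simp add: proper_tree_def tree_root_least)

lemma limit_entails:
  assumes F: "finite F" and cs: "distinct cs" "set cs \<inter> csts \<Theta> = {}"
    and \<phi>: "\<phi> \<in> Sen L (add_consts \<Theta>' cs)" and \<psi>: "\<psi> \<in> Sen L (add_consts \<Theta>' cs)"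
    and step: "\<And>\<sigma>. answers F \<sigma> \<Longrightarrow> entails_above (marked \<sigma>) r cs \<phi> \<psi>"
  shows "entails_above N n cs \<phi> \<psi>"
proof -
  obtain \<chi> where \<chi>: "\<chi> \<in> Sen L \<Theta>'" "\<And>M w. (M, w) \<in> Str L \<Theta>' \<Longrightarrow> Sat L M w \<chi> \<longleftrightarrow> entails_above M w cs \<phi> \<psi>"
    using ex_entailment_sentence[OF is_sig_\<Theta>' cs(1) _ \<phi> \<psi>] cs(2) by auto
  have "Sat L N n \<chi>" using step Str_marked[OF _ r] by (intro limit[OF F \<chi>(1)]) (simp add: \<chi>(2))
  then show ?thesis using \<chi>(2)[OF SN] by simp
qed

lemma limit_Sat_tuple:
  assumes F: "finite F" and \<phi>: "\<phi> \<in> Sen L (add_consts \<Theta>' cs)" and \<psi>: "\<psi> \<in> Sen L (add_consts \<Theta>' cs)"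
    and t: "t \<in> wlds N" and names: "name_tuple N t cs bs" and sat: "Sat_tuple N t cs bs \<phi>"
    and step: "\<And>\<sigma> v as. answers F \<sigma> \<Longrightarrow> v \<in> wlds M \<Longrightarrow> name_tuple (marked \<sigma>) v cs as \<Longrightarrow>
      Sat_tuple (marked \<sigma>) v cs as \<phi> \<Longrightarrow> Sat_tuple (marked \<sigma>) v cs as \<psi>"
  shows "Sat_tuple N t cs bs \<psi>"
proof -
  have "entails_above (marked \<sigma>) r cs \<phi> \<psi>" if "answers F \<sigma>" for \<sigma>
    using step[OF that] model_acc_wlds[OF M] by (simp add: entails_above_def)
  then have "entails_above N n cs \<phi> \<psi>"
    using limit_entails[OF F name_tupleD(1)[OF names] _ \<phi> \<psi>] name_tupleD(2)[OF names] model_sgn[OF N]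
    by simp
  then show ?thesis using limit_root_least[OF t] names sat by (simp add: entails_above_def)
qed

lemma limit_holds:
  assumes F: "finite F" and \<phi>: "\<phi> \<in> formulas (has_eq K) \<Theta>' (length bs)"
    and \<psi>: "\<psi> \<in> formulas (has_eq K) \<Theta>' (length bs)"
    and t: "t \<in> wlds N" and bs: "set bs \<subseteq> dmn N t" and holds: "holds N t (nth bs) \<phi>"
    and step: "\<And>\<sigma> v as. answers F \<sigma> \<Longrightarrow> v \<in> wlds M \<Longrightarrow> length as = length bs \<Longrightarrow> set as \<subseteq> dmn M v \<Longrightarrow>
      holds (marked \<sigma>) v (nth as) \<phi> \<Longrightarrow> holds (marked \<sigma>) v (nth as) \<psi>"
  shows "holds N t (nth bs) \<psi>"
proof -
  let ?cs = "map (fresh_consts \<Theta>') [0..<length bs]"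
  have cs: "distinct ?cs" "set ?cs \<inter> csts \<Theta>' = {}"
    using name_tupleD[OF name_tuple_map_consts[OF fresh_consts_fresh(1)[OF is_sig_\<Theta>'], of N bs t]] bs
      fresh_consts_fresh(2)[OF is_sig_\<Theta>'] model_sgn[OF N] by auto
  have formulas: "\<phi> \<in> formulas (has_eq K) \<Theta>' (length ?cs)" "\<psi> \<in> formulas (has_eq K) \<Theta>' (length ?cs)"
    using \<phi> \<psi> by simp_all
  have "entails_above (marked \<sigma>) r ?cs (translate \<Theta>' ?cs \<phi>) (translate \<Theta>' ?cs \<psi>)" if "answers F \<sigma>" for \<sigma>
    unfolding entails_above_translate[OF is_sig_\<Theta>' Str_marked[OF that r] cs formulas]
    using step[OF that] model_acc_wlds[OF M] by (simp add: fm_entails_above_def)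
  then have "entails_above N n ?cs (translate \<Theta>' ?cs \<phi>) (translate \<Theta>' ?cs \<psi>)"
    using cs(2) translate_Sen[OF is_sig_\<Theta>' formulas(1)] translate_Sen[OF is_sig_\<Theta>' formulas(2)]
    by (intro limit_entails[OF F cs(1)]) simp_all
  then show ?thesis
    unfolding entails_above_translate[OF is_sig_\<Theta>' SN cs formulas]
    using limit_root_least[OF t] bs holds by (simp add: fm_entails_above_def)
qed

lemma limit_world_bears:
  assumes "finite F" "k \<in> markers" "k' \<in> markers" "t \<in> wlds N" "world_bears N t k"
    and "\<And>\<sigma> v. answers F \<sigma> \<Longrightarrow> v \<in> wlds M \<Longrightarrow> world_bears (marked \<sigma>) v k \<Longrightarrow> world_bears (marked \<sigma>) v k'"
  shows "world_bears N t k'"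
  using limit_holds[of F "world_mark k" "[]" "world_mark k'" t] assms by simp

lemma bears_persistent:
  assumes "bears N t k b" "(t, u) \<in> acc N" shows "bears N u k (hom N t u b)"
  using model_pint_hom[OF N assms(2)] assms(1) unfolding bears_def by (metis map_replicate)

lemma world_bears_persistent:
  assumes "world_bears N t k" "(t, u) \<in> acc N" shows "world_bears N u k"
  using assms bears_persistent model_hom[OF N] unfolding world_bears_def by blast

lemma ex_successor_limit:
  assumes uv: "(u, v) \<in> acc M" and t: "t \<in> wlds N" "\<not> world_bears N t (Not_below u)"
  shows "\<exists>t'. (t, t') \<in> acc N \<and> world_bears N t' (Above v) \<and> \<not> world_bears N t' (Not_below v)"
proof (rule ccontr)
  assume none: "\<not> ?thesis"
  have wlds: "u \<in> wlds M" "v \<in> wlds M" using model_acc_wlds[OF M uv] by auto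
  have "holds N t (nth []) (world_mark (Not_below u))"
  proof (rule limit_holds[of "{}" "Imp (world_mark (Above v)) (world_mark (Not_below v))"])
    fix \<sigma> x as assume x: "x \<in> wlds M"
      and "holds (marked \<sigma>) x (nth as) (Imp (world_mark (Above v)) (world_mark (Not_below v)))"
    then have "(x, v) \<notin> acc M"
      using wlds model_acc_refl[OF M wlds(2)]
      by (auto simp: world_bears_marked_Above world_bears_marked_Not_below)
    then show "holds (marked \<sigma>) x (nth as) (world_mark (Not_below u))"
      using x wlds uv model_acc_trans[OF M] by (auto simp: world_bears_marked_Not_below)
  qed (use t none wlds in auto)
  then show False using t(2) by simp
qed

lemma above_root: "world_bears N n (Above r)"
proof -
  have "holds N n (nth []) (world_mark (Above r))"
    by (rule limit_holds[of "{}" "Imp Bot Bot"])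
      (use n r root_least in \<open>auto simp: world_bears_marked_Above\<close>)
  then show ?thesis by simp
qed

lemma above_incomparable:
  assumes "v \<in> wlds M" "u \<in> wlds M" "(v, u) \<notin> acc M" "t \<in> wlds N" "world_bears N t (Above v)"
  shows "world_bears N t (Not_below u)"
  by (rule limit_world_bears[of "{}" "Above v"])
    (use assms model_acc_trans[OF M] in \<open>auto simp: world_bears_marked_Above world_bears_marked_Not_below\<close>)

lemma ex_image:
  assumes a: "a \<in> dmn M v" and t: "t \<in> wlds N" "world_bears N t (Above v)"
  shows "\<exists>x\<in>dmn N t. bears N t (Image_of a) x"
proof -
  note v = model_dmn_wlds[OF M a]
  have "world_bears N t (Image_of a)"
  proof (rule limit_world_bears[of "{}" "Above v"])
    fix \<sigma> y assume y: "y \<in> wlds M" "world_bears (marked \<sigma>) y (Above v)"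
    then have vy: "(v, y) \<in> acc M" using v by (simp add: world_bears_marked_Above)
    then show "world_bears (marked \<sigma>) y (Image_of a)"
      using model_hom[OF M vy a] unfolding world_bears_def by (auto simp: bears_marked_Image_of[OF a])
  qed (use v t model_dmn_elems[OF M a] in simp_all)
  then show ?thesis by (simp add: world_bears_def)
qed

lemma image_hom:
  assumes vu: "(v, u) \<in> acc M" and a: "a \<in> dmn M v" and x: "x \<in> dmn N t" "bears N t (Image_of a) x"
    and above: "world_bears N t (Above u)"
  shows "bears N t (Image_of (hom M v u a)) x"
proof -
  have u: "u \<in> wlds M" using model_acc_wlds[OF M vu] by blast
  note ha = model_hom[OF M vu a]
  have "holds N t (nth [x]) (elem_mark (Image_of (hom M v u a)) 0)"
  proof (rule limit_holds[of "{}" "And (elem_mark (Image_of a) 0) (world_mark (Above u))"])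
    fix \<sigma> y as assume y: "y \<in> wlds M" "length as = length [x]" "set as \<subseteq> dmn M y"
      and holds: "holds (marked \<sigma>) y (nth as) (And (elem_mark (Image_of a) 0) (world_mark (Above u)))"
    have as0: "as ! 0 \<in> dmn M y" using y by auto
    then have "as ! 0 = hom M v y a" "(u, y) \<in> acc M"
      using holds u y(1) by (simp_all add: bears_marked_Image_of[OF a] world_bears_marked_Above)
    then show "holds (marked \<sigma>) y (nth as) (elem_mark (Image_of (hom M v u a)) 0)"
      using as0 model_hom_comp[OF M vu _ a] by (simp add: bears_marked_Image_of[OF ha])
  qed (use a ha u x above model_dmn_elems[OF M] model_dmn_wlds[OF N] in auto)
  then show ?thesis by simp
qed

lemma image_cint:
  assumes c: "c \<in> csts \<Theta>"
  shows "bears N n (Image_of (cint M r c)) (cint N n c)"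
proof -
  let ?a = "cint M r c" and ?\<psi> = "Atom (letter (Image_of (cint M r c))) (replicate m (Cst c))"
  note a = model_cint[OF M r c]
  have "holds N n (nth []) ?\<psi>"
  proof (rule limit_holds[of "{}" "Imp Bot Bot"])
    fix \<sigma> v as assume v: "v \<in> wlds M"
    then have "bears (marked \<sigma>) v (Image_of ?a) (cint M v c)"
      using root_least[OF v] model_cint[OF M v c] model_cint_hom[OF M root_least[OF v] c]
      by (simp add: bears_marked_Image_of[OF a])
    then show "holds (marked \<sigma>) v (nth as) ?\<psi>" by (simp add: bears_def)
  qed (use n c a model_dmn_elems[OF M] in \<open>auto simp: formulas_def\<close>)
  then show ?thesis by (simp add: bears_def)
qed

lemma image_merged:
  assumes ab: "a \<in> dmn M v" "b \<in> dmn M v" "a \<noteq> b"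
    and x: "x \<in> dmn N t" "bears N t (Image_of a) x" "bears N t (Image_of b) x"
  shows "world_bears N t (Not_below v)"
proof -
  note v = model_dmn_wlds[OF M ab(1)]
  have "holds N t (nth [x]) (world_mark (Not_below v))"
  proof (rule limit_holds[of "{}" "And (elem_mark (Image_of a) 0) (elem_mark (Image_of b) 0)"])
    fix \<sigma> y as assume y: "y \<in> wlds M" "length as = length [x]" "set as \<subseteq> dmn M y"
      and "holds (marked \<sigma>) y (nth as) (And (elem_mark (Image_of a) 0) (elem_mark (Image_of b) 0))"
    moreover have "as ! 0 \<in> dmn M y" using y by auto
    ultimately have "(v, y) \<in> acc M" "hom M v y a = hom M v y b"
      by (auto simp: bears_marked_Image_of[OF ab(1)] bears_marked_Image_of[OF ab(2)])
    then have "(y, v) \<notin> acc M"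
      using model_acc_antisym[OF M] model_hom_id[OF M ab(1)] model_hom_id[OF M ab(2)] ab(3) by metis
    then show "holds (marked \<sigma>) y (nth as) (world_mark (Not_below v))"
      using v y(1) by (simp add: world_bears_marked_Not_below)
  qed (use ab v x model_dmn_elems[OF M] model_dmn_wlds[OF N] in auto)
  then show ?thesis by simp
qed

lemma image_unique:
  assumes "has_eq K" and a: "a \<in> dmn M v" and "x \<in> dmn N t" "y \<in> dmn N t"
    and "bears N t (Image_of a) x" "bears N t (Image_of a) y"
  shows "x = y"
proof -
  have eq: "Eq (Var 0) (Var 1) \<in> formulas (has_eq K) \<Theta>' (length [x, y])"
    using assms(1) by (simp add: formulas_def)
  have "holds N t (nth [x, y]) (Eq (Var 0) (Var 1))"
  proof (rule limit_holds[of "{}" "And (elem_mark (Image_of a) 0) (elem_mark (Image_of a) 1)"])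
    fix \<sigma> v as assume "v \<in> wlds M" "length as = length [x, y]" "set as \<subseteq> dmn M v"
      and "holds (marked \<sigma>) v (nth as) (And (elem_mark (Image_of a) 0) (elem_mark (Image_of a) 1))"
    moreover from this have "as ! 0 \<in> dmn M v" "as ! 1 \<in> dmn M v" by auto
    ultimately show "holds (marked \<sigma>) v (nth as) (Eq (Var 0) (Var 1))"
      by (simp add: bears_marked_Image_of[OF a])
  qed (use assms eq model_dmn_elems[OF M] model_dmn_wlds[OF N] in auto)
  then show ?thesis by simp
qed

lemma marked_tree_limit:
  "marked_tree \<Theta> \<Theta>' M N r n (has_eq K) (\<lambda>v t. world_bears N t (Above v)) (\<lambda>v t. world_bears N t (Not_below v))
     (\<lambda>a t. bears N t (Image_of a))"
proof
  show "csts \<Theta> \<subseteq> csts \<Theta>'" by simp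
qed (rule M tree N n world_bears_persistent bears_persistent above_root not_below_root ex_successor_limit
    above_incomparable ex_image image_hom image_cint image_merged image_unique; assumption)+

end

locale marked_embedding = marked_limit \<U> L K M r \<Theta> m N n
  for \<U> :: "'u set" and L :: "('u, 's) logic" and K M r \<Theta> m N n +
  fixes f g :: "'u \<Rightarrow> 'u"
  assumes f_root: "f r = n" and emb: "embedding \<Theta> f g M N"
    and above_image: "v \<in> wlds M \<Longrightarrow> world_bears N (f v) (Above v)"
    and not_below_image: "v \<in> wlds M \<Longrightarrow> \<not> world_bears N (f v) (Not_below v)"
    and bears_image: "a \<in> dmn M v \<Longrightarrow> bears N (f v) (Image_of a) (g a)"

lemma (in marked_limit) ex_marked_embedding: "\<exists>f g. marked_embedding \<U> L K M r \<Theta> m N n f g"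
proof -
  interpret T: marked_tree \<Theta> \<Theta>' M N r n "has_eq K" "\<lambda>v t. world_bears N t (Above v)"
      "\<lambda>v t. world_bears N t (Not_below v)" "\<lambda>a t. bears N t (Image_of a)"
    by (rule marked_tree_limit)
  obtain f g where "f r = n" "embedding \<Theta> f g M N" and adm: "\<And>v. v \<in> wlds M \<Longrightarrow> T.admissible v (f v) g"
    using T.ex_embedding by blast
  moreover have "bears N (f v) (Image_of a) (g a)" if "a \<in> dmn M v" for a v
    using T.admissible_image[OF adm[OF model_dmn_wlds[OF M that]] that] by blast
  ultimately have "marked_embedding \<U> L K M r \<Theta> m N n f g"
    using T.admissible_above[OF adm] by unfold_locales
  then show ?thesis by blast
qed

context marked_embedding
begin

lemma image_wlds: "v \<in> wlds M \<Longrightarrow> f v \<in> wlds N"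
  by (rule embedding_wlds[OF emb])

lemma Str_image: "v \<in> wlds M \<Longrightarrow> (N, f v) \<in> Str L \<Theta>'"
  by (rule Str_change_point[OF is_sig_\<Theta>' SN image_wlds])

lemma image_tuple: "set as \<subseteq> dmn M v \<Longrightarrow> set (map g as) \<subseteq> dmn N (f v)"
  using embedding_dmn[OF emb] by auto

definition position :: "'u \<Rightarrow> 'u list \<Rightarrow> 'u fm" where
  "position v as =
     BigAnd (world_mark (Above v) # map (\<lambda>i. elem_mark (Image_of (as ! i)) i) [0..<length as])"

lemma position_formulas:
  assumes "v \<in> wlds M" "set as \<subseteq> dmn M v" "length as \<le> k"
  shows "position v as \<in> formulas q \<Theta>' k"
proof -
  have "as ! i \<in> elems M" if "i < length as" for i
    using that assms(2) nth_mem model_dmn_elems[OF M] by blast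
  then show ?thesis
    using assms(1,3) by (auto simp: position_def simp del: BigAnd.simps intro!: elem_mark_formulas)
qed

lemma holds_position:
  "holds A t s (position v as) \<longleftrightarrow>
    world_bears A t (Above v) \<and> (\<forall>i<length as. bears A t (Image_of (as ! i)) (s i))"
  by (auto simp: position_def simp del: BigAnd.simps)

lemma holds_position_marked:
  assumes v: "v \<in> wlds M" and as: "set as \<subseteq> dmn M v" and t: "t \<in> wlds M"
    and bs: "length as \<le> length bs" "set bs \<subseteq> dmn M t"
    and holds: "holds (marked \<sigma>) t (nth bs) (position v as)"
  shows "(v, t) \<in> acc M" "take (length as) bs = map (hom M v t) as"
proof -
  show "(v, t) \<in> acc M" using holds v t by (simp add: holds_position world_bears_marked_Above)
  have "bs ! i = hom M v t (as ! i)" if i: "i < length as" for i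
  proof -
    have "as ! i \<in> dmn M v" "bs ! i \<in> dmn M t" using i as bs by (auto simp: subset_iff)
    from bears_marked_Image_of[OF this] show ?thesis using holds i by (auto simp: holds_position)
  qed
  then show "take (length as) bs = map (hom M v t) as" using bs(1) by (intro nth_equalityI) auto
qed

lemma holds_position_limit:
  assumes v: "v \<in> wlds M" and as: "set as \<subseteq> dmn M v" and u: "(f v, u) \<in> acc N"
  shows "holds N u (nth (map (hom N (f v) u) (map g as) @ cs)) (position v as)"
proof -
  have "bears N u (Image_of (as ! i)) (hom N (f v) u (g (as ! i)))" if "i < length as" for i
    using as that by (intro bears_persistent[OF bears_image u]) (auto simp: subset_iff)
  then show ?thesis
    using world_bears_persistent[OF above_image[OF v] u] by (simp add: holds_position nth_append)
qed

definition position_sentence :: "'u \<Rightarrow> 'u list \<Rightarrow> 'u list \<Rightarrow> 's" where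
  "position_sentence v cs as = translate \<Theta>' cs (position v as)"

context
  fixes v cs as \<phi>
  assumes v: "v \<in> wlds M" and names: "name_tuple M v cs as" and \<phi>: "\<phi> \<in> Sen L (add_consts \<Theta> cs)"
begin

lemmas tuple_dmn = name_tupleD(4)[OF names]

lemma name_tuple_image: "name_tuple N (f v) cs (map g as)"
  using names image_tuple[OF tuple_dmn] model_sgn[OF M] model_sgn[OF N]
  by (simp add: name_tuple_def)

lemma Sen_marked: "\<phi> \<in> Sen L (add_consts \<Theta>' cs)"
  using Sen_mono[OF is_sig_add_consts[OF sig] is_sig_add_consts[OF is_sig_\<Theta>'] _ \<phi>] sub_sig_\<Theta>'
  by (simp add: sub_sig_def)

lemma position_formula: "position v as \<in> formulas (has_eq K) \<Theta>' (length cs)"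
  using position_formulas[OF v tuple_dmn] name_tupleD(3)[OF names] by simp

lemma position_sentence_Sen: "position_sentence v cs as \<in> Sen L (add_consts \<Theta>' cs)"
  unfolding position_sentence_def by (rule translate_Sen[OF is_sig_\<Theta>' position_formula])

lemma Sat_position_sentence_limit: "Sat_tuple N (f v) cs (map g as) (position_sentence v cs as)"
proof -
  have "holds N (f v) (nth (map g as)) (position v as)"
    using holds_position_limit[OF v tuple_dmn model_acc_refl[OF N image_wlds[OF v]], of "[]"]
      map_hom_id[OF N image_tuple[OF tuple_dmn]] by (simp del: map_map)
  then show ?thesis
    unfolding position_sentence_def
    using Sat_tuple_translate[OF is_sig_\<Theta>' position_formula Str_image[OF v] name_tuple_image] by simp
qed

lemma Sat_position_sentence_marked:
  assumes \<sigma>: "answers F \<sigma>" and u: "u \<in> wlds M" and bs: "name_tuple (marked \<sigma>) u cs bs"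
    and sat: "Sat_tuple (marked \<sigma>) u cs bs (position_sentence v cs as)"
  shows "(v, u) \<in> acc M" "bs = map (hom M v u) as"
proof -
  have "holds (marked \<sigma>) u (nth bs) (position v as)"
    using sat Sat_tuple_translate[OF is_sig_\<Theta>' position_formula Str_marked[OF \<sigma> u] bs]
    by (simp add: position_sentence_def)
  from holds_position_marked[OF v tuple_dmn u _ _ this] show "(v, u) \<in> acc M" "bs = map (hom M v u) as"
    using name_tupleD[OF bs] name_tupleD(3)[OF names] by simp_all
qed

lemma Sat_tuple_embeddingI:
  assumes sat: "Sat_tuple M v cs as \<phi>"
  shows "Sat_tuple N (f v) cs (map g as) \<phi>"
proof (rule limit_Sat_tuple[of "{}" "position_sentence v cs as"])
  fix \<sigma> u bs assume \<sigma>: "answers {} \<sigma>" and u: "u \<in> wlds M" and bs: "name_tuple (marked \<sigma>) u cs bs"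
    and "Sat_tuple (marked \<sigma>) u cs bs (position_sentence v cs as)"
  then show "Sat_tuple (marked \<sigma>) u cs bs \<phi>"
    using Sat_position_sentence_marked[OF \<sigma> u bs] Sat_tuple_marked[OF \<sigma> u bs \<phi>]
      Sat_tuple_persistent[OF sig Str_change_point[OF sig SM v] _ names \<phi> sat] by simp
qed (simp_all add: position_sentence_Sen Sen_marked image_wlds[OF v] name_tuple_image Sat_position_sentence_limit)

lemma Sat_tuple_embeddingD:
  assumes sat: "Sat_tuple N (f v) cs (map g as) \<phi>"
  shows "Sat_tuple M v cs as \<phi>"
proof (rule ccontr)
  assume not_sat: "\<not> Sat_tuple M v cs as \<phi>"
  have Nb: "world_mark (Not_below v) \<in> formulas (has_eq K) \<Theta>' (length cs)" using v by simp
  define \<kappa> where "\<kappa> = translate \<Theta>' cs (world_mark (Not_below v))"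
  obtain \<mu> where \<mu>: "\<mu> \<in> Sen L (add_consts \<Theta>' cs)"
    "\<And>A a. (A, a) \<in> Str L (add_consts \<Theta>' cs) \<Longrightarrow>
      Sat L A a \<mu> \<longleftrightarrow> Sat L A a (position_sentence v cs as) \<and> Sat L A a \<phi>"
    using ex_and_sentence[OF is_sig_add_consts[OF is_sig_\<Theta>'] position_sentence_Sen Sen_marked] by blast
  have "Sat_tuple N (f v) cs (map g as) \<kappa>"
  proof (rule limit_Sat_tuple[of "{}" \<mu>, OF _ \<mu>(1) _ image_wlds[OF v] name_tuple_image])
    show "\<kappa> \<in> Sen L (add_consts \<Theta>' cs)" unfolding \<kappa>_def by (rule translate_Sen[OF is_sig_\<Theta>' Nb])
    show "Sat_tuple N (f v) cs (map g as) \<mu>"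
      using \<mu>(2)[OF Str_cone_exp_point[OF is_sig_\<Theta>' Str_image[OF v] name_tuple_image]]
        Sat_position_sentence_limit sat by simp
    fix \<sigma> u bs assume \<sigma>: "answers {} \<sigma>" and u: "u \<in> wlds M" and bs: "name_tuple (marked \<sigma>) u cs bs"
      and "Sat_tuple (marked \<sigma>) u cs bs \<mu>"
    then have "Sat_tuple (marked \<sigma>) u cs bs (position_sentence v cs as)"
      and sat_u: "Sat_tuple (marked \<sigma>) u cs bs \<phi>"
      using \<mu>(2)[OF Str_cone_exp_point[OF is_sig_\<Theta>' Str_marked[OF \<sigma> u] bs]] by simp_all
    note image = Sat_position_sentence_marked[OF \<sigma> u bs this(1)]
    have "(u, v) \<notin> acc M"
    proof
      assume "(u, v) \<in> acc M"
      then have "u = v" using model_acc_antisym[OF M] image(1) by blast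
      then show False
        using not_sat sat_u Sat_tuple_marked[OF \<sigma> u bs \<phi>] image(2) map_hom_id[OF M tuple_dmn] by simp
    qed
    then show "Sat_tuple (marked \<sigma>) u cs bs \<kappa>"
      unfolding \<kappa>_def Sat_tuple_translate[OF is_sig_\<Theta>' Nb Str_marked[OF \<sigma> u] bs]
      using v u by (simp add: world_bears_marked_Not_below)
  qed simp
  then show False
    unfolding \<kappa>_def Sat_tuple_translate[OF is_sig_\<Theta>' Nb Str_image[OF v] name_tuple_image]
    using not_below_image[OF v] by simp
qed

end

lemma elementary_embedding: "elementary_embedding \<Theta> f g M (reduct N \<Theta>)"
  unfolding elementary_embedding_def
proof (intro conjI ballI allI impI)
  show "embedding \<Theta> f g M (reduct N \<Theta>)"
    using emb by (simp add: embedding_def)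
  fix v cs as \<phi> assume v: "v \<in> wlds M" and names: "name_tuple M v cs as"
    and \<phi>: "\<phi> \<in> Sen L (add_consts \<Theta> cs)"
  have "name_tuple N (f v) cs (map g as)"
    using names name_tupleD(4)[OF names] image_tuple model_sgn[OF M] model_sgn[OF N]
    by (simp add: name_tuple_def)
  then show "Sat_tuple M v cs as \<phi> \<longleftrightarrow> Sat_tuple (reduct N \<Theta>) (f v) cs (map g as) \<phi>"
    using Sat_tuple_reduct[OF sig is_sig_\<Theta>' sub_sig_\<Theta>' Str_image[OF v] _ \<phi>]
      Sat_tuple_embeddingI[OF v names \<phi>] Sat_tuple_embeddingD[OF v names \<phi>] by blast
qed

context
  fixes \<rho>
  assumes \<rho>: "\<rho> \<in> open_requests"
begin

lemma ex_realiser_local: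
  assumes "is_local \<rho>"
  obtains b where "b \<in> dmn N (f (base \<rho>))" "bears N (f (base \<rho>)) (Realiser \<rho>) b"
    "\<not> world_bears N (f (base \<rho>)) (Not_below_realiser \<rho>)"
proof -
  note base = request_base[OF open_request[OF \<rho>]]
  have "world_bears N (f (base \<rho>)) (Realiser \<rho>)"
  proof (rule limit_world_bears[of "{}" "Above (base \<rho>)"])
    fix \<sigma> v assume \<sigma>: "answers {} \<sigma>" and v: "v \<in> wlds M" "world_bears (marked \<sigma>) v (Above (base \<rho>))"
    note sol = answersD[OF \<sigma> \<rho>]
    have "(fst (\<sigma> \<rho>), v) \<in> acc M"
      using solves_local[OF sol] assms v base by (simp add: world_bears_marked_Above)
    then show "world_bears (marked \<sigma>) v (Realiser \<rho>)"
      using \<rho> v(1) model_hom[OF M] solves_dmn[OF sol] by (auto simp: world_bears_marked)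
  qed (use \<rho> base image_wlds above_image in simp_all)
  moreover have "world_bears N (f (base \<rho>)) (Not_below (base \<rho>))"
    if "world_bears N (f (base \<rho>)) (Not_below_realiser \<rho>)"
  proof (rule limit_world_bears[of "{}" "Not_below_realiser \<rho>", OF _ _ _ _ that])
    fix \<sigma> v assume \<sigma>: "answers {} \<sigma>" and v: "v \<in> wlds M" "world_bears (marked \<sigma>) v (Not_below_realiser \<rho>)"
    have "fst (\<sigma> \<rho>) = base \<rho>" using solves_local[OF answersD[OF \<sigma> \<rho>]] assms by simp
    then show "world_bears (marked \<sigma>) v (Not_below (base \<rho>))"
      using v \<rho> base by (simp add: world_bears_marked_Not_below world_bears_marked_Not_below_realiser)
  qed (use \<rho> base image_wlds in simp_all)
  ultimately show thesis using that not_below_image[OF base] by (auto simp: world_bears_def)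
qed

lemma ex_realiser_above:
  obtains u b where "(f (base \<rho>), u) \<in> acc N" "b \<in> dmn N u" "bears N u (Realiser \<rho>) b"
    "\<not> world_bears N u (Not_below_realiser \<rho>)"
proof (rule ccontr)
  assume none: "\<not> thesis"
  note base = request_base[OF open_request[OF \<rho>]]
  let ?t = "f (base \<rho>)"
  let ?\<psi> = "All 0 (Imp (elem_mark (Realiser \<rho>) 0) (world_mark (Not_below_realiser \<rho>)))"
  have "holds N ?t (nth []) (world_mark (Not_below (base \<rho>)))"
  proof (rule limit_holds[of "{}" ?\<psi>])
    show "?\<psi> \<in> formulas (has_eq K) \<Theta>' (length [])"
      using \<rho> by (auto simp: formulas_def elem_mark_def world_mark_def)
    show "holds N ?t (nth []) ?\<psi>"
      unfolding holds.simps
    proof (intro allI impI ballI)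
      fix u x t' assume "(?t, u) \<in> acc N" "x \<in> dmn N u" and "(u, t') \<in> acc N"
        and "holds N t' (hom N u t' \<circ> (hom N ?t u \<circ> nth [])(0 := x)) (elem_mark (Realiser \<rho>) 0)"
      then have "bears N t' (Realiser \<rho>) (hom N u t' x)" "(?t, t') \<in> acc N" "hom N u t' x \<in> dmn N t'"
        using model_acc_trans[OF N] model_hom[OF N] by auto
      then show "holds N t' (hom N u t' \<circ> (hom N ?t u \<circ> nth [])(0 := x)) (world_mark (Not_below_realiser \<rho>))"
        using none that by auto
    qed
    fix \<sigma> v as assume \<sigma>: "answers {} \<sigma>" and v: "v \<in> wlds M" and holds: "holds (marked \<sigma>) v (nth as) ?\<psi>"
    let ?u = "fst (\<sigma> \<rho>)" and ?b = "snd (\<sigma> \<rho>)"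
    note sol = answersD[OF \<sigma> \<rho>]
    have u: "?u \<in> wlds M" using model_acc_wlds[OF M solves_acc[OF sol]] by simp
    note refl = model_acc_refl[OF M u] and b = solves_dmn[OF sol]
    have "(v, base \<rho>) \<notin> acc M"
    proof
      assume "(v, base \<rho>) \<in> acc M"
      then have "(v, ?u) \<in> acc M" using model_acc_trans[OF M] solves_acc[OF sol] by simp
      moreover have "bears (marked \<sigma>) ?u (Realiser \<rho>) ?b"
        using \<rho> b refl model_hom_id[OF M b] by (simp add: bears_marked)
      ultimately have "world_bears (marked \<sigma>) ?u (Not_below_realiser \<rho>)"
        using holds refl b model_hom_id[OF M b] by (auto dest!: spec[of _ ?u] bspec[of _ _ ?b])
      then show False using refl u \<rho> by (simp add: world_bears_marked_Not_below_realiser)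
    qed
    then show "holds (marked \<sigma>) v (nth as) (world_mark (Not_below (base \<rho>)))"
      using v base by (simp add: world_bears_marked_Not_below)
  qed (use base image_wlds in simp_all)
  then show False using not_below_image[OF base] by simp
qed

definition description :: "'u fm" where
  "description = And (position (base \<rho>) (params \<rho>)) (elem_mark (Realiser \<rho>) (length (params \<rho>)))"

lemma description_formulas: "description \<in> formulas q \<Theta>' (Suc (length (params \<rho>)))"
  using position_formulas[OF request_base[OF open_request[OF \<rho>]] request_params[OF open_request[OF \<rho>]]] \<rho>
  by (simp add: description_def)

lemma holds_description_marked:
  assumes \<sigma>: "answers F \<sigma>" and v: "v \<in> wlds M"
    and bs: "length bs = Suc (length (params \<rho>))" "set bs \<subseteq> dmn M v"
    and holds: "holds (marked \<sigma>) v (nth bs) description"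
  shows "(fst (\<sigma> \<rho>), v) \<in> acc M"
    "bs = map (hom M (fst (\<sigma> \<rho>)) v) (map (hom M (base \<rho>) (fst (\<sigma> \<rho>))) (params \<rho>) @ [snd (\<sigma> \<rho>)])"
proof -
  note \<rho>' = open_request[OF \<rho>] and sol = answersD[OF \<sigma> \<rho>]
  let ?l = "length (params \<rho>)"
  have "bs ! ?l \<in> dmn M v" using bs by auto
  then have last: "(fst (\<sigma> \<rho>), v) \<in> acc M \<and> bs ! ?l = hom M (fst (\<sigma> \<rho>)) v (snd (\<sigma> \<rho>))"
    using holds \<rho> by (simp add: description_def bears_marked)
  then show "(fst (\<sigma> \<rho>), v) \<in> acc M" by blast
  have "take ?l bs = map (hom M (base \<rho>) v) (params \<rho>)"
    using holds bs
    by (intro holds_position_marked(2)[where \<sigma> = \<sigma>, OF request_base[OF \<rho>'] request_params[OF \<rho>'] v])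
      (simp_all add: description_def)
  also have "\<dots> = map (hom M (fst (\<sigma> \<rho>)) v) (map (hom M (base \<rho>) (fst (\<sigma> \<rho>))) (params \<rho>))"
    using map_hom_comp[OF M _ _ request_params[OF \<rho>']] solves_acc[OF sol] last by simp
  finally show "bs = map (hom M (fst (\<sigma> \<rho>)) v) (map (hom M (base \<rho>) (fst (\<sigma> \<rho>))) (params \<rho>) @ [snd (\<sigma> \<rho>)])"
    using bs(1) last take_Suc_conv_app_nth[of ?l bs] by simp
qed

lemma answered_asserted_marked:
  assumes \<psi>: "\<psi> \<in> asserted \<rho>" and \<sigma>: "answers {\<psi>} \<sigma>" and v: "v \<in> wlds M"
    and bs: "length bs = Suc (length (params \<rho>))" "set bs \<subseteq> dmn M v"
    and holds: "holds (marked \<sigma>) v (nth bs) description"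
  shows "holds (marked \<sigma>) v (nth bs) \<psi>"
proof -
  note \<rho>' = open_request[OF \<rho>] and sol = answersD[OF \<sigma> \<rho>]
    and image = holds_description_marked[OF \<sigma> v bs holds]
  let ?as = "map (hom M (base \<rho>) (fst (\<sigma> \<rho>))) (params \<rho>) @ [snd (\<sigma> \<rho>)]"
  have formula: "\<psi> \<in> formulas (has_eq K) \<Theta> (length ?as)" "\<psi> \<in> formulas (has_eq K) \<Theta> (length bs)"
    using request_formulas[OF \<rho>'] \<psi> bs(1) by simp_all
  have "set ?as \<subseteq> dmn M (fst (\<sigma> \<rho>))"
    using solution_tuple[OF M \<rho>'] solves_acc[OF sol] solves_dmn[OF sol] by simp
  then have "holds M v (nth bs) \<psi>"
    using holds_persistent_tuple[OF M formula(1) image(1)] solves_asserted[OF sol] \<psi> image(2) by simp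
  then show ?thesis using holds_marked[OF \<sigma> formula(2) v bs(2)] by blast
qed

lemma answered_refuted_marked:
  assumes \<psi>: "\<psi> \<in> refuted \<rho>" and \<sigma>: "answers {\<psi>} \<sigma>" and v: "v \<in> wlds M"
    and bs: "length bs = Suc (length (params \<rho>))" "set bs \<subseteq> dmn M v"
    and holds: "holds (marked \<sigma>) v (nth bs) description"
    and holds_\<psi>: "holds (marked \<sigma>) v (nth bs) \<psi>"
  shows "world_bears (marked \<sigma>) v (Not_below_realiser \<rho>)"
proof -
  note \<rho>' = open_request[OF \<rho>] and sol = answersD[OF \<sigma> \<rho>]
    and image = holds_description_marked[OF \<sigma> v bs holds]
  let ?as = "map (hom M (base \<rho>) (fst (\<sigma> \<rho>))) (params \<rho>) @ [snd (\<sigma> \<rho>)]"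
  have "\<psi> \<in> formulas (has_eq K) \<Theta> (length bs)" using request_formulas[OF \<rho>'] \<psi> bs(1) by simp
  then have "holds M v (nth bs) \<psi>" using holds_marked[OF \<sigma> _ v bs(2)] holds_\<psi> by blast
  moreover have "set ?as \<subseteq> dmn M (fst (\<sigma> \<rho>))"
    using solution_tuple[OF M \<rho>'] solves_acc[OF sol] solves_dmn[OF sol] by simp
  from map_hom_id[OF M this] have "bs = ?as" if "fst (\<sigma> \<rho>) = v"
    using image(2) that by simp
  moreover have "\<not> holds M (fst (\<sigma> \<rho>)) (nth ?as) \<psi>" using solves_refuted[OF sol] \<psi> by simp
  ultimately have "(v, fst (\<sigma> \<rho>)) \<notin> acc M" using model_acc_antisym[OF M image(1)] by metis
  then show ?thesis using \<rho> v by (simp add: world_bears_marked_Not_below_realiser)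
qed

lemma realiser_solves:
  assumes u: "(f (base \<rho>), u) \<in> acc N" "is_local \<rho> \<Longrightarrow> u = f (base \<rho>)"
    and b: "b \<in> dmn N u" "bears N u (Realiser \<rho>) b" and above: "\<not> world_bears N u (Not_below_realiser \<rho>)"
  shows "solves N (transport f g \<rho>) u b"
proof -
  note \<rho>' = open_request[OF \<rho>] and base = request_base[OF open_request[OF \<rho>]]
    and params = request_params[OF open_request[OF \<rho>]]
  let ?bs = "map (hom N (f (base \<rho>)) u) (map g (params \<rho>)) @ [b]"
  have uW: "u \<in> wlds N" using model_acc_wlds[OF N u(1)] by blast
  have bs: "set ?bs \<subseteq> dmn N u" and len: "length ?bs = Suc (length (params \<rho>))"
    using set_map_hom_subset[OF N u(1) image_tuple[OF params]] b(1) by simp_all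
  have description: "holds N u (nth ?bs) description"
    using holds_position_limit[OF base params u(1)] b(2) by (simp add: description_def nth_append)
  have formula: "\<psi> \<in> formulas (has_eq K) \<Theta>' (length ?bs)" if "\<psi> \<in> asserted \<rho> \<union> refuted \<rho>" for \<psi>
    unfolding len by (rule formulas_sub_sig[OF request_formulas[OF \<rho>' that] sub_sig_\<Theta>'])
  note description_formula = description_formulas[of "has_eq K", folded len]
  have "holds N u (nth ?bs) \<psi>" if \<psi>: "\<psi> \<in> asserted \<rho>" for \<psi>
    by (rule limit_holds[OF _ description_formula _ uW bs description, of "{\<psi>}"])
      (use formula \<psi> answered_asserted_marked[OF \<psi>] len in auto)
  moreover have "\<not> holds N u (nth ?bs) \<psi>" if \<psi>: "\<psi> \<in> refuted \<rho>" for \<psi>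
  proof
    assume "holds N u (nth ?bs) \<psi>"
    then have "holds N u (nth ?bs) (And description \<psi>)" using description by simp
    then have "holds N u (nth ?bs) (world_mark (Not_below_realiser \<rho>))"
      by (rule limit_holds[OF _ _ _ uW bs, of "{\<psi>}", rotated 3])
        (use formula \<psi> description_formula \<rho> answered_refuted_marked[OF \<psi>] len in auto)
    then show False using above by simp
  qed
  ultimately show ?thesis using u b(1) by (simp add: solves_def)
qed

lemma solvable_limit: "solvable N (transport f g \<rho>)"
proof (cases "is_local \<rho>")
  case True
  then obtain b where "b \<in> dmn N (f (base \<rho>))" "bears N (f (base \<rho>)) (Realiser \<rho>) b"
      "\<not> world_bears N (f (base \<rho>)) (Not_below_realiser \<rho>)"
    by (rule ex_realiser_local)
  then show ?thesis
    using realiser_solves model_acc_refl[OF N image_wlds[OF request_base[OF open_request[OF \<rho>]]]]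
    unfolding solvable_def by blast
next
  case False
  obtain u b where "(f (base \<rho>), u) \<in> acc N" "b \<in> dmn N u" "bears N u (Realiser \<rho>) b"
      "\<not> world_bears N u (Not_below_realiser \<rho>)"
    by (rule ex_realiser_above)
  then show ?thesis using realiser_solves False unfolding solvable_def by blast
qed

end

end

lemma (in extension_step) ex_saturating_extension:
  obtains M' where "(M', r) \<in> Str L \<Theta>" "proper_tree (has_eq K) M' r" "elementary_submodel L M M'"
    "saturates (has_eq K) \<Theta> M M'"
proof -
  obtain N n where "marked_limit \<U> L K M r \<Theta> m N n" using ex_marked_limit by blast
  then interpret marked_limit \<U> L K M r \<Theta> m N n .
  obtain f g where "marked_embedding \<U> L K M r \<Theta> m N n f g" using ex_marked_embedding by blast
  then interpret marked_embedding \<U> L K M r \<Theta> m N n f g .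
  let ?N = "reduct N \<Theta>"
  note SR = Str_reduct[OF sig is_sig_\<Theta>' sub_sig_\<Theta>' SN]
  note R = Str_model[OF sig SR]
  obtain M' h k where M': "is_model \<Theta> M'" and iso: "model_iso k h ?N M'"
    and elementary: "elementary_submodel L M M'"
    and h: "\<And>v. v \<in> wlds M \<Longrightarrow> h (f v) = v" and k: "\<And>a. a \<in> elems M \<Longrightarrow> k (g a) = a"
    using ex_elementary_extension[OF sig SM SR elementary_embedding] by metis
  have root: "h n = r" using h[OF r] f_root by simp
  have "solvable M' \<rho>" if \<rho>: "\<rho> \<in> open_requests" for \<rho>
  proof -
    note \<rho>' = open_request[OF \<rho>]
    obtain u b where sol: "solves N (transport f g \<rho>) u b"
      using solvable_limit[OF \<rho>] by (auto simp: solvable_def)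
    have requests: "transport f g \<rho> \<in> requests (has_eq K) \<Theta> N" "transport f g \<rho> \<in> requests (has_eq K) \<Theta> ?N"
      using image_wlds[OF request_base[OF \<rho>']] image_tuple[OF request_params[OF \<rho>']] request_formulas[OF \<rho>']
        request_local[OF \<rho>'] by (auto simp: requests_def)
    have "solves ?N (transport f g \<rho>) u b"
      using solves_morphism[OF N morphism_reduct[OF N R sub_sig_\<Theta>'] requests(1) sol]
      by (simp add: transport_def)
    from solves_morphism[OF R morphism_iso[OF R M' iso] requests(2) this]
    have "solves M' (transport h k (transport f g \<rho>)) (h u) (k b)" .
    moreover have "map k (map g (params \<rho>)) = params \<rho>"
      using k request_params[OF \<rho>'] model_dmn_elems[OF M] by (auto intro!: map_idI)
    then have "transport h k (transport f g \<rho>) = \<rho>"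
      using h request_base[OF \<rho>'] by (intro request.expand) simp
    ultimately show ?thesis by (auto simp: solvable_def)
  qed
  then have "saturates (has_eq K) \<Theta> M M'" by (simp add: saturates_def open_requests_def)
  moreover have "(M', r) \<in> Str L \<Theta>" using Str_iso[OF sig SR M' iso] root by simp
  moreover have "proper_tree (has_eq K) M' r"
    using proper_tree_iso[OF R M' iso proper_tree_reduct[OF tree_N]] sub_sig_\<Theta>' model_sgn[OF N] root by simp
  ultimately show thesis using that elementary by blast
qed


section \<open>Saturated models\<close>

lemma formulas_quantifiers [simp]:
  "All k \<psi> \<in> formulas q \<Theta> k \<longleftrightarrow> \<psi> \<in> formulas q \<Theta> (Suc k)"
  "Ex k \<psi> \<in> formulas q \<Theta> k \<longleftrightarrow> \<psi> \<in> formulas q \<Theta> (Suc k)"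
  by (auto simp: formulas_def lessThan_Suc)

lemma holds_nth_snoc:
  assumes "\<psi> \<in> formulas q \<Theta> (length as)"
  shows "holds M w (nth (as @ [a])) \<psi> \<longleftrightarrow> holds M w (nth as) \<psi>"
  by (rule holds_cong) (use assms in \<open>auto simp: formulas_def nth_append subset_iff\<close>)

lemma solvable_local_iff:
  assumes M: "is_model \<Theta> M" and \<rho>: "\<rho> \<in> requests q \<Theta> M" "is_local \<rho>" and \<gamma>s: "set \<gamma>s = asserted \<rho>"
  shows "solvable M \<rho> \<longleftrightarrow> holds M (base \<rho>) (nth (params \<rho>)) (Ex (length (params \<rho>)) (BigAnd \<gamma>s))"
proof -
  note base = request_base[OF \<rho>(1)]
  have "holds M (base \<rho>) ((nth (params \<rho>))(length (params \<rho>) := b)) \<psi> \<longleftrightarrow>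
      holds M (base \<rho>) (nth (map (hom M (base \<rho>) (base \<rho>)) (params \<rho>) @ [b])) \<psi>" if "\<psi> \<in> asserted \<rho>" for \<psi> b
    unfolding map_hom_id[OF M request_params[OF \<rho>(1)]]
    by (rule holds_nth_upd[of \<psi> q \<Theta>]) (use request_formulas[OF \<rho>(1)] that in blast)
  then show ?thesis
    unfolding solvable_def solves_def using \<rho>(2) request_local[OF \<rho>] \<gamma>s model_acc_refl[OF M base] by auto
qed

lemma solvable_above_iff:
  assumes M: "is_model \<Theta> M" and \<rho>: "\<rho> \<in> requests q \<Theta> M" "\<not> is_local \<rho>"
    and lists: "set \<gamma>s = asserted \<rho>" "set \<delta>s = refuted \<rho>"
  shows "solvable M \<rho> \<longleftrightarrow>
    \<not> holds M (base \<rho>) (nth (params \<rho>)) (All (length (params \<rho>)) (Imp (BigAnd \<gamma>s) (BigOr \<delta>s)))"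
proof -
  let ?w = "base \<rho>" and ?\<alpha> = "params \<rho>"
  let ?s = "\<lambda>v u a. hom M v u \<circ> (hom M ?w v \<circ> nth ?\<alpha>)(length ?\<alpha> := a)"
  have tuple: "holds M u (?s v u a) \<psi> \<longleftrightarrow> holds M u (nth (map (hom M ?w u) ?\<alpha> @ [hom M v u a])) \<psi>"
    if \<psi>: "\<psi> \<in> asserted \<rho> \<union> refuted \<rho>" and acc: "(?w, v) \<in> acc M" "(v, u) \<in> acc M" for v u a \<psi>
  proof (rule holds_cong)
    fix x assume "x \<in> fv \<psi>"
    then have "x < Suc (length ?\<alpha>)" using request_formulas[OF \<rho>(1) \<psi>] by (auto simp: formulas_def)
    then consider "x = length ?\<alpha>" | "x < length ?\<alpha>" "?\<alpha> ! x \<in> dmn M ?w"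
      using subsetD[OF request_params[OF \<rho>(1)] nth_mem] by (auto simp: less_Suc_eq)
    then show "?s v u a x = (map (hom M ?w u) ?\<alpha> @ [hom M v u a]) ! x"
      by cases (simp_all add: nth_append model_hom_comp[OF M acc])
  qed
  show ?thesis
  proof
    assume "solvable M \<rho>"
    then obtain u b where sol: "solves M \<rho> u b" by (auto simp: solvable_def)
    note acc = solves_acc[OF sol] and b = solves_dmn[OF sol]
    have refl: "(u, u) \<in> acc M" using model_acc_wlds[OF M acc] model_acc_refl[OF M] by blast
    have "holds M u (?s u u b) (BigAnd \<gamma>s)" "\<not> holds M u (?s u u b) (BigOr \<delta>s)"
      using tuple[OF _ acc refl, of _ b] model_hom_id[OF M b] solves_asserted[OF sol]
        solves_refuted[OF sol] lists
      by auto
    then show "\<not> holds M ?w (nth ?\<alpha>) (All (length ?\<alpha>) (Imp (BigAnd \<gamma>s) (BigOr \<delta>s)))"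
      unfolding holds.simps using acc b refl by blast
  next
    assume "\<not> holds M ?w (nth ?\<alpha>) (All (length ?\<alpha>) (Imp (BigAnd \<gamma>s) (BigOr \<delta>s)))"
    then obtain v a u where acc: "(?w, v) \<in> acc M" "(v, u) \<in> acc M" and a: "a \<in> dmn M v"
      and "holds M u (?s v u a) (BigAnd \<gamma>s)" "\<not> holds M u (?s v u a) (BigOr \<delta>s)"
      unfolding holds.simps by blast
    then have "solves M \<rho> u (hom M v u a)"
      using tuple[OF _ acc] lists \<rho>(2) model_acc_trans[OF M acc] model_hom[OF M acc(2) a]
      by (auto simp: solves_def)
    then show "solvable M \<rho>" by (auto simp: solvable_def)
  qed
qed

lemma submodel_requests:
  assumes "submodel M N" "\<rho> \<in> requests q \<Theta> M"
  shows "\<rho> \<in> requests q \<Theta> N"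
proof -
  have "wlds M \<subseteq> wlds N" "dmn M (base \<rho>) \<subseteq> dmn N (base \<rho>)"
    using assms(1) request_base[OF assms(2)] by (simp_all add: submodel_def)
  then show ?thesis using assms(2) by (auto simp: requests_def)
qed

lemma submodel_chain_mono:
  assumes "\<And>n. is_model \<Theta> (Ms n)" "\<And>n. submodel (Ms n) (Ms (Suc n))" and "n \<le> k"
  shows "wlds (Ms n) \<subseteq> wlds (Ms k)" "dmn (Ms n) w \<subseteq> dmn (Ms k) w"
proof -
  have "dmn (Ms i) w \<subseteq> dmn (Ms (Suc i)) w" for i
    using assms(2)[of i] model_dmn_out[OF assms(1), of w i]
    by (cases "w \<in> wlds (Ms i)") (auto simp: submodel_def)
  then show "dmn (Ms n) w \<subseteq> dmn (Ms k) w" using assms(3) by (rule lift_Suc_mono_le)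
  have "wlds (Ms i) \<subseteq> wlds (Ms (Suc i))" for i using assms(2) by (simp add: submodel_def)
  then show "wlds (Ms n) \<subseteq> wlds (Ms k)" using assms(3) by (rule lift_Suc_mono_le)
qed

lemma chain_union_stage:
  assumes chain: "\<And>n. is_model \<Theta> (Ms n)" "\<And>n. submodel (Ms n) (Ms (Suc n))"
    and w: "w \<in> wlds (chain_union Ms)" and \<alpha>: "set \<alpha> \<subseteq> dmn (chain_union Ms) w"
  shows "\<exists>n. w \<in> wlds (Ms n) \<and> set \<alpha> \<subseteq> dmn (Ms n) w"
  using \<alpha>
proof (induction \<alpha>)
  case Nil
  then show ?case using w by (auto simp: chain_union_def)
next
  case (Cons a \<alpha>)
  then obtain n k where "w \<in> wlds (Ms n)" "set \<alpha> \<subseteq> dmn (Ms n) w" "a \<in> dmn (Ms k) w"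
    by (auto simp: chain_union_def)
  then have "w \<in> wlds (Ms (max n k))" "set (a # \<alpha>) \<subseteq> dmn (Ms (max n k)) w"
    using submodel_chain_mono[where Ms = Ms, OF chain max.cobounded1[of n k]]
      submodel_chain_mono(2)[where Ms = Ms, OF chain max.cobounded2[of k n]]
    unfolding list.set by blast+
  then show ?case by blast
qed

context extension_logic
begin

lemma elementary_solves:
  assumes sig: "is_sig \<Theta>" and SM: "(M, w) \<in> Str L \<Theta>" and SN: "(N, w') \<in> Str L \<Theta>"
    and el: "elementary_submodel L M N"
    and \<rho>: "\<rho> \<in> requests (has_eq K) \<Theta> M" and sol: "solves M \<rho> u b"
  shows "solves N \<rho> u b"
proof -
  note M = Str_model[OF sig SM]
  have sub: "submodel M N" using el by (simp add: elementary_submodel_def)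
  let ?as = "map (hom M (base \<rho>) u) (params \<rho>) @ [b]"
  note acc = solves_acc[OF sol]
  have u: "u \<in> wlds M" "u \<in> wlds N" using model_acc_wlds[OF M acc] sub by (auto simp: submodel_def)
  have hom: "map (hom N (base \<rho>) u) (params \<rho>) = map (hom M (base \<rho>) u) (params \<rho>)"
    using sub acc request_params[OF \<rho>] by (auto simp: submodel_def)
  have "holds M u (nth ?as) \<psi> \<longleftrightarrow> holds N u (nth ?as) \<psi>" if "\<psi> \<in> asserted \<rho> \<union> refuted \<rho>" for \<psi>
    by (rule elementary_holds[OF sig Str_change_point[OF sig SM u(1)] Str_change_point[OF sig SN u(2)] el
          solution_tuple[OF M \<rho> acc solves_dmn[OF sol]]]) (use request_formulas[OF \<rho> that] in simp)
  moreover have "(base \<rho>, u) \<in> acc N" "b \<in> dmn N u"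
    using sub acc solves_dmn[OF sol] u by (auto simp: submodel_def)
  ultimately show ?thesis using sol unfolding solves_def hom by blast
qed

lemma elementary_solvable_finite:
  assumes sig: "is_sig \<Theta>" and SM: "(M, w) \<in> Str L \<Theta>" and SN: "(N, w') \<in> Str L \<Theta>"
    and el: "elementary_submodel L M N"
    and \<rho>: "\<rho> \<in> requests (has_eq K) \<Theta> M" and fin: "finite (asserted \<rho>)" "finite (refuted \<rho>)"
  shows "solvable M \<rho> \<longleftrightarrow> solvable N \<rho>"
proof -
  note M = Str_model[OF sig SM] and N = Str_model[OF sig SN]
  have \<rho>N: "\<rho> \<in> requests (has_eq K) \<Theta> N"
    using submodel_requests[OF _ \<rho>] el by (simp add: elementary_submodel_def)
  obtain \<gamma>s \<delta>s where lists: "set \<gamma>s = asserted \<rho>" "set \<delta>s = refuted \<rho>" using fin finite_list by meson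
  have "holds M (base \<rho>) (nth (params \<rho>)) \<chi> \<longleftrightarrow> holds N (base \<rho>) (nth (params \<rho>)) \<chi>"
    if "\<chi> \<in> formulas (has_eq K) \<Theta> (length (params \<rho>))" for \<chi>
    using elementary_holds[OF sig Str_change_point[OF sig SM request_base[OF \<rho>]]
        Str_change_point[OF sig SN request_base[OF \<rho>N]] el request_params[OF \<rho>] that] .
  moreover have "set \<gamma>s \<subseteq> formulas (has_eq K) \<Theta> (Suc (length (params \<rho>)))"
      "set \<delta>s \<subseteq> formulas (has_eq K) \<Theta> (Suc (length (params \<rho>)))"
    using request_formulas[OF \<rho>] lists by auto
  ultimately show ?thesis
    using solvable_local_iff[OF M \<rho> _ lists(1)] solvable_local_iff[OF N \<rho>N _ lists(1)]
      solvable_above_iff[OF M \<rho> _ lists] solvable_above_iff[OF N \<rho>N _ lists]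
    by (cases "is_local \<rho>") (simp_all del: holds.simps)
qed

end


subsection \<open>Type inclusion\<close>

definition type_included ::
    "bool \<Rightarrow> 'u signature \<Rightarrow> 'u kmodel \<Rightarrow> 'u kmodel \<Rightarrow> 'u \<Rightarrow> 'u list \<Rightarrow> 'u \<Rightarrow> 'u list \<Rightarrow> bool" where
  "type_included q \<Theta> M N w \<alpha> v \<beta> \<longleftrightarrow>
     w \<in> wlds M \<and> v \<in> wlds N \<and> set \<alpha> \<subseteq> dmn M w \<and> set \<beta> \<subseteq> dmn N v \<and> length \<alpha> = length \<beta> \<and>
     (\<forall>\<psi>\<in>formulas q \<Theta> (length \<alpha>). holds M w (nth \<alpha>) \<psi> \<longrightarrow> holds N v (nth \<beta>) \<psi>)"

lemma
  assumes "type_included q \<Theta> M N w \<alpha> v \<beta>"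
  shows type_included_wlds: "w \<in> wlds M" "v \<in> wlds N"
    and type_included_dmn: "set \<alpha> \<subseteq> dmn M w" "set \<beta> \<subseteq> dmn N v"
    and type_included_length: "length \<alpha> = length \<beta>"
    and type_included_holds: "\<psi> \<in> formulas q \<Theta> (length \<alpha>) \<Longrightarrow> holds M w (nth \<alpha>) \<psi> \<Longrightarrow> holds N v (nth \<beta>) \<psi>"
  using assms unfolding type_included_def by blast+

lemma type_included_butlast:
  assumes "type_included q \<Theta> M N w (\<alpha> @ [a]) v (\<beta> @ [b])"
  shows "type_included q \<Theta> M N w \<alpha> v \<beta>"
proof -
  have "holds N v (nth \<beta>) \<psi>" if \<psi>: "\<psi> \<in> formulas q \<Theta> (length \<alpha>)" and "holds M w (nth \<alpha>) \<psi>" for \<psi>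
  proof -
    have "\<psi> \<in> formulas q \<Theta> (length \<beta>)" using \<psi> type_included_length[OF assms] by simp
    from holds_nth_snoc[OF this] show ?thesis
      using type_included_holds[OF assms, of \<psi>] formulas_mono[OF \<psi>] that(2) holds_nth_snoc[OF \<psi>] by simp
  qed
  then show ?thesis using assms by (simp add: type_included_def)
qed

context
  fixes q :: bool and \<Theta> :: "'u signature" and M N :: "'u kmodel" and w v :: 'u and \<alpha> \<beta> :: "'u list"
  assumes M: "is_model \<Theta> M" and N: "is_model \<Theta> N" and types: "type_included q \<Theta> M N w \<alpha> v \<beta>"
begin

lemma type_included_solvable_local:
  assumes sat: "saturates q \<Theta> N N" and \<Gamma>: "\<Gamma> \<subseteq> formulas q \<Theta> (Suc (length \<alpha>))"
    and sol: "solvable M (Request True w \<alpha> \<Gamma> {})"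
  shows "solvable N (Request True v \<beta> \<Gamma> {})"
proof -
  note len = type_included_length[OF types]
  have requests: "Request True w \<alpha> \<Gamma>' {} \<in> requests q \<Theta> M" "Request True v \<beta> \<Gamma>' {} \<in> requests q \<Theta> N"
    if "\<Gamma>' \<subseteq> \<Gamma>" for \<Gamma>'
    using that \<Gamma> type_included_wlds[OF types] type_included_dmn[OF types] len by (auto simp: requests_def)
  have "solvable N (Request True v \<beta> (\<Gamma> \<inter> F) {})" if "finite F" for F
  proof -
    obtain \<gamma>s where \<gamma>s: "set \<gamma>s = \<Gamma> \<inter> F" using \<open>finite F\<close> finite_list[of "\<Gamma> \<inter> F"] by auto
    have "solvable M (Request True w \<alpha> (\<Gamma> \<inter> F) {})" using sol by (auto simp: solvable_def solves_def)
    then have "holds M w (nth \<alpha>) (Ex (length \<alpha>) (BigAnd \<gamma>s))"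
      using solvable_local_iff[OF M requests(1), of "\<Gamma> \<inter> F" \<gamma>s] \<gamma>s by simp
    then have "holds N v (nth \<beta>) (Ex (length \<beta>) (BigAnd \<gamma>s))"
      unfolding len[symmetric] by (rule type_included_holds[OF types, rotated]) (use \<Gamma> \<gamma>s in auto)
    then show ?thesis using solvable_local_iff[OF N requests(2), of "\<Gamma> \<inter> F" \<gamma>s] \<gamma>s by simp
  qed
  then have "finitely_solvable N (Request True v \<beta> \<Gamma> {})"
    by (simp add: finitely_solvable_def restrict_request_def)
  then show ?thesis using sat requests(2) by (simp add: saturates_def)
qed

lemma type_included_solvable_above:
  assumes sat: "saturates q \<Theta> M M" and \<Gamma>\<Delta>: "\<Gamma> \<union> \<Delta> \<subseteq> formulas q \<Theta> (Suc (length \<alpha>))"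
    and sol: "solvable N (Request False v \<beta> \<Gamma> \<Delta>)"
  shows "solvable M (Request False w \<alpha> \<Gamma> \<Delta>)"
proof -
  note len = type_included_length[OF types]
  have requests: "Request False w \<alpha> \<Gamma>' \<Delta>' \<in> requests q \<Theta> M" "Request False v \<beta> \<Gamma>' \<Delta>' \<in> requests q \<Theta> N"
    if "\<Gamma>' \<subseteq> \<Gamma>" "\<Delta>' \<subseteq> \<Delta>" for \<Gamma>' \<Delta>'
    using that \<Gamma>\<Delta> type_included_wlds[OF types] type_included_dmn[OF types] len by (auto simp: requests_def)
  have "solvable M (Request False w \<alpha> (\<Gamma> \<inter> F) (\<Delta> \<inter> F))" if "finite F" for F
  proof (rule ccontr)
    obtain \<gamma>s \<delta>s where lists: "set \<gamma>s = \<Gamma> \<inter> F" "set \<delta>s = \<Delta> \<inter> F"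
      using \<open>finite F\<close> finite_list[of "\<Gamma> \<inter> F"] finite_list[of "\<Delta> \<inter> F"] by auto
    assume "\<not> ?thesis"
    then have "holds M w (nth \<alpha>) (All (length \<alpha>) (Imp (BigAnd \<gamma>s) (BigOr \<delta>s)))"
      using solvable_above_iff[OF M requests(1), of "\<Gamma> \<inter> F" "\<Delta> \<inter> F" \<gamma>s \<delta>s] lists by (simp del: holds.simps)
    then have "holds N v (nth \<beta>) (All (length \<beta>) (Imp (BigAnd \<gamma>s) (BigOr \<delta>s)))"
      unfolding len[symmetric] by (rule type_included_holds[OF types, rotated]) (use \<Gamma>\<Delta> lists in auto)
    moreover have "solvable N (Request False v \<beta> (\<Gamma> \<inter> F) (\<Delta> \<inter> F))"
      using sol by (auto simp: solvable_def solves_def)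
    ultimately show False
      using solvable_above_iff[OF N requests(2), of "\<Gamma> \<inter> F" "\<Delta> \<inter> F" \<gamma>s \<delta>s] lists by (simp del: holds.simps)
  qed
  then have "finitely_solvable M (Request False w \<alpha> \<Gamma> \<Delta>)"
    by (simp add: finitely_solvable_def restrict_request_def)
  then show ?thesis using sat requests(1) by (simp add: saturates_def)
qed

lemma type_included_forth:
  assumes sat: "saturates q \<Theta> N N" and a: "a \<in> dmn M w"
  shows "\<exists>b\<in>dmn N v. type_included q \<Theta> M N w (\<alpha> @ [a]) v (\<beta> @ [b])"
proof -
  define \<Gamma> where "\<Gamma> = {\<gamma> \<in> formulas q \<Theta> (Suc (length \<alpha>)). holds M w (nth (\<alpha> @ [a])) \<gamma>}"
  note wlds = type_included_wlds[OF types] and dmn = type_included_dmn[OF types]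
  have "solves M (Request True w \<alpha> \<Gamma> {}) w a"
    using a model_acc_refl[OF M wlds(1)] map_hom_id[OF M dmn(1)] by (simp add: solves_def \<Gamma>_def)
  then obtain b where "solves N (Request True v \<beta> \<Gamma> {}) v b"
    using type_included_solvable_local[OF sat, of \<Gamma>] by (auto simp: solvable_def solves_def \<Gamma>_def)
  then show ?thesis
    using a wlds dmn type_included_length[OF types] map_hom_id[OF N dmn(2)]
    by (intro bexI[of _ b]) (auto simp: solves_def type_included_def \<Gamma>_def)
qed

lemma type_included_back:
  assumes sat: "saturates q \<Theta> M M" and t: "(v, t) \<in> acc N" and b: "b \<in> dmn N t"
  obtains u a where "(w, u) \<in> acc M" "a \<in> dmn M u"
    "type_included q \<Theta> M N u (map (hom M w u) \<alpha> @ [a]) t (map (hom N v t) \<beta> @ [b])"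
    "type_included q \<Theta> N M t (map (hom N v t) \<beta> @ [b]) u (map (hom M w u) \<alpha> @ [a])"
proof -
  let ?\<beta> = "map (hom N v t) \<beta> @ [b]"
  define \<Gamma> \<Delta> where "\<Gamma> = {\<gamma> \<in> formulas q \<Theta> (Suc (length \<alpha>)). holds N t (nth ?\<beta>) \<gamma>}"
    and "\<Delta> = {\<delta> \<in> formulas q \<Theta> (Suc (length \<alpha>)). \<not> holds N t (nth ?\<beta>) \<delta>}"
  note dmn = type_included_dmn[OF types]
  have "solves N (Request False v \<beta> \<Gamma> \<Delta>) t b" using t b by (simp add: solves_def \<Gamma>_def \<Delta>_def)
  moreover have "\<Gamma> \<union> \<Delta> \<subseteq> formulas q \<Theta> (Suc (length \<alpha>))" by (auto simp: \<Gamma>_def \<Delta>_def)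
  ultimately obtain u a where sol: "solves M (Request False w \<alpha> \<Gamma> \<Delta>) u a"
    using type_included_solvable_above[OF sat, of \<Gamma> \<Delta>] unfolding solvable_def by blast
  then have u: "(w, u) \<in> acc M" and a: "a \<in> dmn M u" by (simp_all add: solves_def)
  let ?\<alpha> = "map (hom M w u) \<alpha> @ [a]"
  have types_eq: "holds M u (nth ?\<alpha>) \<psi> \<longleftrightarrow> holds N t (nth ?\<beta>) \<psi>" if "\<psi> \<in> formulas q \<Theta> (Suc (length \<alpha>))" for \<psi>
    using that sol by (auto simp: solves_def \<Gamma>_def \<Delta>_def)
  have "set ?\<alpha> \<subseteq> dmn M u" "set ?\<beta> \<subseteq> dmn N t"
    using set_map_hom_subset[OF M u dmn(1)] set_map_hom_subset[OF N t dmn(2)] a b by simp_all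
  then show thesis
    using that[OF u a] types_eq type_included_length[OF types] model_acc_wlds[OF M u] model_acc_wlds[OF N t]
    by (simp add: type_included_def)
qed

end

lemma half_asimulation_type_included:
  assumes M: "is_model \<Theta> M" and N: "is_model \<Theta> N" and sat: "saturates q \<Theta> M M" "saturates q \<Theta> N N"
  shows "half_asimulation q \<Theta> M N (type_included q \<Theta> M N) (type_included q \<Theta> N M)"
proof (rule half_asimulationI)
  fix w \<alpha> v \<beta> assume types: "type_included q \<Theta> M N w \<alpha> v \<beta>"
  show "w \<in> wlds M \<and> v \<in> wlds N \<and> set \<alpha> \<subseteq> dmn M w \<and> set \<beta> \<subseteq> dmn N v \<and> length \<alpha> = length \<beta>"
    using types by (simp add: type_included_def)
  show "holds N v (nth \<beta>) \<psi>" if "\<psi> \<in> formulas q \<Theta> (length \<alpha>)" "holds M w (nth \<alpha>) \<psi>" for \<psi>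
    using type_included_holds[OF types that] .
  show "\<exists>b\<in>dmn N v. type_included q \<Theta> M N w (\<alpha> @ [a]) v (\<beta> @ [b])" if "a \<in> dmn M w" for a
    using type_included_forth[OF M N types sat(2) that] .
  fix t assume t: "(v, t) \<in> acc N"
  show "\<exists>u. (w, u) \<in> acc M \<and> (\<exists>a\<in>dmn M u.
      type_included q \<Theta> M N u (map (hom M w u) \<alpha> @ [a]) t (map (hom N v t) \<beta> @ [b]))" if "b \<in> dmn N t" for b
    using type_included_back[OF M N types sat(1) t that] by blast
  obtain b where "b \<in> dmn N t" using model_acc_wlds[OF N t] model_dmn_nonempty[OF N] by blast
  then show "\<exists>u. (w, u) \<in> acc M \<and> type_included q \<Theta> M N u (map (hom M w u) \<alpha>) t (map (hom N v t) \<beta>) \<and>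
      type_included q \<Theta> N M t (map (hom N v t) \<beta>) u (map (hom M w u) \<alpha>)"
    using type_included_back[OF M N types sat(1) t] type_included_butlast by metis
qed

lemma (in extension_logic) saturated_preservation:
  assumes sig: "is_sig \<Theta>" and SM: "(M, w) \<in> Str L \<Theta>" and SN: "(N, v) \<in> Str L \<Theta>"
    and sat: "saturates (has_eq K) \<Theta> M M" "saturates (has_eq K) \<Theta> N N"
    and types: "type_included (has_eq K) \<Theta> M N w [] v []" and \<phi>: "\<phi> \<in> Sen L \<Theta>" "Sat L M w \<phi>"
  shows "Sat L N v \<phi>"
proof -
  note M = Str_model[OF sig SM] and N = Str_model[OF sig SN]
  show ?thesis
    by (rule half_asimulation_Sat[OF sig SM SN half_asimulation_type_included[OF M N sat]
          half_asimulation_type_included[OF N M sat(2,1)] types \<phi>])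
qed


section \<open>Definability\<close>

locale lindstroem = extension_logic \<U> L K for \<U> :: "'u set" and L :: "('u, 's) logic" and K +
  assumes compact: "star_compact L" and union: "tarski_union_property L"
begin

lemma ex_saturating_chain:
  assumes sig: "is_sig \<Theta>" and fin: "finite_sig \<Theta>" and SM: "(M, r) \<in> Str L \<Theta>"
    and tree: "proper_tree (has_eq K) M r"
  obtains Ms where "Ms 0 = M" "\<And>n. (Ms n, r) \<in> Str L \<Theta>" "\<And>n. elementary_submodel L (Ms n) (Ms (Suc n))"
    "\<And>n. saturates (has_eq K) \<Theta> (Ms n) (Ms (Suc n))"
proof -
  obtain m where m: "preds \<Theta> m = {}" "0 < m" using finite_sig_imp_fresh_arity[OF fin] by blast
  have "\<exists>Ms. \<forall>n. ((Ms n, r) \<in> Str L \<Theta> \<and> proper_tree (has_eq K) (Ms n) r \<and> (n = 0 \<longrightarrow> Ms n = M)) \<and>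
    (elementary_submodel L (Ms n) (Ms (Suc n)) \<and> saturates (has_eq K) \<Theta> (Ms n) (Ms (Suc n)))"
  proof (rule dependent_nat_choice)
    fix N and n :: nat assume N: "(N, r) \<in> Str L \<Theta> \<and> proper_tree (has_eq K) N r \<and> (n = 0 \<longrightarrow> N = M)"
    interpret extension_step \<U> L K N r \<Theta> m
      by unfold_locales (use compact sig fin N m in auto)
    obtain N' where "(N', r) \<in> Str L \<Theta>" "proper_tree (has_eq K) N' r" "elementary_submodel L N N'"
        "saturates (has_eq K) \<Theta> N N'"
      by (rule ex_saturating_extension)
    then show "\<exists>N'. ((N', r) \<in> Str L \<Theta> \<and> proper_tree (has_eq K) N' r \<and> (Suc n = 0 \<longrightarrow> N' = M)) \<and>
      (elementary_submodel L N N' \<and> saturates (has_eq K) \<Theta> N N')" by blast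
  qed (use SM tree in blast)
  then show thesis using that by metis
qed

context
  fixes \<Theta> r and Ms :: "nat \<Rightarrow> 'u kmodel"
  assumes sig: "is_sig \<Theta>" and SM: "\<And>n. (Ms n, r) \<in> Str L \<Theta>"
    and el: "\<And>n. elementary_submodel L (Ms n) (Ms (Suc n))"
begin

lemma
  shows Str_chain_union: "(chain_union Ms, r) \<in> Str L \<Theta>"
    and elementary_chain_union: "elementary_submodel L (Ms n) (chain_union Ms)"
proof -
  have "submodel (Ms n) (Ms (Suc n))" for n using el by (simp add: elementary_submodel_def)
  then show "(chain_union Ms, r) \<in> Str L \<Theta>"
    using abstract sig SM unfolding abstract_logic_def structures_ok_def by blast
  have "\<forall>w\<in>wlds (Ms n). (Ms n, w) \<in> Str L \<Theta>" "is_model \<Theta> (Ms n)" for n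
    using Str_change_point[OF sig SM] Str_model[OF sig SM] by blast+
  then show "elementary_submodel L (Ms n) (chain_union Ms)"
    using union sig el unfolding tarski_union_property_def by blast
qed

lemma saturates_chain_union:
  assumes sat: "\<And>n. saturates (has_eq K) \<Theta> (Ms n) (Ms (Suc n))"
  shows "saturates (has_eq K) \<Theta> (chain_union Ms) (chain_union Ms)"
  unfolding saturates_def
proof (intro ballI impI)
  let ?U = "chain_union Ms"
  have sub: "submodel (Ms n) (Ms (Suc n))" for n using el by (simp add: elementary_submodel_def)
  fix \<rho> assume \<rho>: "\<rho> \<in> requests (has_eq K) \<Theta> ?U" and fin: "finitely_solvable ?U \<rho>"
  obtain n where "base \<rho> \<in> wlds (Ms n)" "set (params \<rho>) \<subseteq> dmn (Ms n) (base \<rho>)"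
    using chain_union_stage[where Ms = Ms, OF Str_model[OF sig SM] sub] request_base[OF \<rho>]
      request_params[OF \<rho>]
    by blast
  then have \<rho>n: "\<rho> \<in> requests (has_eq K) \<Theta> (Ms n)" using \<rho> by (simp add: requests_def)
  have "finitely_solvable (Ms n) \<rho>"
    unfolding finitely_solvable_def
  proof (intro allI impI)
    fix F :: "'u fm set" assume "finite F"
    then have "solvable ?U (restrict_request F \<rho>)" using fin by (simp add: finitely_solvable_def)
    then show "solvable (Ms n) (restrict_request F \<rho>)"
      using \<open>finite F\<close> elementary_solvable_finite[OF sig SM Str_chain_union elementary_chain_union
          restrict_requests[OF \<rho>n]] by simp
  qed
  then obtain u b where "solves (Ms (Suc n)) \<rho> u b"
    using sat[of n] \<rho>n unfolding saturates_def solvable_def by blast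
  then have "solves ?U \<rho> u b"
    using elementary_solves[OF sig SM Str_chain_union elementary_chain_union submodel_requests[OF sub \<rho>n]]
    by blast
  then show "solvable ?U \<rho>" by (auto simp: solvable_def)
qed

end

lemma ex_saturated:
  assumes sig: "is_sig \<Theta>" and fin: "finite_sig \<Theta>" and SM: "(M, w) \<in> Str L \<Theta>"
  obtains N v where "(N, v) \<in> Str L \<Theta>" "saturates (has_eq K) \<Theta> N N"
    "\<And>\<phi>. \<phi> \<in> Sen L \<Theta> \<Longrightarrow> Sat L N v \<phi> \<longleftrightarrow> Sat L M w \<phi>"
proof -
  obtain T r where T: "(T, r) \<in> Str L \<Theta>" "proper_tree (has_eq K) T r"
    and Sat_T: "\<And>\<phi>. \<phi> \<in> Sen L \<Theta> \<Longrightarrow> Sat L T r \<phi> \<longleftrightarrow> Sat L M w \<phi>"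
    using ex_proper_tree[OF sig SM] by blast
  obtain Ms where Ms: "Ms 0 = T" "\<And>n. (Ms n, r) \<in> Str L \<Theta>" "\<And>n. elementary_submodel L (Ms n) (Ms (Suc n))"
    "\<And>n. saturates (has_eq K) \<Theta> (Ms n) (Ms (Suc n))"
    using ex_saturating_chain[OF sig fin T] by blast
  note SU = Str_chain_union[where Ms = Ms, OF sig Ms(2,3)]
  have "Sat L (chain_union Ms) r \<phi> \<longleftrightarrow> Sat L M w \<phi>" if \<phi>: "\<phi> \<in> Sen L \<Theta>" for \<phi>
  proof -
    have "Sat_tuple T r [] [] \<phi> \<longleftrightarrow> Sat_tuple (chain_union Ms) r [] [] \<phi>"
      using elementary_Sat_tuple[OF Str_model[OF sig T(1)] Str_model[OF sig SU], of r "[]" "[]"]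
        elementary_chain_union[where Ms = Ms, OF sig Ms(2,3), of 0] Str_wlds[OF sig T(1)] Ms(1) \<phi> by simp
    then show ?thesis using Sat_cone[OF sig T(1) \<phi>] Sat_cone[OF sig SU \<phi>] Sat_T[OF \<phi>] by simp
  qed
  then show thesis using that[OF SU saturates_chain_union[where Ms = Ms, OF sig Ms(2-4)]] by blast
qed

lemma ex_model_of_standard_theory:
  assumes sig: "is_sig \<Theta>" and std: "\<Gamma> \<subseteq> Sen (std_logic K) \<Theta>" "\<Delta> \<subseteq> Sen (std_logic K) \<Theta>"
    and abs: "\<Phi> \<subseteq> Sen L \<Theta>" "\<Psi> \<subseteq> Sen L \<Theta>"
    and fin: "\<And>\<gamma>s \<delta>s. set \<gamma>s \<subseteq> \<Gamma> \<Longrightarrow> set \<delta>s \<subseteq> \<Delta> \<Longrightarrow> \<exists>(M, w)\<in>Str L \<Theta>. holds M w (nth []) (BigAnd \<gamma>s) \<and>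
      \<not> holds M w (nth []) (BigOr \<delta>s) \<and> (\<forall>\<phi>\<in>\<Phi>. Sat L M w \<phi>) \<and> (\<forall>\<phi>\<in>\<Psi>. \<not> Sat L M w \<phi>)"
  obtains M w where "(M, w) \<in> Str L \<Theta>" "\<And>\<psi>. \<psi> \<in> \<Gamma> \<Longrightarrow> holds M w (nth []) \<psi>"
    "\<And>\<psi>. \<psi> \<in> \<Delta> \<Longrightarrow> \<not> holds M w (nth []) \<psi>"
    "\<And>\<phi>. \<phi> \<in> \<Phi> \<Longrightarrow> Sat L M w \<phi>" "\<And>\<phi>. \<phi> \<in> \<Psi> \<Longrightarrow> \<not> Sat L M w \<phi>"
proof -
  let ?\<tau> = "translate \<Theta> []"
  have Sen: "?\<tau> \<psi> \<in> Sen L \<Theta>" if "\<psi> \<in> \<Gamma> \<union> \<Delta>" for \<psi>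
    using translate_Sen[OF sig, of \<psi> "[]"] that std by (auto simp: Sen_std)
  have Sat: "Sat L M w (?\<tau> \<psi>) \<longleftrightarrow> holds M w (nth []) \<psi>" if "\<psi> \<in> \<Gamma> \<union> \<Delta>" "(M, w) \<in> Str L \<Theta>" for M w \<psi>
    using Sat_translate_sentence[OF sig that(2)] that(1) std by (auto simp: Sen_std)
  obtain M w where Mw: "(M, w) \<in> Str L \<Theta>" and sat: "\<And>\<phi>. \<phi> \<in> ?\<tau> ` \<Gamma> \<union> \<Phi> \<Longrightarrow> Sat L M w \<phi>"
    "\<And>\<phi>. \<phi> \<in> ?\<tau> ` \<Delta> \<union> \<Psi> \<Longrightarrow> \<not> Sat L M w \<phi>"
  proof (rule star_compactE[OF compact sig, of "?\<tau> ` \<Gamma> \<union> \<Phi>" "?\<tau> ` \<Delta> \<union> \<Psi>"])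
    fix \<Gamma>' \<Delta>' assume "finite \<Gamma>'" "finite \<Delta>'" and "\<Gamma>' \<subseteq> ?\<tau> ` \<Gamma> \<union> \<Phi>" "\<Delta>' \<subseteq> ?\<tau> ` \<Delta> \<union> \<Psi>"
    then have "finite (\<Gamma>' - \<Phi>)" "finite (\<Delta>' - \<Psi>)" "\<Gamma>' - \<Phi> \<subseteq> ?\<tau> ` \<Gamma>" "\<Delta>' - \<Psi> \<subseteq> ?\<tau> ` \<Delta>" by blast+
    then obtain \<gamma>s \<delta>s where lists: "set \<gamma>s \<subseteq> \<Gamma>" "\<Gamma>' - \<Phi> = ?\<tau> ` set \<gamma>s" "set \<delta>s \<subseteq> \<Delta>" "\<Delta>' - \<Psi> = ?\<tau> ` set \<delta>s"
      by (metis finite_list finite_subset_image)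
    obtain M w where "(M, w) \<in> Str L \<Theta>" "holds M w (nth []) (BigAnd \<gamma>s)" "\<not> holds M w (nth []) (BigOr \<delta>s)"
      "\<forall>\<phi>\<in>\<Phi>. Sat L M w \<phi>" "\<forall>\<phi>\<in>\<Psi>. \<not> Sat L M w \<phi>"
      using fin[OF lists(1,3)] by blast
    then have "\<forall>\<phi>\<in>(\<Gamma>' - \<Phi>) \<union> \<Phi>. Sat L M w \<phi>" "\<forall>\<phi>\<in>(\<Delta>' - \<Psi>) \<union> \<Psi>. \<not> Sat L M w \<phi>"
      unfolding lists(2,4) using Sat lists(1,3) by auto
    then show "\<exists>(M, w)\<in>Str L \<Theta>. (\<forall>\<phi>\<in>\<Gamma>'. Sat L M w \<phi>) \<and> (\<forall>\<phi>\<in>\<Delta>'. \<not> Sat L M w \<phi>)"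
      using \<open>(M, w) \<in> Str L \<Theta>\<close> by blast
  qed (use Sen abs in auto)
  show thesis by (rule that[OF Mw]) (use Sat[OF _ Mw] sat in blast)+
qed

lemma ex_undefinability_witnesses:
  assumes sig: "is_sig \<Theta>" and \<phi>: "\<phi> \<in> Sen L \<Theta>"
    and undefinable: "\<And>\<psi>. \<psi> \<in> Sen (std_logic K) \<Theta> \<Longrightarrow> \<exists>(M, w)\<in>Str L \<Theta>. Sat L M w \<phi> \<noteq> holds M w (nth []) \<psi>"
  obtains M w N v where "(M, w) \<in> Str L \<Theta>" "Sat L M w \<phi>" "(N, v) \<in> Str L \<Theta>" "\<not> Sat L N v \<phi>"
    "\<And>\<psi>. \<psi> \<in> Sen (std_logic K) \<Theta> \<Longrightarrow> holds M w (nth []) \<psi> \<Longrightarrow> holds N v (nth []) \<psi>"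
proof -
  let ?S = "Sen (std_logic K) \<Theta>"
  define C where "C = {\<psi> \<in> ?S. \<forall>(M, w)\<in>Str L \<Theta>. Sat L M w \<phi> \<longrightarrow> holds M w (nth []) \<psi>}"
  obtain N v where Nv: "(N, v) \<in> Str L \<Theta>" "\<And>\<psi>. \<psi> \<in> C \<Longrightarrow> holds N v (nth []) \<psi>" "\<not> Sat L N v \<phi>"
  proof (rule ex_model_of_standard_theory[OF sig, of C "{}" "{}" "{\<phi>}"])
    fix \<gamma>s \<delta>s :: "'u fm list" assume \<gamma>s: "set \<gamma>s \<subseteq> C" and \<delta>s: "set \<delta>s \<subseteq> {}"
    have "BigAnd \<gamma>s \<in> ?S" using \<gamma>s by (auto simp: Sen_std C_def)
    moreover have "holds M w (nth []) (BigAnd \<gamma>s)" if "(M, w) \<in> Str L \<Theta>" "Sat L M w \<phi>" for M w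
      using \<gamma>s that by (auto simp: C_def)
    ultimately obtain M w where "(M, w) \<in> Str L \<Theta>" "holds M w (nth []) (BigAnd \<gamma>s)" "\<not> Sat L M w \<phi>"
      using undefinable by blast
    then show "\<exists>(M, w)\<in>Str L \<Theta>. holds M w (nth []) (BigAnd \<gamma>s) \<and> \<not> holds M w (nth []) (BigOr \<delta>s) \<and>
        (\<forall>\<phi>\<in>{}. Sat L M w \<phi>) \<and> (\<forall>\<phi>\<in>{\<phi>}. \<not> Sat L M w \<phi>)"
      using \<delta>s by auto
  qed (use \<phi> in \<open>auto simp: C_def\<close>)
  define B where "B = {\<psi> \<in> ?S. \<not> holds N v (nth []) \<psi>}"
  obtain M w where Mw: "(M, w) \<in> Str L \<Theta>" "\<And>\<psi>. \<psi> \<in> B \<Longrightarrow> \<not> holds M w (nth []) \<psi>" "Sat L M w \<phi>"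
  proof (rule ex_model_of_standard_theory[OF sig, of "{}" B "{\<phi>}" "{}"])
    fix \<gamma>s \<delta>s :: "'u fm list" assume \<gamma>s: "set \<gamma>s \<subseteq> {}" and \<delta>s: "set \<delta>s \<subseteq> B"
    have "BigOr \<delta>s \<notin> C" using Nv(2)[of "BigOr \<delta>s"] \<delta>s by (auto simp: B_def)
    moreover have "BigOr \<delta>s \<in> ?S" using \<delta>s by (auto simp: Sen_std B_def)
    ultimately obtain M w where "(M, w) \<in> Str L \<Theta>" "Sat L M w \<phi>" "\<not> holds M w (nth []) (BigOr \<delta>s)"
      by (auto simp: C_def)
    then show "\<exists>(M, w)\<in>Str L \<Theta>. holds M w (nth []) (BigAnd \<gamma>s) \<and> \<not> holds M w (nth []) (BigOr \<delta>s) \<and>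
        (\<forall>\<phi>\<in>{\<phi>}. Sat L M w \<phi>) \<and> (\<forall>\<phi>\<in>{}. \<not> Sat L M w \<phi>)"
      using \<gamma>s by auto
  qed (use \<phi> in \<open>auto simp: B_def\<close>)
  show thesis by (rule that[OF Mw(1,3) Nv(1,3)]) (use Mw(2) in \<open>auto simp: B_def\<close>)
qed

lemma definable:
  assumes sig: "is_sig \<Theta>" and fin: "finite_sig \<Theta>" and \<phi>: "\<phi> \<in> Sen L \<Theta>"
  shows "\<exists>\<psi>\<in>Sen (std_logic K) \<Theta>. \<forall>(M, w)\<in>Str L \<Theta>. Sat L M w \<phi> \<longleftrightarrow> holds M w (nth []) \<psi>"
proof (rule ccontr)
  assume "\<not> ?thesis"
  then obtain M w N v where Mw: "(M, w) \<in> Str L \<Theta>" "Sat L M w \<phi>" and Nv: "(N, v) \<in> Str L \<Theta>" "\<not> Sat L N v \<phi>"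
    and types: "\<And>\<psi>. \<psi> \<in> Sen (std_logic K) \<Theta> \<Longrightarrow> holds M w (nth []) \<psi> \<Longrightarrow> holds N v (nth []) \<psi>"
    using ex_undefinability_witnesses[OF sig \<phi>] by blast
  obtain M' w' where M': "(M', w') \<in> Str L \<Theta>" "saturates (has_eq K) \<Theta> M' M'"
    "\<And>\<phi>. \<phi> \<in> Sen L \<Theta> \<Longrightarrow> Sat L M' w' \<phi> \<longleftrightarrow> Sat L M w \<phi>"
    using ex_saturated[OF sig fin Mw(1)] by blast
  obtain N' v' where N': "(N', v') \<in> Str L \<Theta>" "saturates (has_eq K) \<Theta> N' N'"
    "\<And>\<phi>. \<phi> \<in> Sen L \<Theta> \<Longrightarrow> Sat L N' v' \<phi> \<longleftrightarrow> Sat L N v \<phi>"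
    using ex_saturated[OF sig fin Nv(1)] by blast
  have "holds N' v' (nth []) \<psi>" if \<psi>: "\<psi> \<in> formulas (has_eq K) \<Theta> 0" and "holds M' w' (nth []) \<psi>" for \<psi>
  proof -
    note Sat = Sat_translate_sentence[OF sig _ \<psi>]
    have Sen: "translate \<Theta> [] \<psi> \<in> Sen L \<Theta>" using translate_Sen[OF sig, of \<psi> "[]"] \<psi> by simp
    have "holds M w (nth []) \<psi>" using Sat[OF M'(1)] Sat[OF Mw(1)] M'(3)[OF Sen] that(2) by blast
    then have "holds N v (nth []) \<psi>" using types \<psi> by (simp add: Sen_std)
    then show ?thesis using Sat[OF N'(1)] Sat[OF Nv(1)] N'(3)[OF Sen] by blast
  qed
  then have "type_included (has_eq K) \<Theta> M' N' w' [] v' []"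
    using Str_wlds[OF sig M'(1)] Str_wlds[OF sig N'(1)] by (simp add: type_included_def)
  from saturated_preservation[OF sig M'(1) N'(1) M'(2) N'(2) this \<phi>] show False
    using M'(3)[OF \<phi>] N'(3)[OF \<phi>] Mw(2) Nv(2) by blast
qed

lemma Bpl_std_subset:
  assumes sig: "is_sig \<Theta>" and SM: "(M, w) \<in> Str L \<Theta>" and names: "name_tuple M w cs as"
  shows "Bpl (std_logic K) M w cs as \<subseteq> Bpl L M w cs as"
proof
  fix N assume "N \<in> Bpl (std_logic K) M w cs as"
  then have N: "N \<in> oplus M w cs as" "in_class K N" by (auto simp: std_logic_def)
  obtain N0 where N0: "N0 \<in> Bpl L M w cs as" using Bpl_nonempty[OF sig SM names] by blast
  have "Sat L N0 w \<phi> \<longleftrightarrow> Sat L N w \<phi>" if "\<phi> \<in> Sen L (add_consts \<Theta> cs)" for \<phi>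
    using Sat_oplus[OF sig SM names N that] Sat_oplus[OF sig SM names _ _ that]
      Bpl_oplus[OF sig SM names N0]
    by blast
  then show "N \<in> Bpl L M w cs as"
    using abstract sig SM names N0 N(1) Str_oplus[OF sig SM N] unfolding abstract_logic_def boxplus_ok_def
    by blast
qed

lemma definable_with_signature:
  assumes sig: "is_sig \<Theta>" and fin: "finite_sig \<Theta>" and \<phi>: "\<phi> \<in> Sen L \<Theta>"
  shows "\<exists>\<psi>\<in>Sen (std_logic K) \<Theta>.
    ((\<exists>\<chi>\<in>Sen (std_logic K) \<Theta>. sen_sig (std_logic K) \<chi> = \<Theta>) \<longrightarrow> sen_sig (std_logic K) \<psi> = \<Theta>) \<and>
    (\<forall>(M, w)\<in>Str L \<Theta>. Sat L M w \<phi> \<longleftrightarrow> Sat (std_logic K) M w \<psi>)"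
proof -
  have Sat: "Sat (std_logic K) M w \<psi> \<longleftrightarrow> holds M w (nth []) \<psi>"
    if "\<psi> \<in> Sen (std_logic K) \<Theta>" "(M, w) \<in> Str L \<Theta>" for M w \<psi>
    using that Sat_std_iff[OF Str_model[OF sig that(2)] Str_wlds[OF sig that(2)]]
    by (simp add: Sen_std formulas_def)
  have sen_sig: "sen_sig (std_logic K) \<psi> = fm_sig \<psi>" if "\<psi> \<in> Sen (std_logic K) \<Theta>" for \<psi>
    using sen_sig_eq[OF occurs_exactly_fm_sig[OF sig that]] .
  obtain \<psi> where \<psi>: "\<psi> \<in> Sen (std_logic K) \<Theta>" "\<forall>(M, w)\<in>Str L \<Theta>. Sat L M w \<phi> \<longleftrightarrow> holds M w (nth []) \<psi>"
    using definable[OF sig fin \<phi>] by blast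
  show ?thesis
  proof (cases "\<exists>\<chi>\<in>Sen (std_logic K) \<Theta>. sen_sig (std_logic K) \<chi> = \<Theta>")
    case True
    then obtain \<chi> where \<chi>: "\<chi> \<in> Sen (std_logic K) \<Theta>" "fm_sig \<chi> = \<Theta>" using sen_sig by auto
    let ?\<psi> = "And \<psi> (Imp \<chi> \<chi>)"
    have Sen: "?\<psi> \<in> Sen (std_logic K) \<Theta>" using \<psi>(1) \<chi>(1) by (simp add: Sen_std)
    have "sub_sig (fm_sig \<psi>) \<Theta>"
      using \<psi>(1) fm_over_iff[of "has_eq K" \<Theta> \<psi>] by (simp add: Sen_std formulas_def)
    then have "fm_sig ?\<psi> = \<Theta>" using \<chi>(2) by (auto simp: fm_sig_def sub_sig_def fun_eq_iff subset_iff)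
    then show ?thesis using sen_sig[OF Sen] \<psi>(2) Sat[OF Sen] by (intro bexI[OF _ Sen]) auto
  next
    case False
    then show ?thesis using \<psi>(2) Sat[OF \<psi>(1)] by (intro bexI[OF _ \<psi>(1)]) auto
  qed
qed

lemma extends_std: "extends L (std_logic K)"
  unfolding extends_def
proof (intro conjI allI impI ballI)
  show Str: "Str (std_logic K) \<Theta> = Str L \<Theta>" if "is_sig \<Theta>" for \<Theta>
    using ext that by (simp add: extends_def)
  show "Bpl (std_logic K) M w cs as \<subseteq> Bpl L M w cs as"
    if "is_sig \<Theta> \<and> (M, w) \<in> Str (std_logic K) \<Theta> \<and> name_tuple M w cs as" for \<Theta> M w cs as
    using that Str Bpl_std_subset by blast
  fix \<Theta> \<phi> assume "is_sig \<Theta>" "\<phi> \<in> Sen L \<Theta>"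
  then obtain \<Theta>\<phi> where occ: "occurs_exactly L \<phi> \<Theta>\<phi>"
    using abstract unfolding abstract_logic_def occurrence_def by blast
  then have sig: "is_sig \<Theta>\<phi>" and fin: "finite_sig \<Theta>\<phi>" and \<phi>: "\<phi> \<in> Sen L \<Theta>\<phi>"
    by (auto simp: occurs_exactly_def sub_sig_refl)
  show "let \<Theta>\<phi> = sen_sig L \<phi> in \<exists>\<psi>\<in>Sen (std_logic K) \<Theta>\<phi>.
      ((\<exists>\<chi>\<in>Sen (std_logic K) \<Theta>\<phi>. sen_sig (std_logic K) \<chi> = \<Theta>\<phi>) \<longrightarrow> sen_sig (std_logic K) \<psi> = \<Theta>\<phi>) \<and>
      (\<forall>(M, w)\<in>Str (std_logic K) \<Theta>\<phi>. Sat L M w \<phi> = Sat (std_logic K) M w \<psi>)"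
    unfolding Let_def sen_sig_eq[OF occ] Str[OF sig] by (rule definable_with_signature[OF sig fin \<phi>])
qed

end

theorem theorem5p2:
  fixes L :: "('u, 's) logic" and K :: stil
  assumes "set_universe TYPE('u)"
    and "abstract_logic L"
    and "extends (std_logic K) L"
    and "preserved_under_asimulations K L"
    and "star_compact L"
    and "tarski_union_property L"
  shows "equally_expressive (std_logic K) L"
proof -
  interpret lindstroem UNIV L K
    using assms by unfold_locales auto
  show ?thesis unfolding equally_expressive_def using assms(3) extends_std by blast
qed

end
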